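(* Let $\alpha,\beta,\gamma\in{}^\theta\mathbb{N}I$ and let $L$, $M$, $N$ be modules over $\mathfrak{W}_\alpha$, $\mathfrak{W}_\beta$, $\mathfrak{W}_\gamma$ respectively. The morphisms $R_{X,Y}:X\circ Y\to Y\circ X$ between convolution products of VV algebra modules satisfy $$R_{L,M\circ N}=(M\circ R_{L,N})\,(R_{L,M}\circ N):L\circ M\circ N\to M\circ N\circ L,$$ $$R_{L\circ M,N}=(R_{L,N}\circ M)\,(L\circ R_{M,N}):L\circ M\circ N\to N\circ L\circ M,$$ and the Yang-Baxter equation $$(R_{M,N}\circ L)\,(M\circ R_{L,N})\,(R_{L,M}\circ N)=(N\circ R_{L,M})\,(R_{L,N}\circ M)\,(L\circ R_{M,N}):L\circ M\circ N\to N\circ M\circ L.$$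
   Context: Setup. $k$ is a field with $\mathrm{char}(k)\neq 2$; modules are left modules. Fix $p,q\in k^\times$ such that $p$ is not a power of $q$ and vice versa, $p\neq\pm1$, and $\lambda\in k^\times$. Put $I=\{p^{2n}\lambda^{\pm1}\mid n\in\mathbb{Z}\}$ and assume $\pm1,\pm p,\pm q\notin I$. Let $\Gamma$ be the quiver with vertex set $I$ and an arrow $p^2i\to i$ for each $i\in I$; $|i\to j|$ is the number of arrows from $i$ to $j$. Put $I^+=\{p^{2n}\lambda\mid n\in\mathbb{Z}\}$, so that $I$ is the disjoint union of $I^+$ and $\{i^{-1}\mid i\in I^+\}$. Put $Q_{i,j}(x,y)=(-1)^{|i\to j|}(x-y)^{|i\to j|+|j\to i|}$ if $i\ne j$, and $Q_{i,i}=0$. KLR algebras. $\mathbb{N}I$ is the set of finitely supported formal sums $\tilde\nu=\sum_{i\in I}\tilde\nu_i i$, $\tilde\nu_i\in\mathbb{Z}_{\ge0}$, with $|\tilde\nu|=\sum_i\tilde\nu_i$; $\mathbb{N}I^+$ is the subset supported on $I^+$. For $|\tilde\nu|=m$ let $I^{\tilde\nu}=\{\mathbf{i}=(i_1,\dots,i_m)\in I^m\mid\sum_k i_k=\tilde\nu\}$ (formal sum). $\mathbf{R}_{\tilde\nu}$ is the $k$-algebra generated by $x_1,\dots,x_m$, $\sigma_1,\dots,\sigma_{m-1}$, $e(\mathbf{i})$ ($\mathbf{i}\in I^{\tilde\nu}$) with relations: (1) $e(\mathbf{i})e(\mathbf{j})=\delta_{\mathbf{i}\mathbf{j}}e(\mathbf{i})$,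 $\sum_{\mathbf i}e(\mathbf{i})=1$, $\sigma_ke(\mathbf{i})=e(s_k\mathbf{i})\sigma_k$, $x_le(\mathbf{i})=e(\mathbf{i})x_l$; (2) $x_rx_s=x_sx_r$; (3) $\sigma_k^2e(\mathbf{i})=Q_{i_k,i_{k+1}}(x_{k+1},x_k)e(\mathbf{i})$, $\sigma_j\sigma_k=\sigma_k\sigma_j$ for $j\ne k\pm1$, and $(\sigma_{k+1}\sigma_k\sigma_{k+1}-\sigma_k\sigma_{k+1}\sigma_k)e(\mathbf{i})$ equals $\frac{Q_{i_k,i_{k+1}}(x_{k+1},x_k)-Q_{i_k,i_{k+1}}(x_{k+1},x_{k+2})}{x_k-x_{k+2}}e(\mathbf{i})$ if $i_k=i_{k+2}$ and $0$ otherwise; (4) $(\sigma_kx_l-x_{s_k(l)}\sigma_k)e(\mathbf{i})$ equals $-e(\mathbf{i})$ if $l=k$, $i_k=i_{k+1}$; $e(\mathbf{i})$ if $l=k+1$, $i_k=i_{k+1}$; and $0$ otherwise. $\mathbf{R}_0=k$. VV algebras. ${}^\theta\mathbb{N}I=\{\nu=\sum_{i\in I}\nu_ii\in\mathbb{N}I\mid\nu_i=\nu_{i^{-1}}\ \forall i\}$; $|\nu|=\sum_i\nu_i$ is even. For $|\nu|=2m$ let ${}^\theta I^\nu=\{\mathbf{i}\in I^m\mid\sum_ki_k+\sum_ki_k^{-1}=\nu\}$ (formal sum). $\mathfrak{W}_\nu$ is the $k$-algebra generated by $x_1,\dots,x_m,\sigma_1,\dots,\sigma_{m-1},\pi$ and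 $e(\mathbf{i})$ ($\mathbf{i}\in{}^\theta I^\nu$) with relations (1)–(4) (for $\mathbf{i},\mathbf{j}\in{}^\theta I^\nu$) and (since $q^{\pm1}\notin I$) $\pi e(i_1,i_2,\dots,i_m)=e(i_1^{-1},i_2,\dots,i_m)\pi$, $\pi x_1=-x_1\pi$, $\pi x_l=x_l\pi$ ($l>1$), $\pi\sigma_k=\sigma_k\pi$ ($k\ne1$), $\pi^2=1$, $(\sigma_1\pi)^2=(\pi\sigma_1)^2$. $\mathfrak{W}_0=k$. Convolution. For $\alpha\in{}^\theta\mathbb{N}I$ put $\alpha^+=\sum_{i\in I^+}\alpha_ii\in\mathbb{N}I^+$ and $\mathbf{e}=\sum_{\mathbf{i}\in I^{\alpha^+}}e(\mathbf{i})\in\mathfrak{W}_\alpha$; one has $\mathbf{e}\mathfrak{W}_\alpha\mathbf{e}\cong\mathbf{R}_{\alpha^+}$ naturally. For a $\mathfrak{W}_\alpha$-module $M$ put $\mathrm{Res}(M)=\mathbf{e}M$, an $\mathbf{R}_{\alpha^+}$-module. For a $\mathfrak{W}_\beta$-module $M$ and $\mathfrak{W}_\gamma$-module $N$, $|\beta|=2m$, $|\gamma|=2n$, $$M\circ N:=\mathfrak{W}_{\beta+\gamma}e(\beta^+\gamma^+)\otimes_{\mathbf{R}_{\beta^+}\otimes\mathbf{R}_{\gamma^+}}(\mathrm{Res}(M)\otimes\mathrm{Res}(N)),\quad e(\beta^+\gamma^+)=\sum_{\mathbf{i}\in I^{\beta^+},\mathbf{j}\in I^{\gamma^+}}e(\mathbf{i}\mathbf{j}),$$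 where $\mathbf{R}_{\beta^+}\otimes\mathbf{R}_{\gamma^+}$ acts on the right via $e(\mathbf{i})\otimes e(\mathbf{j})\mapsto e(\mathbf{i}\mathbf{j})$, with $x_k,\sigma_k$ of the first factor mapping to $x_k,\sigma_k$ and of the second factor to $x_{m+k},\sigma_{m+k}$. This product is associative up to canonical isomorphism, which is suppressed. R-matrices. Define $\varphi_k$ ($1\le k<m+n$) by $\varphi_ke(\mathbf{i})=(\sigma_kx_k-x_k\sigma_k)e(\mathbf{i})$ if $i_k=i_{k+1}$ and $\varphi_ke(\mathbf{i})=\sigma_ke(\mathbf{i})$ otherwise. For $w=s_{a_1}\cdots s_{a_r}$ a reduced expression in $\mathfrak{S}_{m+n}$, $\varphi_w=\varphi_{a_1}\cdots\varphi_{a_r}$ (independent of the reduced expression). Let $w[n,m]\in\mathfrak{S}_{m+n}$ be $k\mapsto k+m$ for $1\le k\le n$, $k\mapsto k-n$ for $n<k\le m+n$. Then $R_{M,N}:M\circ N\to N\circ M$ is the $\mathfrak{W}_{\beta+\gamma}$-module morphism extending $\mathrm{Res}(M)\otimes\mathrm{Res}(N)\to N\circ M$, $u\otimes v\mapsto\varphi_{w[n,m]}(v\otimes u)$ (degree shifts are ignored). *)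

theory Defs
  imports
    "HOL-Algebra.Module"
    "HOL-Algebra.QuotRing"
    "HOL-Algebra.Free_Abelian_Groups"
    "HOL-Combinatorics.Combinatorics"
    "HOL-Library.Poly_Mapping"
begin

text \<open>
  Indices are 0-based: the generators of an algebra of rank \<open>m\<close> are \<open>x\<^sub>l\<close> for \<open>l < m\<close> and
  \<open>\<sigma>\<^sub>k\<close> for \<open>Suc k < m\<close>, the simple transposition \<open>s\<^sub>k\<close> exchanges \<open>k\<close> and \<open>Suc k\<close>, and \<open>\<pi>\<close>
  acts at position \<open>0\<close>. Formal sums in \<open>\<nat>I\<close> are multisets over the field, so \<open>|\<nu>|\<close> is
  \<^const>\<open>size\<close>.
\<close>

section \<open>The vertex set and dimension vectors\<close>

definition Ipos :: "'k::field \<Rightarrow> 'k \<Rightarrow> 'k set" where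
  "Ipos p lam = {p powi (2 * n) * lam | n. True}"

definition Iset :: "'k::field \<Rightarrow> 'k \<Rightarrow> 'k set" where
  "Iset p lam = Ipos p lam \<union> {p powi (2 * n) * inverse lam | n. True}"

definition arrows :: "'k::field \<Rightarrow> 'k \<Rightarrow> 'k \<Rightarrow> nat" where
  "arrows p i j = (if i = p^2 * j then 1 else 0)"

definition thetaNI :: "'k::field \<Rightarrow> 'k \<Rightarrow> 'k multiset set" where
  "thetaNI p lam = {\<nu>. set_mset \<nu> \<subseteq> Iset p lam \<and> (\<forall>i\<in>Iset p lam. count \<nu> i = count \<nu> (inverse i))}"

definition pos_part :: "'k::field \<Rightarrow> 'k \<Rightarrow> 'k multiset \<Rightarrow> 'k multiset" where
  "pos_part p lam \<alpha> = filter_mset (\<lambda>i. i \<in> Ipos p lam) \<alpha>"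

text \<open>The set of sequences \<open>I\<^sup>\<nu>\<close> is \<^term>\<open>permutations_of_multiset \<nu>\<close>.\<close>

definition theta_seqs :: "'k::field multiset \<Rightarrow> 'k list set" where
  "theta_seqs \<nu> = {is. mset is + mset (map inverse is) = \<nu>}"

section \<open>Algebras given by generators and relations\<close>

text \<open>
  With concatenation as addition on lists, the convolution product of \<^typ>\<open>'g list \<Rightarrow>\<^sub>0 'k\<close> is the
  multiplication of the free \<open>k\<close>-algebra on \<^typ>\<open>'g\<close>.
\<close>

instantiation list :: (type) monoid_add
begin

definition zero_list :: "'a list" where "zero_list = []"

definition plus_list :: "'a list \<Rightarrow> 'a list \<Rightarrow> 'a list" where "plus_list = (@)"

instance by standard (simp_all add: zero_list_def plus_list_def)

end

definition free_alg :: "'g set \<Rightarrow> ('g list \<Rightarrow>\<^sub>0 'k::field) ring" where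
  "free_alg G = \<lparr>carrier = {f. Poly_Mapping.keys f \<subseteq> lists G},
     monoid.mult = (*), monoid.one = 1, ring.zero = 0, ring.add = (+)\<rparr>"

definition pres_alg :: "'g set \<Rightarrow> ('g list \<Rightarrow>\<^sub>0 'k::field) set \<Rightarrow> ('g list \<Rightarrow>\<^sub>0 'k) set ring" where
  "pres_alg G Rel = free_alg G Quot (Idl\<^bsub>free_alg G\<^esub> Rel)"

definition pres_class ::
  "'g set \<Rightarrow> ('g list \<Rightarrow>\<^sub>0 'k::field) set \<Rightarrow> ('g list \<Rightarrow>\<^sub>0 'k) \<Rightarrow> ('g list \<Rightarrow>\<^sub>0 'k) set" where
  "pres_class G Rel f = (Idl\<^bsub>free_alg G\<^esub> Rel) +>\<^bsub>free_alg G\<^esub> f"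

definition scal :: "'k::field \<Rightarrow> ('g list \<Rightarrow>\<^sub>0 'k)" where
  "scal c = Poly_Mapping.single [] c"

text \<open>The endomorphism of the free algebra with values \<open>h g\<close> on the generators \<open>g\<close>.\<close>

definition subst :: "('g \<Rightarrow> ('g list \<Rightarrow>\<^sub>0 'k)) \<Rightarrow> ('g list \<Rightarrow>\<^sub>0 'k::field) \<Rightarrow> ('g list \<Rightarrow>\<^sub>0 'k)" where
  "subst h f = (\<Sum>w\<in>Poly_Mapping.keys f. scal (Poly_Mapping.lookup f w) * prod_list (map h w))"

section \<open>KLR and VV algebras\<close>

datatype 'k gen = GX nat | GS nat | GP | GE "'k list"

type_synonym 'k falg = "'k gen list \<Rightarrow>\<^sub>0 'k"

type_synonym 'k palg = "'k falg set"

abbreviation gx :: "nat \<Rightarrow> 'k::field falg" where "gx l \<equiv> Poly_Mapping.single [GX l] 1"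
abbreviation gs :: "nat \<Rightarrow> 'k::field falg" where "gs k \<equiv> Poly_Mapping.single [GS k] 1"
abbreviation gp :: "'k::field falg" where "gp \<equiv> Poly_Mapping.single [GP] 1"
abbreviation ge :: "'k list \<Rightarrow> 'k::field falg" where "ge i \<equiv> Poly_Mapping.single [GE i] 1"

abbreviation swap :: "nat \<Rightarrow> nat \<Rightarrow> nat" where "swap k \<equiv> transpose k (Suc k)"

definition Qpol :: "'k::field \<Rightarrow> 'k \<Rightarrow> 'k \<Rightarrow> 'r::ring_1 \<Rightarrow> 'r \<Rightarrow> 'r" where
  "Qpol p i j x y =
     (if i = j then 0 else (-1) ^ arrows p i j * (x - y) ^ (arrows p i j + arrows p j i))"

text \<open>The polynomial \<open>(Q\<^sub>i\<^sub>j(b, a) - Q\<^sub>i\<^sub>j(b, c)) / (a - c)\<close>, see the lemma below.\<close>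

definition Qdiff :: "'k::field \<Rightarrow> 'k \<Rightarrow> 'k \<Rightarrow> 'r::ring_1 \<Rightarrow> 'r \<Rightarrow> 'r \<Rightarrow> 'r" where
  "Qdiff p i j a b c =
     (if i = j then 0
      else let d = arrows p i j + arrows p j i
           in - ((-1) ^ arrows p i j * (\<Sum>t<d. (b - a) ^ t * (b - c) ^ (d - Suc t))))"

lemma Qdiff_divided_difference:
  fixes a b c :: "'r::comm_ring_1"
  shows "Qdiff p i j a b c * (a - c) = Qpol p i j b a - Qpol p i j b c"
proof (cases "i = j")
  case True
  then show ?thesis by (simp add: Qdiff_def Qpol_def)
next
  case False
  define d where "d = arrows p i j + arrows p j i"
  define S where "S = (\<Sum>t<d. (b - a) ^ t * (b - c) ^ (d - Suc t))"
  have S': "S = (\<Sum>t<d. (b - c) ^ (d - Suc t) * (b - a) ^ t)"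
    unfolding S_def by (intro sum.cong refl mult.commute)
  have "(b - a) ^ d - (b - c) ^ d = ((b - a) - (b - c)) * S"
    unfolding S' by (rule power_diff_sumr2)
  then have diff: "(b - a) ^ d - (b - c) ^ d = - (S * (a - c))"
    by (simp add: algebra_simps)
  have "Qdiff p i j a b c * (a - c) = (-1) ^ arrows p i j * - (S * (a - c))"
    using False by (simp add: Qdiff_def S_def d_def Let_def mult.assoc)
  also have "\<dots> = Qpol p i j b a - Qpol p i j b c"
    using False unfolding diff[symmetric] Qpol_def d_def[symmetric]
    by (simp add: right_diff_distrib)
  finally show ?thesis .
qed

definition klr_gens :: "nat \<Rightarrow> 'k list set \<Rightarrow> 'k gen set" where
  "klr_gens m J = {GX l | l. l < m} \<union> {GS k | k. Suc k < m} \<union> GE ` J"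

text \<open>The relations common to both families; \<open>J\<close> is the set of sequences indexing the idempotents.\<close>

definition klr_rels :: "'k::field \<Rightarrow> nat \<Rightarrow> 'k list set \<Rightarrow> 'k falg set" where
  "klr_rels p m J =
     {ge i * ge j - (if i = j then ge i else 0) | i j. i \<in> J \<and> j \<in> J} \<union>
     {(\<Sum>i\<in>J. ge i) - 1} \<union>
     {gs k * ge i - ge (permute_list (swap k) i) * gs k | k i. Suc k < m \<and> i \<in> J} \<union>
     {gx l * ge i - ge i * gx l | l i. l < m \<and> i \<in> J} \<union>
     {gx r * gx s - gx s * gx r | r s. r < m \<and> s < m} \<union>
     {gs k * gs k * ge i - Qpol p (i ! k) (i ! Suc k) (gx (Suc k)) (gx k) * ge i
        | k i. Suc k < m \<and> i \<in> J} \<union>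
     {gs j * gs k - gs k * gs j | j k. Suc j < m \<and> Suc k < m \<and> j \<noteq> Suc k \<and> k \<noteq> Suc j} \<union>
     {(gs (Suc k) * gs k * gs (Suc k) - gs k * gs (Suc k) * gs k) * ge i
        - (if i ! k = i ! (k + 2)
           then Qdiff p (i ! k) (i ! Suc k) (gx k) (gx (Suc k)) (gx (k + 2)) * ge i else 0)
        | k i. k + 2 < m \<and> i \<in> J} \<union>
     {(gs k * gx l - gx (swap k l) * gs k) * ge i
        - (if l = k \<and> i ! k = i ! Suc k then - ge i
           else if l = Suc k \<and> i ! k = i ! Suc k then ge i else 0)
        | k l i. Suc k < m \<and> l < m \<and> i \<in> J}"

definition pi_rels :: "nat \<Rightarrow> 'k::field list set \<Rightarrow> 'k falg set" where
  "pi_rels m J =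
     {gp * ge i - ge (i[0 := inverse (i ! 0)]) * gp | i. i \<in> J} \<union>
     {gp * gx 0 + gx 0 * gp} \<union>
     {gp * gx l - gx l * gp | l. 0 < l \<and> l < m} \<union>
     {gp * gs k - gs k * gp | k. 0 < k \<and> Suc k < m} \<union>
     {gp * gp - 1} \<union>
     (if 1 < m then {(gs 0 * gp)^2 - (gp * gs 0)^2} else {})"

definition KLR_gens :: "'k::field multiset \<Rightarrow> 'k gen set" where
  "KLR_gens \<nu> = klr_gens (size \<nu>) (permutations_of_multiset \<nu>)"

definition KLR_rels :: "'k::field \<Rightarrow> 'k multiset \<Rightarrow> 'k falg set" where
  "KLR_rels p \<nu> = klr_rels p (size \<nu>) (permutations_of_multiset \<nu>)"

definition KLR :: "'k::field \<Rightarrow> 'k multiset \<Rightarrow> 'k palg ring" where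
  "KLR p \<nu> = pres_alg (KLR_gens \<nu>) (KLR_rels p \<nu>)"

definition klr_class :: "'k::field \<Rightarrow> 'k multiset \<Rightarrow> 'k falg \<Rightarrow> 'k palg" where
  "klr_class p \<nu> = pres_class (KLR_gens \<nu>) (KLR_rels p \<nu>)"

definition rank :: "'k multiset \<Rightarrow> nat" where
  "rank \<nu> = size \<nu> div 2"

text \<open>There is no generator \<open>\<pi>\<close> in rank \<open>0\<close>, so that both algebras are \<open>k\<close> for \<open>\<nu> = 0\<close>.\<close>

definition VV_gens :: "'k::field multiset \<Rightarrow> 'k gen set" where
  "VV_gens \<nu> = klr_gens (rank \<nu>) (theta_seqs \<nu>) \<union> (if rank \<nu> = 0 then {} else {GP})"

definition VV_rels :: "'k::field \<Rightarrow> 'k multiset \<Rightarrow> 'k falg set" where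
  "VV_rels p \<nu> = klr_rels p (rank \<nu>) (theta_seqs \<nu>) \<union>
     (if rank \<nu> = 0 then {} else pi_rels (rank \<nu>) (theta_seqs \<nu>))"

definition VV :: "'k::field \<Rightarrow> 'k multiset \<Rightarrow> 'k palg ring" where
  "VV p \<nu> = pres_alg (VV_gens \<nu>) (VV_rels p \<nu>)"

definition vv_class :: "'k::field \<Rightarrow> 'k multiset \<Rightarrow> 'k falg \<Rightarrow> 'k palg" where
  "vv_class p \<nu> = pres_class (VV_gens \<nu>) (VV_rels p \<nu>)"

section \<open>Modules over noncommutative rings and tensor products\<close>

text \<open>
  The locale \<^locale>\<open>module\<close> of the library requires a commutative ring. As there, the
  multiplication and unit fields of the record of a module carry no meaning.
\<close>

locale left_module = R?: ring R + M?: abelian_group M 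
  for R :: "('r, 'x) ring_scheme" (structure) and M :: "('r, 'm, 'y) module_scheme" (structure) +
  assumes smult_closed:
      "\<lbrakk>a \<in> carrier R; x \<in> carrier M\<rbrakk> \<Longrightarrow> a \<odot>\<^bsub>M\<^esub> x \<in> carrier M"
    and smult_l_distr:
      "\<lbrakk>a \<in> carrier R; b \<in> carrier R; x \<in> carrier M\<rbrakk> \<Longrightarrow>
      (a \<oplus>\<^bsub>R\<^esub> b) \<odot>\<^bsub>M\<^esub> x = a \<odot>\<^bsub>M\<^esub> x \<oplus>\<^bsub>M\<^esub> b \<odot>\<^bsub>M\<^esub> x"
    and smult_r_distr:
      "\<lbrakk>a \<in> carrier R; x \<in> carrier M; y \<in> carrier M\<rbrakk> \<Longrightarrow>
      a \<odot>\<^bsub>M\<^esub> (x \<oplus>\<^bsub>M\<^esub> y) = a \<odot>\<^bsub>M\<^esub> x \<oplus>\<^bsub>M\<^esub> a \<odot>\<^bsub>M\<^esub> y"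
    and smult_assoc:
      "\<lbrakk>a \<in> carrier R; b \<in> carrier R; x \<in> carrier M\<rbrakk> \<Longrightarrow>
      (a \<otimes>\<^bsub>R\<^esub> b) \<odot>\<^bsub>M\<^esub> x = a \<odot>\<^bsub>M\<^esub> (b \<odot>\<^bsub>M\<^esub> x)"
    and smult_one:
      "x \<in> carrier M \<Longrightarrow> \<one>\<^bsub>R\<^esub> \<odot>\<^bsub>M\<^esub> x = x"

definition mod_hom ::
  "('r, 'x) ring_scheme \<Rightarrow> ('r, 'a, 'y) module_scheme \<Rightarrow> ('r, 'b, 'z) module_scheme \<Rightarrow> ('a \<Rightarrow> 'b) set"
  where
  "mod_hom R M N = {h \<in> carrier M \<rightarrow> carrier N.
     (\<forall>x\<in>carrier M. \<forall>y\<in>carrier M. h (x \<oplus>\<^bsub>M\<^esub> y) = h x \<oplus>\<^bsub>N\<^esub> h y) \<and>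
     (\<forall>r\<in>carrier R. \<forall>x\<in>carrier M. h (r \<odot>\<^bsub>M\<^esub> x) = r \<odot>\<^bsub>N\<^esub> h x)}"

text \<open>\<open>f\<close> and \<open>g\<close> define the same morphism \<open>M \<rightarrow> N\<close>.\<close>

definition eq_mor ::
  "('r, 'x) ring_scheme \<Rightarrow> ('r, 'a, 'y) module_scheme \<Rightarrow> ('r, 'b, 'z) module_scheme \<Rightarrow>
   ('a \<Rightarrow> 'b) \<Rightarrow> ('a \<Rightarrow> 'b) \<Rightarrow> bool" where
  "eq_mor R M N f g \<longleftrightarrow>
     f \<in> mod_hom R M N \<and> g \<in> mod_hom R M N \<and> (\<forall>x\<in>carrier M. f x = g x)"

definition with_smult :: "('a, 'x) ring_scheme \<Rightarrow> ('r \<Rightarrow> 'a \<Rightarrow> 'a) \<Rightarrow> ('r, 'a) module" where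
  "with_smult A act = \<lparr>carrier = carrier A, monoid.mult = monoid.mult A, monoid.one = monoid.one A,
     ring.zero = ring.zero A, ring.add = ring.add A, smult = act\<rparr>"

type_synonym ('a, 'b) tens = "('a \<times> 'b \<Rightarrow>\<^sub>0 int) set"

text \<open>
  Tensor product over a ring with underlying set \<open>S\<close> of a right module \<open>A\<close> and a left module \<open>B\<close>,
  as the free abelian group on \<open>A \<times> B\<close> modulo the usual relations. For a right module,
  \<^term>\<open>s \<odot>\<^bsub>A\<^esub> a\<close> stands for \<open>a \<cdot> s\<close>.
\<close>

definition tensor_rels ::
  "'s set \<Rightarrow> ('s, 'a, 'x) module_scheme \<Rightarrow> ('s, 'b, 'y) module_scheme \<Rightarrow> ('a \<times> 'b \<Rightarrow>\<^sub>0 int) set" where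
  "tensor_rels S A B =
     {frag_of (a \<oplus>\<^bsub>A\<^esub> a', b) - frag_of (a, b) - frag_of (a', b)
        | a a' b. a \<in> carrier A \<and> a' \<in> carrier A \<and> b \<in> carrier B} \<union>
     {frag_of (a, b \<oplus>\<^bsub>B\<^esub> b') - frag_of (a, b) - frag_of (a, b')
        | a b b'. a \<in> carrier A \<and> b \<in> carrier B \<and> b' \<in> carrier B} \<union>
     {frag_of (s \<odot>\<^bsub>A\<^esub> a, b) - frag_of (a, s \<odot>\<^bsub>B\<^esub> b)
        | s a b. s \<in> S \<and> a \<in> carrier A \<and> b \<in> carrier B}"

definition tensor_sub ::
  "'s set \<Rightarrow> ('s, 'a, 'x) module_scheme \<Rightarrow> ('s, 'b, 'y) module_scheme \<Rightarrow> ('a \<times> 'b \<Rightarrow>\<^sub>0 int) set" where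
  "tensor_sub S A B =
     generate (free_Abelian_group (carrier A \<times> carrier B)) (tensor_rels S A B)"

definition tensor ::
  "'s set \<Rightarrow> ('s, 'a, 'x) module_scheme \<Rightarrow> ('s, 'b, 'y) module_scheme \<Rightarrow> ('a, 'b) tens ring" where
  "tensor S A B = (let Q = free_Abelian_group (carrier A \<times> carrier B) Mod tensor_sub S A B in
     \<lparr>carrier = carrier Q, monoid.mult = undefined, monoid.one = undefined,
      ring.zero = \<one>\<^bsub>Q\<^esub>, ring.add = (\<otimes>\<^bsub>Q\<^esub>)\<rparr>)"

definition pure ::
  "'s set \<Rightarrow> ('s, 'a, 'x) module_scheme \<Rightarrow> ('s, 'b, 'y) module_scheme \<Rightarrow> 'a \<Rightarrow> 'b \<Rightarrow> ('a, 'b) tens"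
  where
  "pure S A B a b =
     tensor_sub S A B #>\<^bsub>free_Abelian_group (carrier A \<times> carrier B)\<^esub> frag_of (a, b)"

text \<open>
  The additive map out of a tensor product into \<open>C\<close> sending \<open>a \<otimes> b\<close> to \<open>f a b\<close>, for balanced \<open>f\<close>.
\<close>

definition tlift :: "('c, 'x) ring_scheme \<Rightarrow> ('a \<Rightarrow> 'b \<Rightarrow> 'c) \<Rightarrow> ('a, 'b) tens \<Rightarrow> 'c" where
  "tlift C f X = the_elem ((\<lambda>x. \<Oplus>\<^bsub>C\<^esub>ab\<in>Poly_Mapping.keys x.
     add_pow C (Poly_Mapping.lookup x ab) (f (fst ab) (snd ab))) ` X)"

section \<open>Tensor products over the field, and of KLR algebras\<close>

text \<open>The underlying \<open>k\<close>-module of a module over a KLR algebra, and of the algebra itself.\<close>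

definition kmod ::
  "'k::field \<Rightarrow> 'k multiset \<Rightarrow> ('k palg, 'm, 'x) module_scheme \<Rightarrow> ('k, 'm) module" where
  "kmod p \<nu> V = with_smult V (\<lambda>c u. klr_class p \<nu> (scal c) \<odot>\<^bsub>V\<^esub> u)"

definition kKLR :: "'k::field \<Rightarrow> 'k multiset \<Rightarrow> ('k, 'k palg) module" where
  "kKLR p \<nu> = kmod p \<nu> (with_smult (KLR p \<nu>) (\<otimes>\<^bsub>KLR p \<nu>\<^esub>))"

text \<open>The \<open>k\<close>-algebra \<open>R\<^sub>\<mu> \<otimes> R\<^sub>\<nu>\<close>.\<close>

definition KLR2 :: "'k::field \<Rightarrow> 'k multiset \<Rightarrow> 'k multiset \<Rightarrow> ('k palg, 'k palg) tens ring" where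
  "KLR2 p \<mu> \<nu> =
     (let T = tensor UNIV (kKLR p \<mu>) (kKLR p \<nu>); t = pure UNIV (kKLR p \<mu>) (kKLR p \<nu>) in
      T\<lparr>monoid.mult := (\<lambda>X Y. tlift T (\<lambda>r s. tlift T (\<lambda>r' s'.
                  t (r \<otimes>\<^bsub>KLR p \<mu>\<^esub> r') (s \<otimes>\<^bsub>KLR p \<nu>\<^esub> s')) Y) X),
        monoid.one := t \<one>\<^bsub>KLR p \<mu>\<^esub> \<one>\<^bsub>KLR p \<nu>\<^esub>\<rparr>)"

text \<open>The outer tensor product of modules over \<open>R\<^sub>\<mu>\<close> and \<open>R\<^sub>\<nu>\<close>, a module over \<open>R\<^sub>\<mu> \<otimes> R\<^sub>\<nu>\<close>.\<close>

definition outer_pure ::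
  "'k::field \<Rightarrow> 'k multiset \<Rightarrow> 'k multiset \<Rightarrow>
   ('k palg, 'm, 'x) module_scheme \<Rightarrow> ('k palg, 'n, 'y) module_scheme \<Rightarrow> 'm \<Rightarrow> 'n \<Rightarrow> ('m, 'n) tens"
  where
  "outer_pure p \<mu> \<nu> U V = pure UNIV (kmod p \<mu> U) (kmod p \<nu> V)"

definition outer ::
  "'k::field \<Rightarrow> 'k multiset \<Rightarrow> 'k multiset \<Rightarrow>
   ('k palg, 'm, 'x) module_scheme \<Rightarrow> ('k palg, 'n, 'y) module_scheme \<Rightarrow>
   (('k palg, 'k palg) tens, ('m, 'n) tens) module" where
  "outer p \<mu> \<nu> U V =
     (let T = tensor UNIV (kmod p \<mu> U) (kmod p \<nu> V) in
      with_smult T (\<lambda>z t. tlift T (\<lambda>r s. tlift T (\<lambda>u v.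
        outer_pure p \<mu> \<nu> U V (r \<odot>\<^bsub>U\<^esub> u) (s \<odot>\<^bsub>V\<^esub> v)) t) z))"

section \<open>VV modules, restriction and convolution\<close>

text \<open>A module together with the index \<open>\<nu>\<close> of the algebra acting on it.\<close>

record ('k, 'm) vv_mod = "('k palg, 'm) module" +
  deg :: "'k multiset"

definition vv_module :: "'k::field \<Rightarrow> 'k \<Rightarrow> ('k, 'm) vv_mod \<Rightarrow> bool" where
  "vv_module p lam M \<longleftrightarrow> deg M \<in> thetaNI p lam \<and> left_module (VV p (deg M)) M"

abbreviation pdeg :: "'k::field \<Rightarrow> 'k \<Rightarrow> ('k, 'm) vv_mod \<Rightarrow> 'k multiset" where
  "pdeg p lam M \<equiv> pos_part p lam (deg M)"

definition e_pos :: "'k::field \<Rightarrow> 'k \<Rightarrow> 'k multiset \<Rightarrow> 'k falg" where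
  "e_pos p lam \<alpha> = (\<Sum>i\<in>permutations_of_multiset (pos_part p lam \<alpha>). ge i)"

text \<open>
  The natural isomorphism of the KLR algebra onto the corner of the VV algebra at the idempotent
  \<^const>\<open>e_pos\<close>, which maps a generator \<open>g\<close> to \<open>g \<cdot> e\<close>.
\<close>

definition corner :: "'k::field \<Rightarrow> 'k \<Rightarrow> 'k multiset \<Rightarrow> 'k palg \<Rightarrow> 'k palg" where
  "corner p lam \<alpha> r = the_elem ((\<lambda>f. vv_class p \<alpha> (f * e_pos p lam \<alpha>)) ` r)"

definition Res :: "'k::field \<Rightarrow> 'k \<Rightarrow> ('k, 'm) vv_mod \<Rightarrow> ('k palg, 'm) module" where
  "Res p lam M =
     \<lparr>carrier = (\<lambda>u. vv_class p (deg M) (e_pos p lam (deg M)) \<odot>\<^bsub>M\<^esub> u) ` carrier M,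
      monoid.mult = monoid.mult M, monoid.one = monoid.one M, ring.zero = ring.zero M, ring.add = ring.add M,
      smult = (\<lambda>r u. corner p lam (deg M) r \<odot>\<^bsub>M\<^esub> u)\<rparr>"

definition e_conv :: "'k::field \<Rightarrow> 'k \<Rightarrow> 'k multiset \<Rightarrow> 'k multiset \<Rightarrow> 'k falg" where
  "e_conv p lam \<beta> \<gamma> = (\<Sum>i\<in>permutations_of_multiset (pos_part p lam \<beta>).
      \<Sum>j\<in>permutations_of_multiset (pos_part p lam \<gamma>). ge (i @ j))"

text \<open>The images of the generators of the two factors under \<open>R\<^sub>\<mu> \<otimes> R\<^sub>\<nu> \<rightarrow> e R\<^sub>\<mu>\<^sub>+\<^sub>\<nu> e\<close>, up to the factor \<open>e\<close>.\<close>

fun emb1_gen :: "'k::field multiset \<Rightarrow> 'k gen \<Rightarrow> 'k falg" where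
  "emb1_gen \<nu> (GX l) = gx l"
| "emb1_gen \<nu> (GS k) = gs k"
| "emb1_gen \<nu> (GE i) = (\<Sum>j\<in>permutations_of_multiset \<nu>. ge (i @ j))"
| "emb1_gen \<nu> GP = 0"

fun emb2_gen :: "'k::field multiset \<Rightarrow> 'k gen \<Rightarrow> 'k falg" where
  "emb2_gen \<mu> (GX l) = gx (size \<mu> + l)"
| "emb2_gen \<mu> (GS k) = gs (size \<mu> + k)"
| "emb2_gen \<mu> (GE j) = (\<Sum>i\<in>permutations_of_multiset \<mu>. ge (i @ j))"
| "emb2_gen \<mu> GP = 0"

definition emb1 :: "'k::field \<Rightarrow> 'k \<Rightarrow> 'k multiset \<Rightarrow> 'k multiset \<Rightarrow> 'k palg \<Rightarrow> 'k palg" where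
  "emb1 p lam \<beta> \<gamma> r = the_elem ((\<lambda>f. vv_class p (\<beta> + \<gamma>)
     (subst (emb1_gen (pos_part p lam \<gamma>)) f * e_conv p lam \<beta> \<gamma>)) ` r)"

definition emb2 :: "'k::field \<Rightarrow> 'k \<Rightarrow> 'k multiset \<Rightarrow> 'k multiset \<Rightarrow> 'k palg \<Rightarrow> 'k palg" where
  "emb2 p lam \<beta> \<gamma> s = the_elem ((\<lambda>f. vv_class p (\<beta> + \<gamma>)
     (subst (emb2_gen (pos_part p lam \<beta>)) f * e_conv p lam \<beta> \<gamma>)) ` s)"

text \<open>The left ideal \<open>W e(\<beta>\<^sup>+\<gamma>\<^sup>+)\<close> as a right module over the tensor product of KLR algebras.\<close>

definition ind_bimod ::
  "'k::field \<Rightarrow> 'k \<Rightarrow> 'k multiset \<Rightarrow> 'k multiset \<Rightarrow> (('k palg, 'k palg) tens, 'k palg) module" where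
  "ind_bimod p lam \<beta> \<gamma> =
     (let W = VV p (\<beta> + \<gamma>) in
      \<lparr>carrier = (\<lambda>w. w \<otimes>\<^bsub>W\<^esub> vv_class p (\<beta> + \<gamma>) (e_conv p lam \<beta> \<gamma>)) ` carrier W,
       monoid.mult = monoid.mult W, monoid.one = monoid.one W, ring.zero = ring.zero W, ring.add = ring.add W,
       smult = (\<lambda>z a. tlift W (\<lambda>r s. a \<otimes>\<^bsub>W\<^esub> (emb1 p lam \<beta> \<gamma> r \<otimes>\<^bsub>W\<^esub> emb2 p lam \<beta> \<gamma> s)) z)\<rparr>)"

definition res_outer ::
  "'k::field \<Rightarrow> 'k \<Rightarrow> ('k, 'm) vv_mod \<Rightarrow> ('k, 'n) vv_mod \<Rightarrow>
   (('k palg, 'k palg) tens, ('m, 'n) tens) module" where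
  "res_outer p lam M N = outer p (pdeg p lam M) (pdeg p lam N) (Res p lam M) (Res p lam N)"

text \<open>The element \<open>w \<otimes> t\<close> of \<open>M \<circ> N\<close>.\<close>

definition conv_tensor ::
  "'k::field \<Rightarrow> 'k \<Rightarrow> ('k, 'm) vv_mod \<Rightarrow> ('k, 'n) vv_mod \<Rightarrow>
   'k palg \<Rightarrow> ('m, 'n) tens \<Rightarrow> ('k palg, ('m, 'n) tens) tens" where
  "conv_tensor p lam M N = pure (carrier (KLR2 p (pdeg p lam M) (pdeg p lam N)))
     (ind_bimod p lam (deg M) (deg N)) (res_outer p lam M N)"

definition conv ::
  "'k::field \<Rightarrow> 'k \<Rightarrow> ('k, 'm) vv_mod \<Rightarrow> ('k, 'n) vv_mod \<Rightarrow>
   ('k, ('k palg, ('m, 'n) tens) tens) vv_mod" where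
  "conv p lam M N =
     (let W = VV p (deg M + deg N);
          T = tensor (carrier (KLR2 p (pdeg p lam M) (pdeg p lam N)))
                (ind_bimod p lam (deg M) (deg N)) (res_outer p lam M N) in
      \<lparr>carrier = carrier T, monoid.mult = monoid.mult T, monoid.one = monoid.one T, ring.zero = ring.zero T, ring.add = ring.add T,
       smult = (\<lambda>w. tlift T (\<lambda>a t. conv_tensor p lam M N (w \<otimes>\<^bsub>W\<^esub> a) t)),
       deg = deg M + deg N\<rparr>)"

abbreviation conv_syntax ("(_ \<circ>\<^bsub>_,_\<^esub> _)" [66, 0, 0, 65] 65) where
  "M \<circ>\<^bsub>p,lam\<^esub> N \<equiv> conv p lam M N"

text \<open>The image of \<open>u \<otimes> v\<close> under \<open>Res M \<otimes> Res N \<rightarrow> M \<circ> N\<close>.\<close>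

definition conv_pure ::
  "'k::field \<Rightarrow> 'k \<Rightarrow> ('k, 'm) vv_mod \<Rightarrow> ('k, 'n) vv_mod \<Rightarrow>
   'm \<Rightarrow> 'n \<Rightarrow> ('k palg, ('m, 'n) tens) tens" where
  "conv_pure p lam M N u v =
     conv_tensor p lam M N (vv_class p (deg M + deg N) (e_conv p lam (deg M) (deg N)))
       (outer_pure p (pdeg p lam M) (pdeg p lam N) (Res p lam M) (Res p lam N) u v)"

text \<open>The morphism \<open>M \<circ> N \<rightarrow> C\<close> of VV modules extending \<open>u \<otimes> v \<mapsto> f u v\<close> on \<open>Res M \<otimes> Res N\<close>.\<close>

definition conv_extend ::
  "'k::field \<Rightarrow> 'k \<Rightarrow> ('k, 'm) vv_mod \<Rightarrow> ('k, 'n) vv_mod \<Rightarrow> ('k, 'c) vv_mod \<Rightarrow>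
   ('m \<Rightarrow> 'n \<Rightarrow> 'c) \<Rightarrow> ('k palg, ('m, 'n) tens) tens \<Rightarrow> 'c" where
  "conv_extend p lam M N C f =
     (THE h. h \<in> mod_hom (VV p (deg M + deg N)) (M \<circ>\<^bsub>p,lam\<^esub> N) C \<and>
             h \<in> extensional (carrier (M \<circ>\<^bsub>p,lam\<^esub> N)) \<and>
             (\<forall>u\<in>carrier (Res p lam M). \<forall>v\<in>carrier (Res p lam N). h (conv_pure p lam M N u v) = f u v))"

text \<open>The morphism \<open>f \<circ> g : M \<circ> N \<rightarrow> M' \<circ> N'\<close>.\<close>

definition conv_map ::
  "'k::field \<Rightarrow> 'k \<Rightarrow> ('k, 'm) vv_mod \<Rightarrow> ('k, 'n) vv_mod \<Rightarrow> ('k, 'm1) vv_mod \<Rightarrow> ('k, 'n1) vv_mod \<Rightarrow>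
   ('m \<Rightarrow> 'm1) \<Rightarrow> ('n \<Rightarrow> 'n1) \<Rightarrow>
   ('k palg, ('m, 'n) tens) tens \<Rightarrow> ('k palg, ('m1, 'n1) tens) tens" where
  "conv_map p lam M N M' N' f g =
     conv_extend p lam M N (M' \<circ>\<^bsub>p,lam\<^esub> N') (\<lambda>u v. conv_pure p lam M' N' (f u) (g v))"

text \<open>
  The canonical isomorphism \<open>(L \<circ> M) \<circ> N \<rightarrow> L \<circ> (M \<circ> N)\<close>; it is determined by its values on
  \<open>Res L \<otimes> Res M \<otimes> Res N\<close>, which generates both sides.
\<close>

definition assoc ::
  "'k::field \<Rightarrow> 'k \<Rightarrow> ('k, 'l) vv_mod \<Rightarrow> ('k, 'm) vv_mod \<Rightarrow> ('k, 'n) vv_mod \<Rightarrow>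
   ('k palg, (('k palg, ('l, 'm) tens) tens, 'n) tens) tens \<Rightarrow>
   ('k palg, ('l, ('k palg, ('m, 'n) tens) tens) tens) tens" where
  "assoc p lam L M N =
     (THE h. h \<in> mod_hom (VV p (deg L + deg M + deg N))
               ((L \<circ>\<^bsub>p,lam\<^esub> M) \<circ>\<^bsub>p,lam\<^esub> N) (L \<circ>\<^bsub>p,lam\<^esub> (M \<circ>\<^bsub>p,lam\<^esub> N)) \<and>
             h \<in> extensional (carrier ((L \<circ>\<^bsub>p,lam\<^esub> M) \<circ>\<^bsub>p,lam\<^esub> N)) \<and>
             bij_betw h (carrier ((L \<circ>\<^bsub>p,lam\<^esub> M) \<circ>\<^bsub>p,lam\<^esub> N)) (carrier (L \<circ>\<^bsub>p,lam\<^esub> (M \<circ>\<^bsub>p,lam\<^esub> N))) \<and>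
             (\<forall>u\<in>carrier (Res p lam L). \<forall>v\<in>carrier (Res p lam M). \<forall>w\<in>carrier (Res p lam N).
                h (conv_pure p lam (L \<circ>\<^bsub>p,lam\<^esub> M) N (conv_pure p lam L M u v) w) =
                conv_pure p lam L (M \<circ>\<^bsub>p,lam\<^esub> N) u (conv_pure p lam M N v w)))"

definition assoc_inv ::
  "'k::field \<Rightarrow> 'k \<Rightarrow> ('k, 'l) vv_mod \<Rightarrow> ('k, 'm) vv_mod \<Rightarrow> ('k, 'n) vv_mod \<Rightarrow>
   ('k palg, ('l, ('k palg, ('m, 'n) tens) tens) tens) tens \<Rightarrow>
   ('k palg, (('k palg, ('l, 'm) tens) tens, 'n) tens) tens" where
  "assoc_inv p lam L M N = inv_into (carrier ((L \<circ>\<^bsub>p,lam\<^esub> M) \<circ>\<^bsub>p,lam\<^esub> N)) (assoc p lam L M N)"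

section \<open>R-matrices\<close>

definition phi :: "'k::field multiset \<Rightarrow> nat \<Rightarrow> 'k falg" where
  "phi \<nu> k = (\<Sum>i\<in>theta_seqs \<nu>.
     (if i ! k = i ! Suc k then gs k * gx k - gx k * gs k else gs k) * ge i)"

definition word_perm :: "nat list \<Rightarrow> nat \<Rightarrow> nat" where
  "word_perm a = foldr (\<lambda>k f. swap k \<circ> f) a id"

definition reduced_expr :: "nat \<Rightarrow> nat list \<Rightarrow> (nat \<Rightarrow> nat) \<Rightarrow> bool" where
  "reduced_expr N a w \<longleftrightarrow> (\<forall>k\<in>set a. Suc k < N) \<and> word_perm a = w \<and>
     (\<forall>b. (\<forall>k\<in>set b. Suc k < N) \<longrightarrow> word_perm b = w \<longrightarrow> length a \<le> length b)"

text \<open>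
  The permutation \<open>w[n, m]\<close>, and the reduced expression of it by which \<open>\<phi>\<close> at \<open>w[n, m]\<close> is
  formed (the product does not depend on the reduced expression).
\<close>

definition block_perm :: "nat \<Rightarrow> nat \<Rightarrow> nat \<Rightarrow> nat" where
  "block_perm n m k = (if k < n then k + m else if k < n + m then k - n else k)"

definition block_word :: "nat \<Rightarrow> nat \<Rightarrow> nat list" where
  "block_word n m = concat (map (\<lambda>j. rev [j..<j + m]) [0..<n])"

lemma word_perm_append: "word_perm (a @ b) = word_perm a \<circ> word_perm b"
  by (induction a) (auto simp: word_perm_def)

lemma word_perm_rev_upt:
  "word_perm (rev [j..<j + m]) t = (if t = j then j + m else if j < t \<and> t \<le> j + m then t - 1 else t)"
  by (induction m) (auto simp: word_perm_def transpose_def)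

lemma word_perm_block_word: "word_perm (block_word n m) = block_perm n m"
proof (induction n)
  case 0
  show ?case by (auto simp: block_word_def block_perm_def word_perm_def fun_eq_iff)
next
  case (Suc n)
  have "block_word (Suc n) m = block_word n m @ rev [n..<n + m]"
    by (simp add: block_word_def)
  then have "word_perm (block_word (Suc n) m) = block_perm n m \<circ> word_perm (rev [n..<n + m])"
    by (simp only: word_perm_append Suc.IH)
  then have step: "word_perm (block_word (Suc n) m) t
      = block_perm n m (if t = n then n + m else if n < t \<and> t \<le> n + m then t - 1 else t)" for t
    by (simp only: o_apply word_perm_rev_upt)
  show ?case
  proof
    fix t
    consider "t < n" | "t = n" | "n < t" "t \<le> n + m" | "n + m < t" by linarith
    then show "word_perm (block_word (Suc n) m) t = block_perm (Suc n) m t"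
      by cases (simp_all add: step block_perm_def, arith)
  qed
qed

lemma inversions_word_perm:
  "finite {(i, j). i < j \<and> word_perm b j < word_perm b i} \<and>
   card {(i, j). i < j \<and> word_perm b j < word_perm b i} \<le> length b"
proof (induction b rule: rev_induct)
  case Nil
  have none: "{(i, j). i < j \<and> word_perm [] j < word_perm [] i} = {}"
    by (auto simp: word_perm_def)
  show ?case unfolding none by simp
next
  case (snoc k b)
  let ?A = "{(i, j). i < j \<and> word_perm b j < word_perm b i}"
  let ?B = "{(i, j). i < j \<and> word_perm (b @ [k]) j < word_perm (b @ [k]) i}"
  have sub: "?B \<subseteq> insert (k, Suc k) (map_prod (swap k) (swap k) ` ?A)"
  proof
    fix x assume "x \<in> ?B"
    then obtain i j where x: "x = (i, j)" "i < j"
      "word_perm b (swap k j) < word_perm b (swap k i)"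
      by (auto simp: word_perm_append) (auto simp: word_perm_def)
    show "x \<in> insert (k, Suc k) (map_prod (swap k) (swap k) ` ?A)"
    proof (cases "x = (k, Suc k)")
      case False
      then have "swap k i < swap k j"
        using x by (auto simp: transpose_def)
      then have "(swap k i, swap k j) \<in> ?A" using x by simp
      then have "map_prod (swap k) (swap k) (swap k i, swap k j) \<in> map_prod (swap k) (swap k) ` ?A"
        by (rule imageI)
      then show ?thesis using x by simp
    qed simp
  qed
  have fin: "finite (insert (k, Suc k) (map_prod (swap k) (swap k) ` ?A))"
    using snoc.IH by simp
  have "card ?B \<le> card (insert (k, Suc k) (map_prod (swap k) (swap k) ` ?A))"
    using fin sub by (rule card_mono)
  also have "\<dots> \<le> Suc (card (map_prod (swap k) (swap k) ` ?A))"
    using fin by (simp add: card_insert_if)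
  also have "\<dots> \<le> Suc (card ?A)"
    using snoc.IH card_image_le by auto
  finally show ?case
    using snoc.IH finite_subset[OF sub fin] by auto
qed

lemma reduced_expr_block_word: "reduced_expr (n + m) (block_word n m) (block_perm n m)"
  unfolding reduced_expr_def
proof (intro conjI allI impI)
  show "\<forall>k\<in>set (block_word n m). Suc k < n + m"
    by (auto simp: block_word_def)
  show "word_perm (block_word n m) = block_perm n m"
    by (rule word_perm_block_word)
  fix b assume b: "word_perm b = block_perm n m"
  let ?A = "{(i, j). i < j \<and> word_perm b j < word_perm b i}"
  have fin: "finite ?A" and le: "card ?A \<le> length b"
    using inversions_word_perm by blast+
  have sub: "{..<n} \<times> {n..<n + m} \<subseteq> ?A"
  proof
    fix x assume "x \<in> {..<n} \<times> {n..<n + m}"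
    then obtain i j where x: "x = (i, j)" and ij: "i < n" "n \<le> j" "j < n + m"
      by auto
    then have "j - n < i + m" by arith
    then show "x \<in> ?A" using ij by (simp add: x b block_perm_def)
  qed
  have "length (block_word n m) = n * m"
  proof (induction n)
    case (Suc n)
    then show ?case by (simp add: block_word_def)
  qed (simp add: block_word_def)
  also have "\<dots> = card ({..<n} \<times> {n..<n + m})"
    by (simp add: card_cartesian_product)
  also have "\<dots> \<le> card ?A"
    using fin sub by (rule card_mono)
  finally show "length (block_word n m) \<le> length b"
    using le by (rule le_trans)
qed

definition phi_word :: "'k::field multiset \<Rightarrow> nat list \<Rightarrow> 'k falg" where
  "phi_word \<nu> a = prod_list (map (phi \<nu>) a)"

definition Rmat ::
  "'k::field \<Rightarrow> 'k \<Rightarrow> ('k, 'm) vv_mod \<Rightarrow> ('k, 'n) vv_mod \<Rightarrow>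
   ('k palg, ('m, 'n) tens) tens \<Rightarrow> ('k palg, ('n, 'm) tens) tens" where
  "Rmat p lam M N =
     conv_extend p lam M N (N \<circ>\<^bsub>p,lam\<^esub> M)
       (\<lambda>u v. vv_class p (deg M + deg N)
                (phi_word (deg M + deg N) (block_word (rank (deg N)) (rank (deg M))))
              \<odot>\<^bsub>N \<circ>\<^bsub>p,lam\<^esub> M\<^esub> conv_pure p lam N M v u)"

end

theory Submission
  imports Defs
begin

text \<open>
  As the left ideal of a VV algebra at the positive sequences is generated by products of the
  elements \<open>\<sigma>\<^sub>j \<dots> \<sigma>\<^sub>0 \<pi>\<close> over the KLR algebra in the corner, \<open>Res (M \<circ> N)\<close> is generated by
  \<open>Res M \<otimes> Res N\<close> over the KLR algebra. So a morphism out of a triple convolution product is determined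
  by its values on \<open>u \<otimes> v \<otimes> w\<close>, where all maps in question are given by products of intertwiners
  \<open>\<phi>\<^sub>k\<close>. The relation \<open>\<phi>\<^sub>k\<^sub>+\<^sub>1 \<phi>\<^sub>k \<sigma>\<^sub>k\<^sub>+\<^sub>1 = \<sigma>\<^sub>k \<phi>\<^sub>k\<^sub>+\<^sub>1 \<phi>\<^sub>k\<close> and its mirror image make the R-matrices well
  defined. The two factorizations of \<open>R\<close> reduce to factorizations of the reduced word
  of the block permutation, which need only the commutation of distant \<open>\<phi>\<^sub>k\<close>; the Yang-Baxter
  equation follows from the first factorization for \<open>(L, M, N)\<close> and \<open>(L, N, M)\<close> and the naturality of \<open>R\<close>.
\<close>

section \<open>Quotients of a ring by two-sided ideals\<close>

text \<open>The obstacle is associativity, which has to be built as a morphism. The generator pi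
  acts at position 0 only, so the VV algebra of two neighbouring factors acts on a part of a triple
  product only where these factors stand first. For (L o M) o N they do. For L o (M o N) the entries
  of L are in the way. The element \<open>TT\<close>, a product of elements sigma_j ... sigma_0 pi,
  carries them one by one to the end, each inverted, and so brings the entries of M and N to the
  front. This can be undone: I^+ is stable under \<open>p^2\<close> and disjoint from its inverses,
  so no arrow joins a positive entry to an inverted one, Q is 1 for such a pair, and sigma is an
  involution there. The same fact drives the straightening of the left ideal at the positive
  sequences.

  The algebras are records over quotients by ideals of relations. To calculate in them by rewriting,
  classes are compared through \<open>qcl\<close>, with values in a type of class
  \<open>ring\<close>. That type has no unit; the class of 1 is a unit only among classes modulo the
  same ideal.\<close>

definition two_sided :: "'a::ring set \<Rightarrow> bool" where
  "two_sided I \<longleftrightarrow> 0 \<in> I \<and> (\<forall>a\<in>I. \<forall>b\<in>I. a - b \<in> I) \<and> (\<forall>a\<in>I. \<forall>x. x * a \<in> I \<and> a * x \<in> I)"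

lemma two_sidedD:
  assumes "two_sided I"
  shows "0 \<in> I" "\<lbrakk>a \<in> I; b \<in> I\<rbrakk> \<Longrightarrow> a - b \<in> I" "a \<in> I \<Longrightarrow> x * a \<in> I" "a \<in> I \<Longrightarrow> a * x \<in> I"
    "\<lbrakk>a \<in> I; b \<in> I\<rbrakk> \<Longrightarrow> a + b \<in> I"
proof -
  show *: "0 \<in> I" "\<And>a b. \<lbrakk>a \<in> I; b \<in> I\<rbrakk> \<Longrightarrow> a - b \<in> I" "a \<in> I \<Longrightarrow> x * a \<in> I" "a \<in> I \<Longrightarrow> a * x \<in> I"
    using assms by (auto simp: two_sided_def)
  show "a + b \<in> I" if "a \<in> I" "b \<in> I"
    using *(2)[OF that(1) *(2)[OF *(1) that(2)]] by simp
qed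

lemma congruence_mod_ideal:
  fixes I :: "'a::ring set"
  assumes I: "two_sided I" and a: "a - a' \<in> I" and b: "b - b' \<in> I"
  shows minus_minus_closed: "a - b - (a' - b') \<in> I"
    and times_times_closed: "a * b - a' * b' \<in> I"
proof -
  have "a - b - (a' - b') = (a - a') - (b - b')" "a * b - a' * b' = a * (b - b') + (a - a') * b'"
    by (simp_all add: algebra_simps)
  then show "a - b - (a' - b') \<in> I" "a * b - a' * b' \<in> I"
    using a b by (simp_all only: two_sidedD[OF I])
qed

lemma uminus_uminus_closed: "\<lbrakk>two_sided I; a - a' \<in> I\<rbrakk> \<Longrightarrow> - a - - a' \<in> I"
  using minus_minus_closed[of I 0 0 a a'] by (simp add: two_sidedD(1))

lemma equivp_mod_ideals:
  "equivp (\<lambda>f g::'a::ring set \<Rightarrow> 'a. \<forall>I. two_sided I \<longrightarrow> f I - g I \<in> I)"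
proof (rule equivpI)
  show "reflp (\<lambda>f g::'a set \<Rightarrow> 'a. \<forall>I. two_sided I \<longrightarrow> f I - g I \<in> I)"
    by (auto simp: reflp_def two_sidedD)
  show "symp (\<lambda>f g::'a set \<Rightarrow> 'a. \<forall>I. two_sided I \<longrightarrow> f I - g I \<in> I)"
    unfolding symp_def
  proof (intro allI impI)
    fix f g :: "'a set \<Rightarrow> 'a" and I :: "'a set"
    assume fg: "\<forall>I. two_sided I \<longrightarrow> f I - g I \<in> I" and I: "two_sided I"
    have "g I - f I = 0 - (f I - g I)" by simp
    then show "g I - f I \<in> I" using fg I by (simp only: two_sidedD(1,2))
  qed
  show "transp (\<lambda>f g::'a set \<Rightarrow> 'a. \<forall>I. two_sided I \<longrightarrow> f I - g I \<in> I)"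
    unfolding transp_def
  proof (intro allI impI)
    fix f g h :: "'a set \<Rightarrow> 'a" and I :: "'a set"
    assume fg: "\<forall>I. two_sided I \<longrightarrow> f I - g I \<in> I" and gh: "\<forall>I. two_sided I \<longrightarrow> g I - h I \<in> I"
      and I: "two_sided I"
    have "f I - h I = (f I - g I) + (g I - h I)" by simp
    then show "f I - h I \<in> I" using fg gh I by (simp only: two_sidedD(5))
  qed
qed

text \<open>
  One element of this type is a family of residue classes, one for each two-sided ideal. In this
  way every quotient ring of a type of class \<open>ring\<close> embeds into a fixed type of class \<open>ring\<close>.
\<close>

quotient_type (overloaded) 'a qring = "'a::ring set \<Rightarrow> 'a" / "\<lambda>f g. \<forall>I. two_sided I \<longrightarrow> f I - g I \<in> I"
  by (rule equivp_mod_ideals)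

instantiation qring :: (ring) ring
begin

lift_definition zero_qring :: "'a qring" is "\<lambda>_. 0" .

lift_definition plus_qring :: "'a qring \<Rightarrow> 'a qring \<Rightarrow> 'a qring" is "\<lambda>f g I. f I + g I"
  by (simp add: add_diff_add two_sidedD(5))

lift_definition minus_qring :: "'a qring \<Rightarrow> 'a qring \<Rightarrow> 'a qring" is "\<lambda>f g I. f I - g I"
  by (blast intro: minus_minus_closed)

lift_definition uminus_qring :: "'a qring \<Rightarrow> 'a qring" is "\<lambda>f I. - f I"
  by (blast intro: uminus_uminus_closed)

lift_definition times_qring :: "'a qring \<Rightarrow> 'a qring \<Rightarrow> 'a qring" is "\<lambda>f g I. f I * g I"
  by (blast intro: times_times_closed)

instance
  by standard (transfer; simp add: algebra_simps two_sidedD(1))+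

end

text \<open>The class sits in coordinate \<open>I\<close>, and every other coordinate is 0. This
  makes the map additive and multiplicative, and the image of 1 an idempotent that is a unit for the
  image only.\<close>

lift_definition qcl :: "'a::ring set \<Rightarrow> 'a \<Rightarrow> 'a qring" is "\<lambda>I a J. if J = I then a else 0" .

lemma qcl_add: "qcl I (a + b) = qcl I a + qcl I b"
  and qcl_diff: "qcl I (a - b) = qcl I a - qcl I b"
  and qcl_uminus: "qcl I (- a) = - qcl I a"
  and qcl_mult: "qcl I (a * b) = qcl I a * qcl I b"
  and qcl_zero: "qcl I 0 = 0"
  by (transfer; simp add: two_sidedD(1))+

lemma qcl_sum: "qcl I (sum f A) = (\<Sum>x\<in>A. qcl I (f x))"
  by (induction A rule: infinite_finite_induct) (auto simp: qcl_add qcl_zero)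

lemma qcl_eq_iff: "two_sided I \<Longrightarrow> qcl I a = qcl I b \<longleftrightarrow> a - b \<in> I"
  by (transfer) (auto simp: two_sidedD(1))

section \<open>Algebras given by generators and relations\<close>

lemma plus_list_eq: "(xs::'a list) + ys = xs @ ys"
  by (simp add: plus_list_def)

lemma single_Nil_one: "Poly_Mapping.single [] 1 = (1::'g list \<Rightarrow>\<^sub>0 'k::field)"
  using single_one[where 'a="'g list" and 'b='k] by (simp add: zero_list_def)

lemma scal_one: "scal 1 = 1"
  by (simp add: scal_def single_Nil_one)

lemma scal_mult: "scal c * scal d = scal (c * d)"
  by (simp add: scal_def mult_single plus_list_eq)

lemma scal_add: "scal (c + d) = scal c + scal d"
  by (simp add: scal_def single_add)

lemma scal_zero: "scal 0 = 0"
  by (simp add: scal_def)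

lemma single_Cons:
  "Poly_Mapping.single (g # w) (c::'k::field) = Poly_Mapping.single [g] 1 * Poly_Mapping.single w c"
  by (simp add: mult_single plus_list_eq)

lemma poly_mapping_expand:
  fixes f :: "'a \<Rightarrow>\<^sub>0 'b::comm_monoid_add"
  shows "f = (\<Sum>w\<in>Poly_Mapping.keys f. Poly_Mapping.single w (Poly_Mapping.lookup f w))"
proof (rule poly_mapping_eqI)
  fix v :: 'a
  have "Poly_Mapping.lookup (\<Sum>w\<in>Poly_Mapping.keys f. Poly_Mapping.single w (Poly_Mapping.lookup f w)) v
    = (\<Sum>w\<in>Poly_Mapping.keys f. if w = v then Poly_Mapping.lookup f w else 0)"
    unfolding lookup_sum by (intro sum.cong) (auto simp: lookup_single when_def)
  then show "Poly_Mapping.lookup f v =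
    Poly_Mapping.lookup (\<Sum>w\<in>Poly_Mapping.keys f. Poly_Mapping.single w (Poly_Mapping.lookup f w)) v"
    by (simp add: sum.delta' in_keys_iff)
qed

lemma poly_mapping_keys_induct [consumes 1, case_names zero single add]:
  fixes f :: "'a \<Rightarrow>\<^sub>0 'b::comm_monoid_add"
  assumes "Poly_Mapping.keys f \<subseteq> S"
    and "P 0"
    and single: "\<And>w c. w \<in> S \<Longrightarrow> P (Poly_Mapping.single w c)"
    and add: "\<And>f g. \<lbrakk>Poly_Mapping.keys f \<subseteq> S; Poly_Mapping.keys g \<subseteq> S; P f; P g\<rbrakk> \<Longrightarrow> P (f + g)"
  shows "P f"
proof -
  have "Poly_Mapping.keys (\<Sum>w\<in>K. Poly_Mapping.single w (Poly_Mapping.lookup f w)) \<subseteq> S \<and>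
    P (\<Sum>w\<in>K. Poly_Mapping.single w (Poly_Mapping.lookup f w))" if "finite K" "K \<subseteq> S" for K
    using that
  proof (induction K)
    case (insert w K)
    have "Poly_Mapping.keys (Poly_Mapping.single w (Poly_Mapping.lookup f w)) \<subseteq> S"
      using insert.prems by auto
    then show ?case
      using insert single[of w "Poly_Mapping.lookup f w"]
      by (auto intro!: add dest!: subsetD[OF keys_add])
  qed (use assms(2) in simp)
  from this[OF finite_keys assms(1)] show ?thesis
    using poly_mapping_expand[of f] by simp
qed

text \<open>A support may be enlarged by words with coefficient 0. This brings the sums for
  \<open>f\<close>, \<open>g\<close> and \<open>f + g\<close> over one common index set.\<close>

lemma subst_superset:
  assumes "finite K" "Poly_Mapping.keys f \<subseteq> K"
  shows "subst h f = (\<Sum>w\<in>K. scal (Poly_Mapping.lookup f w) * prod_list (map h w))"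
  unfolding subst_def
  by (rule sum.mono_neutral_left[OF assms]) (auto simp: in_keys_iff scal_zero)

lemma subst_single: "subst h (Poly_Mapping.single w c) = scal c * prod_list (map h w)"
  by (subst subst_superset[of "{w}"]) (auto simp: lookup_single)

lemma subst_zero: "subst h 0 = 0"
  by (simp add: subst_def)

lemma subst_scal: "subst h (scal c) = scal c"
  by (simp add: scal_def subst_single)

lemma subst_one: "subst h 1 = 1"
  using subst_scal[of h 1] by (simp add: scal_one)

lemma subst_gen: "subst h (Poly_Mapping.single [g] 1) = h g"
  by (simp add: subst_single scal_one)

lemma subst_add: "subst h (f + g) = subst h f + subst h g"
proof -
  let ?K = "Poly_Mapping.keys f \<union> Poly_Mapping.keys g"
  have "Poly_Mapping.keys (f + g) \<subseteq> ?K" by (rule keys_add)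
  then show ?thesis
    by (simp add: subst_superset[of ?K] lookup_add scal_add distrib_right sum.distrib)
qed

lemma subst_uminus: "subst h (- f) = - subst h f"
  using subst_add[of h f "- f"] by (simp add: subst_zero eq_neg_iff_add_eq_0 add.commute)

lemma subst_diff: "subst h (f - g) = subst h f - subst h g"
  using subst_add[of h f "- g"] by (simp add: subst_uminus)

lemma subst_sum: "subst h (sum f A) = (\<Sum>x\<in>A. subst h (f x))"
  by (induction A rule: infinite_finite_induct) (auto simp: subst_add subst_zero)

lemma scal_central: "scal c * f = f * scal c"
proof -
  have "Poly_Mapping.keys f \<subseteq> UNIV" by simp
  then show ?thesis
    by (induction f rule: poly_mapping_keys_induct)
      (auto simp: scal_def mult_single plus_list_eq distrib_left distrib_right mult.commute)
qed

text \<open>On monomials the coefficient of the second factor has to pass the word of the first one,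
  which is the centrality of scalars; additivity in each argument does the rest.\<close>

lemma subst_mult: "subst h (f * g) = subst h f * subst h g"
proof -
  have "subst h (Poly_Mapping.single w c * g) = subst h (Poly_Mapping.single w c) * subst h g" for w c
  proof -
    have "Poly_Mapping.keys g \<subseteq> UNIV" by simp
    then show ?thesis
    proof (induction g rule: poly_mapping_keys_induct)
      case (single v d)
      show ?case
        by (simp add: mult_single plus_list_eq subst_single scal_mult[symmetric] mult.assoc)
          (metis mult.assoc scal_central)
    qed (auto simp: subst_zero subst_add distrib_left)
  qed note 1 = this
  have "Poly_Mapping.keys f \<subseteq> UNIV" by simp
  then show ?thesis
    by (induction f rule: poly_mapping_keys_induct) (auto simp: 1 subst_zero subst_add distrib_right)
qed

lemma subst_power: "subst h (f ^ n) = subst h f ^ n"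
  by (induction n) (auto simp: subst_one subst_mult)

lemmas subst_hom = subst_zero subst_one subst_gen subst_scal subst_add subst_diff subst_uminus
  subst_sum subst_mult subst_power

lemma carrier_free_alg: "f \<in> carrier (free_alg G) \<longleftrightarrow> Poly_Mapping.keys f \<subseteq> lists G"
  by (simp add: free_alg_def)

lemma free_alg_closed:
  fixes f g :: "'g list \<Rightarrow>\<^sub>0 'k::field"
  shows "0 \<in> carrier (free_alg G)" "1 \<in> carrier (free_alg G)" "scal c \<in> carrier (free_alg G)"
    "x \<in> G \<Longrightarrow> Poly_Mapping.single [x] 1 \<in> carrier (free_alg G)"
    "\<lbrakk>f \<in> carrier (free_alg G); g \<in> carrier (free_alg G)\<rbrakk> \<Longrightarrow> f + g \<in> carrier (free_alg G)"
    "\<lbrakk>f \<in> carrier (free_alg G); g \<in> carrier (free_alg G)\<rbrakk> \<Longrightarrow> f - g \<in> carrier (free_alg G)"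
    "\<lbrakk>f \<in> carrier (free_alg G); g \<in> carrier (free_alg G)\<rbrakk> \<Longrightarrow> f * g \<in> carrier (free_alg G)"
    "f \<in> carrier (free_alg G) \<Longrightarrow> - f \<in> carrier (free_alg G)"
proof -
  show "1 \<in> carrier (free_alg G)"
    unfolding carrier_free_alg single_Nil_one[symmetric] by simp
  show "f * g \<in> carrier (free_alg G)" if "f \<in> carrier (free_alg G)" "g \<in> carrier (free_alg G)"
    using that keys_mult[of f g] by (fastforce simp: carrier_free_alg plus_list_eq)
  show uminus: "- f \<in> carrier (free_alg G)" if "f \<in> carrier (free_alg G)" for f :: "'g list \<Rightarrow>\<^sub>0 'k"
    using that by (auto simp: carrier_free_alg in_keys_iff)
  show add: "f + g \<in> carrier (free_alg G)"
    if "f \<in> carrier (free_alg G)" "g \<in> carrier (free_alg G)" for f g :: "'g list \<Rightarrow>\<^sub>0 'k"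
    using that keys_add[of f g] by (auto simp: carrier_free_alg)
  show "f - g \<in> carrier (free_alg G)" if "f \<in> carrier (free_alg G)" "g \<in> carrier (free_alg G)"
    using add[OF that(1) uminus[OF that(2)]] by simp
qed (auto simp: carrier_free_alg scal_def)

lemma free_alg_closed_power: "f \<in> carrier (free_alg G) \<Longrightarrow> f ^ n \<in> carrier (free_alg G)"
  by (induction n) (auto intro: free_alg_closed)

lemma free_alg_closed_sum:
  "(\<And>x. x \<in> A \<Longrightarrow> f x \<in> carrier (free_alg G)) \<Longrightarrow> sum f A \<in> carrier (free_alg G)"
  by (induction A rule: infinite_finite_induct) (auto intro: free_alg_closed)

lemma free_alg_closed_prod_list:
  "(\<And>x. x \<in> set xs \<Longrightarrow> x \<in> carrier (free_alg G)) \<Longrightarrow> prod_list xs \<in> carrier (free_alg G)"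
  by (induction xs) (auto intro: free_alg_closed)

lemmas free_alg_intros =
  free_alg_closed free_alg_closed_power free_alg_closed_sum free_alg_closed_prod_list

text \<open>Words grow at the left end, so the step matches a left action, where
  \<open>g * f\<close> acts by \<open>f\<close> and then by the generator \<open>g\<close>.\<close>

lemma free_alg_induct [consumes 1, case_names scal gen add]:
  assumes f: "f \<in> carrier (free_alg G)"
    and scal: "\<And>c. P (scal c)"
    and gen: "\<And>g f. \<lbrakk>g \<in> G; f \<in> carrier (free_alg G); P f\<rbrakk> \<Longrightarrow> P (Poly_Mapping.single [g] 1 * f)"
    and add: "\<And>f g. \<lbrakk>f \<in> carrier (free_alg G); g \<in> carrier (free_alg G); P f; P g\<rbrakk> \<Longrightarrow> P (f + g)"
  shows "P f"
proof -
  have w: "P (Poly_Mapping.single w c)" if "w \<in> lists G" for w c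
    using that
  proof (induction w)
    case Nil
    then show ?case using scal[of c] by (simp add: scal_def)
  next
    case (Cons g w)
    then have "P (Poly_Mapping.single [g] 1 * Poly_Mapping.single w c)"
      by (intro gen) (auto simp: carrier_free_alg)
    then show ?case by (simp only: single_Cons[of g w c, symmetric])
  qed
  from f[unfolded carrier_free_alg] show ?thesis
    by (induction f rule: poly_mapping_keys_induct)
      (use scal[of 0] w add in \<open>auto simp: scal_zero carrier_free_alg\<close>)
qed

lemma free_alg_sel:
  "f \<otimes>\<^bsub>free_alg G\<^esub> g = f * g" "\<one>\<^bsub>free_alg G\<^esub> = 1" "\<zero>\<^bsub>free_alg G\<^esub> = 0" "f \<oplus>\<^bsub>free_alg G\<^esub> g = f + g"
  by (simp_all add: free_alg_def)

lemma ring_free_alg: "ring (free_alg G)"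
proof (rule ringI)
  show "abelian_group (free_alg G)"
  proof (rule abelian_groupI)
    show "\<exists>y\<in>carrier (free_alg G). y \<oplus>\<^bsub>free_alg G\<^esub> x = \<zero>\<^bsub>free_alg G\<^esub>" if "x \<in> carrier (free_alg G)" for x
      by (rule bexI[of _ "- x"]) (auto simp: free_alg_sel that free_alg_closed)
  qed (auto simp: free_alg_sel free_alg_closed add.assoc add.commute)
  show "monoid (free_alg G)"
    by (rule monoidI) (auto simp: free_alg_sel free_alg_closed mult.assoc)
qed (auto simp: free_alg_sel algebra_simps)

lemma a_minus_free_alg:
  assumes "f \<in> carrier (free_alg G)" "g \<in> carrier (free_alg G)"
  shows "f \<ominus>\<^bsub>free_alg G\<^esub> g = f - g"
proof -
  interpret ring "free_alg G" by (rule ring_free_alg)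
  have "\<ominus>\<^bsub>free_alg G\<^esub> g = - g"
    by (rule minus_equality) (auto simp: assms free_alg_sel free_alg_closed)
  then show ?thesis by (simp add: a_minus_def free_alg_sel)
qed

text \<open>Applied before taking classes, this map makes them additive and multiplicative without closedness premises.\<close>

definition retr :: "'g set \<Rightarrow> ('g list \<Rightarrow>\<^sub>0 'k::field) \<Rightarrow> ('g list \<Rightarrow>\<^sub>0 'k)" where
  "retr G = subst (\<lambda>g. if g \<in> G then Poly_Mapping.single [g] 1 else 0)"

lemmas retr_hom = subst_hom[where h="\<lambda>g. if g \<in> G then Poly_Mapping.single [g] 1 else 0" for G,
    folded retr_def]

lemma retr_closed: "retr G f \<in> carrier (free_alg G)"
  unfolding retr_def subst_def by (intro free_alg_intros) (auto intro!: free_alg_intros)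

lemma retr_id:
  assumes "f \<in> carrier (free_alg G)" shows "retr G f = f"
  using assms by (induction f rule: free_alg_induct) (auto simp: retr_hom)

lemma subst_cong:
  assumes "f \<in> carrier (free_alg G)" and "\<And>g. g \<in> G \<Longrightarrow> h g = h' g"
  shows "subst h f = subst h' f"
  using assms(1) by (induction f rule: free_alg_induct) (auto simp: subst_hom assms(2))

lemma abelian_group_cong:
  assumes "abelian_group X" "carrier Y = carrier X" "ring.add Y = ring.add X" "ring.zero Y = ring.zero X"
  shows "abelian_group Y"
proof -
  interpret abelian_group X by fact
  show ?thesis
    by (rule abelian_groupI) (auto simp: assms(2-4) a_ac intro: l_neg)
qed

section \<open>Algebras presented by generators and relations, and modules over them\<close>

locale presented =
  fixes G :: "'g set" and Rel :: "('g list \<Rightarrow>\<^sub>0 'k::field) set"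
  assumes Rel_closed: "Rel \<subseteq> carrier (free_alg G)"
begin

abbreviation "F \<equiv> free_alg G :: ('g list \<Rightarrow>\<^sub>0 'k) ring"

interpretation FR: ring F by (rule ring_free_alg)

interpretation J: ideal "Idl\<^bsub>F\<^esub> Rel" F by (rule FR.genideal_ideal[OF Rel_closed])

abbreviation "A \<equiv> pres_alg G Rel"

lemma ring_A: "ring A"
  unfolding pres_alg_def by (rule J.quotient_is_ring)

interpretation A: ring A by (rule ring_A)

definition cls :: "('g list \<Rightarrow>\<^sub>0 'k) \<Rightarrow> ('g list \<Rightarrow>\<^sub>0 'k) set" where
  "cls f = pres_class G Rel (retr G f)"

text \<open>Pulled back along \<open>retr\<close>, the ideal of relations becomes a two-sided ideal
  of the whole type, as \<open>qcl\<close> requires. Equality of classes can then be proved by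
  rewriting in a type of class \<open>ring\<close>.\<close>

definition ker :: "('g list \<Rightarrow>\<^sub>0 'k) set" where
  "ker = {f. retr G f \<in> Idl\<^bsub>F\<^esub> Rel}"

lemma pres_class_eq_cls: "f \<in> carrier F \<Longrightarrow> pres_class G Rel f = cls f"
  by (simp add: cls_def retr_id)

lemma cls_hom:
  "cls (f + g) = cls f \<oplus>\<^bsub>A\<^esub> cls g" "cls (f * g) = cls f \<otimes>\<^bsub>A\<^esub> cls g" "cls 1 = \<one>\<^bsub>A\<^esub>"
  using ring_hom_add[OF J.rcos_ring_hom retr_closed retr_closed, of f g]
    ring_hom_mult[OF J.rcos_ring_hom retr_closed retr_closed, of f g] ring_hom_one[OF J.rcos_ring_hom]
  by (simp_all add: cls_def pres_class_def pres_alg_def retr_hom free_alg_sel)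

lemma cls_closed: "cls f \<in> carrier A"
  using ring_hom_closed[OF J.rcos_ring_hom retr_closed, of f]
  by (simp add: cls_def pres_class_def pres_alg_def)

lemma A_cases:
  assumes "a \<in> carrier A"
  obtains f where "f \<in> carrier F" "a = cls f"
proof -
  obtain f where "f \<in> carrier F" "a = Idl\<^bsub>F\<^esub> Rel +>\<^bsub>F\<^esub> f"
    using assms by (auto simp: pres_alg_def FactRing_def A_RCOSETS_defs a_r_coset_def r_coset_def)
  then show thesis
    by (intro that[of f]) (auto simp: cls_def pres_class_def retr_id)
qed

lemma two_sided_ker: "two_sided ker"
  unfolding two_sided_def
proof (intro conjI ballI allI)
  show "0 \<in> ker"
    using additive_subgroup.zero_closed[OF J.is_additive_subgroup] by (simp add: ker_def retr_hom free_alg_sel)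
  fix a x assume a: "a \<in> ker"
  show "x * a \<in> ker" "a * x \<in> ker"
    using J.I_l_closed[of "retr G a" "retr G x"] J.I_r_closed[of "retr G a" "retr G x"] a
    by (auto simp: ker_def retr_hom free_alg_sel retr_closed)
  fix b assume b: "b \<in> ker"
  have "- retr G b \<in> Idl\<^bsub>F\<^esub> Rel"
    using J.I_l_closed[of "retr G b" "- 1"] b by (auto simp: ker_def free_alg_sel free_alg_closed)
  then have "retr G a \<oplus>\<^bsub>F\<^esub> - retr G b \<in> Idl\<^bsub>F\<^esub> Rel"
    using a by (intro additive_subgroup.a_closed[OF J.is_additive_subgroup]) (auto simp: ker_def)
  then show "a - b \<in> ker" by (simp add: ker_def retr_hom free_alg_sel)
qed

lemma cls_eq_iff: "cls f = cls g \<longleftrightarrow> f - g \<in> ker"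
proof -
  have "cls f = cls g \<longleftrightarrow> retr G f \<ominus>\<^bsub>F\<^esub> retr G g \<in> Idl\<^bsub>F\<^esub> Rel"
    using FR.quotient_eq_iff_same_a_r_cos[OF J.ideal_axioms retr_closed retr_closed]
    by (simp add: cls_def pres_class_def)
  then show ?thesis
    by (simp add: ker_def retr_hom a_minus_free_alg retr_closed)
qed

lemma Rel_ker: "r \<in> Rel \<Longrightarrow> r \<in> ker"
  using FR.genideal_self[OF Rel_closed] Rel_closed by (auto simp: ker_def retr_id)

lemma mem_cls:
  assumes "f \<in> carrier F"
  shows "g \<in> cls f \<longleftrightarrow> g \<in> carrier F \<and> g - f \<in> Idl\<^bsub>F\<^esub> Rel"
proof
  assume "g \<in> cls f"
  then obtain h where h: "h \<in> Idl\<^bsub>F\<^esub> Rel" "g = h + f"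
    using assms by (auto simp: cls_def pres_class_def retr_id a_r_coset_def r_coset_def free_alg_sel)
  then show "g \<in> carrier F \<and> g - f \<in> Idl\<^bsub>F\<^esub> Rel"
    using assms J.a_subset by (auto intro: free_alg_closed)
next
  assume "g \<in> carrier F \<and> g - f \<in> Idl\<^bsub>F\<^esub> Rel"
  then show "g \<in> cls f"
    using assms by (auto simp: cls_def pres_class_def retr_id a_r_coset_def r_coset_def free_alg_sel
        intro!: bexI[of _ "g - f"])
qed

text \<open>Closure of \<open>K\<close> under negation comes from multiplication by -1, which lies
  in the free algebra.\<close>

lemma ideal_subsetI:
  assumes "\<And>r. r \<in> Rel \<Longrightarrow> r \<in> K" "K \<subseteq> carrier F" "0 \<in> K"
    "\<And>f g. \<lbrakk>f \<in> K; g \<in> K\<rbrakk> \<Longrightarrow> f + g \<in> K"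
    "\<And>f g. \<lbrakk>f \<in> K; g \<in> carrier F\<rbrakk> \<Longrightarrow> g * f \<in> K" "\<And>f g. \<lbrakk>f \<in> K; g \<in> carrier F\<rbrakk> \<Longrightarrow> f * g \<in> K"
  shows "Idl\<^bsub>F\<^esub> Rel \<subseteq> K"
proof (rule FR.genideal_minimal)
  have "- f \<in> K" if "f \<in> K" for f
    using assms(5)[OF that, of "- 1"] by (simp add: free_alg_closed)
  moreover have "\<ominus>\<^bsub>F\<^esub> f = - f" if "f \<in> K" for f
    using a_minus_free_alg[OF free_alg_closed(1), of f G] that assms(2)
    by (auto simp: a_minus_def free_alg_sel)
  ultimately have "\<ominus>\<^bsub>F\<^esub> f \<in> K" if "f \<in> K" for f
    using that by simp
  then have "inv\<^bsub>add_monoid F\<^esub> f \<in> K" if "f \<in> K" for f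
    using that by (simp only: a_inv_def)
  then have "subgroup K (add_monoid F)"
    using assms by (intro subgroup.intro) (simp_all add: free_alg_sel)
  then show "ideal K F"
    by (intro idealI FR.ring_axioms) (auto simp: free_alg_sel assms)
qed (use assms in auto)

text \<open>The action is written on representatives. Its laws then hold for all elements of the
  type, without membership premises on the algebra side, and words can be changed modulo
  \<open>ker\<close>.\<close>

definition act :: "(('g list \<Rightarrow>\<^sub>0 'k) set, 'm, 'y) module_scheme \<Rightarrow> ('g list \<Rightarrow>\<^sub>0 'k) \<Rightarrow> 'm \<Rightarrow> 'm" where
  "act Y f y = cls f \<odot>\<^bsub>Y\<^esub> y"

lemma act_hom:
  assumes "left_module A Y" and y: "y \<in> carrier Y" "z \<in> carrier Y"
  shows "act Y f y \<in> carrier Y"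
    "act Y (f + g) y = act Y f y \<oplus>\<^bsub>Y\<^esub> act Y g y"
    "act Y f (y \<oplus>\<^bsub>Y\<^esub> z) = act Y f y \<oplus>\<^bsub>Y\<^esub> act Y f z"
    "act Y (f * g) y = act Y f (act Y g y)"
    "act Y 1 y = y"
    "act Y 0 y = \<zero>\<^bsub>Y\<^esub>"
    "act Y f \<zero>\<^bsub>Y\<^esub> = \<zero>\<^bsub>Y\<^esub>"
proof -
  interpret left_module A Y by fact
  show 1: "act Y f y \<in> carrier Y" for f
    using y by (simp add: act_def smult_closed cls_closed)
  show 2: "act Y f (y \<oplus>\<^bsub>Y\<^esub> z) = act Y f y \<oplus>\<^bsub>Y\<^esub> act Y f z"
    "act Y (f * g) y = act Y f (act Y g y)" "act Y 1 y = y"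
    using y by (simp_all add: act_def smult_r_distr smult_assoc cls_closed cls_hom smult_one)
  show 3: "act Y (f + g) y = act Y f y \<oplus>\<^bsub>Y\<^esub> act Y g y" for f g
    using y by (simp add: act_def smult_l_distr cls_closed cls_hom)
  have "act Y 0 y \<oplus>\<^bsub>Y\<^esub> act Y 0 y = act Y 0 y"
    using 3[of 0 0] by simp
  then show "act Y 0 y = \<zero>\<^bsub>Y\<^esub>" using 1[of 0] by simp
  have "act Y f \<zero>\<^bsub>Y\<^esub> \<oplus>\<^bsub>Y\<^esub> act Y f \<zero>\<^bsub>Y\<^esub> = act Y f \<zero>\<^bsub>Y\<^esub>"
    using smult_r_distr[OF cls_closed M.zero_closed M.zero_closed, of f] by (simp add: act_def)
  moreover have "act Y f \<zero>\<^bsub>Y\<^esub> \<in> carrier Y"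
    by (simp add: act_def smult_closed cls_closed)
  ultimately show "act Y f \<zero>\<^bsub>Y\<^esub> = \<zero>\<^bsub>Y\<^esub>" by simp
qed

lemma act_cong_ker: "f - g \<in> ker \<Longrightarrow> act Y f y = act Y g y"
  by (simp add: act_def cls_eq_iff[symmetric])

lemma act_regular: "act (with_smult A (\<otimes>\<^bsub>A\<^esub>)) f y = cls f \<otimes>\<^bsub>A\<^esub> y"
  by (simp add: act_def with_smult_def)

definition op_module :: "('x, 'y) ring_scheme \<Rightarrow> (('g list \<Rightarrow>\<^sub>0 'k) \<Rightarrow> 'x \<Rightarrow> 'x) \<Rightarrow>
    (('g list \<Rightarrow>\<^sub>0 'k) set, 'x) module" where
  "op_module X op = with_smult X (\<lambda>w x. op (SOME f. f \<in> carrier F \<and> cls f = w) x)"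

text \<open>The elements of the free algebra that act as zero form a two-sided ideal
  \<open>K\<close>. It contains the relations, hence the ideal generated by them, so the
  representative picked by \<open>SOME\<close> does not matter.\<close>

lemma op_module:
  fixes op :: "('g list \<Rightarrow>\<^sub>0 'k) \<Rightarrow> 'x \<Rightarrow> 'x" and X (structure)
  assumes X: "abelian_group X"
    and closed: "\<And>f x. \<lbrakk>f \<in> carrier F; x \<in> carrier X\<rbrakk> \<Longrightarrow> op f x \<in> carrier X"
    and add: "\<And>f g x. \<lbrakk>f \<in> carrier F; g \<in> carrier F; x \<in> carrier X\<rbrakk> \<Longrightarrow> op (f + g) x = op f x \<oplus> op g x"
    and mult: "\<And>f g x. \<lbrakk>f \<in> carrier F; g \<in> carrier F; x \<in> carrier X\<rbrakk> \<Longrightarrow> op (f * g) x = op f (op g x)"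
    and add': "\<And>f x y. \<lbrakk>f \<in> carrier F; x \<in> carrier X; y \<in> carrier X\<rbrakk> \<Longrightarrow> op f (x \<oplus> y) = op f x \<oplus> op f y"
    and one: "\<And>x. x \<in> carrier X \<Longrightarrow> op 1 x = x"
    and rel: "\<And>r x. \<lbrakk>r \<in> Rel; x \<in> carrier X\<rbrakk> \<Longrightarrow> op r x = \<zero>"
  shows "left_module A (op_module X op)"
    and "\<And>f x. \<lbrakk>f \<in> carrier F; x \<in> carrier X\<rbrakk> \<Longrightarrow> act (op_module X op) f x = op f x"
proof -
  interpret X: abelian_group X by fact
  define K where "K = {f \<in> carrier F. \<forall>x\<in>carrier X. op f x = \<zero>}"
  have op_zero: "op f \<zero> = \<zero>" if "f \<in> carrier F" for f
  proof -
    have "op f \<zero> \<oplus> op f \<zero> = op f \<zero>" using add'[OF that X.zero_closed X.zero_closed] by simp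
    then show ?thesis using closed[OF that X.zero_closed] by simp
  qed
  have zero_op: "op 0 x = \<zero>" if "x \<in> carrier X" for x
  proof -
    have "op 0 x \<oplus> op 0 x = op 0 x" using add[OF free_alg_closed(1,1) that] by simp
    then show ?thesis using closed[OF free_alg_closed(1) that] by simp
  qed
  have "Idl\<^bsub>F\<^esub> Rel \<subseteq> K"
    by (rule ideal_subsetI)
      (use Rel_closed in \<open>auto simp: K_def rel add mult op_zero zero_op closed free_alg_closed\<close>)
  then have op_eq: "op f x = op g x"
    if "f \<in> carrier F" "g \<in> carrier F" "cls f = cls g" "x \<in> carrier X" for f g x
  proof -
    have "f - g \<in> K"
      using that \<open>_ \<subseteq> K\<close> by (auto simp: cls_eq_iff ker_def retr_id free_alg_closed)
    then have "op (f - g) x = \<zero>" using that by (auto simp: K_def)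
    moreover have "op f x = op (f - g) x \<oplus> op g x"
      using add[of "f - g" g x] that by (simp add: free_alg_closed)
    ultimately show ?thesis using closed that by simp
  qed
  have smult: "cls f \<odot>\<^bsub>op_module X op\<^esub> x = op f x" if "f \<in> carrier F" "x \<in> carrier X" for f x
  proof -
    define g where "g = (SOME g. g \<in> carrier F \<and> cls g = cls f)"
    have "g \<in> carrier F \<and> cls g = cls f"
      unfolding g_def by (rule someI[of _ f]) (use that in simp)
    moreover have "cls f \<odot>\<^bsub>op_module X op\<^esub> x = op g x"
      by (simp add: op_module_def with_smult_def g_def)
    ultimately show ?thesis
      using op_eq[of g f x] that by simp
  qed
  then show "act (op_module X op) f x = op f x" if "f \<in> carrier F" "x \<in> carrier X" for f x
    using that by (simp add: act_def)
  have car: "carrier (op_module X op) = carrier X" "(\<oplus>\<^bsub>op_module X op\<^esub>) = (\<oplus>)"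
    by (simp_all add: op_module_def with_smult_def)
  have grp: "abelian_group (op_module X op)"
    by (rule abelian_group_cong[OF X]) (simp_all add: op_module_def with_smult_def)
  have ax: "a \<odot>\<^bsub>op_module X op\<^esub> x \<in> carrier X \<and>
      (a \<oplus>\<^bsub>A\<^esub> b) \<odot>\<^bsub>op_module X op\<^esub> x = a \<odot>\<^bsub>op_module X op\<^esub> x \<oplus> b \<odot>\<^bsub>op_module X op\<^esub> x \<and>
      a \<odot>\<^bsub>op_module X op\<^esub> (x \<oplus> y) = a \<odot>\<^bsub>op_module X op\<^esub> x \<oplus> a \<odot>\<^bsub>op_module X op\<^esub> y \<and>
      (a \<otimes>\<^bsub>A\<^esub> b) \<odot>\<^bsub>op_module X op\<^esub> x = a \<odot>\<^bsub>op_module X op\<^esub> (b \<odot>\<^bsub>op_module X op\<^esub> x) \<and>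
      \<one>\<^bsub>A\<^esub> \<odot>\<^bsub>op_module X op\<^esub> x = x"
    if a: "a \<in> carrier A" and b: "b \<in> carrier A" and x: "x \<in> carrier X" "y \<in> carrier X" for a b x y
  proof -
    from a obtain f where f: "f \<in> carrier F" "a = cls f" by (rule A_cases)
    from b obtain g where g: "g \<in> carrier F" "b = cls g" by (rule A_cases)
    show ?thesis
      using f g x by (simp add: cls_hom[symmetric] smult free_alg_closed closed add add' mult one)
  qed
  show "left_module A (op_module X op)"
    using ax[OF A.one_closed A.one_closed]
    by (intro left_module.intro left_module_axioms.intro ring_A grp) (auto simp: car ax)
qed

end

section \<open>Tensor products\<close>

text \<open>\<open>tlift\<close> is given by an explicit finite sum. This identifies that sum with
  the homomorphism supplied by the universal property of the free abelian group.\<close>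

lemma hom_free_Abelian_group_expand:
  assumes H: "comm_group H" and h: "h \<in> hom (free_Abelian_group S) H" and x: "Poly_Mapping.keys x \<subseteq> S"
  shows "h x = finprod H (\<lambda>a. h (frag_of a) [^]\<^bsub>H\<^esub> Poly_Mapping.lookup x a) (Poly_Mapping.keys x)"
proof -
  interpret H: comm_group H by fact
  interpret h: group_hom "free_Abelian_group S" H h
    using h by (simp add: group_hom_def group_hom_axioms_def H.is_group)
  have "h (\<Sum>a\<in>K. frag_cmul (Poly_Mapping.lookup x a) (frag_of a)) =
      finprod H (\<lambda>a. h (frag_of a) [^]\<^bsub>H\<^esub> Poly_Mapping.lookup x a) K \<and>
      Poly_Mapping.keys (\<Sum>a\<in>K. frag_cmul (Poly_Mapping.lookup x a) (frag_of a)) \<subseteq> S"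
    if "finite K" "K \<subseteq> S" for K
    using that
  proof (induction K)
    case empty
    then show ?case using h.hom_one by simp
  next
    case (insert a K)
    let ?c = "frag_cmul (Poly_Mapping.lookup x a) (frag_of a)"
    let ?s = "\<Sum>a\<in>K. frag_cmul (Poly_Mapping.lookup x a) (frag_of a)"
    have c: "Poly_Mapping.keys ?c \<subseteq> S" using insert.prems by auto
    have "h ?c = h (frag_of a) [^]\<^bsub>H\<^esub> Poly_Mapping.lookup x a"
      using h.hom_int_pow[of "frag_of a" "Poly_Mapping.lookup x a"] insert.prems by simp
    moreover have "h (?c + ?s) = h ?c \<otimes>\<^bsub>H\<^esub> h ?s"
      using h.hom_mult[of ?c ?s] insert c by simp
    moreover have "h (frag_of b) \<in> carrier H" if "b \<in> insert a K" for b
      using insert.prems that by (intro h.hom_closed) auto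
    ultimately show ?case
      using insert c keys_add[of ?c ?s] by (auto simp: Pi_def)
  qed
  from this[OF finite_keys x] show ?thesis
    using frag_expansion[of x] by (simp add: frag_extend_def)
qed

locale tensor_data =
  fixes S :: "'s set" and A :: "('s, 'a, 'x) module_scheme" and B :: "('s, 'b, 'y) module_scheme"
  assumes A: "abelian_group A" and B: "abelian_group B"
    and smult_A: "\<lbrakk>s \<in> S; a \<in> carrier A\<rbrakk> \<Longrightarrow> s \<odot>\<^bsub>A\<^esub> a \<in> carrier A"
    and smult_B: "\<lbrakk>s \<in> S; b \<in> carrier B\<rbrakk> \<Longrightarrow> s \<odot>\<^bsub>B\<^esub> b \<in> carrier B"
begin

interpretation A: abelian_group A by (rule A)
interpretation B: abelian_group B by (rule B)

abbreviation "Fr \<equiv> free_Abelian_group (carrier A \<times> carrier B)"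
abbreviation "K \<equiv> tensor_sub S A B"
abbreviation "T \<equiv> tensor S A B"
abbreviation "prs \<equiv> pure S A B"

interpretation Fr: comm_group Fr by (rule abelian_free_Abelian_group)

lemma rels_closed: "tensor_rels S A B \<subseteq> carrier Fr"
proof -
  have "frag_of x - y \<in> carrier Fr" if "x \<in> carrier A \<times> carrier B" "y \<in> carrier Fr"
    for x :: "'a \<times> 'b" and y
    using that keys_diff[of "frag_of x" y] by auto
  moreover have "x - frag_of y \<in> carrier Fr" if "x \<in> carrier Fr" "y \<in> carrier A \<times> carrier B"
    for x and y :: "'a \<times> 'b"
    using that keys_diff[of x "frag_of y"] by auto
  ultimately show ?thesis
    by (auto simp: tensor_rels_def smult_A smult_B simp del: carrier_free_Abelian_group_iff)
qed

lemma sub_K: "subgroup K Fr"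
  unfolding tensor_sub_def by (rule Fr.generate_is_subgroup[OF rels_closed])

interpretation K: normal K Fr
  by (rule Fr.subgroup_imp_normal[OF sub_K])

abbreviation "co \<equiv> \<lambda>x. K #>\<^bsub>Fr\<^esub> x"

lemma pure_co: "prs a b = co (frag_of (a, b))"
  by (simp add: pure_def)

lemma T_sel:
  "carrier T = co ` carrier Fr" "\<zero>\<^bsub>T\<^esub> = K"
  "\<lbrakk>x \<in> carrier Fr; y \<in> carrier Fr\<rbrakk> \<Longrightarrow> co x \<oplus>\<^bsub>T\<^esub> co y = co (x + y)"
  using K.rcos_sum[of x y] by (simp_all add: tensor_def Let_def carrier_FactGroup)

lemma T_group: "abelian_group T"
proof -
  have "comm_group (Fr Mod K)" by (rule Fr.abelian_FactGroup[OF sub_K])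
  then interpret Q: comm_group "Fr Mod K" .
  have sel: "carrier T = carrier (Fr Mod K)" "ring.add T = monoid.mult (Fr Mod K)"
    "ring.zero T = one (Fr Mod K)"
    by (simp_all add: tensor_def Let_def)
  show ?thesis
    by (rule abelian_groupI) (auto simp: sel Q.m_ac simp del: mult_FactGroup one_FactGroup
        intro: Q.l_inv Q.inv_closed)
qed

interpretation T: abelian_group T by (rule T_group)

lemma co_eq: "\<lbrakk>x \<in> carrier Fr; y \<in> carrier Fr; x - y \<in> K\<rbrakk> \<Longrightarrow> co x = co y"
  by (rule Fr.repr_independence[OF _ _ sub_K, symmetric]) (auto simp: r_coset_def intro!: bexI[of _ "x - y"])

lemma pure_closed: "\<lbrakk>a \<in> carrier A; b \<in> carrier B\<rbrakk> \<Longrightarrow> prs a b \<in> carrier T"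
  by (auto simp: pure_co T_sel)

lemma frag_in: "\<lbrakk>a \<in> carrier A; b \<in> carrier B\<rbrakk> \<Longrightarrow> frag_of (a, b) \<in> carrier Fr"
  by simp

lemma frag_add_in: "\<lbrakk>x \<in> carrier Fr; y \<in> carrier Fr\<rbrakk> \<Longrightarrow> x + y \<in> carrier Fr"
  using keys_add[of x y] by auto

lemma rel_K: "r \<in> tensor_rels S A B \<Longrightarrow> r \<in> K"
  unfolding tensor_sub_def by (rule generate.incl)

lemma pure_add_left:
  assumes "a \<in> carrier A" "a' \<in> carrier A" "b \<in> carrier B"
  shows "prs (a \<oplus>\<^bsub>A\<^esub> a') b = prs a b \<oplus>\<^bsub>T\<^esub> prs a' b"
proof -
  have "frag_of (a \<oplus>\<^bsub>A\<^esub> a', b) - frag_of (a, b) - frag_of (a', b) \<in> K"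
    by (rule rel_K) (use assms in \<open>auto simp: tensor_rels_def\<close>)
  then have "co (frag_of (a \<oplus>\<^bsub>A\<^esub> a', b)) = co (frag_of (a, b) + frag_of (a', b))"
    using assms by (intro co_eq frag_add_in frag_in) (simp_all add: algebra_simps)
  then show ?thesis using assms by (simp only: pure_co T_sel(3) frag_in)
qed

lemma pure_add_right:
  assumes "a \<in> carrier A" "b \<in> carrier B" "b' \<in> carrier B"
  shows "prs a (b \<oplus>\<^bsub>B\<^esub> b') = prs a b \<oplus>\<^bsub>T\<^esub> prs a b'"
proof -
  have "frag_of (a, b \<oplus>\<^bsub>B\<^esub> b') - frag_of (a, b) - frag_of (a, b') \<in> K"
    by (rule rel_K) (use assms in \<open>auto simp: tensor_rels_def\<close>)
  then have "co (frag_of (a, b \<oplus>\<^bsub>B\<^esub> b')) = co (frag_of (a, b) + frag_of (a, b'))"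
    using assms by (intro co_eq frag_add_in frag_in) (simp_all add: algebra_simps)
  then show ?thesis using assms by (simp only: pure_co T_sel(3) frag_in)
qed

lemma pure_balanced:
  assumes "s \<in> S" "a \<in> carrier A" "b \<in> carrier B"
  shows "prs (s \<odot>\<^bsub>A\<^esub> a) b = prs a (s \<odot>\<^bsub>B\<^esub> b)"
  unfolding pure_co
proof (rule co_eq)
  show "frag_of (s \<odot>\<^bsub>A\<^esub> a, b) - frag_of (a, s \<odot>\<^bsub>B\<^esub> b) \<in> K"
    by (rule rel_K) (use assms in \<open>auto simp: tensor_rels_def\<close>)
qed (use assms smult_A smult_B in auto)

lemma pure_zero_left: "b \<in> carrier B \<Longrightarrow> prs \<zero>\<^bsub>A\<^esub> b = \<zero>\<^bsub>T\<^esub>"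
  using pure_add_left[of "\<zero>\<^bsub>A\<^esub>" "\<zero>\<^bsub>A\<^esub>" b] pure_closed[of "\<zero>\<^bsub>A\<^esub>" b] by simp

lemma pure_minus:
  assumes "a \<in> carrier A" "b \<in> carrier B"
  shows "prs (\<ominus>\<^bsub>A\<^esub> a) b = \<ominus>\<^bsub>T\<^esub> prs a b"
  using pure_add_left[of "\<ominus>\<^bsub>A\<^esub> a" a b] assms pure_zero_left[of b]
  by (intro T.minus_equality[symmetric]) (auto simp: pure_closed A.l_neg)

lemma T_induct [consumes 1, case_names zero pure add]:
  assumes x: "x \<in> carrier T"
    and zero: "P \<zero>\<^bsub>T\<^esub>"
    and pure: "\<And>a b. \<lbrakk>a \<in> carrier A; b \<in> carrier B\<rbrakk> \<Longrightarrow> P (prs a b)"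
    and add: "\<And>x y. \<lbrakk>x \<in> carrier T; y \<in> carrier T; P x; P y\<rbrakk> \<Longrightarrow> P (x \<oplus>\<^bsub>T\<^esub> y)"
  shows "P x"
proof -
  obtain u where u: "Poly_Mapping.keys u \<subseteq> carrier A \<times> carrier B" "x = co u"
    using x by (auto simp: T_sel)
  have zero': "co 0 = \<zero>\<^bsub>T\<^esub>"
    using Fr.coset_join2[OF _ sub_K, of 0] subgroup.one_closed[OF sub_K] by (simp add: T_sel)
  \<comment> \<open>Strengthened to \<open>u\<close> and \<open>- u\<close>, because induction on
    the free abelian group has a step for differences while the claim only knows sums. A negative
    pure tensor is again pure, with the sign in its left factor.\<close>
  from u(1) have "P (co u) \<and> P (co (- u))"
  proof (induction u rule: free_Abelian_group_induct[consumes 1, case_names zero diff gen])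
    case zero
    then show ?case using assms(2) zero' by simp
  next
    case (diff u v)
    have "co (u - v) = co u \<oplus>\<^bsub>T\<^esub> co (- v)" "co (- (u - v)) = co (- u) \<oplus>\<^bsub>T\<^esub> co v"
      using T_sel(3)[of u "- v"] T_sel(3)[of "- u" v] diff by simp_all
    then show ?case
      using diff by (auto intro!: add simp: T_sel(1))
  next
    case (gen ab)
    obtain a b where ab: "ab = (a, b)" "a \<in> carrier A" "b \<in> carrier B" using gen by auto
    have "prs a b \<oplus>\<^bsub>T\<^esub> co (- frag_of (a, b)) = \<zero>\<^bsub>T\<^esub>"
      unfolding pure_co using ab T_sel(3)[of "frag_of (a, b)" "- frag_of (a, b)"] zero' by simp
    then have "co (- frag_of (a, b)) = prs (\<ominus>\<^bsub>A\<^esub> a) b"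
      using ab T.minus_equality[of "co (- frag_of (a, b))" "prs a b"] pure_closed
      by (simp add: pure_minus T.a_comm T_sel(1))
    then show ?case using ab pure[of a b] pure[of "\<ominus>\<^bsub>A\<^esub> a" b] by (simp add: pure_co)
  qed
  then show ?thesis using u by simp
qed

text \<open>The map \<open>f\<close> extends to a homomorphism \<open>h\<close> on the free abelian
  group. Biadditivity and balance say that \<open>h\<close> kills the relations, hence
  \<open>K\<close>. So the sum in \<open>tlift\<close> takes a single value on each coset, and
  \<open>the_elem\<close> picks that value.\<close>

lemma tlift:
  assumes C: "abelian_group C"
    and closed: "\<And>a b. \<lbrakk>a \<in> carrier A; b \<in> carrier B\<rbrakk> \<Longrightarrow> f a b \<in> carrier C"
    and left: "\<And>a a' b. \<lbrakk>a \<in> carrier A; a' \<in> carrier A; b \<in> carrier B\<rbrakk> \<Longrightarrow>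
      f (a \<oplus>\<^bsub>A\<^esub> a') b = f a b \<oplus>\<^bsub>C\<^esub> f a' b"
    and right: "\<And>a b b'. \<lbrakk>a \<in> carrier A; b \<in> carrier B; b' \<in> carrier B\<rbrakk> \<Longrightarrow>
      f a (b \<oplus>\<^bsub>B\<^esub> b') = f a b \<oplus>\<^bsub>C\<^esub> f a b'"
    and bal: "\<And>s a b. \<lbrakk>s \<in> S; a \<in> carrier A; b \<in> carrier B\<rbrakk> \<Longrightarrow> f (s \<odot>\<^bsub>A\<^esub> a) b = f a (s \<odot>\<^bsub>B\<^esub> b)"
  shows "\<And>x. x \<in> carrier T \<Longrightarrow> tlift C f x \<in> carrier C"
    and "\<And>x y. \<lbrakk>x \<in> carrier T; y \<in> carrier T\<rbrakk> \<Longrightarrow> tlift C f (x \<oplus>\<^bsub>T\<^esub> y) = tlift C f x \<oplus>\<^bsub>C\<^esub> tlift C f y"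
    and "\<And>a b. \<lbrakk>a \<in> carrier A; b \<in> carrier B\<rbrakk> \<Longrightarrow> tlift C f (prs a b) = f a b"
proof -
  interpret C: abelian_group C by fact
  let ?H = "add_monoid C"
  have H: "comm_group ?H" by (rule C.a_comm_group)
  have grp: "group ?H" and mon: "monoid ?H" and com: "comm_monoid ?H"
    using H by (auto simp: comm_group_def group_def)
  have "(\<lambda>x. f (fst x) (snd x)) ` (carrier A \<times> carrier B) \<subseteq> carrier ?H"
    using closed by auto
  then obtain h where h: "h \<in> hom Fr ?H"
    and hf: "\<And>x. x \<in> carrier A \<times> carrier B \<Longrightarrow> h (frag_of x) = f (fst x) (snd x)"
    using comm_group.free_Abelian_group_universal[OF H] by blast
  interpret h: group_hom Fr ?H h
    using h by (simp add: group_hom_def group_hom_axioms_def grp)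
  have h_add: "h (x + y) = h x \<oplus>\<^bsub>C\<^esub> h y" if "x \<in> carrier Fr" "y \<in> carrier Fr" for x y
    using h.hom_mult[OF that] by simp
  have h_closed: "h x \<in> carrier C" if "x \<in> carrier Fr" for x
    using h.hom_closed[OF that] by simp
  have h_diff: "h (x - y) = \<zero>\<^bsub>C\<^esub> \<longleftrightarrow> h x = h y" if "x \<in> carrier Fr" "y \<in> carrier Fr" for x y
  proof -
    have d: "x - y \<in> carrier Fr" using that keys_diff[of x y] by auto
    have "h x = h (x - y) \<oplus>\<^bsub>C\<^esub> h y" using h_add[OF d that(2)] by simp
    then show ?thesis using h_closed[OF d] h_closed that by auto
  qed
  have hrel: "h r = \<zero>\<^bsub>C\<^esub>" if "r \<in> tensor_rels S A B" for r
  proof -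
    have *: "x - y - z = x - (y + z)" for x y z :: "'a \<times> 'b \<Rightarrow>\<^sub>0 int" by simp
    show ?thesis
      using that unfolding tensor_rels_def *
      by (elim UnE CollectE exE conjE; hypsubst;
          subst h_diff; (intro frag_in frag_add_in)?;
          simp only: h_add frag_in hf mem_Times_iff fst_conv snd_conv left right bal smult_A smult_B
            A.a_closed B.a_closed)
  qed
  have hK: "h r = \<zero>\<^bsub>C\<^esub>" if "r \<in> K" for r
  proof -
    from that have "r \<in> carrier Fr \<and> h r = \<one>\<^bsub>?H\<^esub>"
      unfolding tensor_sub_def
    proof (induction rule: generate.induct)
      case one
      then show ?case using h.hom_one by simp
    next
      case (incl r)
      then show ?case using hrel[OF incl] subsetD[OF rels_closed incl] by simp
    next
      case (inv r)
      then have r: "r \<in> carrier Fr" "h r = \<one>\<^bsub>?H\<^esub>"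
        using hrel[OF inv] subsetD[OF rels_closed inv] by simp_all
      then show ?case using h.hom_inv[OF r(1)] Fr.inv_closed[OF r(1)] monoid.inv_one[OF mon] by metis
    next
      case (eng r s)
      then show ?case using h.hom_mult[of r s] Fr.m_closed[of r s] monoid.l_one[OF mon monoid.one_closed[OF mon]] by metis
    qed
    then show ?thesis by simp
  qed
  have expand: "(\<Oplus>\<^bsub>C\<^esub>ab\<in>Poly_Mapping.keys x. add_pow C (Poly_Mapping.lookup x ab) (f (fst ab) (snd ab))) = h x"
    if x: "x \<in> carrier Fr" for x
  proof -
    have "h x = finprod ?H (\<lambda>a. h (frag_of a) [^]\<^bsub>?H\<^esub> Poly_Mapping.lookup x a) (Poly_Mapping.keys x)"
      using hom_free_Abelian_group_expand[OF H h] x by simp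
    also have "\<dots> = finprod ?H (\<lambda>a. f (fst a) (snd a) [^]\<^bsub>?H\<^esub> Poly_Mapping.lookup x a) (Poly_Mapping.keys x)"
      by (rule comm_monoid.finprod_cong'[OF com]) (use x hf closed in \<open>auto intro!: group.int_pow_closed[OF grp, simplified]\<close>)
    finally show ?thesis by (simp add: finsum_def add_pow_def)
  qed
  have co: "tlift C f (co x) = h x" if x: "x \<in> carrier Fr" for x
  proof -
    have "(\<lambda>x. \<Oplus>\<^bsub>C\<^esub>ab\<in>Poly_Mapping.keys x. add_pow C (Poly_Mapping.lookup x ab) (f (fst ab) (snd ab))) ` co x = {h x}"
    proof -
      have 1: "y \<in> carrier Fr \<and> h y = h x" if y: "y \<in> co x" for y
      proof -
        obtain k where k: "k \<in> K" "y = k + x" using y by (auto simp: r_coset_def)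
        have "k \<in> carrier Fr" using k(1) subgroup.subset[OF sub_K] by blast
        then show ?thesis
          using k x hK[OF k(1)] h_add[of k x] h_closed[OF x] frag_add_in by simp
      qed
      have "(\<lambda>x. \<Oplus>\<^bsub>C\<^esub>ab\<in>Poly_Mapping.keys x. add_pow C (Poly_Mapping.lookup x ab) (f (fst ab) (snd ab))) ` co x =
          (\<lambda>_. h x) ` co x"
      proof (rule image_cong[OF refl])
        fix y assume "y \<in> co x"
        note y = 1[OF this]
        show "(\<Oplus>\<^bsub>C\<^esub>ab\<in>Poly_Mapping.keys y. add_pow C (Poly_Mapping.lookup y ab) (f (fst ab) (snd ab))) = h x"
          by (rule trans[OF expand[OF conjunct1[OF y]] conjunct2[OF y]])
      qed
      then show ?thesis
        using Fr.rcos_self[OF x sub_K] by (simp only: image_constant)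
    qed
    then show ?thesis by (simp add: tlift_def)
  qed
  show "tlift C f x \<in> carrier C" if "x \<in> carrier T" for x
    using that by (auto simp: T_sel co h_closed simp del: carrier_free_Abelian_group_iff)
  show "tlift C f (x \<oplus>\<^bsub>T\<^esub> y) = tlift C f x \<oplus>\<^bsub>C\<^esub> tlift C f y" if "x \<in> carrier T" "y \<in> carrier T" for x y
    using that by (auto simp: T_sel co h_add frag_add_in simp del: carrier_free_Abelian_group_iff)
  show "tlift C f (prs a b) = f a b" if "a \<in> carrier A" "b \<in> carrier B" for a b
    using that by (simp only: pure_co co frag_in hf mem_Times_iff fst_conv snd_conv)
qed

end

section \<open>The relations of KLR and VV algebras\<close>

lemma length_theta_seqs: "i \<in> theta_seqs \<nu> \<Longrightarrow> length i = rank \<nu>"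
  by (auto simp: theta_seqs_def rank_def)

lemma finite_theta_seqs: "finite (theta_seqs \<nu>)"
proof (rule finite_subset)
  show "theta_seqs \<nu> \<subseteq> {i. set i \<subseteq> set_mset \<nu> \<and> length i = rank \<nu>}"
    by (auto simp: length_theta_seqs) (auto simp: theta_seqs_def)
  show "finite {i. set i \<subseteq> set_mset \<nu> \<and> length i = rank \<nu>}"
    by (rule finite_lists_length_eq) simp
qed

lemma mset_swap: "Suc k < length i \<Longrightarrow> mset (permute_list (swap k) i) = mset i"
  by (rule mset_permute_list) (simp add: permutes_swap_id)

lemma theta_seqs_swap: "\<lbrakk>i \<in> theta_seqs \<nu>; Suc k < rank \<nu>\<rbrakk> \<Longrightarrow> permute_list (swap k) i \<in> theta_seqs \<nu>"
  using mset_swap[of k i] by (auto simp: theta_seqs_def length_theta_seqs)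

lemma theta_seqs_flip:
  assumes "i \<in> theta_seqs \<nu>" "0 < rank \<nu>"
  shows "i[0 := inverse (i ! 0)] \<in> theta_seqs (\<nu>::'k::field multiset)"
  using assms length_theta_seqs[OF assms(1)] by (cases i) (auto simp: theta_seqs_def)

lemma theta_seqs_append:
  "\<lbrakk>i \<in> theta_seqs \<mu>; j \<in> theta_seqs \<nu>\<rbrakk> \<Longrightarrow> i @ j \<in> theta_seqs (\<mu> + \<nu>)"
  by (auto simp: theta_seqs_def)

lemma permutations_swap:
  "\<lbrakk>i \<in> permutations_of_multiset \<nu>; Suc k < size \<nu>\<rbrakk> \<Longrightarrow> permute_list (swap k) i \<in> permutations_of_multiset \<nu>"
  using mset_swap[of k i] by (auto simp: permutations_of_multiset_def)

lemma Qpol_closed: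
  "\<lbrakk>f \<in> carrier (free_alg G); g \<in> carrier (free_alg G)\<rbrakk> \<Longrightarrow> Qpol p i j f g \<in> carrier (free_alg G)"
  by (auto simp: Qpol_def intro!: free_alg_intros)

lemma Qdiff_closed:
  "\<lbrakk>f \<in> carrier (free_alg G); g \<in> carrier (free_alg G); h \<in> carrier (free_alg G)\<rbrakk> \<Longrightarrow>
    Qdiff p i j f g h \<in> carrier (free_alg G)"
  by (auto simp: Qdiff_def Let_def intro!: free_alg_intros)

lemma subst_Qpol: "subst h (Qpol p i j f g) = Qpol p i j (subst h f) (subst h g)"
  by (simp add: Qpol_def subst_hom)

lemma subst_Qdiff: "subst h (Qdiff p i j f g r) = Qdiff p i j (subst h f) (subst h g) (subst h r)"
  by (simp add: Qdiff_def Let_def subst_hom)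

lemma klr_rels_closed:
  assumes "klr_gens m J \<subseteq> G"
    and "\<And>i k. \<lbrakk>i \<in> J; Suc k < m\<rbrakk> \<Longrightarrow> permute_list (swap k) i \<in> J"
  shows "klr_rels p m J \<subseteq> carrier (free_alg G)"
proof -
  have g: "l < m \<Longrightarrow> GX l \<in> G" "Suc k < m \<Longrightarrow> GS k \<in> G" "i \<in> J \<Longrightarrow> GE i \<in> G" for l k i
    using assms(1) by (auto simp: klr_gens_def)
  have sw: "swap k l < m" if "l < m" "Suc k < m" for k l
    using that by (auto simp: transpose_def)
  show ?thesis
    unfolding klr_rels_def
    by (intro Un_least subsetI; elim CollectE exE conjE insertE emptyE; hypsubst)
      (auto intro!: free_alg_intros Qpol_closed Qdiff_closed g sw assms(2))
qed

lemma presented_KLR: "presented (KLR_gens \<nu>) (KLR_rels p \<nu>)"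
  unfolding presented_def KLR_gens_def KLR_rels_def
  by (rule klr_rels_closed) (auto simp: permutations_swap)

lemma presented_VV: "presented (VV_gens \<nu>) (VV_rels p \<nu>)"
proof -
  have g: "l < rank \<nu> \<Longrightarrow> GX l \<in> VV_gens \<nu>" "Suc k < rank \<nu> \<Longrightarrow> GS k \<in> VV_gens \<nu>"
    "i \<in> theta_seqs \<nu> \<Longrightarrow> GE i \<in> VV_gens \<nu>" "0 < rank \<nu> \<Longrightarrow> GP \<in> VV_gens \<nu>" for l k i
    by (auto simp: klr_gens_def VV_gens_def)
  have "klr_rels p (rank \<nu>) (theta_seqs \<nu>) \<subseteq> carrier (free_alg (VV_gens \<nu>))"
    by (rule klr_rels_closed) (auto simp: VV_gens_def theta_seqs_swap)
  moreover have "pi_rels (rank \<nu>) (theta_seqs \<nu>) \<subseteq> carrier (free_alg (VV_gens \<nu>))" if "0 < rank \<nu>"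
    using that unfolding pi_rels_def
    by (auto intro!: free_alg_intros g theta_seqs_flip)
  ultimately show ?thesis
    by (auto simp: presented_def VV_rels_def)
qed

interpretation VV: presented "VV_gens \<nu>" "VV_rels p \<nu>"
  rewrites "pres_alg (VV_gens \<nu>) (VV_rels p \<nu>) = VV p \<nu>"
    and "pres_class (VV_gens \<nu>) (VV_rels p \<nu>) = vv_class p \<nu>"
  for \<nu> p
  by (simp_all only: presented_VV VV_def vv_class_def)

interpretation KLR: presented "KLR_gens \<nu>" "KLR_rels p \<nu>"
  rewrites "pres_alg (KLR_gens \<nu>) (KLR_rels p \<nu>) = KLR p \<nu>"
    and "pres_class (KLR_gens \<nu>) (KLR_rels p \<nu>) = klr_class p \<nu>"
  for \<nu> p
  by (simp_all only: presented_KLR KLR_def klr_class_def)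

abbreviation vcl :: "'k::field \<Rightarrow> 'k multiset \<Rightarrow> 'k falg \<Rightarrow> 'k palg" where
  "vcl p \<nu> \<equiv> presented.cls (VV_gens \<nu>) (VV_rels p \<nu>)"

abbreviation vker :: "'k::field \<Rightarrow> 'k multiset \<Rightarrow> 'k falg set" where
  "vker p \<nu> \<equiv> presented.ker (VV_gens \<nu>) (VV_rels p \<nu>)"

abbreviation vact :: "'k::field \<Rightarrow> 'k multiset \<Rightarrow> ('k palg, 'm, 'y) module_scheme \<Rightarrow> 'k falg \<Rightarrow> 'm \<Rightarrow> 'm" where
  "vact p \<nu> \<equiv> presented.act (VV_gens \<nu>) (VV_rels p \<nu>)"

abbreviation vq :: "'k::field \<Rightarrow> 'k multiset \<Rightarrow> 'k falg \<Rightarrow> 'k falg qring" where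
  "vq p \<nu> \<equiv> qcl (vker p \<nu>)"

lemma vq_eq_iff: "vq p \<nu> f = vq p \<nu> g \<longleftrightarrow> f - g \<in> vker p \<nu>"
  by (rule qcl_eq_iff[OF VV.two_sided_ker])

lemma vcl_eq_vq: "vcl p \<nu> f = vcl p \<nu> g \<longleftrightarrow> vq p \<nu> f = vq p \<nu> g"
  by (simp add: vq_eq_iff VV.cls_eq_iff)

lemma vact_cong: "vq p \<nu> f = vq p \<nu> g \<Longrightarrow> vact p \<nu> Y f y = vact p \<nu> Y g y"
  by (simp add: vq_eq_iff VV.act_cong_ker)

lemma vq_rel: "r \<in> VV_rels p \<nu> \<Longrightarrow> vq p \<nu> r = 0"
proof -
  assume "r \<in> VV_rels p \<nu>"
  then have "vq p \<nu> r = vq p \<nu> 0"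
    unfolding vq_eq_iff using VV.Rel_ker by simp
  then show ?thesis by (simp add: qcl_zero)
qed

lemmas q_hom = qcl_add qcl_diff qcl_uminus qcl_mult qcl_zero qcl_sum

locale vv_ring =
  fixes p :: "'k::field" and \<nu> :: "'k multiset"
begin

abbreviation "\<theta> \<equiv> theta_seqs \<nu>"
abbreviation "q \<equiv> vq p \<nu>"
abbreviation "X l \<equiv> q (gx l)"
abbreviation "S k \<equiv> q (gs k)"
abbreviation "P \<equiv> q gp"
abbreviation "E i \<equiv> q (ge i)"

text \<open>Substitute for the unit laws: the class of 1 is a unit among classes modulo the
  relations.\<close>

lemma q_one: "q f * q 1 = q f" "q 1 * q f = q f"
  by (simp_all add: qcl_mult[symmetric])

lemma klr_rel: "r \<in> klr_rels p (rank \<nu>) \<theta> \<Longrightarrow> q r = 0"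
  by (rule vq_rel) (simp add: VV_rels_def)

lemma pi_rel: "\<lbrakk>r \<in> pi_rels (rank \<nu>) \<theta>; 0 < rank \<nu>\<rbrakk> \<Longrightarrow> q r = 0"
  by (rule vq_rel) (simp add: VV_rels_def)

lemma E_mult: assumes "i \<in> \<theta>" "j \<in> \<theta>" shows "E i * E j = (if i = j then E i else 0)"
proof -
  have "q (ge i * ge j - (if i = j then ge i else 0)) = 0"
    by (rule klr_rel) (use assms in \<open>unfold klr_rels_def, blast\<close>)
  then show ?thesis by (auto simp: q_hom split: if_splits)
qed

lemma sum_E: "(\<Sum>i\<in>\<theta>. E i) = q 1"
proof -
  have "q ((\<Sum>i\<in>\<theta>. ge i) - 1) = 0"
    by (rule klr_rel) (unfold klr_rels_def, blast)
  then show ?thesis by (simp add: q_hom)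
qed

lemma S_E:
  assumes "Suc k < rank \<nu>" "i \<in> \<theta>" shows "S k * E i = E (permute_list (swap k) i) * S k"
proof -
  have "q (gs k * ge i - ge (permute_list (swap k) i) * gs k) = 0"
    by (rule klr_rel) (use assms in \<open>unfold klr_rels_def, blast\<close>)
  then show ?thesis by (simp add: q_hom)
qed

lemma X_E: assumes "l < rank \<nu>" "i \<in> \<theta>" shows "X l * E i = E i * X l"
proof -
  have "q (gx l * ge i - ge i * gx l) = 0"
    by (rule klr_rel) (use assms in \<open>unfold klr_rels_def, blast\<close>)
  then show ?thesis by (simp add: q_hom)
qed

lemma X_X: assumes "l < rank \<nu>" "r < rank \<nu>" shows "X l * X r = X r * X l"
proof -
  have "q (gx l * gx r - gx r * gx l) = 0"
    by (rule klr_rel) (use assms in \<open>unfold klr_rels_def, blast\<close>)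
  then show ?thesis by (simp add: q_hom)
qed

lemma S_S:
  assumes "Suc k < rank \<nu>" "i \<in> \<theta>"
  shows "S k * S k * E i = q (Qpol p (i ! k) (i ! Suc k) (gx (Suc k)) (gx k)) * E i"
proof -
  have "q (gs k * gs k * ge i - Qpol p (i ! k) (i ! Suc k) (gx (Suc k)) (gx k) * ge i) = 0"
    by (rule klr_rel) (use assms in \<open>unfold klr_rels_def, blast\<close>)
  then show ?thesis by (simp add: q_hom)
qed

lemma S_S_distant:
  assumes "Suc j < rank \<nu>" "Suc k < rank \<nu>" "j \<noteq> Suc k" "k \<noteq> Suc j"
  shows "S j * S k = S k * S j"
proof -
  have "q (gs j * gs k - gs k * gs j) = 0"
    by (rule klr_rel) (use assms in \<open>unfold klr_rels_def, blast\<close>)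
  then show ?thesis by (simp add: q_hom)
qed

lemma braid:
  assumes "k + 2 < rank \<nu>" "i \<in> \<theta>"
  shows "(S (Suc k) * S k * S (Suc k) - S k * S (Suc k) * S k) * E i =
    (if i ! k = i ! (k + 2)
     then q (Qdiff p (i ! k) (i ! Suc k) (gx k) (gx (Suc k)) (gx (k + 2))) * E i else 0)"
proof -
  have "q ((gs (Suc k) * gs k * gs (Suc k) - gs k * gs (Suc k) * gs k) * ge i
        - (if i ! k = i ! (k + 2)
           then Qdiff p (i ! k) (i ! Suc k) (gx k) (gx (Suc k)) (gx (k + 2)) * ge i else 0)) = 0"
    by (rule klr_rel) (use assms in \<open>unfold klr_rels_def, blast\<close>)
  then show ?thesis by (simp add: q_hom split: if_splits)
qed

lemma S_X:
  assumes "Suc k < rank \<nu>" "l < rank \<nu>" "i \<in> \<theta>"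
  shows "(S k * X l - X (swap k l) * S k) * E i =
    (if l = k \<and> i ! k = i ! Suc k then - E i
     else if l = Suc k \<and> i ! k = i ! Suc k then E i else 0)"
proof -
  have "q ((gs k * gx l - gx (swap k l) * gs k) * ge i
        - (if l = k \<and> i ! k = i ! Suc k then - ge i
           else if l = Suc k \<and> i ! k = i ! Suc k then ge i else 0)) = 0"
    by (rule klr_rel) (use assms in \<open>unfold klr_rels_def, blast\<close>)
  then show ?thesis by (simp add: q_hom split: if_splits)
qed

lemma P_E: assumes "0 < rank \<nu>" "i \<in> \<theta>" shows "P * E i = E (i[0 := inverse (i ! 0)]) * P"
proof -
  have "q (gp * ge i - ge (i[0 := inverse (i ! 0)]) * gp) = 0"
    by (rule pi_rel) (use assms in \<open>unfold pi_rels_def, blast\<close>, rule assms)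
  then show ?thesis by (simp add: q_hom)
qed

lemma P_X0: assumes "0 < rank \<nu>" shows "P * X 0 = - (X 0 * P)"
proof -
  have "q (gp * gx 0 + gx 0 * gp) = 0"
    by (rule pi_rel) (unfold pi_rels_def, blast, rule assms)
  then show ?thesis by (simp add: q_hom eq_neg_iff_add_eq_0)
qed

lemma P_X: assumes "0 < l" "l < rank \<nu>" shows "P * X l = X l * P"
proof -
  have "q (gp * gx l - gx l * gp) = 0"
    by (rule pi_rel) (use assms in \<open>unfold pi_rels_def, blast\<close>, use assms in simp)
  then show ?thesis by (simp add: q_hom)
qed

lemma P_S: assumes "0 < k" "Suc k < rank \<nu>" shows "P * S k = S k * P"
proof -
  have "q (gp * gs k - gs k * gp) = 0"
    by (rule pi_rel) (use assms in \<open>unfold pi_rels_def, blast\<close>, use assms in simp)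
  then show ?thesis by (simp add: q_hom)
qed

lemma P_P: assumes "0 < rank \<nu>" shows "P * P = q 1"
proof -
  have "q (gp * gp - 1) = 0"
    by (rule pi_rel) (unfold pi_rels_def, blast, rule assms)
  then show ?thesis by (simp add: q_hom)
qed

lemma SP_SP: assumes "1 < rank \<nu>" shows "S 0 * P * S 0 * P = P * S 0 * P * S 0"
proof -
  have "q ((gs 0 * gp)^2 - (gp * gs 0)^2) = 0"
    by (rule pi_rel) (use assms in \<open>unfold pi_rels_def, simp\<close>, use assms in simp)
  then show ?thesis by (simp add: q_hom power2_eq_square mult.assoc)
qed

end

subsection \<open>Algebras of smaller rank inside a VV algebra\<close>

text \<open>The generators acting on the entries number \<open>s\<close>, \<open>s + 1\<close>, \<dots> of a sequence, where the
  entries before them form a sequence in \<open>A\<close> and the remaining ones a sequence in \<open>B\<close>.\<close>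

fun loc_gen :: "nat \<Rightarrow> 'k::field list set \<Rightarrow> 'k list set \<Rightarrow> 'k gen \<Rightarrow> 'k falg" where
  "loc_gen s A B (GX l) = gx (s + l)"
| "loc_gen s A B (GS k) = gs (s + k)"
| "loc_gen s A B (GE i) = (\<Sum>a\<in>A. \<Sum>b\<in>B. ge (a @ i @ b))"
| "loc_gen s A B GP = gp"

text \<open>\<open>A\<close> and \<open>B\<close> are finite sets of admissible prefixes and
  suffixes. The generators placed at the block only change the middle part of a sequence, so the
  idempotent \<open>eJ\<close> of all sequences in question commutes with them.\<close>

locale vv_block = vv_ring p \<nu> for p :: "'k::field" and \<nu> +
  fixes s m :: nat and A B J :: "'k list set"
  assumes fin: "finite A" "finite B" "finite J"
    and len_A: "a \<in> A \<Longrightarrow> length a = s" and len_J: "i \<in> J \<Longrightarrow> length i = m"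
    and mem: "\<lbrakk>a \<in> A; i \<in> J; b \<in> B\<rbrakk> \<Longrightarrow> a @ i @ b \<in> theta_seqs \<nu>"
    and le_rank: "s + m \<le> rank \<nu>"
    and swap_J: "\<lbrakk>i \<in> J; Suc k < m\<rbrakk> \<Longrightarrow> permute_list (swap k) i \<in> J"
begin

abbreviation "loc \<equiv> subst (loc_gen s A B)"
abbreviation "EB i \<equiv> \<Sum>a\<in>A. \<Sum>b\<in>B. E (a @ i @ b)"
abbreviation "eJ \<equiv> \<Sum>i\<in>J. loc_gen s A B (GE i)"

lemma q_eJ: "q eJ = (\<Sum>i\<in>J. EB i)"
  by (simp add: q_hom)

text \<open>Prefix and middle part have fixed lengths, so a sequence splits in one way only, and
  orthogonality of the idempotents leaves a single summand.\<close>

lemma E_EB: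
  assumes a: "a \<in> A" and i: "i \<in> J" and b: "b \<in> B" and j: "j \<in> J"
  shows "E (a @ i @ b) * EB j = (if i = j then E (a @ i @ b) else 0)"
    and "EB j * E (a @ i @ b) = (if i = j then E (a @ i @ b) else 0)"
proof -
  have inj: "a @ i @ b = a' @ j @ b' \<longleftrightarrow> a = a' \<and> i = j \<and> b = b'" if "a' \<in> A" for a' b'
    using a i j that len_A len_J by auto
  let ?d = "\<lambda>a' b'. if a' = a then if b' = b then if i = j then E (a @ i @ b) else 0 else 0 else 0"
  have l: "E (a @ i @ b) * E (a' @ j @ b') = ?d a' b'" if "a' \<in> A" "b' \<in> B" for a' b'
    using E_mult[OF mem[OF a i b] mem[OF that(1) j that(2)]] unfolding inj[OF that(1)] by auto
  have r: "E (a' @ j @ b') * E (a @ i @ b) = ?d a' b'" if "a' \<in> A" "b' \<in> B" for a' b'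
    using E_mult[OF mem[OF that(1) j that(2)] mem[OF a i b]]
    unfolding eq_commute[of "a' @ j @ b'"] inj[OF that(1)] by auto
  have "(\<Sum>a'\<in>A. \<Sum>b'\<in>B. ?d a' b') = (\<Sum>a'\<in>A. if a' = a then (\<Sum>b'\<in>B. if b' = b then if i = j then E (a @ i @ b) else 0 else 0) else 0)"
    by (intro sum.cong refl) auto
  also have "\<dots> = (if i = j then E (a @ i @ b) else 0)"
    using a b fin by (simp add: sum.delta)
  finally have d: "(\<Sum>a'\<in>A. \<Sum>b'\<in>B. ?d a' b') = (if i = j then E (a @ i @ b) else 0)" .
  show "E (a @ i @ b) * EB j = (if i = j then E (a @ i @ b) else 0)"
    by (rule trans[OF _ d], unfold sum_distrib_left, intro sum.cong refl l)
  show "EB j * E (a @ i @ b) = (if i = j then E (a @ i @ b) else 0)"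
    by (rule trans[OF _ d], unfold sum_distrib_right, intro sum.cong refl r)
qed

lemma EB_EB: "\<lbrakk>i \<in> J; j \<in> J\<rbrakk> \<Longrightarrow> EB i * EB j = (if i = j then EB i else 0)"
  by (subst sum_distrib_right, subst sum_distrib_right) (auto simp: E_EB intro!: sum.neutral)

lemma EB_eJ: "i \<in> J \<Longrightarrow> EB i * q eJ = EB i" "i \<in> J \<Longrightarrow> q eJ * EB i = EB i"
proof -
  assume i: "i \<in> J"
  have "EB i * q eJ = (\<Sum>j\<in>J. EB i * EB j)" "q eJ * EB i = (\<Sum>j\<in>J. EB j * EB i)"
    unfolding q_eJ
    by (rule sum_distrib_left[of "EB i" "\<lambda>j. EB j" J], rule sum_distrib_right[of "\<lambda>j. EB j" J "EB i"])
  moreover have "(\<Sum>j\<in>J. EB i * EB j) = (\<Sum>j\<in>J. if i = j then EB i else 0)"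
    "(\<Sum>j\<in>J. EB j * EB i) = (\<Sum>j\<in>J. if i = j then EB i else 0)"
    by (intro sum.cong refl; simp only: EB_EB i; auto)+
  ultimately show "EB i * q eJ = EB i" "q eJ * EB i = EB i"
    using i fin by (simp_all only: sum.delta' if_True)
qed

lemma eJ_idem: "q eJ * q eJ = q eJ"
proof -
  have "(\<Sum>i\<in>J. EB i) * q eJ = (\<Sum>i\<in>J. EB i * q eJ)"
    by (rule sum_distrib_right)
  also have "\<dots> = (\<Sum>i\<in>J. EB i)"
    by (intro sum.cong refl EB_eJ)
  finally show ?thesis by (simp only: q_eJ[symmetric])
qed

lemma permute_append:
  assumes "length a = s" "length i = m" "Suc k < m"
  shows "permute_list (swap (s + k)) (a @ i @ b) = a @ permute_list (swap k) i @ b"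
proof (rule nth_equalityI)
  fix t assume "t < length (permute_list (swap (s + k)) (a @ i @ b))"
  then have t: "t < s + m + length b" using assms by simp
  have "swap (s + k) t < length (a @ i @ b)"
    using t assms by (auto simp: transpose_def)
  then show "permute_list (swap (s + k)) (a @ i @ b) ! t = (a @ permute_list (swap k) i @ b) ! t"
    using t assms by (auto simp: permute_list_def nth_append transpose_def)
qed (simp add: assms)

lemma nth_block: "\<lbrakk>a \<in> A; i \<in> J; t < m\<rbrakk> \<Longrightarrow> (a @ i @ b) ! (s + t) = i ! t"
  using len_A[of a] len_J[of i] by (simp add: nth_append)

lemma S_EB: "\<lbrakk>i \<in> J; Suc k < m\<rbrakk> \<Longrightarrow> S (s + k) * EB i = EB (permute_list (swap k) i) * S (s + k)"
  unfolding sum_distrib_left sum_distrib_right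
  by (intro sum.cong refl) (use le_rank in \<open>simp add: S_E mem permute_append len_A len_J\<close>)

lemma X_EB: "\<lbrakk>i \<in> J; l < m\<rbrakk> \<Longrightarrow> X (s + l) * EB i = EB i * X (s + l)"
  unfolding sum_distrib_left sum_distrib_right
  by (intro sum.cong refl) (use le_rank in \<open>simp add: X_E mem\<close>)

lemma EB_reindex:
  assumes k: "Suc k < m"
  shows "(\<Sum>i\<in>J. EB (permute_list (swap k) i)) = (\<Sum>i\<in>J. EB i)"
proof (rule sum.reindex_bij_witness[of _ "permute_list (swap k)" "permute_list (swap k)"])
  show inv: "permute_list (swap k) (permute_list (swap k) i) = i" if "i \<in> J" for i
  proof -
    have "permute_list (swap k) (permute_list (swap k) i) = permute_list (swap k \<circ> swap k) i"
      by (rule permute_list_compose[symmetric]) (use k len_J[OF that] in \<open>simp add: permutes_swap_id\<close>)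
    then show ?thesis by simp
  qed
  then show "permute_list (swap k) (permute_list (swap k) i) = i" if "i \<in> J" for i
    using that .
qed (simp_all add: swap_J k)

lemma loc_commutes:
  assumes "g \<in> klr_gens m J" shows "q (loc_gen s A B g) * q eJ = q eJ * q (loc_gen s A B g)"
proof -
  consider l where "g = GX l" "l < m" | k where "g = GS k" "Suc k < m" | i where "g = GE i" "i \<in> J"
    using assms by (auto simp: klr_gens_def)
  then show ?thesis
  proof cases
    case 1
    have "X (s + l) * (\<Sum>i\<in>J. EB i) = (\<Sum>i\<in>J. X (s + l) * EB i)"
      by (rule sum_distrib_left)
    also have "\<dots> = (\<Sum>i\<in>J. EB i * X (s + l))"
      by (intro sum.cong refl X_EB 1)
    also have "\<dots> = (\<Sum>i\<in>J. EB i) * X (s + l)"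
      by (rule sum_distrib_right[symmetric])
    finally show ?thesis unfolding q_eJ unfolding 1(1) loc_gen.simps .
  next
    case 2
    have "S (s + k) * (\<Sum>i\<in>J. EB i) = (\<Sum>i\<in>J. S (s + k) * EB i)"
      by (rule sum_distrib_left)
    also have "\<dots> = (\<Sum>i\<in>J. EB (permute_list (swap k) i) * S (s + k))"
      by (intro sum.cong refl S_EB 2)
    also have "\<dots> = (\<Sum>i\<in>J. EB (permute_list (swap k) i)) * S (s + k)"
      by (rule sum_distrib_right[symmetric])
    finally show ?thesis unfolding EB_reindex[OF 2(2)] q_eJ unfolding 2(1) loc_gen.simps .
  next
    case 3
    have "q (loc_gen s A B g) = EB i" by (simp add: 3 q_hom)
    then show ?thesis by (simp only: EB_eJ[OF 3(2)])
  qed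
qed

text \<open>The entries of \<open>a @ i @ b\<close> at the shifted positions are those of
  \<open>i\<close>. Hence each relation carrying an idempotent can be tested on the single sequences
  \<open>a @ i @ b\<close>, where it is a relation of the large algebra.\<close>

lemma loc_rel:
  assumes "r \<in> klr_rels p m J" shows "q (loc r * eJ) = 0"
proof -
  have block: "q (f * loc_gen s A B (GE i)) = 0"
    if "i \<in> J" "\<And>a b. \<lbrakk>a \<in> A; b \<in> B\<rbrakk> \<Longrightarrow> q f * E (a @ i @ b) = 0" for f i
    using that by (simp add: q_hom sum_distrib_left)
  have block': "q (f * loc_gen s A B (GE i) * eJ) = 0"
    if "i \<in> J" "\<And>a b. \<lbrakk>a \<in> A; b \<in> B\<rbrakk> \<Longrightarrow> q f * E (a @ i @ b) = 0" for f i
    using block[OF that] by (simp add: qcl_mult)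
  have ind: "s + t < rank \<nu>" if "t < m" for t
    using that le_rank by simp
  have sw: "swap (s + k) (s + l) = s + swap k l" for k l
    by (simp add: transpose_def)
  from assms show ?thesis
    unfolding klr_rels_def
  proof (elim UnE CollectE exE conjE insertE emptyE)
    fix i j assume r: "r = ge i * ge j - (if i = j then ge i else 0)" "i \<in> J" "j \<in> J"
    have "q (loc r) = EB i * EB j - (if i = j then EB i else 0)"
      by (simp add: r subst_hom q_hom)
    then show ?thesis using r by (simp add: EB_EB qcl_mult)
  next
    \<comment> \<open>This is the relation that calls for the factor \<open>eJ\<close>: the unit of
      the small algebra becomes the idempotent \<open>eJ\<close>, not the unit of the large
      one.\<close>
    assume r: "r = (\<Sum>i\<in>J. ge i) - 1"
    have "loc r = eJ - 1" by (simp add: r subst_hom)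
    then show ?thesis by (simp only: qcl_mult qcl_diff left_diff_distrib eJ_idem q_one) simp
  next
    fix k i assume r: "r = gs k * ge i - ge (permute_list (swap k) i) * gs k" "Suc k < m" "i \<in> J"
    have "q (loc r) = S (s + k) * EB i - EB (permute_list (swap k) i) * S (s + k)"
      by (simp add: r subst_hom q_hom)
    then show ?thesis using r by (simp add: S_EB qcl_mult)
  next
    fix l i assume r: "r = gx l * ge i - ge i * gx l" "l < m" "i \<in> J"
    have "q (loc r) = X (s + l) * EB i - EB i * X (s + l)"
      by (simp add: r subst_hom q_hom)
    then show ?thesis using r by (simp add: X_EB qcl_mult)
  next
    fix l t assume r: "r = gx l * gx t - gx t * gx l" "l < m" "t < m"
    have "q (loc r) = X (s + l) * X (s + t) - X (s + t) * X (s + l)"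
      by (simp add: r subst_hom q_hom)
    then show ?thesis using r ind by (simp add: X_X qcl_mult)
  next
    fix k i assume r: "r = gs k * gs k * ge i - Qpol p (i ! k) (i ! Suc k) (gx (Suc k)) (gx k) * ge i"
      "Suc k < m" "i \<in> J"
    let ?f = "gs (s + k) * gs (s + k) - Qpol p (i ! k) (i ! Suc k) (gx (s + Suc k)) (gx (s + k))"
    have "loc r = ?f * loc_gen s A B (GE i)"
      by (simp add: r subst_hom subst_Qpol left_diff_distrib del: add_Suc_right)
    moreover have "q ?f * E (a @ i @ b) = 0" if "a \<in> A" "b \<in> B" for a b
      using S_S[of "s + k" "a @ i @ b"] r that ind[of "Suc k"] mem nth_block[of a i k b] nth_block[of a i "Suc k" b]
      by (simp add: q_hom left_diff_distrib)
    ultimately show ?thesis using r by (simp only: block')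
  next
    fix j k assume r: "r = gs j * gs k - gs k * gs j" "Suc j < m" "Suc k < m" "j \<noteq> Suc k" "k \<noteq> Suc j"
    have "q (loc r) = S (s + j) * S (s + k) - S (s + k) * S (s + j)"
      by (simp add: r subst_hom q_hom)
    then show ?thesis using r ind[of "Suc j"] ind[of "Suc k"] by (simp add: S_S_distant qcl_mult)
  next
    fix k i assume r: "r = (gs (Suc k) * gs k * gs (Suc k) - gs k * gs (Suc k) * gs k) * ge i
        - (if i ! k = i ! (k + 2)
           then Qdiff p (i ! k) (i ! Suc k) (gx k) (gx (Suc k)) (gx (k + 2)) * ge i else 0)"
      "k + 2 < m" "i \<in> J"
    let ?f = "gs (Suc (s + k)) * gs (s + k) * gs (Suc (s + k)) - gs (s + k) * gs (Suc (s + k)) * gs (s + k)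
      - (if i ! k = i ! (k + 2)
           then Qdiff p (i ! k) (i ! Suc k) (gx (s + k)) (gx (Suc (s + k))) (gx (s + k + 2)) else 0)"
    have "loc r = ?f * loc_gen s A B (GE i)"
      by (simp add: r subst_hom subst_Qdiff left_diff_distrib add.assoc)
    moreover have "q ?f * E (a @ i @ b) = 0" if "a \<in> A" "b \<in> B" for a b
      using braid[of "s + k" "a @ i @ b"] r that ind[of "k + 2"] mem nth_block[of a i k b]
        nth_block[of a i "Suc k" b] nth_block[of a i "k + 2" b]
      by (auto simp: q_hom left_diff_distrib add.assoc)
    ultimately show ?thesis using r by (simp only: block')
  next
    fix k l i assume r: "r = (gs k * gx l - gx (swap k l) * gs k) * ge i
        - (if l = k \<and> i ! k = i ! Suc k then - ge i
           else if l = Suc k \<and> i ! k = i ! Suc k then ge i else 0)" "Suc k < m" "l < m" "i \<in> J"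
    let ?f = "gs (s + k) * gx (s + l) - gx (swap (s + k) (s + l)) * gs (s + k)
      - (if l = k \<and> i ! k = i ! Suc k then - 1
           else if l = Suc k \<and> i ! k = i ! Suc k then 1 else 0)"
    have "loc r = ?f * loc_gen s A B (GE i)"
      unfolding sw by (simp add: r subst_hom left_diff_distrib)
    moreover have "q ?f * E (a @ i @ b) = 0" if "a \<in> A" "b \<in> B" for a b
      using S_X[of "s + k" "s + l" "a @ i @ b"] r that ind[of "Suc k"] ind[of l] mem nth_block[of a i k b]
        nth_block[of a i "Suc k" b]
      by (auto simp: q_hom left_diff_distrib q_one)
    ultimately show ?thesis using r by (simp only: block')
  qed
qed

lemma loc_carrier_commutes:
  assumes "\<And>g. g \<in> G \<Longrightarrow> q (loc_gen s A B g) * q eJ = q eJ * q (loc_gen s A B g)"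
    and "f \<in> carrier (free_alg G)"
  shows "q (loc f) * q eJ = q eJ * q (loc f)"
  using assms(2)
proof (induction f rule: free_alg_induct)
  case (scal c)
  then show ?case by (simp add: subst_hom qcl_mult[symmetric] scal_central)
next
  case (gen g f)
  have "q (loc (Poly_Mapping.single [g] 1 * f)) * q eJ = q (loc_gen s A B g) * (q (loc f) * q eJ)"
    by (simp only: subst_hom qcl_mult mult.assoc)
  also have "\<dots> = q (loc_gen s A B g) * q eJ * q (loc f)"
    by (simp only: gen mult.assoc)
  also have "\<dots> = q eJ * q (loc (Poly_Mapping.single [g] 1 * f))"
    by (simp only: assms(1)[OF gen(1)] subst_hom qcl_mult mult.assoc)
  finally show ?case .
next
  case (add f g)
  then show ?case by (simp only: subst_hom qcl_add distrib_left distrib_right)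
qed

text \<open>Since \<open>eJ\<close> commutes with the images of all generators, the elements
  \<open>f\<close> with \<open>loc f * eJ\<close> equal to zero form an ideal on both sides, and it
  contains the relations.\<close>

lemma loc_ideal:
  assumes G: "\<And>g. g \<in> G \<Longrightarrow> q (loc_gen s A B g) * q eJ = q eJ * q (loc_gen s A B g)"
    and Rel: "presented G Rel" "\<And>r. r \<in> Rel \<Longrightarrow> q (loc r * eJ) = 0"
    and f: "f \<in> Idl\<^bsub>free_alg G\<^esub> Rel"
  shows "q (loc f * eJ) = 0"
proof -
  have "Idl\<^bsub>free_alg G\<^esub> Rel \<subseteq> {f \<in> carrier (free_alg G). q (loc f * eJ) = 0}"
  proof (rule presented.ideal_subsetI[OF Rel(1)])
    fix f g :: "'k falg"
    assume f: "f \<in> {f \<in> carrier (free_alg G). q (loc f * eJ) = 0}" and g: "g \<in> carrier (free_alg G)"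
    have "q (loc (f * g) * eJ) = q (loc f * eJ) * q (loc g)"
      by (simp only: subst_hom qcl_mult mult.assoc loc_carrier_commutes[OF G g])
    moreover have "q (loc (g * f) * eJ) = q (loc g) * q (loc f * eJ)"
      by (simp only: subst_hom qcl_mult mult.assoc)
    ultimately show "f * g \<in> {f \<in> carrier (free_alg G). q (loc f * eJ) = 0}"
      "g * f \<in> {f \<in> carrier (free_alg G). q (loc f * eJ) = 0}"
      using f g by (simp_all add: free_alg_closed)
  next
    fix f g :: "'k falg"
    assume "f \<in> {f \<in> carrier (free_alg G). q (loc f * eJ) = 0}"
      and "g \<in> {f \<in> carrier (free_alg G). q (loc f * eJ) = 0}"
    then show "f + g \<in> {f \<in> carrier (free_alg G). q (loc f * eJ) = 0}"
      by (simp add: free_alg_closed subst_hom qcl_add distrib_right del: loc_gen.simps)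
  qed (use Rel presented.Rel_closed[OF Rel(1)] in \<open>auto simp: free_alg_closed subst_hom qcl_zero simp del: loc_gen.simps\<close>)
  then show ?thesis using f by blast
qed

end

text \<open>The generator pi acts at position 0, so a smaller VV algebra, as opposed to a KLR
  algebra, sits in a block only when the prefix is empty. The set \<open>J\<close> has to be stable
  under inversion of the first entry as well.\<close>

locale vv_left_block = vv_block p \<nu> 0 m "{[]}" B J for p :: "'k::field" and \<nu> m B J +
  assumes flip_J: "\<lbrakk>i \<in> J; 0 < m\<rbrakk> \<Longrightarrow> i[0 := inverse (i ! 0)] \<in> J"
begin

lemma EB_eq: "EB i = (\<Sum>b\<in>B. E (i @ b))"
  by simp

lemma P_EB: "\<lbrakk>i \<in> J; 0 < m\<rbrakk> \<Longrightarrow> P * EB i = EB (i[0 := inverse (i ! 0)]) * P"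
  unfolding EB_eq sum_distrib_left sum_distrib_right
proof (intro sum.cong refl)
  fix b assume i: "i \<in> J" "0 < m" and b: "b \<in> B"
  then show "P * E (i @ b) = E (i[0 := inverse (i ! 0)] @ b) * P"
    using P_E[of "i @ b"] mem[of "[]" i b] le_rank len_J[of i]
    by (simp add: list_update_append nth_append)
qed

lemma P_commutes: assumes "0 < m" shows "P * q eJ = q eJ * P"
proof -
  have "P * (\<Sum>i\<in>J. EB i) = (\<Sum>i\<in>J. P * EB i)"
    by (rule sum_distrib_left)
  also have "\<dots> = (\<Sum>i\<in>J. EB (i[0 := inverse (i ! 0)]) * P)"
    by (intro sum.cong refl P_EB assms)
  also have "\<dots> = (\<Sum>i\<in>J. EB (i[0 := inverse (i ! 0)])) * P"
    by (rule sum_distrib_right[symmetric])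
  also have "(\<Sum>i\<in>J. EB (i[0 := inverse (i ! 0)])) = (\<Sum>i\<in>J. EB i)"
  proof (rule sum.reindex_bij_witness[of _ "\<lambda>i. i[0 := inverse (i ! 0)]" "\<lambda>i. i[0 := inverse (i ! 0)]"])
    fix i assume "i \<in> J"
    then show "i[0 := inverse (i ! 0), 0 := inverse (i[0 := inverse (i ! 0)] ! 0)] = i"
      using len_J[of i] assms by (cases i) auto
    then show "i[0 := inverse (i ! 0), 0 := inverse (i[0 := inverse (i ! 0)] ! 0)] = i" .
  qed (use assms in \<open>auto simp: flip_J\<close>)
  finally show ?thesis unfolding q_eJ .
qed

lemma loc_pi_rel:
  assumes "r \<in> pi_rels m J" and m: "0 < m" shows "q (loc r * eJ) = 0"
  using assms(1) unfolding pi_rels_def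
proof (elim UnE CollectE exE conjE insertE emptyE)
  fix i assume r: "r = gp * ge i - ge (i[0 := inverse (i ! 0)]) * gp" "i \<in> J"
  have "q (loc r) = P * EB i - EB (i[0 := inverse (i ! 0)]) * P"
    by (simp add: r subst_hom q_hom)
  then show ?thesis using P_EB[OF r(2) m] by (simp add: qcl_mult)
next
  assume "r = gp * gx 0 + gx 0 * gp"
  then have "q (loc r) = P * X 0 + X 0 * P" by (simp add: subst_hom q_hom)
  then show ?thesis using P_X0 le_rank m by (simp add: qcl_mult)
next
  fix l assume r: "r = gp * gx l - gx l * gp" "0 < l" "l < m"
  then have "q (loc r) = P * X l - X l * P" by (simp add: subst_hom q_hom)
  then show ?thesis using P_X[of l] le_rank r by (simp add: qcl_mult)
next
  fix k assume r: "r = gp * gs k - gs k * gp" "0 < k" "Suc k < m"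
  then have "q (loc r) = P * S k - S k * P" by (simp add: subst_hom q_hom)
  then show ?thesis using P_S[of k] le_rank r by (simp add: qcl_mult)
next
  assume "r = gp * gp - 1"
  then have "q (loc r) = P * P - q 1" by (simp add: subst_hom q_hom)
  then show ?thesis using P_P le_rank m by (simp add: qcl_mult)
next
  assume "r \<in> (if 1 < m then {(gs 0 * gp)\<^sup>2 - (gp * gs 0)\<^sup>2} else {})"
  then have "1 < m" "q (loc r) = S 0 * P * S 0 * P - P * S 0 * P * S 0"
    by (auto simp: subst_hom q_hom power2_eq_square mult.assoc split: if_splits)
  then show ?thesis using SP_SP le_rank by (simp add: qcl_mult)
qed

end

section \<open>Positive sequences and restriction\<close>

lemma image_const_the_elem:
  assumes "f \<in> r" "\<And>g. g \<in> r \<Longrightarrow> h g = h f"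
  shows "the_elem (h ` r) = h f"
proof -
  have "h ` r = (\<lambda>_. h f) ` r" by (rule image_cong[OF refl]) (rule assms(2))
  then show ?thesis using assms(1) by (simp add: image_constant)
qed

lemma subst_closed:
  assumes "f \<in> carrier (free_alg G)" "\<And>g. g \<in> G \<Longrightarrow> h g \<in> carrier (free_alg G')"
  shows "subst h f \<in> carrier (free_alg G')"
  using assms(1) by (induction f rule: free_alg_induct) (auto simp: subst_hom assms(2) intro!: free_alg_intros)

lemma subst_id: "subst (\<lambda>g. Poly_Mapping.single [g] 1) f = f"
proof -
  have "f \<in> carrier (free_alg UNIV)" by (simp add: carrier_free_alg)
  then show ?thesis by (induction f rule: free_alg_induct) (auto simp: subst_hom)
qed

abbreviation kcl :: "'k::field \<Rightarrow> 'k multiset \<Rightarrow> 'k falg \<Rightarrow> 'k palg" where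
  "kcl p \<nu> \<equiv> presented.cls (KLR_gens \<nu>) (KLR_rels p \<nu>)"

abbreviation KF :: "'k::field multiset \<Rightarrow> 'k falg set" where
  "KF \<nu> \<equiv> carrier (free_alg (KLR_gens \<nu>))"

text \<open>\<open>pos_inverse\<close> is the form in which the conditions on I enter: every vertex
  lies either in I^+ or among the inverses of I^+, so an entry of a sequence has a sign.\<close>

locale vv_setup =
  fixes p lam :: "'k::field"
  assumes p0: "p \<noteq> 0" and lam0: "lam \<noteq> 0"
    and pos_inverse: "i \<in> Ipos p lam \<Longrightarrow> inverse i \<notin> Ipos p lam"
begin

abbreviation "pos \<equiv> pos_part p lam"
abbreviation "ps \<alpha> \<equiv> permutations_of_multiset (pos \<alpha>)"
abbreviation "TH \<equiv> thetaNI p lam"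

lemma Iset_eq: "Iset p lam = Ipos p lam \<union> inverse ` Ipos p lam"
proof -
  have "{p powi (2 * n) * inverse lam | n. True} = inverse ` Ipos p lam"
  proof (intro Set.set_eqI iffI)
    fix x assume "x \<in> {p powi (2 * n) * inverse lam | n. True}"
    then obtain n where "x = p powi (2 * n) * inverse lam" by blast
    then have "x = inverse (p powi (2 * (- n)) * lam)"
      by (simp add: power_int_minus)
    then show "x \<in> inverse ` Ipos p lam" unfolding Ipos_def by blast
  next
    fix x assume "x \<in> inverse ` Ipos p lam"
    then obtain y where "y \<in> Ipos p lam" and xy: "x = inverse y" by blast
    then obtain n where "y = p powi (2 * n) * lam" unfolding Ipos_def by blast
    then have "x = p powi (2 * (- n)) * inverse lam"
      using xy by (simp add: power_int_minus)
    then show "x \<in> {p powi (2 * n) * inverse lam | n. True}" by blast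
  qed
  then show ?thesis by (simp add: Iset_def)
qed

lemma Iset_iff: "x \<in> Iset p lam \<longleftrightarrow> x \<in> Ipos p lam \<or> inverse x \<in> Ipos p lam"
proof -
  have "x \<in> inverse ` Ipos p lam \<longleftrightarrow> inverse x \<in> Ipos p lam"
    by (auto simp: image_iff intro!: bexI[of _ "inverse x"])
  then show ?thesis by (simp add: Iset_eq)
qed

text \<open>A vertex of I outside I^+ has its inverse in I^+, and the symmetry of
  \<open>\<alpha>\<close> carries the multiplicity over. By \<open>pos_inverse\<close> the two
  summands do not overlap.\<close>

lemma TH_decomp:
  assumes "\<alpha> \<in> TH" shows "\<alpha> = pos \<alpha> + image_mset inverse (pos \<alpha>)"
proof (rule multiset_eqI)
  fix x
  have cnt: "count (image_mset inverse (pos \<alpha>)) x = count (pos \<alpha>) (inverse x)"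
  proof -
    have "inverse -` {x} = {inverse x}" by (auto simp: vimage_def)
    then show ?thesis by (simp add: count_image_mset not_in_iff Int_insert_left)
  qed
  have cntp: "count (pos \<alpha>) y = (if y \<in> Ipos p lam then count \<alpha> y else 0)" for y
    by (simp add: pos_part_def)
  consider "x \<in> Ipos p lam" | "x \<notin> Ipos p lam" "inverse x \<in> Ipos p lam" | "x \<notin> Iset p lam"
    by (auto simp: Iset_iff)
  then show "count \<alpha> x = count (pos \<alpha> + image_mset inverse (pos \<alpha>)) x"
  proof cases
    case 1
    then show ?thesis using pos_inverse[of x] by (simp add: cnt cntp)
  next
    case 2
    then have "x \<in> Iset p lam" by (simp add: Iset_iff)
    then have "count \<alpha> x = count \<alpha> (inverse x)" using assms by (auto simp: thetaNI_def)
    then show ?thesis using 2 by (simp add: cnt cntp)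
  next
    case 3
    then have "x \<notin> Ipos p lam" "inverse x \<notin> Ipos p lam" "x \<notin># \<alpha>"
      using assms by (auto simp: Iset_iff thetaNI_def)
    then show ?thesis by (simp add: cnt cntp not_in_iff)
  qed
qed

lemma size_pos: "\<alpha> \<in> TH \<Longrightarrow> size (pos \<alpha>) = rank \<alpha>"
proof -
  assume "\<alpha> \<in> TH"
  from arg_cong[OF TH_decomp[OF this], of size] show ?thesis by (simp add: rank_def)
qed

lemma ps_theta: "\<lbrakk>\<alpha> \<in> TH; i \<in> ps \<alpha>\<rbrakk> \<Longrightarrow> i \<in> theta_seqs \<alpha>"
  using TH_decomp[of \<alpha>] by (simp add: theta_seqs_def permutations_of_multiset_def)

lemma length_ps: "\<lbrakk>\<alpha> \<in> TH; i \<in> ps \<alpha>\<rbrakk> \<Longrightarrow> length i = rank \<alpha>"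
  by (metis ps_theta length_theta_seqs)

lemma ps_Ipos: "\<lbrakk>i \<in> ps \<alpha>; x \<in> set i\<rbrakk> \<Longrightarrow> x \<in> Ipos p lam"
  by (auto simp: permutations_of_multiset_def pos_part_def simp flip: set_mset_mset)

lemma pos_add: "pos (\<alpha> + \<beta>) = pos \<alpha> + pos \<beta>"
  by (simp add: pos_part_def)

lemma TH_add: "\<lbrakk>\<alpha> \<in> TH; \<beta> \<in> TH\<rbrakk> \<Longrightarrow> \<alpha> + \<beta> \<in> TH"
  by (auto simp: thetaNI_def)

lemma rank_add: "\<lbrakk>\<alpha> \<in> TH; \<beta> \<in> TH\<rbrakk> \<Longrightarrow> rank (\<alpha> + \<beta>) = rank \<alpha> + rank \<beta>"
  by (simp add: size_pos[symmetric] TH_add pos_add)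

lemma ps_append: "\<lbrakk>i \<in> ps \<alpha>; j \<in> ps \<beta>\<rbrakk> \<Longrightarrow> i @ j \<in> ps (\<alpha> + \<beta>)"
  by (simp add: permutations_of_multiset_def pos_add)

lemma finite_ps: "finite (ps \<alpha>)"
  by simp

lemma ps_swap: "\<lbrakk>\<alpha> \<in> TH; i \<in> ps \<alpha>; Suc k < rank \<alpha>\<rbrakk> \<Longrightarrow> permute_list (swap k) i \<in> ps \<alpha>"
  by (rule permutations_swap) (simp_all add: size_pos)

text \<open>The two KLR factors inside the algebra of the sum and the corner itself are instances of
  one construction: \<open>block1\<close> is the first factor, \<open>block2\<close> the second,
  \<open>block0\<close> the block of full length.\<close>

lemma block1: "\<lbrakk>\<beta> \<in> TH; \<gamma> \<in> TH\<rbrakk> \<Longrightarrow> vv_block (\<beta> + \<gamma>) 0 (rank \<beta>) {[]} (ps \<gamma>) (ps \<beta>)"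
  by unfold_locales (auto simp: length_ps rank_add ps_swap intro: ps_theta TH_add ps_append)

lemma block2: "\<lbrakk>\<beta> \<in> TH; \<gamma> \<in> TH\<rbrakk> \<Longrightarrow> vv_block (\<beta> + \<gamma>) (rank \<beta>) (rank \<gamma>) (ps \<beta>) {[]} (ps \<gamma>)"
  by unfold_locales (auto simp: length_ps rank_add ps_swap intro: ps_theta TH_add ps_append)

lemma block0: "\<alpha> \<in> TH \<Longrightarrow> vv_block \<alpha> 0 (rank \<alpha>) {[]} {[]} (ps \<alpha>)"
  by unfold_locales (auto simp: length_ps ps_swap intro: ps_theta)

lemma e_pos_block: "e_pos p lam \<alpha> = (\<Sum>i\<in>ps \<alpha>. loc_gen 0 {[]} {[]} (GE i))"
  by (simp add: e_pos_def)

lemma e_conv_block1: "e_conv p lam \<beta> \<gamma> = (\<Sum>i\<in>ps \<beta>. loc_gen 0 {[]} (ps \<gamma>) (GE i))"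
  by (simp add: e_conv_def)

lemma e_conv_block2: "e_conv p lam \<beta> \<gamma> = (\<Sum>i\<in>ps \<gamma>. loc_gen (rank \<beta>) (ps \<beta>) {[]} (GE i))"
  by (simp add: e_conv_def sum.swap[of _ "ps \<beta>"])

lemma KLR_gens_eq: "\<alpha> \<in> TH \<Longrightarrow> KLR_gens (pos \<alpha>) = klr_gens (rank \<alpha>) (ps \<alpha>)"
  by (simp add: KLR_gens_def size_pos)

lemma KLR_rels_eq: "\<alpha> \<in> TH \<Longrightarrow> KLR_rels p (pos \<alpha>) = klr_rels p (rank \<alpha>) (ps \<alpha>)"
  by (simp add: KLR_rels_def size_pos)

text \<open>Independence of the representative for \<open>corner\<close>, \<open>emb1\<close> and
  \<open>emb2\<close>, which are all defined by \<open>the_elem\<close> of the image of a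
  coset.\<close>

lemma block_ideal:
  assumes \<alpha>: "\<alpha> \<in> TH" and "vv_block \<nu> s (rank \<alpha>) A B (ps \<alpha>)"
    and fg: "g \<in> kcl p (pos \<alpha>) f" "f \<in> KF (pos \<alpha>)"
  shows "vq p \<nu> (subst (loc_gen s A B) g * (\<Sum>i\<in>ps \<alpha>. loc_gen s A B (GE i))) =
    vq p \<nu> (subst (loc_gen s A B) f * (\<Sum>i\<in>ps \<alpha>. loc_gen s A B (GE i)))"
proof -
  interpret vv_block p \<nu> s "rank \<alpha>" A B "ps \<alpha>" by fact
  have "g - f \<in> Idl\<^bsub>free_alg (KLR_gens (pos \<alpha>))\<^esub> (KLR_rels p (pos \<alpha>))"
    using fg KLR.mem_cls by blast
  then have "q (loc (g - f) * eJ) = 0"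
    by (rule loc_ideal[OF _ presented_KLR, rotated -1])
      (simp_all only: KLR_gens_eq[OF \<alpha>] KLR_rels_eq[OF \<alpha>] loc_commutes loc_rel)
  then show ?thesis
    by (simp only: subst_hom left_diff_distrib qcl_diff) simp
qed

lemma block_commutes:
  assumes \<alpha>: "\<alpha> \<in> TH" and "vv_block \<nu> s (rank \<alpha>) A B (ps \<alpha>)" and f: "f \<in> KF (pos \<alpha>)"
  shows "vq p \<nu> (subst (loc_gen s A B) f * (\<Sum>i\<in>ps \<alpha>. loc_gen s A B (GE i))) =
    vq p \<nu> ((\<Sum>i\<in>ps \<alpha>. loc_gen s A B (GE i)) * subst (loc_gen s A B) f)"
proof -
  interpret vv_block p \<nu> s "rank \<alpha>" A B "ps \<alpha>" by fact
  show ?thesis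
    unfolding qcl_mult by (rule loc_carrier_commutes[OF _ f]) (simp only: KLR_gens_eq[OF \<alpha>] loc_commutes)
qed

lemma block_gens_closed:
  assumes "\<alpha> \<in> TH" "vv_block \<nu> s (rank \<alpha>) A B (ps \<alpha>)" "g \<in> KLR_gens (pos \<alpha>)"
  shows "loc_gen s A B g \<in> carrier (free_alg (VV_gens \<nu>))"
proof -
  interpret vv_block p \<nu> s "rank \<alpha>" A B "ps \<alpha>" by fact
  show ?thesis
    using assms(3) le_rank mem
    by (auto simp: KLR_gens_eq[OF assms(1)] klr_gens_def VV_gens_def intro!: free_alg_intros)
qed

text \<open>On KLR words these substitutions agree with those by \<open>emb1_gen\<close> and
  \<open>emb2_gen\<close>; the difference is at \<open>GP\<close>, which \<open>loc_gen\<close>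
  keeps and the others send to 0.\<close>

definition emb_l :: "'k multiset \<Rightarrow> 'k falg \<Rightarrow> 'k falg" where
  "emb_l \<gamma> = subst (loc_gen 0 {[]} (ps \<gamma>))"

definition emb_r :: "'k multiset \<Rightarrow> 'k falg \<Rightarrow> 'k falg" where
  "emb_r \<beta> = subst (loc_gen (rank \<beta>) (ps \<beta>) {[]})"

lemmas emb_l_hom = subst_hom[where h="loc_gen 0 {[]} (ps \<gamma>)" for \<gamma>, folded emb_l_def]
lemmas emb_r_hom = subst_hom[where h="loc_gen (rank \<beta>) (ps \<beta>) {[]}" for \<beta>, folded emb_r_def]

lemma loc_gen_emb:
  assumes "\<beta> \<in> TH" "\<gamma> \<in> TH"
  shows "f \<in> KF (pos \<beta>) \<Longrightarrow> subst (emb1_gen (pos \<gamma>)) f = emb_l \<gamma> f"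
    and "f \<in> KF (pos \<gamma>) \<Longrightarrow> subst (emb2_gen (pos \<beta>)) f = emb_r \<beta> f"
  unfolding emb_l_def emb_r_def
  by (rule subst_cong, assumption,
      auto simp: KLR_gens_eq[OF assms(1)] KLR_gens_eq[OF assms(2)] klr_gens_def size_pos[OF assms(1)])+

lemma e_conv_closed: "\<lbrakk>\<beta> \<in> TH; \<gamma> \<in> TH\<rbrakk> \<Longrightarrow> e_conv p lam \<beta> \<gamma> \<in> carrier (free_alg (VV_gens (\<beta> + \<gamma>)))"
  by (auto simp: e_conv_def VV_gens_def klr_gens_def intro!: free_alg_intros intro: ps_theta TH_add ps_append)

lemma e_pos_closed: "\<alpha> \<in> TH \<Longrightarrow> e_pos p lam \<alpha> \<in> carrier (free_alg (VV_gens \<alpha>))"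
  by (auto simp: e_pos_def VV_gens_def klr_gens_def intro!: free_alg_intros intro: ps_theta)

lemma emb_closed:
  assumes "\<beta> \<in> TH" "\<gamma> \<in> TH"
  shows "f \<in> KF (pos \<beta>) \<Longrightarrow> emb_l \<gamma> f \<in> carrier (free_alg (VV_gens (\<beta> + \<gamma>)))"
    and "f \<in> KF (pos \<gamma>) \<Longrightarrow> emb_r \<beta> f \<in> carrier (free_alg (VV_gens (\<beta> + \<gamma>)))"
  unfolding emb_l_def emb_r_def
  by (erule subst_closed, rule block_gens_closed[OF assms(1) block1[OF assms]], assumption)
    (erule subst_closed, rule block_gens_closed[OF assms(2) block2[OF assms]], assumption)

lemma emb1_class:
  assumes "\<beta> \<in> TH" "\<gamma> \<in> TH" "f \<in> KF (pos \<beta>)"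
  shows "emb1 p lam \<beta> \<gamma> (kcl p (pos \<beta>) f) = vcl p (\<beta> + \<gamma>) (emb_l \<gamma> f * e_conv p lam \<beta> \<gamma>)"
proof -
  let ?h = "\<lambda>f. vv_class p (\<beta> + \<gamma>) (subst (emb1_gen (pos \<gamma>)) f * e_conv p lam \<beta> \<gamma>)"
  have h: "?h g = vcl p (\<beta> + \<gamma>) (emb_l \<gamma> g * e_conv p lam \<beta> \<gamma>)" if "g \<in> KF (pos \<beta>)" for g
    using VV.pres_class_eq_cls[OF free_alg_closed(7)[OF emb_closed(1)[OF assms(1,2) that] e_conv_closed[OF assms(1,2)]]]
    by (simp only: loc_gen_emb(1)[OF assms(1,2) that])
  have "the_elem (?h ` kcl p (pos \<beta>) f) = ?h f"
  proof (rule image_const_the_elem)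
    show "f \<in> kcl p (pos \<beta>) f" using assms(3) KLR.mem_cls[OF assms(3)]
      by (simp add: additive_subgroup.zero_closed[OF ideal.axioms(1)[OF ring.genideal_ideal[OF ring_free_alg presented.Rel_closed[OF presented_KLR]]], unfolded free_alg_sel])
    fix g assume g: "g \<in> kcl p (pos \<beta>) f"
    then have "g \<in> KF (pos \<beta>)" using KLR.mem_cls[OF assms(3)] by blast
    then show "?h g = ?h f"
      using block_ideal[OF assms(1) block1[OF assms(1,2)] g assms(3)] h assms(3)
      by (simp only: vcl_eq_vq emb_l_def e_conv_block1)
  qed
  then show ?thesis by (simp only: emb1_def h[OF assms(3)])
qed

lemma emb2_class:
  assumes "\<beta> \<in> TH" "\<gamma> \<in> TH" "f \<in> KF (pos \<gamma>)"
  shows "emb2 p lam \<beta> \<gamma> (kcl p (pos \<gamma>) f) = vcl p (\<beta> + \<gamma>) (emb_r \<beta> f * e_conv p lam \<beta> \<gamma>)"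
proof -
  let ?h = "\<lambda>f. vv_class p (\<beta> + \<gamma>) (subst (emb2_gen (pos \<beta>)) f * e_conv p lam \<beta> \<gamma>)"
  have h: "?h g = vcl p (\<beta> + \<gamma>) (emb_r \<beta> g * e_conv p lam \<beta> \<gamma>)" if "g \<in> KF (pos \<gamma>)" for g
    using VV.pres_class_eq_cls[OF free_alg_closed(7)[OF emb_closed(2)[OF assms(1,2) that] e_conv_closed[OF assms(1,2)]]]
    by (simp only: loc_gen_emb(2)[OF assms(1,2) that])
  have "the_elem (?h ` kcl p (pos \<gamma>) f) = ?h f"
  proof (rule image_const_the_elem)
    show "f \<in> kcl p (pos \<gamma>) f" using assms(3) KLR.mem_cls[OF assms(3)]
      by (simp add: additive_subgroup.zero_closed[OF ideal.axioms(1)[OF ring.genideal_ideal[OF ring_free_alg presented.Rel_closed[OF presented_KLR]]], unfolded free_alg_sel])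
    fix g assume g: "g \<in> kcl p (pos \<gamma>) f"
    then have "g \<in> KF (pos \<gamma>)" using KLR.mem_cls[OF assms(3)] by blast
    then show "?h g = ?h f"
      using block_ideal[OF assms(2) block2[OF assms(1,2)] g assms(3)] h assms(3)
      by (simp only: vcl_eq_vq emb_r_def e_conv_block2)
  qed
  then show ?thesis by (simp only: emb2_def h[OF assms(3)])
qed

lemma loc_gen_trivial: "subst (loc_gen 0 {[]} {[]}) f = (f :: 'k falg)"
proof -
  have "loc_gen 0 {[]} {[]} = (\<lambda>g. Poly_Mapping.single [g] (1::'k))"
    by (rule ext, case_tac g) auto
  then show ?thesis by (simp add: subst_id)
qed

lemma KF_VV: "\<lbrakk>\<alpha> \<in> TH; f \<in> KF (pos \<alpha>)\<rbrakk> \<Longrightarrow> f \<in> carrier (free_alg (VV_gens \<alpha>))"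
  using subst_closed[of f "KLR_gens (pos \<alpha>)" "loc_gen 0 {[]} {[]}" "VV_gens \<alpha>"]
    block_gens_closed[OF _ block0] by (simp add: loc_gen_trivial)

lemma corner_class:
  assumes "\<alpha> \<in> TH" "f \<in> KF (pos \<alpha>)"
  shows "corner p lam \<alpha> (kcl p (pos \<alpha>) f) = vcl p \<alpha> (f * e_pos p lam \<alpha>)"
proof -
  let ?h = "\<lambda>f. vv_class p \<alpha> (f * e_pos p lam \<alpha>)"
  have h: "?h g = vcl p \<alpha> (g * e_pos p lam \<alpha>)" if "g \<in> KF (pos \<alpha>)" for g
    using VV.pres_class_eq_cls[OF free_alg_closed(7)[OF KF_VV[OF assms(1) that] e_pos_closed[OF assms(1)]]] .
  have "the_elem (?h ` kcl p (pos \<alpha>) f) = ?h f"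
  proof (rule image_const_the_elem)
    show "f \<in> kcl p (pos \<alpha>) f" using assms(2) KLR.mem_cls[OF assms(2)]
      by (simp add: additive_subgroup.zero_closed[OF ideal.axioms(1)[OF ring.genideal_ideal[OF ring_free_alg presented.Rel_closed[OF presented_KLR]]], unfolded free_alg_sel])
    fix g assume g: "g \<in> kcl p (pos \<alpha>) f"
    then have "g \<in> KF (pos \<alpha>)" using KLR.mem_cls[OF assms(2)] by blast
    then show "?h g = ?h f"
      using block_ideal[OF assms(1) block0[OF assms(1)] g assms(2)] h assms(2)
      by (simp only: vcl_eq_vq loc_gen_trivial e_pos_block)
  qed
  then show ?thesis by (simp only: corner_def h[OF assms(2)])
qed

lemma e_pos_commutes:
  assumes "\<alpha> \<in> TH" "f \<in> KF (pos \<alpha>)"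
  shows "vq p \<alpha> (f * e_pos p lam \<alpha>) = vq p \<alpha> (e_pos p lam \<alpha> * f)"
  using block_commutes[OF assms(1) block0[OF assms(1)] assms(2)]
  by (simp only: loc_gen_trivial e_pos_block)

lemma e_pos_idem: "\<alpha> \<in> TH \<Longrightarrow> vq p \<alpha> (e_pos p lam \<alpha> * e_pos p lam \<alpha>) = vq p \<alpha> (e_pos p lam \<alpha>)"
  using vv_block.eJ_idem[OF block0, of \<alpha>] by (simp only: e_pos_block qcl_mult)

lemma e_conv_idem:
  "\<lbrakk>\<beta> \<in> TH; \<gamma> \<in> TH\<rbrakk> \<Longrightarrow> vq p (\<beta> + \<gamma>) (e_conv p lam \<beta> \<gamma> * e_conv p lam \<beta> \<gamma>) = vq p (\<beta> + \<gamma>) (e_conv p lam \<beta> \<gamma>)"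
  using vv_block.eJ_idem[OF block1, of \<beta> \<gamma>] by (simp only: e_conv_block1 qcl_mult)

lemma emb_commutes:
  assumes "\<beta> \<in> TH" "\<gamma> \<in> TH"
  shows "f \<in> KF (pos \<beta>) \<Longrightarrow>
      vq p (\<beta> + \<gamma>) (emb_l \<gamma> f * e_conv p lam \<beta> \<gamma>) = vq p (\<beta> + \<gamma>) (e_conv p lam \<beta> \<gamma> * emb_l \<gamma> f)"
    and "f \<in> KF (pos \<gamma>) \<Longrightarrow>
      vq p (\<beta> + \<gamma>) (emb_r \<beta> f * e_conv p lam \<beta> \<gamma>) = vq p (\<beta> + \<gamma>) (e_conv p lam \<beta> \<gamma> * emb_r \<beta> f)"
  using block_commutes[OF assms(1) block1[OF assms]] block_commutes[OF assms(2) block2[OF assms]]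
  by (simp_all only: emb_l_def emb_r_def e_conv_block1[of \<beta> \<gamma>]) (simp only: e_conv_block2[of \<beta> \<gamma>] flip: e_conv_block1[of \<beta> \<gamma>])

lemma e_pos_e_conv:
  assumes "\<beta> \<in> TH" "\<gamma> \<in> TH"
  shows "vq p (\<beta> + \<gamma>) (e_pos p lam (\<beta> + \<gamma>) * e_conv p lam \<beta> \<gamma>) = vq p (\<beta> + \<gamma>) (e_conv p lam \<beta> \<gamma>)"
proof -
  interpret vv_block p "\<beta> + \<gamma>" 0 "rank (\<beta> + \<gamma>)" "{[]}" "{[]}" "ps (\<beta> + \<gamma>)"
    by (rule block0[OF TH_add[OF assms]])
  have "q (e_pos p lam (\<beta> + \<gamma>)) * E (i @ j) = E (i @ j)" if "i \<in> ps \<beta>" "j \<in> ps \<gamma>" for i j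
    using EB_eJ(2)[OF ps_append[OF that]] by (simp add: e_pos_block)
  then show ?thesis by (simp add: e_conv_def q_hom sum_distrib_left)
qed

end

lemma with_smult_sel [simp]:
  "carrier (with_smult Y a) = carrier Y" "ring.add (with_smult Y a) = ring.add Y"
  "ring.zero (with_smult Y a) = ring.zero Y" "r \<odot>\<^bsub>with_smult Y a\<^esub> y = a r y"
  by (simp_all add: with_smult_def)

lemma mod_homD:
  assumes "h \<in> mod_hom R M N"
  shows "x \<in> carrier M \<Longrightarrow> h x \<in> carrier N"
    "\<lbrakk>x \<in> carrier M; y \<in> carrier M\<rbrakk> \<Longrightarrow> h (x \<oplus>\<^bsub>M\<^esub> y) = h x \<oplus>\<^bsub>N\<^esub> h y"
    "\<lbrakk>r \<in> carrier R; x \<in> carrier M\<rbrakk> \<Longrightarrow> h (r \<odot>\<^bsub>M\<^esub> x) = r \<odot>\<^bsub>N\<^esub> h x"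
  using assms by (auto simp: mod_hom_def)

section \<open>Outer tensor products\<close>

locale outer_data =
  fixes p :: "'k::field" and \<mu> \<nu> :: "'k multiset"
    and U :: "('k palg, 'u, 'x) module_scheme" and V :: "('k palg, 'v, 'y) module_scheme"
  assumes U: "left_module (KLR p \<mu>) U" and V: "left_module (KLR p \<nu>) V"
begin

interpretation U: left_module "KLR p \<mu>" U by (rule U)
interpretation V: left_module "KLR p \<nu>" V by (rule V)

abbreviation "kactU \<equiv> presented.act (KLR_gens \<mu>) (KLR_rels p \<mu>) U"
abbreviation "kactV \<equiv> presented.act (KLR_gens \<nu>) (KLR_rels p \<nu>) V"

lemma klr_class_scal: "klr_class p \<xi> (scal c) = kcl p \<xi> (scal c)"
  by (rule KLR.pres_class_eq_cls) (rule free_alg_closed)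

lemma tensor_data: "tensor_data UNIV (kmod p \<mu> U) (kmod p \<nu> V)"
proof (rule tensor_data.intro)
  show "abelian_group (kmod p \<mu> U)" "abelian_group (kmod p \<nu> V)"
    by (rule abelian_group_cong[OF U.abelian_group_axioms] abelian_group_cong[OF V.abelian_group_axioms];
        simp add: kmod_def)+
qed (simp_all add: kmod_def klr_class_scal U.smult_closed V.smult_closed KLR.cls_closed)

interpretation T: tensor_data UNIV "kmod p \<mu> U" "kmod p \<nu> V"
  by (rule tensor_data)

abbreviation "T0 \<equiv> tensor UNIV (kmod p \<mu> U) (kmod p \<nu> V)"
abbreviation "opure \<equiv> outer_pure p \<mu> \<nu> U V"

lemma kmod_smult: "c \<odot>\<^bsub>kmod p \<mu> U\<^esub> u = kactU (scal c) u" "c \<odot>\<^bsub>kmod p \<nu> V\<^esub> v = kactV (scal c) v"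
  by (simp_all add: kmod_def klr_class_scal KLR.act_def)

lemma kmod_carrier: "carrier (kmod p \<mu> U) = carrier U" "carrier (kmod p \<nu> V) = carrier V"
  "ring.add (kmod p \<mu> U) = ring.add U" "ring.add (kmod p \<nu> V) = ring.add V"
  by (simp_all add: kmod_def)

lemma T0_group: "abelian_group T0" by (rule T.T_group)

lemma opure_closed: "\<lbrakk>u \<in> carrier U; v \<in> carrier V\<rbrakk> \<Longrightarrow> opure u v \<in> carrier T0"
  unfolding outer_pure_def by (rule T.pure_closed) (simp_all add: kmod_carrier)

lemma opure_add:
  "\<lbrakk>u \<in> carrier U; u' \<in> carrier U; v \<in> carrier V\<rbrakk> \<Longrightarrow> opure (u \<oplus>\<^bsub>U\<^esub> u') v = opure u v \<oplus>\<^bsub>T0\<^esub> opure u' v"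
  "\<lbrakk>u \<in> carrier U; v \<in> carrier V; v' \<in> carrier V\<rbrakk> \<Longrightarrow> opure u (v \<oplus>\<^bsub>V\<^esub> v') = opure u v \<oplus>\<^bsub>T0\<^esub> opure u v'"
  unfolding outer_pure_def
  using T.pure_add_left[unfolded kmod_carrier] T.pure_add_right[unfolded kmod_carrier] by blast+

lemma opure_scal:
  "\<lbrakk>u \<in> carrier U; v \<in> carrier V\<rbrakk> \<Longrightarrow> opure (kactU (scal c) u) v = opure u (kactV (scal c) v)"
  unfolding outer_pure_def using T.pure_balanced[unfolded kmod_carrier kmod_smult] by blast

lemma T0_induct [consumes 1, case_names zero pure add]:
  assumes "x \<in> carrier T0" "P \<zero>\<^bsub>T0\<^esub>" "\<And>u v. \<lbrakk>u \<in> carrier U; v \<in> carrier V\<rbrakk> \<Longrightarrow> P (opure u v)"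
    "\<And>x y. \<lbrakk>x \<in> carrier T0; y \<in> carrier T0; P x; P y\<rbrakk> \<Longrightarrow> P (x \<oplus>\<^bsub>T0\<^esub> y)"
  shows "P x"
  by (rule T.T_induct[OF assms(1)]) (use assms in \<open>auto simp: kmod_carrier outer_pure_def\<close>)

lemma T0_lift:
  assumes C: "abelian_group C"
    and "\<And>a b. \<lbrakk>a \<in> carrier U; b \<in> carrier V\<rbrakk> \<Longrightarrow> f a b \<in> carrier C"
    and "\<And>a a' b. \<lbrakk>a \<in> carrier U; a' \<in> carrier U; b \<in> carrier V\<rbrakk> \<Longrightarrow>
      f (a \<oplus>\<^bsub>U\<^esub> a') b = f a b \<oplus>\<^bsub>C\<^esub> f a' b"
    and "\<And>a b b'. \<lbrakk>a \<in> carrier U; b \<in> carrier V; b' \<in> carrier V\<rbrakk> \<Longrightarrow>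
      f a (b \<oplus>\<^bsub>V\<^esub> b') = f a b \<oplus>\<^bsub>C\<^esub> f a b'"
    and "\<And>c a b. \<lbrakk>a \<in> carrier U; b \<in> carrier V\<rbrakk> \<Longrightarrow> f (kactU (scal c) a) b = f a (kactV (scal c) b)"
  shows "\<And>x. x \<in> carrier T0 \<Longrightarrow> tlift C f x \<in> carrier C"
    and "\<And>x y. \<lbrakk>x \<in> carrier T0; y \<in> carrier T0\<rbrakk> \<Longrightarrow> tlift C f (x \<oplus>\<^bsub>T0\<^esub> y) = tlift C f x \<oplus>\<^bsub>C\<^esub> tlift C f y"
    and "\<And>a b. \<lbrakk>a \<in> carrier U; b \<in> carrier V\<rbrakk> \<Longrightarrow> tlift C f (opure a b) = f a b"
proof -
  have bal: "\<And>c a b. \<lbrakk>c \<in> UNIV; a \<in> carrier U; b \<in> carrier V\<rbrakk> \<Longrightarrow>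
      f (kactU (scal c) a) b = f a (kactV (scal c) b)"
    by (rule assms(5))
  note * = T.tlift[where f=f, OF C, unfolded kmod_carrier kmod_smult, OF assms(2-4) bal]
  show "\<And>x. x \<in> carrier T0 \<Longrightarrow> tlift C f x \<in> carrier C"
    by (rule *(1))
  show "\<And>x y. \<lbrakk>x \<in> carrier T0; y \<in> carrier T0\<rbrakk> \<Longrightarrow> tlift C f (x \<oplus>\<^bsub>T0\<^esub> y) = tlift C f x \<oplus>\<^bsub>C\<^esub> tlift C f y"
    by (rule *(2))
  show "\<And>a b. \<lbrakk>a \<in> carrier U; b \<in> carrier V\<rbrakk> \<Longrightarrow> tlift C f (opure a b) = f a b"
    unfolding outer_pure_def by (rule *(3))
qed

end

lemma left_module_regular: "left_module (KLR p \<nu>) (with_smult (KLR p \<nu>) (\<otimes>\<^bsub>KLR p \<nu>\<^esub>))"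
proof -
  interpret ring "KLR p \<nu>" by (rule KLR.ring_A)
  have "abelian_group (with_smult (KLR p \<nu>) (\<otimes>\<^bsub>KLR p \<nu>\<^esub>))"
    by (rule abelian_group_cong[OF abelian_group_axioms]) simp_all
  then show ?thesis
    by (intro left_module.intro left_module_axioms.intro ring_axioms) (auto simp: l_distr r_distr m_assoc)
qed

text \<open>Regular modules make the tensor product of two KLR algebras an outer tensor product of
  modules, so its induction rule and its universal property are inherited.\<close>

lemma outer_data_KLR2:
  "outer_data p \<mu> \<nu> (with_smult (KLR p \<mu>) (\<otimes>\<^bsub>KLR p \<mu>\<^esub>)) (with_smult (KLR p \<nu>) (\<otimes>\<^bsub>KLR p \<nu>\<^esub>))"
  by (rule outer_data.intro) (rule left_module_regular)+

definition kpure :: "'k::field \<Rightarrow> 'k multiset \<Rightarrow> 'k multiset \<Rightarrow> 'k palg \<Rightarrow> 'k palg \<Rightarrow> ('k palg, 'k palg) tens" where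
  "kpure p \<mu> \<nu> = outer_pure p \<mu> \<nu> (with_smult (KLR p \<mu>) (\<otimes>\<^bsub>KLR p \<mu>\<^esub>)) (with_smult (KLR p \<nu>) (\<otimes>\<^bsub>KLR p \<nu>\<^esub>))"

abbreviation KLR2g :: "'k::field \<Rightarrow> 'k multiset \<Rightarrow> 'k multiset \<Rightarrow> ('k palg, 'k palg) tens ring" where
  "KLR2g p \<mu> \<nu> \<equiv> tensor UNIV (kKLR p \<mu>) (kKLR p \<nu>)"

lemma carrier_KLR2: "carrier (KLR2 p \<mu> \<nu>) = carrier (KLR2g p \<mu> \<nu>)"
  by (simp add: KLR2_def Let_def)

lemma KLR2g_group: "abelian_group (KLR2g p \<mu> \<nu>)"
  using outer_data.T0_group[OF outer_data_KLR2] by (simp add: kKLR_def)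

lemma kpure_closed: "\<lbrakk>r \<in> carrier (KLR p \<mu>); s \<in> carrier (KLR p \<nu>)\<rbrakk> \<Longrightarrow> kpure p \<mu> \<nu> r s \<in> carrier (KLR2g p \<mu> \<nu>)"
  using outer_data.opure_closed[OF outer_data_KLR2] by (simp add: kKLR_def kpure_def)

lemma KLR2g_induct [consumes 1, case_names zero pure add]:
  assumes "x \<in> carrier (KLR2g p \<mu> \<nu>)" "P \<zero>\<^bsub>KLR2g p \<mu> \<nu>\<^esub>"
    "\<And>u v. \<lbrakk>u \<in> carrier (KLR p \<mu>); v \<in> carrier (KLR p \<nu>)\<rbrakk> \<Longrightarrow> P (kpure p \<mu> \<nu> u v)"
    "\<And>x y. \<lbrakk>x \<in> carrier (KLR2g p \<mu> \<nu>); y \<in> carrier (KLR2g p \<mu> \<nu>); P x; P y\<rbrakk> \<Longrightarrow> P (x \<oplus>\<^bsub>KLR2g p \<mu> \<nu>\<^esub> y)"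
  shows "P x"
  by (rule outer_data.T0_induct[where P=P, OF outer_data_KLR2, folded kKLR_def kpure_def,
        unfolded with_smult_sel, OF assms])

lemma KLR2g_lift:
  assumes C: "abelian_group C"
    and "\<And>a b. \<lbrakk>a \<in> carrier (KLR p \<mu>); b \<in> carrier (KLR p \<nu>)\<rbrakk> \<Longrightarrow> f a b \<in> carrier C"
    and "\<And>a a' b. \<lbrakk>a \<in> carrier (KLR p \<mu>); a' \<in> carrier (KLR p \<mu>); b \<in> carrier (KLR p \<nu>)\<rbrakk> \<Longrightarrow>
      f (a \<oplus>\<^bsub>KLR p \<mu>\<^esub> a') b = f a b \<oplus>\<^bsub>C\<^esub> f a' b"
    and "\<And>a b b'. \<lbrakk>a \<in> carrier (KLR p \<mu>); b \<in> carrier (KLR p \<nu>); b' \<in> carrier (KLR p \<nu>)\<rbrakk> \<Longrightarrow>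
      f a (b \<oplus>\<^bsub>KLR p \<nu>\<^esub> b') = f a b \<oplus>\<^bsub>C\<^esub> f a b'"
    and "\<And>c a b. \<lbrakk>a \<in> carrier (KLR p \<mu>); b \<in> carrier (KLR p \<nu>)\<rbrakk> \<Longrightarrow>
      f (kcl p \<mu> (scal c) \<otimes>\<^bsub>KLR p \<mu>\<^esub> a) b = f a (kcl p \<nu> (scal c) \<otimes>\<^bsub>KLR p \<nu>\<^esub> b)"
  shows "\<And>x. x \<in> carrier (KLR2g p \<mu> \<nu>) \<Longrightarrow> tlift C f x \<in> carrier C"
    and "\<And>x y. \<lbrakk>x \<in> carrier (KLR2g p \<mu> \<nu>); y \<in> carrier (KLR2g p \<mu> \<nu>)\<rbrakk> \<Longrightarrow>
      tlift C f (x \<oplus>\<^bsub>KLR2g p \<mu> \<nu>\<^esub> y) = tlift C f x \<oplus>\<^bsub>C\<^esub> tlift C f y"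
    and "\<And>a b. \<lbrakk>a \<in> carrier (KLR p \<mu>); b \<in> carrier (KLR p \<nu>)\<rbrakk> \<Longrightarrow> tlift C f (kpure p \<mu> \<nu> a b) = f a b"
proof -
  note * = outer_data.T0_lift[where f=f, OF outer_data_KLR2 C, folded kKLR_def kpure_def,
      unfolded with_smult_sel KLR.act_regular, OF assms(2-5)]
  show "\<And>x. x \<in> carrier (KLR2g p \<mu> \<nu>) \<Longrightarrow> tlift C f x \<in> carrier C"
    by (rule *(1))
  show "\<And>x y. \<lbrakk>x \<in> carrier (KLR2g p \<mu> \<nu>); y \<in> carrier (KLR2g p \<mu> \<nu>)\<rbrakk> \<Longrightarrow>
      tlift C f (x \<oplus>\<^bsub>KLR2g p \<mu> \<nu>\<^esub> y) = tlift C f x \<oplus>\<^bsub>C\<^esub> tlift C f y"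
    by (rule *(2))
  show "\<And>a b. \<lbrakk>a \<in> carrier (KLR p \<mu>); b \<in> carrier (KLR p \<nu>)\<rbrakk> \<Longrightarrow> tlift C f (kpure p \<mu> \<nu> a b) = f a b"
    by (rule *(3))
qed

context outer_data
begin

interpretation U: left_module "KLR p \<mu>" U by (rule U)
interpretation V: left_module "KLR p \<nu>" V by (rule V)
interpretation T0: abelian_group T0 by (rule T0_group)
interpretation R1: ring "KLR p \<mu>" by (rule KLR.ring_A)
interpretation R2: ring "KLR p \<nu>" by (rule KLR.ring_A)

lemma scal_smult:
  "\<lbrakk>r \<in> carrier (KLR p \<mu>); u \<in> carrier U\<rbrakk> \<Longrightarrow> r \<odot>\<^bsub>U\<^esub> kactU (scal c) u = kactU (scal c) (r \<odot>\<^bsub>U\<^esub> u)"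
  "\<lbrakk>s \<in> carrier (KLR p \<nu>); v \<in> carrier V\<rbrakk> \<Longrightarrow> s \<odot>\<^bsub>V\<^esub> kactV (scal c) v = kactV (scal c) (s \<odot>\<^bsub>V\<^esub> v)"
proof -
  have *: "kcl p \<xi> (scal c) \<otimes>\<^bsub>KLR p \<xi>\<^esub> r = r \<otimes>\<^bsub>KLR p \<xi>\<^esub> kcl p \<xi> (scal c)" if "r \<in> carrier (KLR p \<xi>)" for r \<xi>
    using that by (elim KLR.A_cases) (simp add: scal_central flip: KLR.cls_hom(2))
  show "\<lbrakk>r \<in> carrier (KLR p \<mu>); u \<in> carrier U\<rbrakk> \<Longrightarrow> r \<odot>\<^bsub>U\<^esub> kactU (scal c) u = kactU (scal c) (r \<odot>\<^bsub>U\<^esub> u)"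
    by (simp add: KLR.act_def U.smult_assoc[symmetric] KLR.cls_closed *)
  show "\<lbrakk>s \<in> carrier (KLR p \<nu>); v \<in> carrier V\<rbrakk> \<Longrightarrow> s \<odot>\<^bsub>V\<^esub> kactV (scal c) v = kactV (scal c) (s \<odot>\<^bsub>V\<^esub> v)"
    by (simp add: KLR.act_def V.smult_assoc[symmetric] KLR.cls_closed *)
qed

abbreviation "inner r s \<equiv> tlift T0 (\<lambda>u v. opure (r \<odot>\<^bsub>U\<^esub> u) (s \<odot>\<^bsub>V\<^esub> v))"

lemma inner:
  assumes r: "r \<in> carrier (KLR p \<mu>)" and s: "s \<in> carrier (KLR p \<nu>)"
  shows "t \<in> carrier T0 \<Longrightarrow> inner r s t \<in> carrier T0"
    "\<lbrakk>t \<in> carrier T0; t' \<in> carrier T0\<rbrakk> \<Longrightarrow> inner r s (t \<oplus>\<^bsub>T0\<^esub> t') = inner r s t \<oplus>\<^bsub>T0\<^esub> inner r s t'"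
    "\<lbrakk>u \<in> carrier U; v \<in> carrier V\<rbrakk> \<Longrightarrow> inner r s (opure u v) = opure (r \<odot>\<^bsub>U\<^esub> u) (s \<odot>\<^bsub>V\<^esub> v)"
proof -
  note * = T0_lift[OF T0_group, of "\<lambda>u v. opure (r \<odot>\<^bsub>U\<^esub> u) (s \<odot>\<^bsub>V\<^esub> v)"]
  note S = opure_closed opure_add opure_scal scal_smult r s U.smult_closed V.smult_closed U.smult_r_distr V.smult_r_distr
  show "t \<in> carrier T0 \<Longrightarrow> inner r s t \<in> carrier T0"
    by (rule *(1)) (simp_all add: S)
  show "\<lbrakk>t \<in> carrier T0; t' \<in> carrier T0\<rbrakk> \<Longrightarrow> inner r s (t \<oplus>\<^bsub>T0\<^esub> t') = inner r s t \<oplus>\<^bsub>T0\<^esub> inner r s t'"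
    by (rule *(2)) (simp_all add: S)
  show "\<lbrakk>u \<in> carrier U; v \<in> carrier V\<rbrakk> \<Longrightarrow> inner r s (opure u v) = opure (r \<odot>\<^bsub>U\<^esub> u) (s \<odot>\<^bsub>V\<^esub> v)"
    by (rule *(3)) (simp_all add: S)
qed

lemma hom_zero:
  assumes "\<And>t t'. \<lbrakk>t \<in> carrier T0; t' \<in> carrier T0\<rbrakk> \<Longrightarrow> f (t \<oplus>\<^bsub>T0\<^esub> t') = f t \<oplus>\<^bsub>T0\<^esub> f t'"
    "\<And>t. t \<in> carrier T0 \<Longrightarrow> f t \<in> carrier T0"
  shows "f \<zero>\<^bsub>T0\<^esub> = \<zero>\<^bsub>T0\<^esub>"
  using assms(1)[of "\<zero>\<^bsub>T0\<^esub>" "\<zero>\<^bsub>T0\<^esub>"] assms(2)[of "\<zero>\<^bsub>T0\<^esub>"] by simp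

lemma inner_zero: "\<lbrakk>r \<in> carrier (KLR p \<mu>); s \<in> carrier (KLR p \<nu>)\<rbrakk> \<Longrightarrow> inner r s \<zero>\<^bsub>T0\<^esub> = \<zero>\<^bsub>T0\<^esub>"
  by (rule hom_zero) (auto simp: inner)

text \<open>The outer action is a lift over the tensor product of the algebras whose values are
  lifts over the tensor product of the modules. The outer lift exists because the inner one is
  biadditive and balanced in \<open>r\<close> and \<open>s\<close>.\<close>

lemma inner_add:
  assumes t: "t \<in> carrier T0"
  shows "\<lbrakk>r \<in> carrier (KLR p \<mu>); r' \<in> carrier (KLR p \<mu>); s \<in> carrier (KLR p \<nu>)\<rbrakk> \<Longrightarrow>
      inner (r \<oplus>\<^bsub>KLR p \<mu>\<^esub> r') s t = inner r s t \<oplus>\<^bsub>T0\<^esub> inner r' s t"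
    and "\<lbrakk>r \<in> carrier (KLR p \<mu>); s \<in> carrier (KLR p \<nu>); s' \<in> carrier (KLR p \<nu>)\<rbrakk> \<Longrightarrow>
      inner r (s \<oplus>\<^bsub>KLR p \<nu>\<^esub> s') t = inner r s t \<oplus>\<^bsub>T0\<^esub> inner r s' t"
    and "\<lbrakk>r \<in> carrier (KLR p \<mu>); s \<in> carrier (KLR p \<nu>)\<rbrakk> \<Longrightarrow>
      inner (kcl p \<mu> (scal c) \<otimes>\<^bsub>KLR p \<mu>\<^esub> r) s t = inner r (kcl p \<nu> (scal c) \<otimes>\<^bsub>KLR p \<nu>\<^esub> s) t"
  using t
proof (induction t rule: T0_induct)
  case zero
  { case 1 then show ?case by (simp add: inner_zero) }
  { case 2 then show ?case by (simp add: inner_zero) }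
  { case 3 then show ?case by (simp add: inner_zero KLR.cls_closed) }
next
  case (pure u v)
  { case 1 then show ?case using pure
      by (simp add: inner(3) U.smult_l_distr opure_add U.smult_closed V.smult_closed) }
  { case 2 then show ?case using pure
      by (simp add: inner(3) V.smult_l_distr opure_add U.smult_closed V.smult_closed) }
  { case 3 then show ?case using pure
      by (simp add: inner(3) KLR.cls_closed U.smult_closed V.smult_closed U.smult_assoc V.smult_assoc
          opure_scal flip: KLR.act_def) }
next
  case (add x y)
  { case 1 then show ?case using add by (simp add: inner T0.a_ac) }
  { case 2 then show ?case using add by (simp add: inner T0.a_ac) }
  { case 3 then show ?case using add by (simp add: inner KLR.cls_closed) }
qed

lemma outer_carrier: "carrier (outer p \<mu> \<nu> U V) = carrier T0" "ring.add (outer p \<mu> \<nu> U V) = ring.add T0"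
  "ring.zero (outer p \<mu> \<nu> U V) = ring.zero T0"
  by (simp_all add: outer_def Let_def)

lemma outer_group: "abelian_group (outer p \<mu> \<nu> U V)"
  by (rule abelian_group_cong[OF T0_group]) (simp_all add: outer_carrier)

lemma outer_smult_def: "z \<odot>\<^bsub>outer p \<mu> \<nu> U V\<^esub> t = tlift T0 (\<lambda>r s. inner r s t) z"
  by (simp add: outer_def Let_def)

lemma outer_smult:
  assumes t: "t \<in> carrier T0"
  shows "z \<in> carrier (KLR2g p \<mu> \<nu>) \<Longrightarrow> z \<odot>\<^bsub>outer p \<mu> \<nu> U V\<^esub> t \<in> carrier T0"
    "\<lbrakk>z \<in> carrier (KLR2g p \<mu> \<nu>); z' \<in> carrier (KLR2g p \<mu> \<nu>)\<rbrakk> \<Longrightarrow>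
      (z \<oplus>\<^bsub>KLR2g p \<mu> \<nu>\<^esub> z') \<odot>\<^bsub>outer p \<mu> \<nu> U V\<^esub> t = z \<odot>\<^bsub>outer p \<mu> \<nu> U V\<^esub> t \<oplus>\<^bsub>T0\<^esub> z' \<odot>\<^bsub>outer p \<mu> \<nu> U V\<^esub> t"
    "\<lbrakk>r \<in> carrier (KLR p \<mu>); s \<in> carrier (KLR p \<nu>)\<rbrakk> \<Longrightarrow>
      kpure p \<mu> \<nu> r s \<odot>\<^bsub>outer p \<mu> \<nu> U V\<^esub> t = inner r s t"
proof -
  note * = KLR2g_lift[OF T0_group, of p \<mu> \<nu> "\<lambda>r s. inner r s t"]
  note S = inner(1)[OF _ _ t] inner_add[OF t]
  show "z \<in> carrier (KLR2g p \<mu> \<nu>) \<Longrightarrow> z \<odot>\<^bsub>outer p \<mu> \<nu> U V\<^esub> t \<in> carrier T0"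
    unfolding outer_smult_def by (rule *(1)) (simp_all add: S)
  show "\<lbrakk>z \<in> carrier (KLR2g p \<mu> \<nu>); z' \<in> carrier (KLR2g p \<mu> \<nu>)\<rbrakk> \<Longrightarrow>
      (z \<oplus>\<^bsub>KLR2g p \<mu> \<nu>\<^esub> z') \<odot>\<^bsub>outer p \<mu> \<nu> U V\<^esub> t = z \<odot>\<^bsub>outer p \<mu> \<nu> U V\<^esub> t \<oplus>\<^bsub>T0\<^esub> z' \<odot>\<^bsub>outer p \<mu> \<nu> U V\<^esub> t"
    unfolding outer_smult_def by (rule *(2)) (simp_all add: S)
  show "\<lbrakk>r \<in> carrier (KLR p \<mu>); s \<in> carrier (KLR p \<nu>)\<rbrakk> \<Longrightarrow>
      kpure p \<mu> \<nu> r s \<odot>\<^bsub>outer p \<mu> \<nu> U V\<^esub> t = inner r s t"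
    unfolding outer_smult_def by (rule *(3)) (simp_all add: S)
qed

end

section \<open>Convolution products\<close>

context vv_setup
begin

abbreviation act :: "('k, 'm) vv_mod \<Rightarrow> 'k falg \<Rightarrow> 'm \<Rightarrow> 'm" where
  "act M \<equiv> vact p (deg M) M"

abbreviation vvm :: "('k, 'm) vv_mod \<Rightarrow> bool" where
  "vvm \<equiv> vv_module p lam"

abbreviation RC :: "('k, 'm) vv_mod \<Rightarrow> 'm set" where
  "RC M \<equiv> carrier (Res p lam M)"

abbreviation conv' (infixl \<open>\<bullet>\<close> 65) where
  "M \<bullet> N \<equiv> conv p lam M N"

lemma vvm_TH: "vvm M \<Longrightarrow> deg M \<in> TH"
  and vvm_module: "vvm M \<Longrightarrow> left_module (VV p (deg M)) M"
  by (simp_all add: vv_module_def)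

lemmas act_hom = VV.act_hom[OF vvm_module]

lemma vvm_group: "vvm M \<Longrightarrow> abelian_group M"
  using vvm_module left_module_def by blast

lemma Res_sel [simp]:
  "ring.add (Res p lam M) = ring.add M" "ring.zero (Res p lam M) = ring.zero M"
  by (simp_all add: Res_def)

text \<open>The idempotent acts as a projection, so its image is its set of fixed elements. In this
  form membership in \<open>Res\<close> is checked by equations.\<close>

lemma RC_iff:
  assumes M: "vvm M" shows "u \<in> RC M \<longleftrightarrow> u \<in> carrier M \<and> act M (e_pos p lam (deg M)) u = u"
proof -
  let ?e = "e_pos p lam (deg M)"
  have "RC M = act M ?e ` carrier M"
    using VV.pres_class_eq_cls[OF e_pos_closed[OF vvm_TH[OF M]]] by (simp add: Res_def VV.act_def)
  moreover have "act M ?e (act M ?e u) = act M ?e u" if "u \<in> carrier M" for u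
    using act_hom(4)[OF M that that, of ?e ?e] vact_cong[OF e_pos_idem[OF vvm_TH[OF M]], of M u] by simp
  ultimately show ?thesis using act_hom(1)[OF M] by (auto simp: image_iff) metis
qed

lemma RC_closed:
  assumes M: "vvm M" and u: "u \<in> RC M"
  shows "u \<in> carrier M" "f \<in> KF (pos (deg M)) \<Longrightarrow> act M f u \<in> RC M"
    "u' \<in> RC M \<Longrightarrow> u \<oplus>\<^bsub>M\<^esub> u' \<in> RC M"
proof -
  let ?e = "e_pos p lam (deg M)"
  interpret abelian_group M by (rule vvm_group[OF M])
  show uM: "u \<in> carrier M" using u RC_iff[OF M] by blast
  show "act M f u \<in> RC M" if f: "f \<in> KF (pos (deg M))"
    using act_hom(4)[OF M uM uM, of ?e f] act_hom(4)[OF M uM uM, of f ?e] u act_hom(1)[OF M uM uM]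
      vact_cong[OF e_pos_commutes[OF vvm_TH[OF M] f], of M u]
    unfolding RC_iff[OF M] by simp
  show "u \<oplus>\<^bsub>M\<^esub> u' \<in> RC M" if "u' \<in> RC M"
    using that u act_hom(3)[OF M, of u u'] unfolding RC_iff[OF M] by simp
qed

lemma Res_group: assumes M: "vvm M" shows "abelian_group (Res p lam M)"
proof -
  interpret abelian_group M by (rule vvm_group[OF M])
  have z: "\<zero>\<^bsub>M\<^esub> \<in> RC M" unfolding RC_iff[OF M] using act_hom(7)[OF M zero_closed zero_closed] zero_closed by simp
  show ?thesis
  proof (rule abelian_groupI)
    fix x assume x: "x \<in> RC M"
    have "act M (- 1) x \<in> RC M"
      by (rule RC_closed(2)[OF M x]) (intro free_alg_closed)
    moreover have "act M (- 1) x \<oplus>\<^bsub>M\<^esub> x = \<zero>\<^bsub>M\<^esub>"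
      using act_hom(2)[OF M RC_closed(1)[OF M x] RC_closed(1)[OF M x], of "- 1" 1]
        act_hom(5,6)[OF M RC_closed(1)[OF M x] RC_closed(1)[OF M x]] by simp
    ultimately show "\<exists>y\<in>RC M. y \<oplus>\<^bsub>Res p lam M\<^esub> x = \<zero>\<^bsub>Res p lam M\<^esub>" by auto
  qed (use z RC_closed[OF M] in \<open>auto simp: a_ac\<close>)
qed

text \<open>\<open>corner\<close> appends the idempotent, which fixes \<open>u\<close>. On
  \<open>Res\<close> a KLR element therefore acts as the same word does in the VV algebra.\<close>

lemma Res_smult:
  assumes M: "vvm M" and f: "f \<in> KF (pos (deg M))" and u: "u \<in> RC M"
  shows "kcl p (pos (deg M)) f \<odot>\<^bsub>Res p lam M\<^esub> u = act M f u"
proof -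
  have uM: "u \<in> carrier M" by (rule RC_closed(1)[OF M u])
  have "kcl p (pos (deg M)) f \<odot>\<^bsub>Res p lam M\<^esub> u = act M (f * e_pos p lam (deg M)) u"
    by (simp add: Res_def corner_class[OF vvm_TH[OF M] f] VV.act_def)
  also have "\<dots> = act M f u"
    using act_hom(4)[OF M uM uM] u RC_iff[OF M] by simp
  finally show ?thesis .
qed

lemma Res_module: assumes M: "vvm M" shows "left_module (KLR p (pos (deg M))) (Res p lam M)"
proof -
  interpret R: ring "KLR p (pos (deg M))" by (rule KLR.ring_A)
  have ax: "a \<odot>\<^bsub>Res p lam M\<^esub> x \<in> RC M \<and>
      (a \<oplus>\<^bsub>KLR p (pos (deg M))\<^esub> b) \<odot>\<^bsub>Res p lam M\<^esub> x = a \<odot>\<^bsub>Res p lam M\<^esub> x \<oplus>\<^bsub>M\<^esub> b \<odot>\<^bsub>Res p lam M\<^esub> x \<and>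
      a \<odot>\<^bsub>Res p lam M\<^esub> (x \<oplus>\<^bsub>M\<^esub> y) = a \<odot>\<^bsub>Res p lam M\<^esub> x \<oplus>\<^bsub>M\<^esub> a \<odot>\<^bsub>Res p lam M\<^esub> y \<and>
      (a \<otimes>\<^bsub>KLR p (pos (deg M))\<^esub> b) \<odot>\<^bsub>Res p lam M\<^esub> x = a \<odot>\<^bsub>Res p lam M\<^esub> (b \<odot>\<^bsub>Res p lam M\<^esub> x) \<and>
      \<one>\<^bsub>KLR p (pos (deg M))\<^esub> \<odot>\<^bsub>Res p lam M\<^esub> x = x"
    if a: "a \<in> carrier (KLR p (pos (deg M)))" and b: "b \<in> carrier (KLR p (pos (deg M)))"
      and x: "x \<in> RC M" "y \<in> RC M" for a b x y
  proof -
    from a obtain f where f: "f \<in> KF (pos (deg M))" "a = kcl p (pos (deg M)) f" by (rule KLR.A_cases)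
    from b obtain g where g: "g \<in> KF (pos (deg M))" "b = kcl p (pos (deg M)) g" by (rule KLR.A_cases)
    note C = RC_closed(1)[OF M x(1)] RC_closed(1)[OF M x(2)]
    show ?thesis
      using f g x by (simp add: KLR.cls_hom[symmetric] Res_smult[OF M] free_alg_closed RC_closed[OF M]
          act_hom[OF M C(1) C(1)] act_hom[OF M C])
  qed
  show ?thesis
    using ax[OF R.one_closed R.one_closed]
    by (intro left_module.intro left_module_axioms.intro KLR.ring_A Res_group M) (auto simp: ax)
qed

end

section \<open>The convolution product as a module and its universal property\<close>

locale conv_data = vv_setup p lam for p lam :: "'k::field" +
  fixes M :: "('k, 'm) vv_mod" and N :: "('k, 'n) vv_mod"
  assumes M: "vv_module p lam M" and N: "vv_module p lam N"
begin

abbreviation "\<beta> \<equiv> deg M"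
abbreviation "\<gamma> \<equiv> deg N"
abbreviation "e \<equiv> e_conv p lam \<beta> \<gamma>"
abbreviation "W \<equiv> VV p (\<beta> + \<gamma>)"
abbreviation "wcl \<equiv> vcl p (\<beta> + \<gamma>)"

lemma TH: "\<beta> \<in> TH" "\<gamma> \<in> TH"
  using M N by (auto intro: vvm_TH)

interpretation W: ring W by (rule VV.ring_A)

lemma outer_data: "outer_data p (pos \<beta>) (pos \<gamma>) (Res p lam M) (Res p lam N)"
  by (rule outer_data.intro) (rule Res_module M N)+

interpretation O: outer_data p "pos \<beta>" "pos \<gamma>" "Res p lam M" "Res p lam N"
  by (rule outer_data)

abbreviation "IB \<equiv> ind_bimod p lam \<beta> \<gamma>"
abbreviation "RO \<equiv> res_outer p lam M N"
abbreviation "SS \<equiv> carrier (KLR2 p (pos \<beta>) (pos \<gamma>))"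
abbreviation "K2 \<equiv> KLR2g p (pos \<beta>) (pos \<gamma>)"
abbreviation "opure \<equiv> outer_pure p (pos \<beta>) (pos \<gamma>) (Res p lam M) (Res p lam N)"

lemma IB_sel: "ring.add IB = ring.add W" "ring.zero IB = ring.zero W"
  "z \<odot>\<^bsub>IB\<^esub> a = tlift W (\<lambda>r s. a \<otimes>\<^bsub>W\<^esub> (emb1 p lam \<beta> \<gamma> r \<otimes>\<^bsub>W\<^esub> emb2 p lam \<beta> \<gamma> s)) z"
  by (simp_all add: ind_bimod_def Let_def)

lemma wcl_e: "vv_class p (\<beta> + \<gamma>) e = wcl e"
  by (rule VV.pres_class_eq_cls) (rule e_conv_closed[OF TH])

lemma e_e: "wcl e \<otimes>\<^bsub>W\<^esub> wcl e = wcl e"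
  using e_conv_idem[OF TH] by (simp add: VV.cls_hom(2)[symmetric] vcl_eq_vq)

lemma IB_carrier: "a \<in> carrier IB \<longleftrightarrow> a \<in> carrier W \<and> a \<otimes>\<^bsub>W\<^esub> wcl e = a"
proof -
  have "carrier IB = (\<lambda>w. w \<otimes>\<^bsub>W\<^esub> wcl e) ` carrier W"
    by (simp add: ind_bimod_def Let_def wcl_e)
  moreover have "w \<otimes>\<^bsub>W\<^esub> wcl e \<otimes>\<^bsub>W\<^esub> wcl e = w \<otimes>\<^bsub>W\<^esub> wcl e" if "w \<in> carrier W" for w
    using that by (simp add: W.m_assoc VV.cls_closed e_e)
  ultimately show ?thesis by (auto simp: image_iff VV.cls_closed)
qed

lemma IB_group: "abelian_group IB"
proof (rule abelian_groupI)
  fix x assume x: "x \<in> carrier IB"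
  then show "\<exists>y\<in>carrier IB. y \<oplus>\<^bsub>IB\<^esub> x = \<zero>\<^bsub>IB\<^esub>"
    by (intro bexI[of _ "\<ominus>\<^bsub>W\<^esub> x"]) (auto simp: IB_carrier IB_sel W.l_neg W.l_minus VV.cls_closed)
qed (auto simp: IB_carrier IB_sel W.l_distr VV.cls_closed W.a_ac)

lemma emb1_eq: "f \<in> KF (pos \<beta>) \<Longrightarrow> emb1 p lam \<beta> \<gamma> (kcl p (pos \<beta>) f) = wcl (emb_l \<gamma> f * e)"
  and emb2_eq: "f \<in> KF (pos \<gamma>) \<Longrightarrow> emb2 p lam \<beta> \<gamma> (kcl p (pos \<gamma>) f) = wcl (emb_r \<beta> f * e)"
  using emb1_class[OF TH] emb2_class[OF TH] by blast+

lemma emb_closed':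
  "r \<in> carrier (KLR p (pos \<beta>)) \<Longrightarrow> emb1 p lam \<beta> \<gamma> r \<in> carrier W"
  "s \<in> carrier (KLR p (pos \<gamma>)) \<Longrightarrow> emb2 p lam \<beta> \<gamma> s \<in> carrier W"
  "s \<in> carrier (KLR p (pos \<gamma>)) \<Longrightarrow> emb2 p lam \<beta> \<gamma> s \<otimes>\<^bsub>W\<^esub> wcl e = emb2 p lam \<beta> \<gamma> s"
  by (auto elim!: KLR.A_cases simp: emb1_eq emb2_eq VV.cls_closed VV.cls_hom W.m_assoc e_e)

lemma emb_add:
  "\<lbrakk>r \<in> carrier (KLR p (pos \<beta>)); r' \<in> carrier (KLR p (pos \<beta>))\<rbrakk> \<Longrightarrow>
    emb1 p lam \<beta> \<gamma> (r \<oplus>\<^bsub>KLR p (pos \<beta>)\<^esub> r') = emb1 p lam \<beta> \<gamma> r \<oplus>\<^bsub>W\<^esub> emb1 p lam \<beta> \<gamma> r'"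
  "\<lbrakk>s \<in> carrier (KLR p (pos \<gamma>)); s' \<in> carrier (KLR p (pos \<gamma>))\<rbrakk> \<Longrightarrow>
    emb2 p lam \<beta> \<gamma> (s \<oplus>\<^bsub>KLR p (pos \<gamma>)\<^esub> s') = emb2 p lam \<beta> \<gamma> s \<oplus>\<^bsub>W\<^esub> emb2 p lam \<beta> \<gamma> s'"
  by (elim KLR.A_cases; simp add: KLR.cls_hom[symmetric] emb1_eq emb2_eq free_alg_closed
      emb_l_hom emb_r_hom distrib_right VV.cls_hom(1))+

lemma emb_scal:
  assumes "r \<in> carrier (KLR p (pos \<beta>))" "s \<in> carrier (KLR p (pos \<gamma>))"
  shows "emb1 p lam \<beta> \<gamma> (kcl p (pos \<beta>) (scal c) \<otimes>\<^bsub>KLR p (pos \<beta>)\<^esub> r) \<otimes>\<^bsub>W\<^esub> emb2 p lam \<beta> \<gamma> s =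
    emb1 p lam \<beta> \<gamma> r \<otimes>\<^bsub>W\<^esub> emb2 p lam \<beta> \<gamma> (kcl p (pos \<gamma>) (scal c) \<otimes>\<^bsub>KLR p (pos \<gamma>)\<^esub> s)"
proof -
  from assms(1) obtain f where f: "f \<in> KF (pos \<beta>)" "r = kcl p (pos \<beta>) f" by (rule KLR.A_cases)
  from assms(2) obtain g where g: "g \<in> KF (pos \<gamma>)" "s = kcl p (pos \<gamma>) g" by (rule KLR.A_cases)
  have "(scal c * emb_l \<gamma> f * e) * (emb_r \<beta> g * e) = (emb_l \<gamma> f * e) * (scal c * emb_r \<beta> g * e)"
    by (simp add: mult.assoc scal_central)
  then show ?thesis
    using f g by (simp add: KLR.cls_hom[symmetric] emb1_eq emb2_eq free_alg_closed
      emb_l_hom emb_r_hom VV.cls_hom(2)[symmetric])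
qed

lemma IB_smult:
  assumes a: "a \<in> carrier W"
  shows "z \<in> carrier K2 \<Longrightarrow> z \<odot>\<^bsub>IB\<^esub> a \<in> carrier W"
    "\<lbrakk>z \<in> carrier K2; z' \<in> carrier K2\<rbrakk> \<Longrightarrow> (z \<oplus>\<^bsub>K2\<^esub> z') \<odot>\<^bsub>IB\<^esub> a = z \<odot>\<^bsub>IB\<^esub> a \<oplus>\<^bsub>W\<^esub> z' \<odot>\<^bsub>IB\<^esub> a"
    "\<lbrakk>r \<in> carrier (KLR p (pos \<beta>)); s \<in> carrier (KLR p (pos \<gamma>))\<rbrakk> \<Longrightarrow>
      kpure p (pos \<beta>) (pos \<gamma>) r s \<odot>\<^bsub>IB\<^esub> a = a \<otimes>\<^bsub>W\<^esub> (emb1 p lam \<beta> \<gamma> r \<otimes>\<^bsub>W\<^esub> emb2 p lam \<beta> \<gamma> s)"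
proof -
  note * = KLR2g_lift[OF W.abelian_group_axioms, of p "pos \<beta>" "pos \<gamma>"
      "\<lambda>r s. a \<otimes>\<^bsub>W\<^esub> (emb1 p lam \<beta> \<gamma> r \<otimes>\<^bsub>W\<^esub> emb2 p lam \<beta> \<gamma> s)"]
  note S = emb_closed' emb_add emb_scal a W.l_distr W.r_distr
  show "z \<in> carrier K2 \<Longrightarrow> z \<odot>\<^bsub>IB\<^esub> a \<in> carrier W"
    unfolding IB_sel by (rule *(1)) (simp_all add: S)
  show "\<lbrakk>z \<in> carrier K2; z' \<in> carrier K2\<rbrakk> \<Longrightarrow> (z \<oplus>\<^bsub>K2\<^esub> z') \<odot>\<^bsub>IB\<^esub> a = z \<odot>\<^bsub>IB\<^esub> a \<oplus>\<^bsub>W\<^esub> z' \<odot>\<^bsub>IB\<^esub> a"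
    unfolding IB_sel by (rule *(2)) (simp_all add: S)
  show "\<lbrakk>r \<in> carrier (KLR p (pos \<beta>)); s \<in> carrier (KLR p (pos \<gamma>))\<rbrakk> \<Longrightarrow>
      kpure p (pos \<beta>) (pos \<gamma>) r s \<odot>\<^bsub>IB\<^esub> a = a \<otimes>\<^bsub>W\<^esub> (emb1 p lam \<beta> \<gamma> r \<otimes>\<^bsub>W\<^esub> emb2 p lam \<beta> \<gamma> s)"
    unfolding IB_sel by (rule *(3)) (simp_all add: S)
qed

interpretation K2: abelian_group K2 by (rule KLR2g_group)

lemma IB_smult_zero: "a \<in> carrier W \<Longrightarrow> \<zero>\<^bsub>K2\<^esub> \<odot>\<^bsub>IB\<^esub> a = \<zero>\<^bsub>W\<^esub>"
  using IB_smult(2)[of a "\<zero>\<^bsub>K2\<^esub>" "\<zero>\<^bsub>K2\<^esub>"] IB_smult(1)[of a "\<zero>\<^bsub>K2\<^esub>"] by simp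

text \<open>Left multiplication commutes with the right action of the KLR algebras, which lets the
  VV algebra act on the first tensor factor.\<close>

lemma IB_smult_mult:
  assumes "z \<in> carrier K2" and w: "w \<in> carrier W" and a: "a \<in> carrier W"
  shows "z \<odot>\<^bsub>IB\<^esub> (w \<otimes>\<^bsub>W\<^esub> a) = w \<otimes>\<^bsub>W\<^esub> (z \<odot>\<^bsub>IB\<^esub> a)"
  using assms(1)
proof (induction z rule: KLR2g_induct)
  case zero
  then show ?case using w a by (simp add: IB_smult_zero)
next
  case (pure r s)
  then show ?case using w a by (simp add: IB_smult emb_closed' W.m_assoc)
next
  case (add x y)
  then show ?case using w a by (simp add: IB_smult W.r_distr)
qed

lemma IB_closed:
  assumes "z \<in> carrier K2" and a: "a \<in> carrier IB" shows "z \<odot>\<^bsub>IB\<^esub> a \<in> carrier IB"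
  using assms(1)
proof (induction z rule: KLR2g_induct)
  case zero
  then show ?case using a by (simp add: IB_smult_zero IB_carrier VV.cls_closed)
next
  case (pure r s)
  then show ?case using a by (simp add: IB_smult emb_closed' W.m_assoc IB_carrier VV.cls_closed)
next
  case (add x y)
  then show ?case using a by (simp add: IB_smult W.l_distr IB_carrier VV.cls_closed)
qed

lemma TC: "tensor_data SS IB RO"
  by (rule tensor_data.intro)
    (auto simp: IB_group res_outer_def O.outer_group O.outer_carrier carrier_KLR2 IB_closed O.outer_smult)

interpretation TC: tensor_data SS IB RO by (rule TC)

abbreviation "CT \<equiv> tensor SS IB RO"
abbreviation "cten \<equiv> conv_tensor p lam M N"

lemma RO_carrier: "carrier RO = carrier O.T0" "ring.add RO = ring.add O.T0" "ring.zero RO = ring.zero O.T0"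
  by (simp_all add: res_outer_def O.outer_carrier)

interpretation CT: abelian_group CT by (rule TC.T_group)

lemma conv_sel: "carrier (M \<bullet> N) = carrier CT" "ring.add (M \<bullet> N) = ring.add CT"
  "ring.zero (M \<bullet> N) = ring.zero CT" "deg (M \<bullet> N) = \<beta> + \<gamma>"
  "w \<odot>\<^bsub>M \<bullet> N\<^esub> x = tlift CT (\<lambda>a t. cten (w \<otimes>\<^bsub>W\<^esub> a) t) x"
  by (simp_all add: conv_def Let_def)

lemma cten_closed: "\<lbrakk>a \<in> carrier IB; t \<in> carrier O.T0\<rbrakk> \<Longrightarrow> cten a t \<in> carrier CT"
  and cten_add: "\<lbrakk>a \<in> carrier IB; a' \<in> carrier IB; t \<in> carrier O.T0\<rbrakk> \<Longrightarrow>
      cten (a \<oplus>\<^bsub>W\<^esub> a') t = cten a t \<oplus>\<^bsub>CT\<^esub> cten a' t"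
    "\<lbrakk>a \<in> carrier IB; t \<in> carrier O.T0; t' \<in> carrier O.T0\<rbrakk> \<Longrightarrow>
      cten a (t \<oplus>\<^bsub>O.T0\<^esub> t') = cten a t \<oplus>\<^bsub>CT\<^esub> cten a t'"
  and cten_bal: "\<lbrakk>z \<in> SS; a \<in> carrier IB; t \<in> carrier O.T0\<rbrakk> \<Longrightarrow> cten (z \<odot>\<^bsub>IB\<^esub> a) t = cten a (z \<odot>\<^bsub>RO\<^esub> t)"
  unfolding conv_tensor_def
  using TC.pure_closed TC.pure_add_left TC.pure_add_right TC.pure_balanced
  by (simp_all add: RO_carrier IB_sel(1))

lemma conv_smult:
  assumes w: "w \<in> carrier W"
  shows "x \<in> carrier CT \<Longrightarrow> w \<odot>\<^bsub>M \<bullet> N\<^esub> x \<in> carrier CT"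
    "\<lbrakk>x \<in> carrier CT; y \<in> carrier CT\<rbrakk> \<Longrightarrow> w \<odot>\<^bsub>M \<bullet> N\<^esub> (x \<oplus>\<^bsub>CT\<^esub> y) = w \<odot>\<^bsub>M \<bullet> N\<^esub> x \<oplus>\<^bsub>CT\<^esub> w \<odot>\<^bsub>M \<bullet> N\<^esub> y"
    "\<lbrakk>a \<in> carrier IB; t \<in> carrier O.T0\<rbrakk> \<Longrightarrow> w \<odot>\<^bsub>M \<bullet> N\<^esub> cten a t = cten (w \<otimes>\<^bsub>W\<^esub> a) t"
proof -
  have cl: "w \<otimes>\<^bsub>W\<^esub> a \<in> carrier IB" if "a \<in> carrier IB" for a
    using that w by (simp add: IB_carrier W.m_assoc VV.cls_closed)
  have bal: "cten (w \<otimes>\<^bsub>W\<^esub> (z \<odot>\<^bsub>IB\<^esub> a)) t = cten (w \<otimes>\<^bsub>W\<^esub> a) (z \<odot>\<^bsub>RO\<^esub> t)"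
    if "z \<in> SS" "a \<in> carrier IB" "t \<in> carrier O.T0" for z a t
    using that w cten_bal[OF that(1) cl[OF that(2)] that(3)]
    by (simp add: carrier_KLR2 IB_smult_mult IB_carrier)
  have rd: "w \<otimes>\<^bsub>W\<^esub> (a \<oplus>\<^bsub>W\<^esub> a') = w \<otimes>\<^bsub>W\<^esub> a \<oplus>\<^bsub>W\<^esub> w \<otimes>\<^bsub>W\<^esub> a'" if "a \<in> carrier IB" "a' \<in> carrier IB" for a a'
    using that w by (simp add: IB_carrier W.r_distr)
  note * = TC.tlift[where f="\<lambda>a t. cten (w \<otimes>\<^bsub>W\<^esub> a) t", OF TC.T_group, unfolded RO_carrier IB_sel(1,2)]
  note S = cten_closed cten_add cl bal rd
  show "x \<in> carrier CT \<Longrightarrow> w \<odot>\<^bsub>M \<bullet> N\<^esub> x \<in> carrier CT"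
    unfolding conv_sel by (rule *(1)) (simp_all add: S)
  show "\<lbrakk>x \<in> carrier CT; y \<in> carrier CT\<rbrakk> \<Longrightarrow> w \<odot>\<^bsub>M \<bullet> N\<^esub> (x \<oplus>\<^bsub>CT\<^esub> y) = w \<odot>\<^bsub>M \<bullet> N\<^esub> x \<oplus>\<^bsub>CT\<^esub> w \<odot>\<^bsub>M \<bullet> N\<^esub> y"
    unfolding conv_sel by (rule *(2)) (simp_all add: S)
  show "\<lbrakk>a \<in> carrier IB; t \<in> carrier O.T0\<rbrakk> \<Longrightarrow> w \<odot>\<^bsub>M \<bullet> N\<^esub> cten a t = cten (w \<otimes>\<^bsub>W\<^esub> a) t"
    unfolding conv_sel by (subst (2) conv_tensor_def, rule *(3)) (simp_all add: S)
qed

lemma CT_induct [consumes 1, case_names zero pure add]: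
  assumes "x \<in> carrier CT" "P \<zero>\<^bsub>CT\<^esub>" "\<And>a t. \<lbrakk>a \<in> carrier IB; t \<in> carrier O.T0\<rbrakk> \<Longrightarrow> P (cten a t)"
    "\<And>x y. \<lbrakk>x \<in> carrier CT; y \<in> carrier CT; P x; P y\<rbrakk> \<Longrightarrow> P (x \<oplus>\<^bsub>CT\<^esub> y)"
  shows "P x"
  by (rule TC.T_induct[OF assms(1)]) (use assms in \<open>auto simp: RO_carrier conv_tensor_def\<close>)

lemma conv_smult_zero: "w \<in> carrier W \<Longrightarrow> w \<odot>\<^bsub>M \<bullet> N\<^esub> \<zero>\<^bsub>CT\<^esub> = \<zero>\<^bsub>CT\<^esub>"
  using conv_smult(2)[of w "\<zero>\<^bsub>CT\<^esub>" "\<zero>\<^bsub>CT\<^esub>"] conv_smult(1)[of w "\<zero>\<^bsub>CT\<^esub>"] by simp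

lemma W_IB: "\<lbrakk>w \<in> carrier W; a \<in> carrier IB\<rbrakk> \<Longrightarrow> w \<otimes>\<^bsub>W\<^esub> a \<in> carrier IB"
  by (simp add: IB_carrier W.m_assoc VV.cls_closed)

lemma conv_module: "left_module W (M \<bullet> N)"
proof (intro left_module.intro left_module_axioms.intro VV.ring_A)
  show "abelian_group (M \<bullet> N)"
    by (rule abelian_group_cong[OF TC.T_group]) (simp_all add: conv_sel)
  fix a x assume a: "a \<in> carrier W" and x: "x \<in> carrier (M \<bullet> N)"
  then show "a \<odot>\<^bsub>M \<bullet> N\<^esub> x \<in> carrier (M \<bullet> N)" by (simp add: conv_smult conv_sel(1))
  show "a \<odot>\<^bsub>M \<bullet> N\<^esub> (x \<oplus>\<^bsub>M \<bullet> N\<^esub> y) = a \<odot>\<^bsub>M \<bullet> N\<^esub> x \<oplus>\<^bsub>M \<bullet> N\<^esub> a \<odot>\<^bsub>M \<bullet> N\<^esub> y" if "y \<in> carrier (M \<bullet> N)" for y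
    using a x that by (simp add: conv_smult conv_sel(1,2))
  fix b assume b: "b \<in> carrier W"
  from x have x': "x \<in> carrier CT" by (simp add: conv_sel)
  show "(a \<oplus>\<^bsub>W\<^esub> b) \<odot>\<^bsub>M \<bullet> N\<^esub> x = a \<odot>\<^bsub>M \<bullet> N\<^esub> x \<oplus>\<^bsub>M \<bullet> N\<^esub> b \<odot>\<^bsub>M \<bullet> N\<^esub> x"
    unfolding conv_sel(2) using x' a b
  proof (induction x rule: CT_induct)
    case (pure c t)
    then have "c \<in> carrier W" by (simp add: IB_carrier)
    then show ?case using pure by (simp add: conv_smult W.l_distr cten_add W_IB)
  qed (simp_all add: conv_smult conv_smult_zero CT.a_ac)
  show "(a \<otimes>\<^bsub>W\<^esub> b) \<odot>\<^bsub>M \<bullet> N\<^esub> x = a \<odot>\<^bsub>M \<bullet> N\<^esub> (b \<odot>\<^bsub>M \<bullet> N\<^esub> x)"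
    using x' a b
  proof (induction x rule: CT_induct)
    case (pure c t)
    then have "c \<in> carrier W" by (simp add: IB_carrier)
    then show ?case using pure by (simp add: conv_smult W.m_assoc W_IB)
  qed (simp_all add: conv_smult conv_smult_zero)
next
  fix x assume "x \<in> carrier (M \<bullet> N)"
  then have "x \<in> carrier CT" by (simp add: conv_sel)
  then show "\<one>\<^bsub>W\<^esub> \<odot>\<^bsub>M \<bullet> N\<^esub> x = x"
    by (induction x rule: CT_induct) (simp_all add: conv_smult conv_smult_zero IB_carrier)
qed

lemma conv_vvm: "vvm (M \<bullet> N)"
  using conv_module TH_add[OF TH] by (simp add: vv_module_def conv_sel)

abbreviation "cp \<equiv> conv_pure p lam M N"

lemma conv_pure_eq: "cp u v = cten (wcl e) (opure u v)"
  by (simp add: conv_pure_def wcl_e)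

lemma e_IB: "wcl e \<in> carrier IB"
  by (simp add: IB_carrier VV.cls_closed e_e)

lemma cp_closed: "\<lbrakk>u \<in> RC M; v \<in> RC N\<rbrakk> \<Longrightarrow> cp u v \<in> carrier (M \<bullet> N)"
  by (simp add: conv_pure_eq cten_closed e_IB O.opure_closed conv_sel)

lemma cp_add:
  "\<lbrakk>u \<in> RC M; u' \<in> RC M; v \<in> RC N\<rbrakk> \<Longrightarrow> cp (u \<oplus>\<^bsub>M\<^esub> u') v = cp u v \<oplus>\<^bsub>M \<bullet> N\<^esub> cp u' v"
  "\<lbrakk>u \<in> RC M; v \<in> RC N; v' \<in> RC N\<rbrakk> \<Longrightarrow> cp u (v \<oplus>\<^bsub>N\<^esub> v') = cp u v \<oplus>\<^bsub>M \<bullet> N\<^esub> cp u v'"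
  using O.opure_add cten_add(2) e_IB O.opure_closed by (simp_all add: conv_pure_eq conv_sel)

lemma wact_cp:
  assumes "u \<in> RC M" "v \<in> RC N"
  shows "act (M \<bullet> N) f (cp u v) = cten (wcl (f * e)) (opure u v)"
  using assms by (simp add: VV.act_def conv_sel(4) conv_pure_eq conv_smult VV.cls_closed e_IB O.opure_closed
      VV.cls_hom)

lemma cp_e: "\<lbrakk>u \<in> RC M; v \<in> RC N\<rbrakk> \<Longrightarrow> act (M \<bullet> N) e (cp u v) = cp u v"
  unfolding wact_cp by (simp add: VV.cls_hom e_e conv_pure_eq)

lemma cp_RC: "\<lbrakk>u \<in> RC M; v \<in> RC N\<rbrakk> \<Longrightarrow> cp u v \<in> RC (M \<bullet> N)"
  using e_pos_e_conv[OF TH] wact_cp[of u v "e_pos p lam (\<beta> + \<gamma>)"] cp_closed[of u v]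
  unfolding RC_iff[OF conv_vvm] by (simp add: conv_sel(4) conv_pure_eq flip: vcl_eq_vq)

lemma cp_emb:
  assumes u: "u \<in> RC M" and v: "v \<in> RC N"
  shows "f \<in> KF (pos \<beta>) \<Longrightarrow> cp (act M f u) v = act (M \<bullet> N) (emb_l \<gamma> f) (cp u v)"
    and "f \<in> KF (pos \<gamma>) \<Longrightarrow> cp u (act N f v) = act (M \<bullet> N) (emb_r \<beta> f) (cp u v)"
proof -
  have main: "cp (act M f u) (act N g v) = act (M \<bullet> N) (emb_l \<gamma> f * e * emb_r \<beta> g) (cp u v)"
    if f: "f \<in> KF (pos \<beta>)" and g: "g \<in> KF (pos \<gamma>)" for f g
  proof -
    let ?r = "kcl p (pos \<beta>) f" and ?s = "kcl p (pos \<gamma>) g"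
    have cl: "?r \<in> carrier (KLR p (pos \<beta>))" "?s \<in> carrier (KLR p (pos \<gamma>))" by (rule KLR.cls_closed)+
    have z: "kpure p (pos \<beta>) (pos \<gamma>) ?r ?s \<in> SS"
      unfolding carrier_KLR2 by (rule kpure_closed[OF cl])
    have o: "opure u v \<in> carrier O.T0" by (rule O.opure_closed[OF u v])
    have "opure (act M f u) (act N g v) = kpure p (pos \<beta>) (pos \<gamma>) ?r ?s \<odot>\<^bsub>RO\<^esub> opure u v"
      unfolding res_outer_def O.outer_smult(3)[OF o cl] O.inner(3)[OF cl u v]
        Res_smult[OF M f u] Res_smult[OF N g v] ..
    then have "cp (act M f u) (act N g v) = cten (kpure p (pos \<beta>) (pos \<gamma>) ?r ?s \<odot>\<^bsub>IB\<^esub> wcl e) (opure u v)"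
      by (simp add: conv_pure_eq cten_bal[OF z e_IB o])
    also have "kpure p (pos \<beta>) (pos \<gamma>) ?r ?s \<odot>\<^bsub>IB\<^esub> wcl e = wcl (e * (emb_l \<gamma> f * e * (emb_r \<beta> g * e)))"
      by (simp add: IB_smult(3)[OF VV.cls_closed cl] emb1_eq[OF f] emb2_eq[OF g] VV.cls_hom)
    also have "\<dots> = wcl (emb_l \<gamma> f * e * emb_r \<beta> g * e)"
    proof -
      let ?q = "vq p (\<beta> + \<gamma>)"
      have "?q (e * (emb_l \<gamma> f * e * (emb_r \<beta> g * e))) =
          (?q e * ?q (emb_l \<gamma> f)) * (?q e * (?q (emb_r \<beta> g) * ?q e))"
        by (simp only: qcl_mult mult.assoc)
      also have "?q e * ?q (emb_l \<gamma> f) = ?q (emb_l \<gamma> f) * ?q e"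
        using emb_commutes(1)[OF TH f] by (simp only: qcl_mult)
      also have "?q (emb_l \<gamma> f) * ?q e * (?q e * (?q (emb_r \<beta> g) * ?q e)) =
          ?q (emb_l \<gamma> f) * (?q e * ?q e) * (?q (emb_r \<beta> g) * ?q e)"
        by (simp only: mult.assoc)
      also have "?q e * ?q e = ?q e"
        using e_conv_idem[OF TH] by (simp only: qcl_mult)
      also have "?q (emb_l \<gamma> f) * ?q e * (?q (emb_r \<beta> g) * ?q e) = ?q (emb_l \<gamma> f * e * emb_r \<beta> g * e)"
        by (simp only: qcl_mult mult.assoc)
      finally show ?thesis by (simp only: vcl_eq_vq)
    qed
    finally show ?thesis by (simp add: wact_cp[OF u v])
  qed
  have one: "act M 1 u = u" "act N 1 v = v"
    using act_hom(5)[OF M RC_closed(1)[OF M u] RC_closed(1)[OF M u]]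
      act_hom(5)[OF N RC_closed(1)[OF N v] RC_closed(1)[OF N v]] by auto
  have c: "cp u v \<in> carrier (M \<bullet> N)" by (rule cp_closed[OF u v])
  show "cp (act M f u) v = act (M \<bullet> N) (emb_l \<gamma> f) (cp u v)" if f: "f \<in> KF (pos \<beta>)"
    using main[OF f free_alg_closed(2)] act_hom(4)[OF conv_vvm c c] by (simp add: one emb_r_hom cp_e u v)
  show "cp u (act N f v) = act (M \<bullet> N) (emb_r \<beta> f) (cp u v)" if f: "f \<in> KF (pos \<gamma>)"
  proof -
    have "vq p (\<beta> + \<gamma>) (e * emb_r \<beta> f) = vq p (\<beta> + \<gamma>) (emb_r \<beta> f * e)"
      using emb_commutes(2)[OF TH f] by simp
    moreover have "vact p (\<beta> + \<gamma>) (M \<bullet> N) e (cp u v) = cp u v"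
      using cp_e[OF u v] by (simp add: conv_sel(4))
    ultimately show ?thesis using vact_cong[of "\<beta> + \<gamma>" p "e * emb_r \<beta> f" "emb_r \<beta> f * e" "M \<bullet> N" "cp u v"]
      main[OF free_alg_closed(2) f] act_hom(4)[OF conv_vvm c c]
      by (simp add: one emb_l_hom conv_sel(4))
  qed
qed

text \<open>An element of the left ideal satisfies \<open>a = a * e\<close>, so \<open>a\<close>
  tensored with \<open>u\<close> and \<open>v\<close> is the translate by \<open>a\<close> of
  \<open>e\<close> tensored with \<open>u\<close> and \<open>v\<close>.\<close>

lemma conv_induct [consumes 1, case_names zero gen add]:
  assumes x: "x \<in> carrier (M \<bullet> N)" and zero: "P \<zero>\<^bsub>M \<bullet> N\<^esub>"
    and gen: "\<And>f u v. \<lbrakk>u \<in> RC M; v \<in> RC N\<rbrakk> \<Longrightarrow> P (act (M \<bullet> N) f (cp u v))"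
    and add: "\<And>x y. \<lbrakk>x \<in> carrier (M \<bullet> N); y \<in> carrier (M \<bullet> N); P x; P y\<rbrakk> \<Longrightarrow> P (x \<oplus>\<^bsub>M \<bullet> N\<^esub> y)"
  shows "P x"
proof -
  from x have "x \<in> carrier CT" by (simp add: conv_sel)
  then show ?thesis
  proof (induction x rule: CT_induct)
    case zero
    then show ?case using assms(2) by (simp add: conv_sel)
  next
    case (pure a t)
    from pure(2,1) show ?case
    proof (induction t rule: O.T0_induct)
      case zero
      interpret T0: abelian_group O.T0 by (rule O.T0_group)
      have "cten a \<zero>\<^bsub>O.T0\<^esub> = \<zero>\<^bsub>CT\<^esub>"
        using cten_add(2)[OF zero T0.zero_closed T0.zero_closed] cten_closed[OF zero T0.zero_closed] by simp
      then show ?case using assms(2) by (simp add: conv_sel)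
    next
      case (pure u v)
      then have "a \<in> carrier W" "a \<otimes>\<^bsub>W\<^esub> wcl e = a" by (auto simp: IB_carrier)
      then obtain f where f: "a = wcl f" by (elim VV.A_cases)
      then have "a = wcl (f * e)" using \<open>a \<otimes>\<^bsub>W\<^esub> wcl e = a\<close> by (simp add: VV.cls_hom)
      then show ?case using gen[of u v f] pure by (simp add: wact_cp)
    next
      case (add s t)
      then show ?case
        using assms(4)[of "cten a s" "cten a t"] by (simp add: cten_add cten_closed conv_sel)
    qed
  next
    case (add x y)
    then show ?case using assms(4)[of x y] by (simp add: conv_sel)
  qed
qed

lemma mod_hom_act:
  assumes "h \<in> mod_hom W (M \<bullet> N) C" "x \<in> carrier (M \<bullet> N)"
  shows "h (act (M \<bullet> N) f x) = vact p (\<beta> + \<gamma>) C f (h x)"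
  using mod_homD(3)[OF assms(1) VV.cls_closed assms(2)] by (simp add: VV.act_def conv_sel(4))

lemma hom_eqI:
  assumes C: "left_module W C" and g: "g \<in> mod_hom W (M \<bullet> N) C" and h: "h \<in> mod_hom W (M \<bullet> N) C"
    and eq: "\<And>u v. \<lbrakk>u \<in> RC M; v \<in> RC N\<rbrakk> \<Longrightarrow> g (cp u v) = h (cp u v)" and x: "x \<in> carrier (M \<bullet> N)"
  shows "g x = h x"
proof -
  interpret C: abelian_group C using C left_module_def by blast
  interpret MN: abelian_group "M \<bullet> N" by (rule vvm_group[OF conv_vvm])
  have z: "k \<zero>\<^bsub>M \<bullet> N\<^esub> = \<zero>\<^bsub>C\<^esub>" if "k \<in> mod_hom W (M \<bullet> N) C" for k
    using mod_homD(2)[OF that MN.zero_closed MN.zero_closed] mod_homD(1)[OF that MN.zero_closed] by simp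
  show ?thesis
    using x
  proof (induction x rule: conv_induct)
    case (gen f u v)
    then show ?case using eq by (simp add: mod_hom_act[OF g] mod_hom_act[OF h] cp_closed)
  next
    case (add x y)
    then show ?case by (simp add: mod_homD(2)[OF g] mod_homD(2)[OF h])
  qed (simp add: z g h)
qed

text \<open>
  Bilinear maps on \<open>Res M \<times> Res N\<close> which commute with the generators of both KLR algebras; these
  correspond to the morphisms out of \<open>M \<circ> N\<close>.
\<close>

definition balanced :: "('k palg, 'c, 'y) module_scheme \<Rightarrow> ('m \<Rightarrow> 'n \<Rightarrow> 'c) \<Rightarrow> bool" where
  "balanced C f \<longleftrightarrow> (\<forall>u\<in>RC M. \<forall>v\<in>RC N. f u v \<in> carrier C \<and>
     (\<forall>u'\<in>RC M. f (u \<oplus>\<^bsub>M\<^esub> u') v = f u v \<oplus>\<^bsub>C\<^esub> f u' v) \<and>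
     (\<forall>v'\<in>RC N. f u (v \<oplus>\<^bsub>N\<^esub> v') = f u v \<oplus>\<^bsub>C\<^esub> f u v') \<and>
     (\<forall>c. f (act M (scal c) u) v = vact p (\<beta> + \<gamma>) C (scal c) (f u v)) \<and>
     (\<forall>c. f u (act N (scal c) v) = vact p (\<beta> + \<gamma>) C (scal c) (f u v)) \<and>
     (\<forall>g\<in>KLR_gens (pos \<beta>). f (act M (Poly_Mapping.single [g] 1) u) v =
        vact p (\<beta> + \<gamma>) C (loc_gen 0 {[]} (ps \<gamma>) g) (f u v)) \<and>
     (\<forall>g\<in>KLR_gens (pos \<gamma>). f u (act N (Poly_Mapping.single [g] 1) v) =
        vact p (\<beta> + \<gamma>) C (loc_gen (rank \<beta>) (ps \<beta>) {[]} g) (f u v)))"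

lemma balanced_emb:
  assumes C: "left_module W C" and f: "balanced C f" and u: "u \<in> RC M" and v: "v \<in> RC N"
  shows "g \<in> KF (pos \<beta>) \<Longrightarrow> f (act M g u) v = vact p (\<beta> + \<gamma>) C (emb_l \<gamma> g) (f u v)"
    and "g \<in> KF (pos \<gamma>) \<Longrightarrow> f u (act N g v) = vact p (\<beta> + \<gamma>) C (emb_r \<beta> g) (f u v)"
proof -
  have fc: "f u v \<in> carrier C" if "u \<in> RC M" "v \<in> RC N" for u v
    using f that by (simp add: balanced_def)
  note uM = RC_closed(1)[OF M u] and vN = RC_closed(1)[OF N v]
  show "f (act M g u) v = vact p (\<beta> + \<gamma>) C (emb_l \<gamma> g) (f u v)" if "g \<in> KF (pos \<beta>)"
    using that
  proof (induction g rule: free_alg_induct)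
    case (scal c)
    then show ?case using f u v by (simp add: balanced_def emb_l_hom)
  next
    case (gen x g)
    then show ?case
      using f RC_closed(2)[OF M u gen(2)] v
      by (simp add: balanced_def emb_l_hom act_hom(4)[OF M uM uM] VV.act_hom(4)[OF C fc[OF u v] fc[OF u v]])
  next
    case (add g h)
    then show ?case
      using f RC_closed(2)[OF M u] v
      by (simp add: balanced_def emb_l_hom act_hom(2)[OF M uM uM] VV.act_hom(2)[OF C fc[OF u v] fc[OF u v]])
  qed
  show "f u (act N g v) = vact p (\<beta> + \<gamma>) C (emb_r \<beta> g) (f u v)" if "g \<in> KF (pos \<gamma>)"
    using that
  proof (induction g rule: free_alg_induct)
    case (scal c)
    then show ?case using f u v by (simp add: balanced_def emb_r_hom)
  next
    case (gen x g)
    then show ?case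
      using f RC_closed(2)[OF N v gen(2)] u
      by (simp add: balanced_def emb_r_hom act_hom(4)[OF N vN vN] VV.act_hom(4)[OF C fc[OF u v] fc[OF u v]])
  next
    case (add g h)
    then show ?case
      using f RC_closed(2)[OF N v] u
      by (simp add: balanced_def emb_r_hom act_hom(2)[OF N vN vN] VV.act_hom(2)[OF C fc[OF u v] fc[OF u v]])
  qed
qed

lemma e_pos_KF: "e_pos p lam \<alpha> \<in> KF (pos \<alpha>)"
  by (auto simp: e_pos_def KLR_gens_def klr_gens_def intro!: free_alg_intros)

text \<open>This follows from balance: \<open>emb_l\<close> sends the idempotent of the first factor
  to \<open>e\<close>, and that idempotent fixes \<open>u\<close>.\<close>

lemma balanced_e:
  assumes C: "left_module W C" and f: "balanced C f" and u: "u \<in> RC M" and v: "v \<in> RC N"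
  shows "vact p (\<beta> + \<gamma>) C e (f u v) = f u v"
proof -
  have "emb_l \<gamma> (e_pos p lam \<beta>) = e"
    by (simp add: e_pos_def emb_l_hom e_conv_def)
  then show ?thesis
    using balanced_emb(1)[OF C f u v e_pos_KF] u by (simp add: RC_iff[OF M])
qed

text \<open>Tensor-hom adjunction in two stages: \<open>F\<close> lifts \<open>f\<close> to the
  outer tensor product of the restrictions, and \<open>H\<close> extends \<open>F\<close> from the
  KLR algebras to the VV algebra by sending \<open>a\<close> tensored with \<open>t\<close> to
  \<open>a\<close> applied to \<open>F t\<close>.\<close>

theorem conv_universal:
  assumes C: "left_module W C" and f: "balanced C f"
  shows "\<exists>h \<in> mod_hom W (M \<bullet> N) C. h \<in> extensional (carrier (M \<bullet> N)) \<and>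
    (\<forall>u\<in>RC M. \<forall>v\<in>RC N. h (cp u v) = f u v)"
proof -
  interpret C: left_module W C by (rule C)
  have fc: "f u v \<in> carrier C" if "u \<in> RC M" "v \<in> RC N" for u v
    using f that by (simp add: balanced_def)
  define F where "F = tlift C f"
  have scal: "f (KLR.act (pos \<beta>) p (Res p lam M) (scal c) u) v = f u (KLR.act (pos \<gamma>) p (Res p lam N) (scal c) v)"
    if "u \<in> RC M" "v \<in> RC N" for c u v
    using f that by (simp add: balanced_def KLR.act_def Res_smult M N free_alg_closed)
  have F: "t \<in> carrier O.T0 \<Longrightarrow> F t \<in> carrier C"
    "\<lbrakk>t \<in> carrier O.T0; t' \<in> carrier O.T0\<rbrakk> \<Longrightarrow> F (t \<oplus>\<^bsub>O.T0\<^esub> t') = F t \<oplus>\<^bsub>C\<^esub> F t'"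
    "\<lbrakk>u \<in> RC M; v \<in> RC N\<rbrakk> \<Longrightarrow> F (opure u v) = f u v" for t t' u v
    unfolding F_def
    by (rule O.T0_lift[OF C.abelian_group_axioms], (use f scal in \<open>simp_all add: balanced_def\<close>)[6])+
  interpret T0: abelian_group O.T0 by (rule O.T0_group)
  have F_zero: "F \<zero>\<^bsub>O.T0\<^esub> = \<zero>\<^bsub>C\<^esub>"
    using F(2)[OF T0.zero_closed T0.zero_closed] F(1)[OF T0.zero_closed] by simp
  \<comment> \<open>\<open>F\<close> turns the action of the two KLR algebras into that of their
    images in the VV algebra. The factors \<open>e\<close> contained in \<open>emb1\<close> and
    \<open>emb2\<close> act trivially by \<open>balanced_e\<close>.\<close>
  have inner: "F (O.inner r s t) = (emb1 p lam \<beta> \<gamma> r \<otimes>\<^bsub>W\<^esub> emb2 p lam \<beta> \<gamma> s) \<odot>\<^bsub>C\<^esub> F t"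
    if r: "r \<in> carrier (KLR p (pos \<beta>))" and s: "s \<in> carrier (KLR p (pos \<gamma>))" and t: "t \<in> carrier O.T0" for r s t
    using t
  proof (induction t rule: O.T0_induct)
    case zero
    have "w \<odot>\<^bsub>C\<^esub> \<zero>\<^bsub>C\<^esub> = \<zero>\<^bsub>C\<^esub>" if "w \<in> carrier W" for w
      using C.smult_r_distr[OF that C.M.zero_closed C.M.zero_closed] C.smult_closed[OF that C.M.zero_closed] by simp
    then show ?case using r s by (simp add: O.inner_zero F_zero emb_closed')
  next
    case (pure u v)
    from r obtain g where g: "g \<in> KF (pos \<beta>)" "r = kcl p (pos \<beta>) g" by (rule KLR.A_cases)
    from s obtain g' where g': "g' \<in> KF (pos \<gamma>)" "s = kcl p (pos \<gamma>) g'" by (rule KLR.A_cases)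
    have u': "act M g u \<in> RC M" and v': "act N g' v \<in> RC N"
      using RC_closed(2)[OF M pure(1) g(1)] RC_closed(2)[OF N pure(2) g'(1)] by auto
    have "F (O.inner r s (opure u v)) = f (act M g u) (act N g' v)"
      using pure u' v' by (simp add: O.inner(3) KLR.cls_closed g g' Res_smult M N F(3))
    also have "\<dots> = vact p (\<beta> + \<gamma>) C (emb_l \<gamma> g) (vact p (\<beta> + \<gamma>) C (emb_r \<beta> g') (f u v))"
      by (simp add: balanced_emb[OF C f] pure g g' v')
    also have "\<dots> = vact p (\<beta> + \<gamma>) C (emb_l \<gamma> g * e) (vact p (\<beta> + \<gamma>) C (emb_r \<beta> g' * e) (f u v))"
    proof -
      note c = fc[OF pure] fc[OF pure]
      have "vact p (\<beta> + \<gamma>) C (emb_r \<beta> g' * e) (f u v) = f u (act N g' v)"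
        by (simp add: VV.act_hom(4)[OF C c] balanced_e[OF C f] balanced_emb[OF C f] pure g')
      moreover have "vact p (\<beta> + \<gamma>) C (emb_l \<gamma> g * e) (f u (act N g' v)) =
          vact p (\<beta> + \<gamma>) C (emb_l \<gamma> g) (f u (act N g' v))"
        by (simp add: VV.act_hom(4)[OF C fc[OF pure(1) v'] fc[OF pure(1) v']] balanced_e[OF C f] pure v')
      ultimately show ?thesis by (simp add: balanced_emb[OF C f] pure g')
    qed
    also have "\<dots> = (emb1 p lam \<beta> \<gamma> r \<otimes>\<^bsub>W\<^esub> emb2 p lam \<beta> \<gamma> s) \<odot>\<^bsub>C\<^esub> F (opure u v)"
      using pure fc by (simp add: g g' emb1_eq emb2_eq VV.act_def F(3) C.smult_assoc VV.cls_closed)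
    finally show ?case .
  next
    case (add x y)
    then show ?case using r s
      by (simp add: O.inner F C.smult_r_distr emb_closed')
  qed
  have sm: "a \<odot>\<^bsub>C\<^esub> F (z \<odot>\<^bsub>RO\<^esub> t) = (z \<odot>\<^bsub>IB\<^esub> a) \<odot>\<^bsub>C\<^esub> F t"
    if "z \<in> carrier K2" "a \<in> carrier W" "t \<in> carrier O.T0" for z a t
    using that
  proof (induction z rule: KLR2g_induct)
    case zero
    have "\<zero>\<^bsub>K2\<^esub> \<odot>\<^bsub>RO\<^esub> t = \<zero>\<^bsub>O.T0\<^esub>"
      using O.outer_smult(2)[OF zero(2) K2.zero_closed K2.zero_closed] O.outer_smult(1)[OF zero(2) K2.zero_closed]
      by (simp add: res_outer_def)
    moreover have "\<zero>\<^bsub>W\<^esub> \<odot>\<^bsub>C\<^esub> F t = \<zero>\<^bsub>C\<^esub>"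
      using C.smult_l_distr[OF W.zero_closed W.zero_closed F(1)[OF zero(2)]]
        C.smult_closed[OF W.zero_closed F(1)[OF zero(2)]] by simp
    moreover have "a \<odot>\<^bsub>C\<^esub> \<zero>\<^bsub>C\<^esub> = \<zero>\<^bsub>C\<^esub>"
      using C.smult_r_distr[OF zero(1) C.M.zero_closed C.M.zero_closed] C.smult_closed[OF zero(1) C.M.zero_closed] by simp
    ultimately show ?case using zero by (simp add: IB_smult_zero F_zero)
  next
    case (pure r s)
    then show ?case
      by (simp add: res_outer_def O.outer_smult inner IB_smult C.smult_assoc F emb_closed')
  next
    case (add x y)
    then show ?case
      using O.outer_smult(2)[of t x y] O.outer_smult(1)[of t]
      by (simp add: res_outer_def F C.smult_r_distr IB_smult C.smult_l_distr)
  qed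
  \<comment> \<open>Extension of scalars; its balance over the tensor product of the KLR algebras is
    the linearity of \<open>F\<close> recorded in \<open>sm\<close>.\<close>
  define H where "H = tlift C (\<lambda>a t. a \<odot>\<^bsub>C\<^esub> F t)"
  have sub: "a \<in> carrier W" if "a \<in> carrier IB" for a using that by (simp add: IB_carrier)
  have Hc: "a \<odot>\<^bsub>C\<^esub> F t \<in> carrier C" if "a \<in> carrier IB" "t \<in> carrier O.T0" for a t
    using that by (simp add: C.smult_closed F sub)
  have Hl: "(a \<oplus>\<^bsub>W\<^esub> a') \<odot>\<^bsub>C\<^esub> F t = a \<odot>\<^bsub>C\<^esub> F t \<oplus>\<^bsub>C\<^esub> a' \<odot>\<^bsub>C\<^esub> F t"
    if "a \<in> carrier IB" "a' \<in> carrier IB" "t \<in> carrier O.T0" for a a' t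
    using that by (simp add: C.smult_l_distr F sub)
  have Hr: "a \<odot>\<^bsub>C\<^esub> F (t \<oplus>\<^bsub>O.T0\<^esub> t') = a \<odot>\<^bsub>C\<^esub> F t \<oplus>\<^bsub>C\<^esub> a \<odot>\<^bsub>C\<^esub> F t'"
    if "a \<in> carrier IB" "t \<in> carrier O.T0" "t' \<in> carrier O.T0" for a t t'
    using that by (simp add: C.smult_r_distr F sub)
  have Hb: "(z \<odot>\<^bsub>IB\<^esub> a) \<odot>\<^bsub>C\<^esub> F t = a \<odot>\<^bsub>C\<^esub> F (z \<odot>\<^bsub>RO\<^esub> t)"
    if "z \<in> SS" "a \<in> carrier IB" "t \<in> carrier O.T0" for z a t
    using that sm[of z a t] by (simp add: carrier_KLR2 sub)
  note lift = TC.tlift[where f="\<lambda>a t. a \<odot>\<^bsub>C\<^esub> F t", OF C.abelian_group_axioms,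
      unfolded RO_carrier IB_sel(1,2), folded H_def conv_tensor_def]
  have H: "x \<in> carrier CT \<Longrightarrow> H x \<in> carrier C"
    "\<lbrakk>x \<in> carrier CT; y \<in> carrier CT\<rbrakk> \<Longrightarrow> H (x \<oplus>\<^bsub>CT\<^esub> y) = H x \<oplus>\<^bsub>C\<^esub> H y"
    "\<lbrakk>a \<in> carrier IB; t \<in> carrier O.T0\<rbrakk> \<Longrightarrow> H (cten a t) = a \<odot>\<^bsub>C\<^esub> F t" for x y a t
    subgoal by (rule lift(1)) (simp_all add: Hc Hl Hr Hb)
    subgoal by (rule lift(2)) (simp_all add: Hc Hl Hr Hb)
    subgoal by (rule lift(3)) (simp_all add: Hc Hl Hr Hb)
    done
  have HW: "H (w \<odot>\<^bsub>M \<bullet> N\<^esub> x) = w \<odot>\<^bsub>C\<^esub> H x" if w: "w \<in> carrier W" and "x \<in> carrier CT" for w x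
    using that(2)
  proof (induction x rule: CT_induct)
    case zero
    have "H \<zero>\<^bsub>CT\<^esub> = \<zero>\<^bsub>C\<^esub>"
      using H(2)[OF CT.zero_closed CT.zero_closed] H(1)[OF CT.zero_closed] by simp
    moreover have "w \<odot>\<^bsub>C\<^esub> \<zero>\<^bsub>C\<^esub> = \<zero>\<^bsub>C\<^esub>"
      using C.smult_r_distr[OF w C.M.zero_closed C.M.zero_closed] C.smult_closed[OF w C.M.zero_closed] by simp
    ultimately show ?case using w by (simp add: conv_smult_zero)
  next
    case (pure a t)
    then show ?case using w by (simp add: conv_smult H(3) W_IB C.smult_assoc F sub)
  next
    case (add x y)
    then show ?case using w by (simp add: conv_smult H(1,2) C.smult_r_distr)
  qed
  let ?h = "restrict H (carrier (M \<bullet> N))"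
  have "?h \<in> mod_hom W (M \<bullet> N) C"
    unfolding mod_hom_def by (auto simp: conv_sel(1,2) conv_smult H(1,2) HW)
  moreover have "?h (cp u v) = f u v" if "u \<in> RC M" "v \<in> RC N" for u v
  proof -
    have "?h (cp u v) = wcl e \<odot>\<^bsub>C\<^esub> f u v"
      using that cp_closed[OF that] H(3)[OF e_IB O.opure_closed[OF that]] by (simp add: conv_pure_eq F(3))
    then show ?thesis using balanced_e[OF C f that] by (simp add: VV.act_def)
  qed
  ultimately show ?thesis by (intro bexI[of _ ?h]) auto
qed

lemma conv_extend_props:
  fixes C :: "('k, 'c) vv_mod"
  assumes C: "left_module W C" and f: "balanced C f"
  shows "conv_extend p lam M N C f \<in> mod_hom W (M \<bullet> N) C"
    and "\<lbrakk>u \<in> RC M; v \<in> RC N\<rbrakk> \<Longrightarrow> conv_extend p lam M N C f (cp u v) = f u v"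
proof -
  let ?P = "\<lambda>h. h \<in> mod_hom W (M \<bullet> N) C \<and> h \<in> extensional (carrier (M \<bullet> N)) \<and>
    (\<forall>u\<in>RC M. \<forall>v\<in>RC N. h (cp u v) = f u v)"
  obtain h where h: "?P h" using conv_universal[OF C f] by blast
  have "?P (THE h. ?P h)"
  proof (rule theI[of ?P, OF h])
    fix g assume g: "?P g"
    show "g = h"
    proof (rule extensionalityI)
      fix x assume "x \<in> carrier (M \<bullet> N)"
      then show "g x = h x" by (rule hom_eqI[OF C, rotated -1]) (use g h in auto)
    qed (use g h in auto)
  qed
  then show "conv_extend p lam M N C f \<in> mod_hom W (M \<bullet> N) C"
    "\<lbrakk>u \<in> RC M; v \<in> RC N\<rbrakk> \<Longrightarrow> conv_extend p lam M N C f (cp u v) = f u v"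
    by (simp_all add: conv_extend_def)
qed

end

section \<open>The corner at the positive sequences\<close>

text \<open>Read from the right: \<open>gp\<close> inverts the entry at position 0, and the
  \<open>gs\<close> carry it to position \<open>j\<close> past entries that each move one place to
  the left. \<open>dl\<close> is the effect on sequences.\<close>

fun Df :: "nat \<Rightarrow> 'k::field falg" where
  "Df 0 = gp"
| "Df (Suc j) = gs j * Df j"

fun dl :: "nat \<Rightarrow> 'k::field list \<Rightarrow> 'k list" where
  "dl 0 i = i[0 := inverse (i ! 0)]"
| "dl (Suc j) i = permute_list (swap j) (dl j i)"

lemma length_dl [simp]: "length (dl j i) = length i"
  by (induction j) auto

lemma nth_dl:
  "\<lbrakk>j < length i; t < length i\<rbrakk> \<Longrightarrow>
    dl j i ! t = (if t < j then i ! Suc t else if t = j then inverse (i ! 0) else i ! t)"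
proof (induction j arbitrary: t)
  case 0
  then show ?case by (auto simp: nth_list_update)
next
  case (Suc j)
  have "swap j t < length i" using Suc.prems by (auto simp: transpose_def)
  then have "dl (Suc j) i ! t = dl j i ! (swap j t)"
    using Suc.prems by (simp add: permute_list_def)
  then show ?case using Suc.prems Suc.IH[of "swap j t"] \<open>swap j t < length i\<close>
    by (auto simp: transpose_def split: if_splits)
qed

declare dl.simps(2) [simp del]

lemma mult_ext: "(a::'r::semigroup_mult) * b = c \<Longrightarrow> a * (b * z) = c * z"
  by (simp flip: mult.assoc)

section \<open>Relations between entries of opposite sign\<close>

locale vv_signed = vv_setup p lam + vv_ring p \<nu> for p lam :: "'k::field" and \<nu> +
  assumes \<nu>: "\<nu> \<in> thetaNI p lam"
begin

abbreviation "m \<equiv> rank \<nu>"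
abbreviation "D j \<equiv> q (Df j)"
abbreviation "sg i t \<equiv> i ! t \<in> Ipos p lam"

lemma Ipos_shift: "p\<^sup>2 * x \<in> Ipos p lam \<longleftrightarrow> x \<in> Ipos p lam"
proof -
  have 1: "p\<^sup>2 * x \<in> Ipos p lam" if x: "x \<in> Ipos p lam" for x
  proof -
    obtain n where "x = p powi (2 * n) * lam" using x by (auto simp: Ipos_def)
    then have "p\<^sup>2 * x = p powi (2 * (n + 1)) * lam"
      using p0 by (simp add: power_int_add distrib_left)
    then show ?thesis unfolding Ipos_def by blast
  qed
  have 2: "x \<in> Ipos p lam" if x: "p\<^sup>2 * x \<in> Ipos p lam" for x
  proof -
    obtain n where "p\<^sup>2 * x = p powi (2 * n) * lam" using x by (auto simp: Ipos_def)
    moreover have "p powi (2 * n) = p\<^sup>2 * p powi (2 * (n - 1))"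
      using p0 power_int_add[of p 2 "2 * (n - 1)"] by simp
    ultimately have "p\<^sup>2 * x = p\<^sup>2 * (p powi (2 * (n - 1)) * lam)"
      by (simp add: mult.assoc)
    then have "x = p powi (2 * (n - 1)) * lam" using p0 by simp
    then show ?thesis unfolding Ipos_def by blast
  qed
  from 1 2 show ?thesis by blast
qed

text \<open>An arrow joins vertices that differ by the factor \<open>p^2\<close>, and multiplication
  by this factor neither enters nor leaves I^+.\<close>

lemma arrows_opp: "(x \<in> Ipos p lam) \<noteq> (y \<in> Ipos p lam) \<Longrightarrow> arrows p x y = 0"
  using Ipos_shift by (auto simp: arrows_def)

text \<open>Without arrows between the two vertices the polynomial Q is 1. So a crossing of entries
  of opposite sign is its own inverse, which is what makes straightening possible.\<close>

lemma SS_opp: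
  assumes "Suc k < m" "i \<in> \<theta>" "sg i k \<noteq> sg i (Suc k)"
  shows "S k * (S k * E i) = E i"
proof -
  have "i ! k \<noteq> i ! Suc k" using assms by auto
  then have "Qpol p (i ! k) (i ! Suc k) (gx (Suc k)) (gx k) = (1 :: 'k falg)"
    using arrows_opp[OF assms(3)] arrows_opp[of "i ! Suc k" "i ! k"] assms(3) by (simp add: Qpol_def)
  then show ?thesis using S_S[OF assms(1,2)] by (simp add: q_one mult.assoc)
qed

lemma SX_opp:
  assumes "Suc k < m" "l < m" "i \<in> \<theta>" "sg i k \<noteq> sg i (Suc k)"
  shows "X l * (S k * E i) = S k * (X (swap k l) * E i)"
proof -
  have ne: "i ! k \<noteq> i ! Suc k" using assms by auto
  have "swap k l < m" using assms by (auto simp: transpose_def)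
  from S_X[OF assms(1) this assms(3)] show ?thesis
    using ne by (simp add: left_diff_distrib mult.assoc)
qed

text \<open>The defect of the braid relation lives on triples with equal outer entries; opposite
  signs exclude this.\<close>

lemma braid_opp:
  assumes "k + 2 < m" "i \<in> \<theta>" "sg i k \<noteq> sg i (k + 2)"
  shows "S (Suc k) * (S k * (S (Suc k) * E i)) = S k * (S (Suc k) * (S k * E i))"
proof -
  have ne: "i ! k \<noteq> i ! (k + 2)" using assms by auto
  from braid[OF assms(1,2)] show ?thesis
    using ne by (simp add: left_diff_distrib mult.assoc)
qed

lemma dl_theta: "\<lbrakk>i \<in> \<theta>; j < m\<rbrakk> \<Longrightarrow> dl j i \<in> \<theta>"
  by (induction j) (auto simp: dl.simps(2) intro!: theta_seqs_flip theta_seqs_swap)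

lemma D_E: "\<lbrakk>i \<in> \<theta>; j < m\<rbrakk> \<Longrightarrow> D j * E i = E (dl j i) * D j"
proof (induction j)
  case 0
  then show ?case by (simp add: P_E)
next
  case (Suc j)
  have "D (Suc j) * E i = S j * (D j * E i)" by (simp add: qcl_mult mult.assoc)
  also have "\<dots> = S j * E (dl j i) * D j" using Suc by (simp add: mult.assoc)
  also have "\<dots> = E (dl (Suc j) i) * D (Suc j)"
    using Suc.prems dl_theta[of i j] by (simp add: S_E dl.simps(2) qcl_mult mult.assoc)
  finally show ?case .
qed

lemma S_D_gt: "\<lbrakk>j < k; Suc k < m\<rbrakk> \<Longrightarrow> S k * D j = D j * S k"
proof (induction j)
  case 0
  then show ?case using P_S[of k] by simp
next
  case (Suc j)
  have "S k * D (Suc j) = S k * S j * D j" by (simp add: qcl_mult mult.assoc)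
  also have "S k * S j = S j * S k" using Suc.prems by (intro S_S_distant) auto
  also have "S j * S k * D j = S j * (S k * D j)" by (simp add: mult.assoc)
  also have "S k * D j = D j * S k" using Suc by simp
  finally show ?case by (simp add: qcl_mult mult.assoc)
qed

text \<open>\<open>D (Suc j)\<close> ends with a crossing at \<open>j\<close>, so a square of
  crossings appears. Behind \<open>D j\<close> the inverted entry is at \<open>j\<close> and a
  positive one at \<open>Suc j\<close>, where the square is the identity.\<close>

lemma S_D_same:
  assumes "Suc j < m" "i \<in> \<theta>" "sg i 0" "sg i (Suc j)"
  shows "S j * (D (Suc j) * E i) = D j * E i"
proof -
  have len: "length i = m" using assms length_theta_seqs by blast
  have "S j * (D (Suc j) * E i) = S j * (S j * (D j * E i))"
    by (simp add: qcl_mult mult.assoc)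
  also have "\<dots> = S j * (S j * E (dl j i)) * D j"
    using assms by (simp add: D_E mult.assoc)
  also have "S j * (S j * E (dl j i)) = E (dl j i)"
    using assms len pos_inverse[of "i ! 0"]
    by (intro SS_opp dl_theta) (auto simp: nth_dl)
  finally show ?thesis using assms by (simp add: D_E)
qed

text \<open>For \<open>j = k + 2\<close> this is the braid relation: behind \<open>D k\<close> the
  outer entries of the triple at \<open>k\<close> have opposite signs, so there is no defect.
  Further crossings are distant from \<open>k\<close>.\<close>

lemma S_D_lt:
  assumes "Suc k < j" "j < m" "i \<in> \<theta>" "sg i 0" "sg i (k + 2)"
  shows "S k * (D j * E i) = D j * (S (Suc k) * E i)"
  using assms(1,2)
proof (induction j)
  case (Suc j)
  show ?case
  proof (cases "j = Suc k")
    case True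
    have len: "length i = m" using assms length_theta_seqs by blast
    have k: "k + 2 < m" using True Suc.prems by simp
    have b: "S k * (S (Suc k) * (S k * E (dl k i))) = S (Suc k) * (S k * (S (Suc k) * E (dl k i)))"
      by (rule braid_opp[symmetric]) (use assms len k pos_inverse[of "i ! 0"] in \<open>auto simp: nth_dl intro!: dl_theta\<close>)
    have "S k * (D (Suc j) * E i) = S k * (S (Suc k) * (S k * (D k * E i)))"
      by (simp add: True qcl_mult mult.assoc)
    also have "D k * E i = E (dl k i) * D k"
      using assms k by (simp add: D_E)
    also have "S k * (S (Suc k) * (S k * (E (dl k i) * D k))) = S (Suc k) * (S k * (S (Suc k) * E (dl k i))) * D k"
      by (simp add: b[symmetric] mult.assoc)
    also have "\<dots> = S (Suc k) * (S k * (S (Suc k) * (E (dl k i) * D k)))"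
      by (simp add: mult.assoc)
    also have "E (dl k i) * D k = D k * E i"
      using assms k by (simp add: D_E)
    also have "S (Suc k) * (S k * (S (Suc k) * (D k * E i))) = S (Suc k) * (S k * ((S (Suc k) * D k) * E i))"
      by (simp add: mult.assoc)
    also have "S (Suc k) * D k = D k * S (Suc k)"
      by (rule S_D_gt) (use k in auto)
    finally show ?thesis by (simp add: True qcl_mult mult.assoc)
  next
    case False
    have "S k * (D (Suc j) * E i) = S k * S j * (D j * E i)" by (simp add: qcl_mult mult.assoc)
    also have "S k * S j = S j * S k" using False Suc.prems by (intro S_S_distant) auto
    also have "S j * S k * (D j * E i) = S j * (S k * (D j * E i))" by (simp add: mult.assoc)
    also have "S k * (D j * E i) = D j * (S (Suc k) * E i)" using False Suc by simp
    finally show ?thesis by (simp add: qcl_mult mult.assoc)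
  qed
qed simp

text \<open>The base case is the relation between \<open>(sigma_0 pi)^2\<close> and
  \<open>(pi sigma_0)^2\<close>. The step is a braid relation on a triple with outer entries of
  opposite sign.\<close>

lemma S_D_D:
  assumes "Suc k < m" "i \<in> \<theta>" "\<And>t. t \<le> Suc k \<Longrightarrow> sg i t"
  shows "S k * (D k * (D (Suc k) * E i)) = D k * (D (Suc k) * (S 0 * E i))"
  using assms
proof (induction k)
  case 0
  have "S 0 * (D 0 * (D 1 * E i)) = (S 0 * P * S 0 * P) * E i" by (simp add: qcl_mult mult.assoc)
  also have "S 0 * P * S 0 * P = P * S 0 * P * S 0" using 0 by (intro SP_SP) auto
  finally show ?case by (simp add: qcl_mult mult.assoc)
next
  case (Suc k)
  let ?j = "dl k (dl (Suc k) i)"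
  have len: "length i = m" using Suc.prems length_theta_seqs by blast
  have j: "?j \<in> \<theta>" using Suc.prems by (intro dl_theta) auto
  have comm: "S (Suc k) * D k = D k * S (Suc k)" by (rule S_D_gt) (use Suc.prems in auto)
  have mv: "D k * (D (Suc k) * E i) = E ?j * (D k * D (Suc k))"
  proof -
    have "D k * (D (Suc k) * E i) = (D k * E (dl (Suc k) i)) * D (Suc k)"
      using D_E[of i "Suc k"] Suc.prems by (simp only: mult.assoc)
    also have "D k * E (dl (Suc k) i) = E ?j * D k"
      by (rule D_E) (use Suc.prems in \<open>auto intro!: dl_theta\<close>)
    finally show ?thesis by (simp only: mult.assoc)
  qed
  have b: "S (Suc k) * (S k * (S (Suc k) * E ?j)) = S k * (S (Suc k) * (S k * E ?j))"
    by (rule braid_opp[OF _ j]) (use Suc.prems len pos_inverse[of "i ! 1"] pos_inverse[of "i ! Suc 0"] in \<open>auto simp: nth_dl\<close>)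
  have "S (Suc k) * (D (Suc k) * (D (Suc (Suc k)) * E i)) =
      S (Suc k) * (S k * ((D k * S (Suc k)) * (D (Suc k) * E i)))"
    by (simp add: qcl_mult mult.assoc)
  also have "\<dots> = S (Suc k) * (S k * (S (Suc k) * (D k * (D (Suc k) * E i))))"
    by (simp only: comm[symmetric] mult.assoc)
  also have "\<dots> = S (Suc k) * (S k * (S (Suc k) * E ?j)) * (D k * D (Suc k))"
    by (simp only: mv mult.assoc)
  also have "\<dots> = S k * (S (Suc k) * (S k * (D k * (D (Suc k) * E i))))"
    by (simp only: b mv mult.assoc)
  also have "S k * (D k * (D (Suc k) * E i)) = D k * (D (Suc k) * (S 0 * E i))"
    using Suc by simp
  also have "S k * (S (Suc k) * (D k * (D (Suc k) * (S 0 * E i)))) =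
      S k * ((S (Suc k) * D k) * (D (Suc k) * (S 0 * E i)))" by (simp add: mult.assoc)
  also have "\<dots> = D (Suc k) * (D (Suc (Suc k)) * (S 0 * E i))"
    by (simp add: comm qcl_mult mult.assoc)
  finally show ?case .
qed

text \<open>The inverted entry crosses positive entries only, so no correction terms arise. The sign
  is the one in the exchange of pi with \<open>X 0\<close>.\<close>

lemma X_D:
  assumes "i \<in> \<theta>" "j < m" "l < m" "\<And>t. t \<le> j \<Longrightarrow> sg i t"
  shows "X l * (D j * E i) = (if l = j then - (D j * (X 0 * E i)) else if l < j then D j * (X (Suc l) * E i) else D j * (X l * E i))"
  using assms(2-4)
proof (induction j arbitrary: l)
  case 0
  then show ?case using mult_ext[OF P_X0, of "E i"] mult_ext[OF P_X[of l], of "E i"]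
    by (auto simp: mult.assoc)
next
  case (Suc j)
  have len: "length i = m" using assms length_theta_seqs by blast
  have sw: "swap j l < m" using Suc.prems by (auto simp: transpose_def)
  have "X l * (D (Suc j) * E i) = X l * (S j * (E (dl j i) * D j))"
    using Suc.prems assms(1) by (simp add: D_E[symmetric] qcl_mult mult.assoc)
  also have "\<dots> = X l * (S j * E (dl j i)) * D j" by (simp add: mult.assoc)
  also have "X l * (S j * E (dl j i)) = S j * (X (swap j l) * E (dl j i))"
    by (rule SX_opp) (use Suc.prems assms(1) len pos_inverse[of "i ! 0"] in \<open>auto simp: nth_dl intro!: dl_theta\<close>)
  also have "S j * (X (swap j l) * E (dl j i)) * D j = S j * (X (swap j l) * (D j * E i))"
    using Suc.prems assms(1) by (simp add: D_E mult.assoc)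
  also have "X (swap j l) * (D j * E i) = (if swap j l = j then - (D j * (X 0 * E i)) else if swap j l < j then D j * (X (Suc (swap j l)) * E i) else D j * (X (swap j l) * E i))"
    by (rule Suc.IH) (use Suc.prems sw in auto)
  finally show ?case
    by (auto simp: transpose_def qcl_mult mult.assoc)
qed

section \<open>Straightening of products with coset representatives\<close>

definition Tf :: "nat list \<Rightarrow> 'k falg" where
  "Tf ks = prod_list (map Df ks)"

abbreviation "T ks \<equiv> q (Tf ks)"
abbreviation "dls ks i \<equiv> foldr dl ks i"

lemma T_simps: "T [] = q 1" "T (j # ks) = D j * T ks"
  by (simp_all add: Tf_def qcl_mult)

text \<open>One increasing list for each set of positions. Its \<open>Tf\<close> corresponds to the
  minimal representative of a coset of the symmetric group in the Weyl group of type B, the one that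
  makes exactly these positions negative.\<close>

definition valid :: "nat list \<Rightarrow> bool" where
  "valid ks \<longleftrightarrow> sorted_wrt (<) ks \<and> set ks \<subseteq> {..<m}"

lemma valid_Cons: "valid (j # ks) \<longleftrightarrow> j < m \<and> (\<forall>x\<in>set ks. j < x) \<and> valid ks"
  by (auto simp: valid_def)

lemma length_valid: "\<lbrakk>valid ks; \<forall>x\<in>set ks. a \<le> x\<rbrakk> \<Longrightarrow> length ks \<le> m - a"
proof -
  assume ks: "valid ks" "\<forall>x\<in>set ks. a \<le> x"
  then have "length ks = card (set ks)"
    by (simp add: valid_def strict_sorted_iff distinct_card)
  also have "\<dots> \<le> card {a..<m}"
    using ks by (intro card_mono) (auto simp: valid_def)
  finally show ?thesis by simp
qed

lemma dls_theta: "\<lbrakk>valid ks; i \<in> \<theta>\<rbrakk> \<Longrightarrow> dls ks i \<in> \<theta>"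
  by (induction ks) (auto simp: valid_Cons dl_theta)

lemma T_E: "\<lbrakk>valid ks; i \<in> \<theta>\<rbrakk> \<Longrightarrow> T ks * E i = E (dls ks i) * T ks"
proof (induction ks)
  case Nil
  then show ?case by (simp add: T_simps q_one)
next
  case (Cons j ks)
  then show ?case
    using dls_theta[of ks i] by (simp add: T_simps valid_Cons mult.assoc mult_ext[OF D_E])
qed

definition positive :: "'k list \<Rightarrow> bool" where
  "positive i \<longleftrightarrow> (\<forall>t<m. sg i t)"

text \<open>The largest index acts first. A later \<open>dl j\<close> moves entries at positions up
  to \<open>j\<close> only, which are still positive, and leaves the negative ones in place.\<close>

lemma sg_dls:
  assumes "valid ks" "i \<in> \<theta>" "positive i" "t < m"
  shows "sg (dls ks i) t \<longleftrightarrow> t \<notin> set ks"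
  using assms(1,4)
proof (induction ks arbitrary: t)
  case Nil
  then show ?case using assms(3) by (simp add: positive_def)
next
  case (Cons j ks)
  have len: "length (dls ks i) = m"
    using Cons.prems assms(2) dls_theta[of ks i] length_theta_seqs by (auto simp: valid_Cons)
  have j: "valid ks" "j < m" "\<forall>x\<in>set ks. j < x" using Cons.prems by (auto simp: valid_Cons)
  have z: "sg (dls ks i) 0" using Cons.IH[of 0] j by auto
  have n: "dl j (dls ks i) ! t = (if t < j then dls ks i ! Suc t else if t = j then inverse (dls ks i ! 0) else dls ks i ! t)"
    by (rule nth_dl) (use j Cons.prems len in auto)
  consider "t < j" | "t = j" | "j < t" by linarith
  then show ?case
  proof cases
    case 1
    then have "sg (dls ks i) (Suc t)" using Cons.IH[of "Suc t"] j by auto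
    then show ?thesis using 1 n j by auto
  next
    case 2
    then show ?thesis using n pos_inverse[OF z] by simp
  next
    case 3
    then show ?thesis using n Cons.IH[of t] j Cons.prems by simp
  qed
qed

lemma sg_dls_le:
  assumes "valid (j # ks)" "i \<in> \<theta>" "positive i" "t \<le> j" shows "sg (dls ks i) t"
  using sg_dls[of ks i t] assms by (auto simp: valid_Cons)

text \<open>Each factor \<open>D j\<close> with \<open>j\<close> beyond \<open>Suc k\<close> has
  taken away an entry from the front, so the index of the crossing grows by one as it
  passes.\<close>

lemma S_T_gt:
  assumes "valid ks" "\<forall>x\<in>set ks. Suc k < x" "i \<in> \<theta>" "positive i"
  shows "S k * (T ks * E i) = T ks * (S (k + length ks) * E i)"
  using assms(1,2)
proof (induction ks arbitrary: k)
  case Nil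
  then show ?case by (simp add: T_simps q_one flip: mult.assoc)
next
  case (Cons j ks)
  let ?i = "dls ks i"
  have v: "valid ks" "Suc k < j" "j < m" and i: "?i \<in> \<theta>"
    using Cons.prems assms(3) dls_theta[of ks i] by (auto simp: valid_Cons)
  have "S k * (T (j # ks) * E i) = S k * (D j * E ?i) * T ks"
    using T_E[OF v(1) assms(3)] by (simp add: T_simps mult.assoc)
  also have "S k * (D j * E ?i) = D j * (S (Suc k) * E ?i)"
    by (rule S_D_lt[OF v(2,3) i]) (use sg_dls_le[OF Cons.prems(1) assms(3,4)] v in auto)
  also have "D j * (S (Suc k) * E ?i) * T ks = D j * (S (Suc k) * (T ks * E i))"
    using T_E[OF v(1) assms(3)] by (simp add: mult.assoc)
  also have "S (Suc k) * (T ks * E i) = T ks * (S (Suc k + length ks) * E i)"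
    by (rule Cons.IH[OF v(1)]) (use Cons.prems v in \<open>auto simp: valid_Cons\<close>)
  finally show ?case by (simp add: T_simps mult.assoc)
qed

text \<open>Every generator maps \<open>T\<^sub>k e R\<close> into some \<open>T\<^sub>l e R\<close>.\<close>

lemma S_T:
  assumes "valid ks" "Suc k < m"
  shows "\<exists>ls f. valid ls \<and> (\<forall>b. (\<forall>x\<in>set ks. b \<le> x) \<longrightarrow> b \<le> k \<longrightarrow> (\<forall>x\<in>set ls. b \<le> x)) \<and>
    f \<in> insert 1 {gs t | t. Suc t < m} \<and>
    (\<forall>i\<in>\<theta>. positive i \<longrightarrow> S k * (T ks * E i) = T ls * (q f * E i))"
  using assms(1)
proof (induction ks)
  case Nil
  have "S k * (T [] * E i) = T [] * (q (gs k) * E i)" for i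
    by (simp add: T_simps q_one flip: mult.assoc)
  then show ?case using assms(2) by (intro exI[of _ "[]"] exI[of _ "gs k"]) (auto simp: valid_def)
next
  case (Cons j ks)
  have v: "valid ks" "j < m" "\<forall>x\<in>set ks. j < x" using Cons.prems by (auto simp: valid_Cons)
  have pull: "T (j # ks) * E i = D j * E (dls ks i) * T ks" if "i \<in> \<theta>" for i
    using T_E[OF v(1) that] by (simp add: T_simps mult.assoc)
  have push: "E (dls ks i) * T ks = T ks * E i" if "i \<in> \<theta>" for i
    using T_E[OF v(1) that] by simp
  have th: "dls ks i \<in> \<theta>" if "i \<in> \<theta>" for i using that v dls_theta by auto
  have one: "q 1 * E i = E i" for i by (simp add: q_one)
  \<comment> \<open>The signs at \<open>k\<close> and \<open>Suc k\<close> decide. If they agree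
    (cases 2 and 4), the crossing comes out on the right as another crossing; if they differ (cases
    3 and 5), it is absorbed and moves one index of the list. Case 1 passes it on to the
    tail.\<close>
  consider "j < k" | "Suc k < j" | "j = Suc k" | "j = k" "ks \<noteq> []" "hd ks = Suc k"
    | "j = k" "\<not> (ks \<noteq> [] \<and> hd ks = Suc k)" by linarith
  then show ?case
  proof cases
    case 1
    obtain ls f where ls: "valid ls" "\<And>b. \<lbrakk>\<forall>x\<in>set ks. b \<le> x; b \<le> k\<rbrakk> \<Longrightarrow> \<forall>x\<in>set ls. b \<le> x"
      "f \<in> insert 1 {gs t | t. Suc t < m}"
      "\<And>i. \<lbrakk>i \<in> \<theta>; positive i\<rbrakk> \<Longrightarrow> S k * (T ks * E i) = T ls * (q f * E i)"
      using Cons.IH[OF v(1)] by blast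
    \<comment> \<open>Here the clause on lower bounds pays off: the tail has no index below
      \<open>Suc j\<close>, and \<open>k\<close> is not below it either, so the new tail stays above
      \<open>j\<close>.\<close>
    have gt: "\<forall>x\<in>set ls. j < x" using ls(2)[of "Suc j"] v(3) 1 by (auto simp: Suc_le_eq)
    have eq: "S k * (T (j # ks) * E i) = T (j # ls) * (q f * E i)" if "i \<in> \<theta>" "positive i" for i
    proof -
      have "S k * (T (j # ks) * E i) = (S k * D j) * (T ks * E i)"
        by (simp add: T_simps mult.assoc)
      also have "\<dots> = D j * (S k * (T ks * E i))"
        using S_D_gt[OF 1 assms(2)] by (simp add: mult.assoc)
      finally show ?thesis using ls(4)[OF that] by (simp add: T_simps mult.assoc)
    qed
    show ?thesis
    proof (intro exI[of _ "j # ls"] exI[of _ "f"] conjI)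
      show "valid (j # ls)" using gt ls(1) v by (simp add: valid_Cons)
      show "\<forall>b. (\<forall>x\<in>set (j # ks). b \<le> x) \<longrightarrow> b \<le> k \<longrightarrow> (\<forall>x\<in>set (j # ls). b \<le> x)"
      proof (intro allI impI)
        fix b assume "\<forall>x\<in>set (j # ks). b \<le> x" "b \<le> k"
        then show "\<forall>x\<in>set (j # ls). b \<le> x" using ls(2)[of b] by simp
      qed
      show "f \<in> insert 1 {gs t | t. Suc t < m}" by (rule ls(3))
      show "\<forall>i\<in>\<theta>. positive i \<longrightarrow> S k * (T (j # ks) * E i) = T (j # ls) * (q (f) * E i)" using eq by blast
    qed
  next
    case 2
    have gt: "\<forall>x\<in>set (j # ks). Suc k < x" using 2 v by auto
    \<comment> \<open>At most \<open>m - (k + 2)\<close> indices fit above \<open>Suc k\<close>, so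
      the shifted crossing exists.\<close>
    have lt: "Suc (k + length (j # ks)) < m"
      using length_valid[OF Cons.prems, of "k + 2"] gt 2 v(2) by (simp add: Suc_le_eq)
    show ?thesis
    proof (intro exI[of _ "j # ks"] exI[of _ "gs (k + length (j # ks))"] conjI)
      show "valid (j # ks)" by (rule Cons.prems)
      show "\<forall>b. (\<forall>x\<in>set (j # ks). b \<le> x) \<longrightarrow> b \<le> k \<longrightarrow> (\<forall>x\<in>set (j # ks). b \<le> x)" by simp
      show "gs (k + length (j # ks)) \<in> insert 1 {gs t | t. Suc t < m}" using lt by blast
      show "\<forall>i\<in>\<theta>. positive i \<longrightarrow> S k * (T (j # ks) * E i) = T (j # ks) * (q (gs (k + length (j # ks))) * E i)" using S_T_gt[OF Cons.prems gt] by blast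
    qed
  next
    case 3
    have eq: "S k * (T (j # ks) * E i) = T (k # ks) * (q 1 * E i)" if i: "i \<in> \<theta>" "positive i" for i
    proof -
      have "S k * (T (j # ks) * E i) = S k * (D j * E (dls ks i)) * T ks"
        by (simp only: pull[OF i(1)] mult.assoc)
      also have "S k * (D j * E (dls ks i)) = D k * E (dls ks i)"
        unfolding 3 by (rule S_D_same[OF assms(2) th[OF i(1)]]) (use sg_dls_le[OF Cons.prems i] 3 in auto)
      also have "D k * E (dls ks i) * T ks = T (k # ks) * (q 1 * E i)"
        by (simp only: mult.assoc push[OF i(1)] T_simps one)
      finally show ?thesis .
    qed
    show ?thesis
    proof (intro exI[of _ "k # ks"] exI[of _ "1"] conjI)
      show "valid (k # ks)" using 3 v assms(2) by (auto simp: valid_Cons)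
      show "\<forall>b. (\<forall>x\<in>set (j # ks). b \<le> x) \<longrightarrow> b \<le> k \<longrightarrow> (\<forall>x\<in>set (k # ks). b \<le> x)" by simp
      show "1 \<in> insert 1 {gs t | t. Suc t < m}" by simp
      show "\<forall>i\<in>\<theta>. positive i \<longrightarrow> S k * (T (j # ks) * E i) = T (k # ks) * (q (1) * E i)" using eq by blast
    qed
  next
    case 4
    then obtain ls where ks: "ks = Suc k # ls" by (cases ks) auto
    have vl: "valid ls" "\<forall>x\<in>set ls. Suc k < x" using v ks by (auto simp: valid_Cons)
    have eq: "S k * (T (j # ks) * E i) = T (j # ks) * (q (gs (length ls)) * E i)" if i: "i \<in> \<theta>" "positive i" for i
    proof -
      have push': "E (dls ls i) * T ls = T ls * E i" using T_E[OF vl(1) i(1)] by simp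
      have "S k * (T (j # ks) * E i) = S k * (D k * (D (Suc k) * E (dls ls i))) * T ls"
        by (simp only: 4 ks T_simps mult.assoc push')
      also have "S k * (D k * (D (Suc k) * E (dls ls i))) = D k * (D (Suc k) * (S 0 * E (dls ls i)))"
        by (rule S_D_D[OF assms(2) dls_theta[OF vl(1) i(1)]])
          (use sg_dls_le[of "Suc k" ls i] v ks i in auto)
      also have "D k * (D (Suc k) * (S 0 * E (dls ls i))) * T ls = D k * (D (Suc k) * (S 0 * (T ls * E i)))"
        by (simp only: mult.assoc push')
      also have "S 0 * (T ls * E i) = T ls * (S (0 + length ls) * E i)"
        by (rule S_T_gt[OF vl(1) _ i]) (use vl in auto)
      finally show ?thesis by (simp add: 4 ks T_simps mult.assoc)
    qed
    have lt: "Suc (length ls) < m"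
      using length_valid[OF Cons.prems, of 0] ks by simp
    show ?thesis
    proof (intro exI[of _ "j # ks"] exI[of _ "gs (length ls)"] conjI)
      show "valid (j # ks)" by (rule Cons.prems)
      show "\<forall>b. (\<forall>x\<in>set (j # ks). b \<le> x) \<longrightarrow> b \<le> k \<longrightarrow> (\<forall>x\<in>set (j # ks). b \<le> x)" by simp
      show "gs (length ls) \<in> insert 1 {gs t | t. Suc t < m}" using lt by blast
      show "\<forall>i\<in>\<theta>. positive i \<longrightarrow> S k * (T (j # ks) * E i) = T (j # ks) * (q (gs (length ls)) * E i)" using eq by blast
    qed
  next
    case 5
    have eq: "S k * (T (j # ks) * E i) = T (Suc k # ks) * (q 1 * E i)" for i
      by (simp only: T_simps 5 one Df.simps qcl_mult mult.assoc)
    have gt: "\<forall>x\<in>set ks. Suc k < x"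
    proof (cases ks)
      case (Cons l ls)
      then have "Suc k < l" using 5 v by auto
      then show ?thesis using v Cons by (auto simp: valid_Cons)
    qed simp
    show ?thesis
    proof (intro exI[of _ "Suc k # ks"] exI[of _ "1"] conjI)
      show "valid (Suc k # ks)" using gt v assms(2) by (simp add: valid_Cons)
      show "\<forall>b. (\<forall>x\<in>set (j # ks). b \<le> x) \<longrightarrow> b \<le> k \<longrightarrow> (\<forall>x\<in>set (Suc k # ks). b \<le> x)" using 5 by auto
      show "1 \<in> insert 1 {gs t | t. Suc t < m}" by simp
      show "\<forall>i\<in>\<theta>. positive i \<longrightarrow> S k * (T (j # ks) * E i) = T (Suc k # ks) * (q (1) * E i)" using eq by blast
    qed
  qed
qed

text \<open>Passing \<open>D j\<close> shifts the index or, for the entry that \<open>D j\<close>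
  inverts, sends it to 0 with a sign. So plus or minus another polynomial generator comes
  out.\<close>

lemma X_T:
  assumes "valid ks" "l < m"
  shows "\<exists>f \<in> {gx t | t. t < m} \<union> {- gx t | t. t < m}.
    \<forall>i\<in>\<theta>. positive i \<longrightarrow> X l * (T ks * E i) = T ks * (q f * E i)"
  using assms
proof (induction ks arbitrary: l)
  case Nil
  have "X l * (T [] * E i) = T [] * (q (gx l) * E i)" for i
    by (simp add: T_simps q_one flip: mult.assoc)
  then show ?case using Nil by (intro bexI[of _ "gx l"]) auto
next
  case (Cons j ks)
  have v: "valid ks" "j < m" "\<forall>x\<in>set ks. j < x" using Cons.prems by (auto simp: valid_Cons)
  let ?l = "if l = j then 0 else if l < j then Suc l else l"
  have "?l < m" using v Cons.prems by auto
  from Cons.IH[OF v(1) this] obtain f where f: "f \<in> {gx t | t. t < m} \<union> {- gx t | t. t < m}"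
    "\<And>i. \<lbrakk>i \<in> \<theta>; positive i\<rbrakk> \<Longrightarrow> X ?l * (T ks * E i) = T ks * (q f * E i)" by blast
  have "X l * (T (j # ks) * E i) = T (j # ks) * (q (if l = j then - f else f) * E i)" if i: "i \<in> \<theta>" "positive i" for i
  proof -
    have push: "E (dls ks i) * T ks = T ks * E i" using T_E[OF v(1) i(1)] by simp
    have "X l * (T (j # ks) * E i) = X l * (D j * E (dls ks i)) * T ks"
      by (simp only: T_simps mult.assoc push)
    also have "X l * (D j * E (dls ks i)) = (if l = j then - (D j * (X ?l * E (dls ks i))) else D j * (X ?l * E (dls ks i)))"
      using X_D[OF dls_theta[OF v(1) i(1)] v(2) Cons.prems(2)] sg_dls_le[OF Cons.prems(1) i] by simp
    also have "\<dots> * T ks = (if l = j then - (D j * (X ?l * (T ks * E i))) else D j * (X ?l * (T ks * E i)))"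
      by (simp add: mult.assoc push)
    finally show ?thesis unfolding f(2)[OF i] by (simp add: T_simps mult.assoc qcl_uminus)
  qed
  moreover have "(if l = j then - f else f) \<in> {gx t | t. t < m} \<union> {- gx t | t. t < m}"
    using f(1) by auto
  ultimately show ?case by (intro bexI[of _ "if l = j then - f else f"]) auto
qed

section \<open>The left ideal at the positive sequences and its corner\<close>

lemma ps_positive: "i \<in> ps \<nu> \<Longrightarrow> i \<in> \<theta> \<and> positive i"
  using ps_theta[OF \<nu>] length_ps[OF \<nu>] ps_Ipos by (auto simp: positive_def)

lemma KF_gens: "t < m \<Longrightarrow> gx t \<in> KF (pos \<nu>)" "Suc t < m \<Longrightarrow> gs t \<in> KF (pos \<nu>)"
  "i \<in> ps \<nu> \<Longrightarrow> ge i \<in> KF (pos \<nu>)"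
  by (auto simp: KLR_gens_eq[OF \<nu>] klr_gens_def intro!: free_alg_intros)

lemma gen_T:
  assumes g: "g \<in> VV_gens \<nu>" and v: "valid ks"
  shows "\<exists>ls f. valid ls \<and> f \<in> KF (pos \<nu>) \<and>
    (\<forall>i\<in>ps \<nu>. q (Poly_Mapping.single [g] 1) * (T ks * E i) = T ls * (q f * E i))"
proof -
  consider l where "g = GX l" "l < m" | k where "g = GS k" "Suc k < m" | j where "g = GE j" "j \<in> \<theta>"
    | "g = GP" "0 < m"
    using g by (auto simp: VV_gens_def klr_gens_def split: if_splits)
  then show ?thesis
  proof cases
    case 1
    from X_T[OF v 1(2)] obtain f where f: "f \<in> {gx t | t. t < m} \<union> {- gx t | t. t < m}"
      "\<forall>i\<in>\<theta>. positive i \<longrightarrow> X l * (T ks * E i) = T ks * (q f * E i)" by blast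
    then have "f \<in> KF (pos \<nu>)" using KF_gens by (auto intro: free_alg_intros)
    then show ?thesis using f(2) v ps_positive 1 by blast
  next
    case 2
    from S_T[OF v 2(2)] obtain ls f where f: "valid ls" "f \<in> insert 1 {gs t | t. Suc t < m}"
      "\<forall>i\<in>\<theta>. positive i \<longrightarrow> S k * (T ks * E i) = T ls * (q f * E i)" by blast
    then have "f \<in> KF (pos \<nu>)" using KF_gens by (auto intro: free_alg_intros)
    then show ?thesis using f ps_positive 2 by blast
  next
    case 3
    \<comment> \<open>In front of \<open>T ks\<close> the idempotent at \<open>j\<close> selects the
      positive sequences that \<open>T ks\<close> carries to \<open>j\<close>; the sum allows for
      there being none.\<close>
    let ?f = "\<Sum>i | i \<in> ps \<nu> \<and> dls ks i = j. ge i :: 'k falg"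
    have "E j * (T ks * E i) = T ks * (q ?f * E i)" if i: "i \<in> ps \<nu>" for i
    proof -
      have it: "i \<in> \<theta>" using ps_positive[OF i] by simp
      have "q ?f * E i = (\<Sum>i' | i' \<in> ps \<nu> \<and> dls ks i' = j. if i' = i then E i else 0)"
        unfolding qcl_sum sum_distrib_right
        by (intro sum.cong refl) (use ps_positive i E_mult in auto)
      also have "\<dots> = (if dls ks i = j then E i else 0)"
        using i by (subst sum.delta) auto
      finally have "q ?f * E i = (if dls ks i = j then E i else 0)" .
      moreover have "E j * (T ks * E i) = (if dls ks i = j then T ks * E i else 0)"
        using E_mult[OF 3(2) dls_theta[OF v it]] T_E[OF v it] by (auto simp flip: mult.assoc)
      ultimately show ?thesis by simp
    qed
    moreover have "?f \<in> KF (pos \<nu>)" by (rule free_alg_closed_sum) (auto intro: KF_gens)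
    ultimately show ?thesis using v 3 by blast
  next
    case 4
    show ?thesis
    \<comment> \<open>Multiplication by pi toggles the index 0 in the list: it cancels a leading
      \<open>D 0\<close>, since pi squares to 1, or else it prepends one.\<close>
    proof (cases "ks \<noteq> [] \<and> hd ks = 0")
      case True
      then obtain ls where ks: "ks = 0 # ls" by (cases ks) auto
      have "P * (T ks * E i) = T ls * (q 1 * E i)" for i
        by (simp add: ks T_simps q_one mult.assoc mult_ext[OF P_P[OF 4(2)]] flip: mult.assoc[of "q 1"])
      then show ?thesis using v ks 4 free_alg_closed(2)
        by (intro exI[of _ ls] exI[of _ 1]) (auto simp: valid_Cons)
    next
      case False
      have "P * (T ks * E i) = T (0 # ks) * (q 1 * E i)" for i
        by (simp add: T_simps q_one mult.assoc)
      moreover have "valid (0 # ks)" using v 4 False by (cases ks) (auto simp: valid_Cons)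
      ultimately show ?thesis using 4 free_alg_closed(2)
        by (intro exI[of _ "0 # ks"] exI[of _ 1]) auto
    qed
  qed
qed

abbreviation "ep \<equiv> e_pos p lam \<nu>"

text \<open>The sum of all T_k e R. Closure under addition suffices as a rule, because scalars and
  signs are absorbed by \<open>f\<close>. It turns out to be the whole left ideal generated by
  \<open>ep\<close>.\<close>

inductive_set spn :: "'k falg qring set" where
  base: "\<lbrakk>valid ks; f \<in> KF (pos \<nu>)\<rbrakk> \<Longrightarrow> T ks * q (f * ep) \<in> spn"
| add: "\<lbrakk>x \<in> spn; y \<in> spn\<rbrakk> \<Longrightarrow> x + y \<in> spn"

lemma gen_spn: "\<lbrakk>x \<in> spn; g \<in> VV_gens \<nu>\<rbrakk> \<Longrightarrow> q (Poly_Mapping.single [g] 1) * x \<in> spn"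
proof (induction rule: spn.induct)
  case (base ks f)
  from gen_T[OF base(3,1)] obtain ls h where h: "valid ls" "h \<in> KF (pos \<nu>)"
    "\<And>i. i \<in> ps \<nu> \<Longrightarrow> q (Poly_Mapping.single [g] 1) * (T ks * E i) = T ls * (q h * E i)" by blast
  have sum: "q (Poly_Mapping.single [g] 1) * (T ks * q ep) = T ls * (q h * q ep)"
    unfolding e_pos_def qcl_sum sum_distrib_left by (intro sum.cong refl h(3))
  \<comment> \<open>\<open>f\<close> is moved behind \<open>ep\<close>, since \<open>gen_T\<close>
    speaks of \<open>T ks\<close> applied directly to the idempotents of the positive
    sequences.\<close>
  have "q (Poly_Mapping.single [g] 1) * (T ks * q (f * ep)) =
      q (Poly_Mapping.single [g] 1) * (T ks * q ep) * q f"
    by (simp only: e_pos_commutes[OF \<nu> base(2), unfolded qcl_mult] qcl_mult mult.assoc)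
  also have "\<dots> = T ls * (q h * (q ep * q f))"
    by (simp only: sum mult.assoc)
  also have "\<dots> = T ls * q ((h * f) * ep)"
    using e_pos_commutes[OF \<nu> base(2)] by (simp only: qcl_mult mult.assoc)
  also have "\<dots> \<in> spn" using h base by (intro spn.base free_alg_intros) auto
  finally show ?case .
next
  case (add x y)
  then show ?case by (simp add: distrib_left spn.add)
qed

lemma spn_all: "f \<in> carrier (free_alg (VV_gens \<nu>)) \<Longrightarrow> q (f * ep) \<in> spn"
proof (induction f rule: free_alg_induct)
  case (scal c)
  have "T [] * q (scal c * ep) \<in> spn" by (rule spn.base) (auto simp: valid_def free_alg_closed)
  then show ?case by (simp add: T_simps q_one)
next
  case (gen g f)
  then show ?case using gen_spn[OF gen(3,1)] by (simp add: qcl_mult mult.assoc)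
next
  case (add f g)
  then show ?case by (simp add: distrib_right qcl_add spn.add)
qed

text \<open>A nonempty list makes some entry negative, and such a sequence is orthogonal to all
  positive ones.\<close>

lemma ep_T: "\<lbrakk>valid ks; ks \<noteq> []\<rbrakk> \<Longrightarrow> q ep * (T ks * q ep) = 0"
proof -
  assume v: "valid ks" "ks \<noteq> []"
  have "E j * (T ks * E i) = 0" if i: "i \<in> ps \<nu>" and j: "j \<in> ps \<nu>" for i j
  proof -
    obtain t where t: "t \<in> set ks" "t < m" using v by (cases ks) (auto simp: valid_def)
    have ip: "i \<in> \<theta>" "positive i" "j \<in> \<theta>" "positive j" using ps_positive i j by auto
    have "\<not> sg (dls ks i) t" using sg_dls[OF v(1) ip(1,2) t(2)] t(1) by simp
    moreover have "sg j t" using ip(4) t(2) by (simp add: positive_def)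
    ultimately have "j \<noteq> dls ks i" by auto
    then show ?thesis
      using E_mult[OF ip(3) dls_theta[OF v(1) ip(1)]] T_E[OF v(1) ip(1)] by (simp flip: mult.assoc)
  qed
  then show ?thesis
    unfolding e_pos_def qcl_sum sum_distrib_left sum_distrib_right by (intro sum.neutral ballI) auto
qed

text \<open>The KLR algebra maps onto the corner: multiplied by \<open>ep\<close> from the left,
  every summand of \<open>spn\<close> with a nonempty list vanishes, and the summands with the empty
  list come from the KLR algebra.\<close>

theorem corner_surj:
  "\<exists>g \<in> KF (pos \<nu>). q (ep * f * ep) = q (g * ep)"
proof -
  have idem: "q ep * q ep = q ep" using e_pos_idem[OF \<nu>] by (simp add: qcl_mult)
  have main: "\<exists>g \<in> KF (pos \<nu>). q ep * x = q (g * ep)" if "x \<in> spn" for x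
    using that
  proof (induction rule: spn.induct)
    case (base ks f)
    show ?case
    proof (cases "ks = []")
      case True
      have "q ep * (T ks * q (f * ep)) = q ep * (q f * q ep)"
        by (simp add: True T_simps q_one qcl_mult flip: mult.assoc[of "q 1"])
      also have "\<dots> = q ep * (q ep * q f)"
        using e_pos_commutes[OF \<nu> base(2)] by (simp only: qcl_mult)
      also have "\<dots> = q (f * ep)"
        using e_pos_commutes[OF \<nu> base(2)] by (simp only: qcl_mult idem flip: mult.assoc)
      finally show ?thesis using base by blast
    next
      case False
      have "q ep * (T ks * q (f * ep)) = q ep * (T ks * q ep) * q f"
        using e_pos_commutes[OF \<nu> base(2)] by (simp only: qcl_mult mult.assoc)
      also have "\<dots> = q (0 * ep)" by (simp add: ep_T[OF base(1) False] qcl_zero)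
      finally show ?thesis using free_alg_closed(1) by blast
    qed
  next
    case (add x y)
    then obtain g h where "g \<in> KF (pos \<nu>)" "h \<in> KF (pos \<nu>)" "q ep * x = q (g * ep)" "q ep * y = q (h * ep)" by blast
    then show ?case
      by (intro bexI[of _ "g + h"]) (auto simp: distrib_left distrib_right qcl_add intro: free_alg_closed)
  qed
  \<comment> \<open>\<open>f\<close> is any element of the type, while \<open>spn_all\<close> speaks
    of words in the generators; \<open>retr\<close> replaces it without changing its class.\<close>
  have "q f = q (retr (VV_gens \<nu>) f)"
    unfolding vq_eq_iff using two_sidedD(1)[OF VV.two_sided_ker[of \<nu> p]]
    by (simp add: VV.ker_def retr_hom retr_id[OF retr_closed])
  then have "q (ep * f * ep) = q ep * q (retr (VV_gens \<nu>) f * ep)"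
    by (simp add: qcl_mult mult.assoc)
  then show ?thesis using main[OF spn_all[OF retr_closed]] by simp
qed

end

section \<open>Carrying a block of entries to the end\<close>

definition cat :: "'a list set \<Rightarrow> 'a list set \<Rightarrow> 'a list set" where
  "cat A B = (\<lambda>(a, b). a @ b) ` (A \<times> B)"

lemma cat_simps [simp]: "cat {[]} B = B" "cat A {[]} = A"
  by (auto simp: cat_def image_iff)

lemma cat_mem: "\<lbrakk>a \<in> A; b \<in> B\<rbrakk> \<Longrightarrow> a @ b \<in> cat A B"
  by (auto simp: cat_def)

lemma sum_cat:
  assumes "\<And>a. a \<in> A \<Longrightarrow> length a = n"
  shows "sum f (cat A B) = (\<Sum>a\<in>A. \<Sum>b\<in>B. f (a @ b))"
proof -
  have "inj_on (\<lambda>(a, b). a @ b) (A \<times> B)"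
    using assms by (auto simp: inj_on_def)
  then have "sum f (cat A B) = (\<Sum>x\<in>A \<times> B. f (fst x @ snd x))"
    unfolding cat_def by (subst sum.reindex) (auto intro!: sum.cong)
  then show ?thesis by (simp add: sum.cartesian_product case_prod_unfold)
qed

definition flips :: "'k::field list \<Rightarrow> 'k list" where
  "flips i = rev (map inverse i)"

lemma inj_flips: "inj_on flips A"
  by (rule inj_onI) (auto simp: flips_def intro: map_injective[OF _ injI])

lemma dl_append: "length as = k \<Longrightarrow> dl k (a # as @ r) = as @ inverse a # r"
  by (rule nth_equalityI) (auto simp: nth_dl nth_append nth_Cons split: nat.splits intro!: arg_cong[where f="(!) r"])

text \<open>The largest index acts first and puts the inverted head of \<open>i\<close> just before
  \<open>r\<close>. The heads taken later are put in front of it, whence the reversal in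
  \<open>flips\<close>.\<close>

lemma dls_flips: "length j = n \<Longrightarrow> foldr dl [n..<n + length i] (i @ j @ r) = j @ flips i @ r"
proof (induction i arbitrary: r)
  case (Cons a i)
  have "dl (n + length i) ((a # i) @ j @ r) = i @ j @ (inverse a # r)"
    using dl_append[of "i @ j" "n + length i" a r] Cons.prems by simp
  then show ?case using Cons by (simp add: flips_def)
qed (simp add: flips_def)

text \<open>The words of \<open>Df\<close> and \<open>Tf\<close> read backwards. At positive
  sequences they are left inverses, since every crossing then meets entries of opposite sign and
  squares to the identity.\<close>

fun Di :: "nat \<Rightarrow> 'k::field falg" where
  "Di 0 = gp"
| "Di (Suc j) = Di j * gs j"

fun Ti :: "nat list \<Rightarrow> 'k::field falg" where
  "Ti [] = 1"
| "Ti (j # ks) = Ti ks * Di j"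

context vv_ring
begin

text \<open>The exchange relation is given at one idempotent at a time; summation over all sequences
  removes it.\<close>

lemma S_X_far:
  assumes "Suc k < rank \<nu>" "l < rank \<nu>" "l \<noteq> k" "l \<noteq> Suc k"
  shows "S k * X l = X l * S k"
proof -
  have "(S k * X l - X l * S k) * (\<Sum>i\<in>\<theta>. E i) = 0"
    unfolding sum_distrib_left
    by (rule sum.neutral) (use S_X[OF assms(1,2)] assms in \<open>auto simp: transpose_def\<close>)
  then have "(S k * X l - X l * S k) * q 1 = 0" by (simp only: sum_E)
  then show ?thesis by (simp add: left_diff_distrib mult.assoc q_one)
qed

end

context vv_signed
begin

lemma Di_D: "\<lbrakk>i \<in> \<theta>; j < m; \<And>t. t \<le> j \<Longrightarrow> sg i t\<rbrakk> \<Longrightarrow> q (Di j) * (D j * E i) = E i"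
proof (induction j)
  case 0
  then show ?case by (simp add: P_P q_one flip: mult.assoc)
next
  case (Suc j)
  have "q (Di (Suc j)) * (D (Suc j) * E i) = q (Di j) * (S j * (D (Suc j) * E i))"
    by (simp only: Di.simps qcl_mult mult.assoc)
  also have "S j * (D (Suc j) * E i) = D j * E i"
    by (rule S_D_same) (use Suc.prems in auto)
  finally show ?case using Suc by simp
qed

lemma Ti_T: "\<lbrakk>valid ks; i \<in> \<theta>; positive i\<rbrakk> \<Longrightarrow> q (Ti ks) * (T ks * E i) = E i"
proof (induction ks)
  case Nil
  then show ?case by (simp add: T_simps q_one)
next
  case (Cons j ks)
  have v: "valid ks" "j < m" using Cons.prems by (auto simp: valid_Cons)
  note TE = T_E[OF v(1) Cons.prems(2)]
  have "q (Ti (j # ks)) * (T (j # ks) * E i) = q (Ti ks) * (q (Di j) * (D j * E (dls ks i)) * T ks)"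
    by (simp only: Ti.simps T_simps qcl_mult mult.assoc TE)
  also have "q (Di j) * (D j * E (dls ks i)) = E (dls ks i)"
    by (rule Di_D[OF dls_theta[OF v(1) Cons.prems(2)] v(2)]) (use sg_dls_le[OF Cons.prems] in auto)
  finally show ?case using Cons v by (simp add: TE[symmetric])
qed

lemma X_T_gt:
  assumes "valid ks" "\<forall>x\<in>set ks. l < x" "l < m" "i \<in> \<theta>" "positive i"
  shows "X l * (T ks * E i) = T ks * (X (l + length ks) * E i)"
  using assms(1-3)
proof (induction ks arbitrary: l)
  case Nil
  then show ?case by (simp add: T_simps q_one flip: mult.assoc)
next
  case (Cons j ks)
  let ?i = "dls ks i"
  have v: "valid ks" "l < j" "j < m" and i: "?i \<in> \<theta>"
    using Cons.prems assms(4) dls_theta[of ks i] by (auto simp: valid_Cons)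
  note TE = T_E[OF v(1) assms(4)]
  have "X l * (T (j # ks) * E i) = X l * (D j * E ?i) * T ks"
    by (simp add: T_simps TE mult.assoc)
  also have "X l * (D j * E ?i) = D j * (X (Suc l) * E ?i)"
    using X_D[OF i v(3) Cons.prems(3)] sg_dls_le[OF Cons.prems(1) assms(4,5)] v(2) by simp
  also have "D j * (X (Suc l) * E ?i) * T ks = D j * (X (Suc l) * (T ks * E i))"
    by (simp add: TE mult.assoc)
  also have "X (Suc l) * (T ks * E i) = T ks * (X (Suc l + length ks) * E i)"
    by (rule Cons.IH[OF v(1)]) (use Cons.prems v in \<open>auto simp: valid_Cons\<close>)
  finally show ?case by (simp add: T_simps mult.assoc)
qed

lemma ep_sum:
  assumes "\<And>i. \<lbrakk>i \<in> \<theta>; positive i\<rbrakk> \<Longrightarrow> q f * E i = q g * E i"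
  shows "q (f * ep) = q (g * ep)"
  unfolding e_pos_def qcl_mult qcl_sum sum_distrib_left
  by (intro sum.cong refl assms) (use ps_positive in auto)

lemma Ti_T_ep: "valid ks \<Longrightarrow> q (Ti ks * Tf ks * ep) = q ep"
proof -
  assume v: "valid ks"
  have "q (Ti ks * Tf ks * ep) = q (1 * ep)"
    by (rule ep_sum) (simp add: qcl_mult mult.assoc Ti_T[OF v] q_one)
  then show ?thesis by simp
qed

end

section \<open>Commuting KLR factors, and parts of a module cut out by suffixes\<close>

context vv_setup
begin

text \<open>Checked on pairs of generators and extended by induction in each argument. It makes a
  morphism constructed in two of three factors compatible with the action on the third.\<close>

lemma emb_comm:
  assumes TH: "\<beta> \<in> TH" "\<gamma> \<in> TH" and h: "h \<in> KF (pos \<beta>)" and g: "g \<in> KF (pos \<gamma>)"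
  shows "vq p (\<beta> + \<gamma>) (emb_l \<gamma> h * emb_r \<beta> g) = vq p (\<beta> + \<gamma>) (emb_r \<beta> g * emb_l \<gamma> h)"
proof -
  interpret vv_ring p "\<beta> + \<gamma>" .
  interpret B1: vv_block p "\<beta> + \<gamma>" 0 "rank \<beta>" "{[]}" "ps \<gamma>" "ps \<beta>" by (rule block1[OF TH])
  interpret B2: vv_block p "\<beta> + \<gamma>" "rank \<beta>" "rank \<gamma>" "ps \<beta>" "{[]}" "ps \<gamma>" by (rule block2[OF TH])
  let ?l = "loc_gen 0 {[]} (ps \<gamma>)" and ?r = "loc_gen (rank \<beta>) (ps \<beta>) {[]}"
  have rk: "rank (\<beta> + \<gamma>) = rank \<beta> + rank \<gamma>" by (rule rank_add[OF TH])
  have th: "i @ j \<in> theta_seqs (\<beta> + \<gamma>)" if "i \<in> ps \<beta>" "j \<in> ps \<gamma>" for i j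
    by (rule ps_theta[OF TH_add[OF TH] ps_append[OF that]])
  have lr: "q (?l x) * q (?r y) = q (?r y) * q (?l x)"
    if x: "x \<in> klr_gens (rank \<beta>) (ps \<beta>)" and y: "y \<in> klr_gens (rank \<gamma>) (ps \<gamma>)" for x y
  proof -
    have EX: "q (?r (GE j)) * X l = X l * q (?r (GE j))" if "j \<in> ps \<gamma>" "l < rank (\<beta> + \<gamma>)" for j l
      using that by (simp add: qcl_sum sum_distrib_left sum_distrib_right X_E th)
    have XE: "q (?l (GE i)) * X l = X l * q (?l (GE i))" if "i \<in> ps \<beta>" "l < rank (\<beta> + \<gamma>)" for i l
      using that by (simp add: qcl_sum sum_distrib_left sum_distrib_right X_E th)
    have SE: "S k * q (?r (GE j)) = q (?r (GE j)) * S k" if j: "j \<in> ps \<gamma>" and k: "Suc k < rank \<beta>" for j k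
    proof -
      have inv: "permute_list (swap k) (permute_list (swap k) i) = i" if "i \<in> ps \<beta>" for i
        using permute_list_compose[of "swap k" i "swap k"] k length_ps[OF TH(1) that] by (simp add: permutes_swap_id)
      have "(\<Sum>i\<in>ps \<beta>. S k * E (i @ j)) = (\<Sum>i\<in>ps \<beta>. E (permute_list (swap k) i @ j) * S k)"
      proof (rule sum.cong[OF refl])
        fix i assume i: "i \<in> ps \<beta>"
        have "permute_list (swap k) (i @ j) = permute_list (swap k) i @ j"
          using B1.permute_append[of "[]" i k j] length_ps[OF TH(1) i] k by simp
        then show "S k * E (i @ j) = E (permute_list (swap k) i @ j) * S k"
          using S_E[OF _ th[OF i j], of k] k rk by simp
      qed
      \<comment> \<open>The sum runs over all arrangements in \<open>ps \<beta>\<close>, which the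
        transposition merely permutes.\<close>
      also have "\<dots> = (\<Sum>i\<in>ps \<beta>. E (i @ j) * S k)"
        by (rule sum.reindex_bij_witness[of _ "permute_list (swap k)" "permute_list (swap k)"])
          (use inv ps_swap[OF TH(1)] k in auto)
      finally show ?thesis by (simp add: qcl_sum sum_distrib_left sum_distrib_right)
    qed
    have ES: "S (rank \<beta> + k) * q (?l (GE i)) = q (?l (GE i)) * S (rank \<beta> + k)"
      if i: "i \<in> ps \<beta>" and k: "Suc k < rank \<gamma>" for i k
    proof -
      have inv: "permute_list (swap k) (permute_list (swap k) j) = j" if "j \<in> ps \<gamma>" for j
        using permute_list_compose[of "swap k" j "swap k"] k length_ps[OF TH(2) that] by (simp add: permutes_swap_id)
      have "(\<Sum>j\<in>ps \<gamma>. S (rank \<beta> + k) * E (i @ j)) = (\<Sum>j\<in>ps \<gamma>. E (i @ permute_list (swap k) j) * S (rank \<beta> + k))"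
      proof (rule sum.cong[OF refl])
        fix j assume j: "j \<in> ps \<gamma>"
        have "permute_list (swap (rank \<beta> + k)) (i @ j) = i @ permute_list (swap k) j"
          using B2.permute_append[of i j k "[]"] length_ps[OF TH(1) i] length_ps[OF TH(2) j] k by simp
        then show "S (rank \<beta> + k) * E (i @ j) = E (i @ permute_list (swap k) j) * S (rank \<beta> + k)"
          using S_E[OF _ th[OF i j], of "rank \<beta> + k"] k rk by simp
      qed
      also have "\<dots> = (\<Sum>j\<in>ps \<gamma>. E (i @ j) * S (rank \<beta> + k))"
        by (rule sum.reindex_bij_witness[of _ "permute_list (swap k)" "permute_list (swap k)"])
          (use inv ps_swap[OF TH(2)] k in auto)
      finally show ?thesis by (simp add: qcl_sum sum_distrib_left sum_distrib_right)
    qed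
    have EE: "q (?l (GE i)) * q (?r (GE j)) = E (i @ j)" "q (?r (GE j)) * q (?l (GE i)) = E (i @ j)"
      if i: "i \<in> ps \<beta>" and j: "j \<in> ps \<gamma>" for i j
    proof -
      have *: "E (i @ b) * q (?r (GE j)) = (if b = j then E (i @ j) else 0)" if b: "b \<in> ps \<gamma>" for b
        using B2.E_EB(1)[OF i b _ j, of "[]"] by (simp add: qcl_sum)
      have **: "q (?r (GE j)) * E (i @ b) = (if b = j then E (i @ j) else 0)" if b: "b \<in> ps \<gamma>" for b
        using B2.E_EB(2)[OF i b _ j, of "[]"] by (simp add: qcl_sum)
      have l: "q (?l (GE i)) = (\<Sum>b\<in>ps \<gamma>. E (i @ b))" by (simp add: qcl_sum)
      show "q (?l (GE i)) * q (?r (GE j)) = E (i @ j)"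
        unfolding l sum_distrib_right using j by (simp only: * sum.delta finite_ps if_True cong: sum.cong)
      show "q (?r (GE j)) * q (?l (GE i)) = E (i @ j)"
        unfolding l sum_distrib_left using j by (simp only: ** sum.delta finite_ps if_True cong: sum.cong)
    qed
    from x consider l where "x = GX l" "l < rank \<beta>" | k where "x = GS k" "Suc k < rank \<beta>" | i where "x = GE i" "i \<in> ps \<beta>"
      by (auto simp: klr_gens_def)
    note xc = this
    from y consider l where "y = GX l" "l < rank \<gamma>" | k where "y = GS k" "Suc k < rank \<gamma>" | i where "y = GE i" "i \<in> ps \<gamma>"
      by (auto simp: klr_gens_def)
    note yc = this
    show ?thesis
    proof (cases rule: xc)
      case x: (1 l)
      show ?thesis
        by (cases rule: yc) (use x rk EX in \<open>auto simp: X_X S_X_far simp del: loc_gen.simps(3)\<close>)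
    next
      case x: (2 k)
      show ?thesis
        by (cases rule: yc) (use x rk SE in \<open>auto simp: S_X_far S_S_distant simp del: loc_gen.simps(3)\<close>)
    next
      case x: (3 i)
      show ?thesis
        by (cases rule: yc) (use x rk XE ES EE in \<open>auto simp del: loc_gen.simps(3)\<close>)
    qed
  qed
  have 1: "q (?l x) * q (emb_r \<beta> g) = q (emb_r \<beta> g) * q (?l x)" if x: "x \<in> klr_gens (rank \<beta>) (ps \<beta>)" for x
    using g
  proof (induction g rule: free_alg_induct)
    case (scal c)
    then show ?case by (simp add: emb_r_hom qcl_mult[symmetric] scal_central)
  next
    case (gen y g)
    have "q (?l x) * q (emb_r \<beta> (Poly_Mapping.single [y] 1 * g)) = (q (?l x) * q (?r y)) * q (emb_r \<beta> g)"
      by (simp only: emb_r_hom qcl_mult mult.assoc)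
    also have "q (?l x) * q (?r y) = q (?r y) * q (?l x)"
      by (rule lr[OF x]) (use gen KLR_gens_eq[OF TH(2)] in simp)
    also have "q (?r y) * q (?l x) * q (emb_r \<beta> g) = q (?r y) * (q (emb_r \<beta> g) * q (?l x))"
      by (simp only: gen mult.assoc)
    finally show ?case by (simp only: emb_r_hom qcl_mult mult.assoc)
  next
    case (add g h)
    then show ?case by (simp only: emb_r_hom qcl_add distrib_left distrib_right)
  qed
  show ?thesis
    unfolding qcl_mult using h
  proof (induction h rule: free_alg_induct)
    case (scal c)
    then show ?case by (simp add: emb_l_hom qcl_mult[symmetric] scal_central)
  next
    case (gen x h)
    have "q (emb_l \<gamma> (Poly_Mapping.single [x] 1 * h)) * q (emb_r \<beta> g) = q (?l x) * (q (emb_l \<gamma> h) * q (emb_r \<beta> g))"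
      by (simp only: emb_l_hom qcl_mult mult.assoc)
    also have "\<dots> = (q (?l x) * q (emb_r \<beta> g)) * q (emb_l \<gamma> h)"
      by (simp only: gen mult.assoc)
    also have "q (?l x) * q (emb_r \<beta> g) = q (emb_r \<beta> g) * q (?l x)"
      by (rule 1) (use gen KLR_gens_eq[OF TH(1)] in simp)
    finally show ?case by (simp only: emb_l_hom qcl_mult mult.assoc)
  next
    case (add g h)
    then show ?case by (simp only: emb_l_hom qcl_add distrib_left distrib_right)
  qed
qed

text \<open>
  The part of a module cut out by the sequences \<open>i j\<close> with \<open>j \<in> J\<close> is a module over the VV algebra
  acting on the first entries.
\<close>

lemma left_block:
  assumes "finite J" "J \<subseteq> theta_seqs \<nu>"
  shows "vv_left_block (\<mu> + \<nu>) (rank \<mu>) J (theta_seqs \<mu>)"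
  using assms
  by unfold_locales
    (auto simp: finite_theta_seqs length_theta_seqs theta_seqs_swap theta_seqs_flip rank_def div_le_mono
      intro!: theta_seqs_append)

definition par_e :: "'k multiset \<Rightarrow> 'k list set \<Rightarrow> 'k falg" where
  "par_e \<mu> J = (\<Sum>i\<in>theta_seqs \<mu>. loc_gen 0 {[]} J (GE i))"

definition par_op :: "'k multiset \<Rightarrow> 'k list set \<Rightarrow> ('k palg, 'c, 'y) module_scheme \<Rightarrow> 'k falg \<Rightarrow> 'c \<Rightarrow> 'c" where
  "par_op \<rho> J C f = vact p \<rho> C (subst (loc_gen 0 {[]} J) f)"

definition par_grp :: "'k multiset \<Rightarrow> 'k multiset \<Rightarrow> 'k list set \<Rightarrow> ('k palg, 'c, 'y) module_scheme \<Rightarrow> 'c ring" where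
  "par_grp \<mu> \<rho> J C = \<lparr>carrier = {y \<in> carrier C. vact p \<rho> C (par_e \<mu> J) y = y}, monoid.mult = undefined,
     monoid.one = undefined, ring.zero = \<zero>\<^bsub>C\<^esub>, ring.add = (\<oplus>\<^bsub>C\<^esub>)\<rparr>"

definition par :: "'k multiset \<Rightarrow> 'k multiset \<Rightarrow> 'k list set \<Rightarrow> ('k palg, 'c, 'y) module_scheme \<Rightarrow> ('k palg, 'c) module" where
  "par \<mu> \<rho> J C = presented.op_module (VV_gens \<mu>) (VV_rels p \<mu>) (par_grp \<mu> \<rho> J C) (par_op \<rho> J C)"

lemma par_sel: "carrier (par \<mu> \<rho> J C) = {y \<in> carrier C. vact p \<rho> C (par_e \<mu> J) y = y}"
  "ring.zero (par \<mu> \<rho> J C) = \<zero>\<^bsub>C\<^esub>" "ring.add (par \<mu> \<rho> J C) = ring.add C"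
  by (simp_all add: par_def VV.op_module_def par_grp_def)

text \<open>The idempotent \<open>par_e\<close> commutes with every generator of the smaller
  algebra, pi included, so its image is stable. Relations of the smaller algebra times
  \<open>par_e\<close> vanish by \<open>loc_rel\<close> and \<open>loc_pi_rel\<close>, so the
  operators descend by \<open>op_module\<close>.\<close>

lemma par_module:
  fixes C :: "('k palg, 'c, 'y) module_scheme"
  assumes J: "finite J" "J \<subseteq> theta_seqs \<nu>" and \<rho>: "\<rho> = \<mu> + \<nu>" and C: "left_module (VV p \<rho>) C"
  shows "left_module (VV p \<mu>) (par \<mu> \<rho> J C)"
    and "\<And>f y. \<lbrakk>f \<in> carrier (free_alg (VV_gens \<mu>)); y \<in> carrier (par \<mu> \<rho> J C)\<rbrakk> \<Longrightarrow>
      vact p \<mu> (par \<mu> \<rho> J C) f y = vact p \<rho> C (subst (loc_gen 0 {[]} J) f) y"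
proof -
  interpret vv_left_block p \<rho> "rank \<mu>" J "theta_seqs \<mu>"
    unfolding \<rho> by (rule left_block[OF J])
  interpret C: left_module "VV p \<rho>" C by (rule C)
  let ?e = "par_e \<mu> J" and ?X = "{y \<in> carrier C. vact p \<rho> C (par_e \<mu> J) y = y}"
  have eJ: "?e = eJ" by (simp only: par_e_def)
  have comm: "vq p \<rho> (loc f * ?e) = vq p \<rho> (?e * loc f)" if "f \<in> carrier (free_alg (VV_gens \<mu>))" for f
    unfolding qcl_mult eJ
  proof (rule loc_carrier_commutes[OF _ that])
    fix g assume "g \<in> VV_gens \<mu>"
    then consider "g \<in> klr_gens (rank \<mu>) (theta_seqs \<mu>)" | "g = GP" "0 < rank \<mu>"
      by (auto simp: VV_gens_def split: if_splits)
    then show "q (loc_gen 0 {[]} J g) * q eJ = q eJ * q (loc_gen 0 {[]} J g)"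
    proof cases
      case 2
      then show ?thesis using P_commutes by simp
    qed (rule loc_commutes)
  qed
  have rel: "vq p \<rho> (loc r * ?e) = vq p \<rho> 0" if "r \<in> VV_rels p \<mu>" for r
  proof -
    have "r \<in> klr_rels p (rank \<mu>) (theta_seqs \<mu>) \<or> r \<in> pi_rels (rank \<mu>) (theta_seqs \<mu>) \<and> 0 < rank \<mu>"
      using that by (auto simp: VV_rels_def split: if_splits)
    then show ?thesis unfolding eJ qcl_zero
      by (elim disjE conjE) (rule loc_rel loc_pi_rel; assumption)+
  qed
  note hom = VV.act_hom[OF C]
  have X: "abelian_group (par_grp \<mu> \<rho> J C)"
  proof (rule abelian_groupI)
    fix x assume x: "x \<in> carrier (par_grp \<mu> \<rho> J C)"
    then have xC: "x \<in> carrier C" by (simp add: par_grp_def)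
    have "vact p \<rho> C (- 1) x \<oplus>\<^bsub>C\<^esub> x = \<zero>\<^bsub>C\<^esub>"
      using hom(2)[OF xC xC, of "- 1" 1] hom(5,6)[OF xC xC] by simp
    moreover have "vact p \<rho> C ?e (vact p \<rho> C (- 1) x) = vact p \<rho> C (- 1) x"
      using hom(4)[OF xC xC, of ?e "- 1"] hom(4)[OF xC xC, of "- 1" ?e] x by (simp add: par_grp_def)
    ultimately show "\<exists>y\<in>carrier (par_grp \<mu> \<rho> J C). y \<oplus>\<^bsub>par_grp \<mu> \<rho> J C\<^esub> x = \<zero>\<^bsub>par_grp \<mu> \<rho> J C\<^esub>"
      using hom(1)[OF xC xC] by (intro bexI[of _ "vact p \<rho> C (- 1) x"]) (simp_all add: par_grp_def)
  qed (auto simp: par_grp_def hom C.a_ac hom(7)[OF C.M.zero_closed C.M.zero_closed])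
  have closed: "par_op \<rho> J C f y \<in> ?X" if f: "f \<in> carrier (free_alg (VV_gens \<mu>))" and y: "y \<in> ?X" for f y
  proof -
    have yC: "y \<in> carrier C" using y by simp
    have "vact p \<rho> C ?e (vact p \<rho> C (loc f) y) = vact p \<rho> C (loc f) (vact p \<rho> C ?e y)"
      using vact_cong[OF comm[OF f], of C y] by (simp add: hom(4)[OF yC yC])
    then show ?thesis using y hom(1)[OF yC yC] by (simp add: par_op_def)
  qed
  have rel': "par_op \<rho> J C r y = \<zero>\<^bsub>C\<^esub>" if r: "r \<in> VV_rels p \<mu>" and y: "y \<in> ?X" for r y
  proof -
    have yC: "y \<in> carrier C" using y by simp
    have "vact p \<rho> C (loc r) y = vact p \<rho> C (loc r * ?e) y"
      using y by (simp add: hom(4)[OF yC yC])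
    also have "\<dots> = \<zero>\<^bsub>C\<^esub>"
      using vact_cong[OF rel[OF r], of C y] hom(6)[OF yC yC] by simp
    finally show ?thesis by (simp add: par_op_def)
  qed
  have car: "carrier (par_grp \<mu> \<rho> J C) = ?X" "ring.add (par_grp \<mu> \<rho> J C) = ring.add C"
    "ring.zero (par_grp \<mu> \<rho> J C) = \<zero>\<^bsub>C\<^esub>"
    by (simp_all add: par_grp_def)
  note op = VV.op_module[OF X, unfolded car, of \<mu> "par_op \<rho> J C" p, folded par_def]
  have S: "par_op \<rho> J C (f + g) y = par_op \<rho> J C f y \<oplus>\<^bsub>C\<^esub> par_op \<rho> J C g y"
    "par_op \<rho> J C (f * g) y = par_op \<rho> J C f (par_op \<rho> J C g y)" "par_op \<rho> J C 1 y = y"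
    "par_op \<rho> J C f (y \<oplus>\<^bsub>C\<^esub> z) = par_op \<rho> J C f y \<oplus>\<^bsub>C\<^esub> par_op \<rho> J C f z"
    if "y \<in> ?X" "z \<in> ?X" for f g y z
    using hom[of y z] that by (simp_all add: par_op_def subst_hom)
  show "left_module (VV p \<mu>) (par \<mu> \<rho> J C)"
    by (rule op(1)[OF closed S(1) S(2) S(4) S(3) rel'])
  fix f :: "'k falg" and y
  assume f: "f \<in> carrier (free_alg (VV_gens \<mu>))" and y: "y \<in> carrier (par \<mu> \<rho> J C)"
  have "vact p \<mu> (par \<mu> \<rho> J C) f y = par_op \<rho> J C f y"
    by (rule op(2)[OF closed S(1) S(2) S(4) S(3) rel' f]) (use y in \<open>simp_all only: par_sel\<close>)
  then show "vact p \<mu> (par \<mu> \<rho> J C) f y = vact p \<rho> C (subst (loc_gen 0 {[]} J) f) y"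
    by (simp add: par_op_def)
qed

end

section \<open>Generation of the restriction of a convolution product\<close>

context conv_data
begin

text \<open>A pure tensor is fixed by the idempotent \<open>?e\<close>. So \<open>?e * f\<close>
  acts on it as \<open>?e * f * ?e\<close>, which \<open>corner_surj\<close> replaces by an element
  of the KLR algebra.\<close>

lemma Res_conv_induct [consumes 1, case_names zero pure act add]:
  assumes x: "x \<in> RC (M \<bullet> N)" and zero: "P \<zero>\<^bsub>M \<bullet> N\<^esub>"
    and pure: "\<And>u v. \<lbrakk>u \<in> RC M; v \<in> RC N\<rbrakk> \<Longrightarrow> P (cp u v)"
    and act: "\<And>f x. \<lbrakk>f \<in> KF (pos (\<beta> + \<gamma>)); x \<in> RC (M \<bullet> N); P x\<rbrakk> \<Longrightarrow> P (act (M \<bullet> N) f x)"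
    and add: "\<And>x y. \<lbrakk>x \<in> RC (M \<bullet> N); y \<in> RC (M \<bullet> N); P x; P y\<rbrakk> \<Longrightarrow> P (x \<oplus>\<^bsub>M \<bullet> N\<^esub> y)"
  shows "P x"
proof -
  interpret vv_signed p lam "\<beta> + \<gamma>"
    by unfold_locales (rule TH_add[OF TH])
  let ?e = "e_pos p lam (\<beta> + \<gamma>)"
  have deg: "deg (M \<bullet> N) = \<beta> + \<gamma>" by (simp add: conv_sel)
  note hom = act_hom[OF conv_vvm]
  interpret MN: abelian_group "M \<bullet> N" by (rule vvm_group[OF conv_vvm])
  have main: "act (M \<bullet> N) ?e x \<in> RC (M \<bullet> N) \<and> P (act (M \<bullet> N) ?e x)" if "x \<in> carrier (M \<bullet> N)" for x
    using that
  proof (induction x rule: conv_induct)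
    case zero
    then show ?case
      using assms(2) hom(7)[OF MN.zero_closed MN.zero_closed] MN.zero_closed by (simp add: RC_iff[OF conv_vvm])
  next
    case (gen f u v)
    obtain g where g: "g \<in> KF (pos (\<beta> + \<gamma>))" "q (?e * f * ?e) = q (g * ?e)"
      using corner_surj[of f] by blast
    have c: "cp u v \<in> carrier (M \<bullet> N)" "act (M \<bullet> N) ?e (cp u v) = cp u v"
      using cp_RC[OF gen] by (simp_all add: RC_iff[OF conv_vvm] deg)
    have "act (M \<bullet> N) ?e (act (M \<bullet> N) f (cp u v)) = act (M \<bullet> N) (?e * f * ?e) (cp u v)"
      by (simp add: hom(4)[OF c(1) c(1)] c(2))
    also have "\<dots> = act (M \<bullet> N) (g * ?e) (cp u v)"
      using vact_cong[OF g(2)] by (simp add: deg)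
    also have "\<dots> = act (M \<bullet> N) g (cp u v)"
      by (simp add: hom(4)[OF c(1) c(1)] c(2))
    finally show ?case
      using act[OF g(1) cp_RC[OF gen] pure[OF gen]] RC_closed(2)[OF conv_vvm cp_RC[OF gen], of g] g(1) by (simp add: deg)
  next
    case (add x y)
    then show ?case using assms(5) RC_closed(3)[OF conv_vvm] by (simp add: hom(3)[OF add(1,2)])
  qed
  have "x \<in> carrier (M \<bullet> N)" "act (M \<bullet> N) ?e x = x"
    using x unfolding RC_iff[OF conv_vvm] deg by simp_all
  then show ?thesis using main[of x] by simp
qed

end

section \<open>Associativity\<close>

context vv_block
begin

lemma eJ_E: "\<lbrakk>a \<in> A; i \<in> J; b \<in> B\<rbrakk> \<Longrightarrow> q eJ * E (a @ i @ b) = E (a @ i @ b)"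
proof -
  assume h: "a \<in> A" "i \<in> J" "b \<in> B"
  have "q eJ * E (a @ i @ b) = (\<Sum>j\<in>J. EB j * E (a @ i @ b))"
    unfolding q_eJ by (rule sum_distrib_right)
  also have "\<dots> = (\<Sum>j\<in>J. if i = j then E (a @ i @ b) else 0)"
    by (intro sum.cong refl E_EB(2) h)
  finally show ?thesis using h fin by (simp only: sum.delta' if_True)
qed

lemma EB_E: "\<lbrakk>a \<in> A; i \<in> J; b \<in> B; j \<in> J\<rbrakk> \<Longrightarrow>
    q (loc_gen s A B (GE j)) * E (a @ i @ b) = (if i = j then E (a @ i @ b) else 0)"
  using E_EB(2)[of a i b j] by (simp add: qcl_sum)

end

text \<open>Blocks compose: the complement of the inner block is extended by that of the outer one.
  Constant length makes each concatenation in \<open>cat\<close> come from one pair only.\<close>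

lemma loc_loc_left:
  assumes "\<And>b. b \<in> B \<Longrightarrow> length b = n" and "g \<noteq> GP"
  shows "subst (loc_gen 0 {[]} J) (loc_gen s A B g) = loc_gen s A (cat B J) g"
  using assms(2) by (cases g) (simp_all add: subst_hom sum_cat[OF assms(1)])

lemma loc_loc_right:
  assumes "\<And>a. a \<in> A \<Longrightarrow> length a = n" and "g \<noteq> GP"
  shows "subst (loc_gen s A {[]}) (loc_gen t A' B g) = loc_gen (s + t) (cat A A') B g"
proof (cases g)
  case (GE i)
  have "(\<Sum>a'\<in>A'. \<Sum>b\<in>B. \<Sum>a\<in>A. ge (a @ a' @ i @ b)) = (\<Sum>a'\<in>A'. \<Sum>a\<in>A. \<Sum>b\<in>B. ge (a @ a' @ i @ b))"
    by (intro sum.cong refl sum.swap)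
  also have "\<dots> = (\<Sum>a\<in>A. \<Sum>a'\<in>A'. \<Sum>b\<in>B. ge (a @ a' @ i @ b))"
    by (rule sum.swap)
  finally show ?thesis by (simp add: GE subst_hom sum_cat[OF assms(1)])
qed (use assms in \<open>simp_all add: subst_hom add.assoc\<close>)

context vv_setup
begin

lemma KF_cl_l: "\<lbrakk>\<beta> \<in> TH; \<gamma> \<in> TH; g \<in> KLR_gens (pos \<beta>)\<rbrakk> \<Longrightarrow> loc_gen 0 {[]} (ps \<gamma>) g \<in> KF (pos (\<beta> + \<gamma>))"
  by (auto simp: KLR_gens_eq TH_add klr_gens_def rank_add intro!: free_alg_intros ps_append)

lemma KF_cl_r: "\<lbrakk>\<beta> \<in> TH; \<gamma> \<in> TH; g \<in> KLR_gens (pos \<gamma>)\<rbrakk> \<Longrightarrow> loc_gen (rank \<beta>) (ps \<beta>) {[]} g \<in> KF (pos (\<beta> + \<gamma>))"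
  by (auto simp: KLR_gens_eq TH_add klr_gens_def rank_add intro!: free_alg_intros ps_append)

lemma e_conv_KF: "\<lbrakk>\<beta> \<in> TH; \<gamma> \<in> TH\<rbrakk> \<Longrightarrow> e_conv p lam \<beta> \<gamma> \<in> KF (pos (\<beta> + \<gamma>))"
  by (auto simp: e_conv_def KLR_gens_eq TH_add klr_gens_def intro!: free_alg_intros ps_append)

lemma gens_not_GP: "g \<in> KLR_gens \<nu> \<Longrightarrow> g \<noteq> GP"
  by (auto simp: KLR_gens_def klr_gens_def)

lemma zero_RC: "vvm M \<Longrightarrow> \<zero>\<^bsub>M\<^esub> \<in> RC M"
  using abelian_group.axioms(1)[OF Res_group, of M] abelian_monoid.zero_closed[of "Res p lam M"] by simp

lemma gen_KF: "g \<in> KLR_gens \<nu> \<Longrightarrow> Poly_Mapping.single [g] 1 \<in> KF \<nu>"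
  by (rule free_alg_closed)

end

context conv_data
begin

lemma cp_zero: "v \<in> RC N \<Longrightarrow> cp \<zero>\<^bsub>M\<^esub> v = \<zero>\<^bsub>M \<bullet> N\<^esub>"
proof -
  assume v: "v \<in> RC N"
  interpret A: abelian_group M by (rule vvm_group[OF M])
  interpret B: abelian_group "M \<bullet> N" by (rule vvm_group[OF conv_vvm])
  show ?thesis
    using cp_add(1)[OF zero_RC[OF M] zero_RC[OF M] v] cp_closed[OF zero_RC[OF M] v] by simp
qed

lemma Res_induct [consumes 1, case_names pure act add]:
  assumes x: "x \<in> RC (M \<bullet> N)"
    and pure: "\<And>u v. \<lbrakk>u \<in> RC M; v \<in> RC N\<rbrakk> \<Longrightarrow> P (cp u v)"
    and act: "\<And>f x. \<lbrakk>f \<in> KF (pos (\<beta> + \<gamma>)); x \<in> RC (M \<bullet> N); P x\<rbrakk> \<Longrightarrow> P (act (M \<bullet> N) f x)"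
    and add: "\<And>x y. \<lbrakk>x \<in> RC (M \<bullet> N); y \<in> RC (M \<bullet> N); P x; P y\<rbrakk> \<Longrightarrow> P (x \<oplus>\<^bsub>M \<bullet> N\<^esub> y)"
  shows "P x"
  using x
proof (induction rule: Res_conv_induct)
  case zero
  then show ?case using pure[OF zero_RC[OF M] zero_RC[OF N]] cp_zero[OF zero_RC[OF N]] by simp
qed (use pure act add in auto)

lemma cp_gen:
  assumes u: "u \<in> RC M" and v: "v \<in> RC N"
  shows "g \<in> KLR_gens (pos \<beta>) \<Longrightarrow> cp (act M (Poly_Mapping.single [g] 1) u) v =
      vact p (\<beta> + \<gamma>) (M \<bullet> N) (loc_gen 0 {[]} (ps \<gamma>) g) (cp u v)"
    and "g \<in> KLR_gens (pos \<gamma>) \<Longrightarrow> cp u (act N (Poly_Mapping.single [g] 1) v) =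
      vact p (\<beta> + \<gamma>) (M \<bullet> N) (loc_gen (rank \<beta>) (ps \<beta>) {[]} g) (cp u v)"
    and "cp (act M (scal c) u) v = vact p (\<beta> + \<gamma>) (M \<bullet> N) (scal c) (cp u v)"
    and "cp u (act N (scal c) v) = vact p (\<beta> + \<gamma>) (M \<bullet> N) (scal c) (cp u v)"
proof -
  show "g \<in> KLR_gens (pos \<beta>) \<Longrightarrow> cp (act M (Poly_Mapping.single [g] 1) u) v =
      vact p (\<beta> + \<gamma>) (M \<bullet> N) (loc_gen 0 {[]} (ps \<gamma>) g) (cp u v)"
    using cp_emb(1)[OF u v gen_KF, of g] by (simp add: emb_l_hom conv_sel(4))
  show "g \<in> KLR_gens (pos \<gamma>) \<Longrightarrow> cp u (act N (Poly_Mapping.single [g] 1) v) =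
      vact p (\<beta> + \<gamma>) (M \<bullet> N) (loc_gen (rank \<beta>) (ps \<beta>) {[]} g) (cp u v)"
    using cp_emb(2)[OF u v gen_KF, of g] by (simp add: emb_r_hom conv_sel(4))
  show "cp (act M (scal c) u) v = vact p (\<beta> + \<gamma>) (M \<bullet> N) (scal c) (cp u v)"
    using cp_emb(1)[OF u v free_alg_closed(3), of c] by (simp add: emb_l_hom conv_sel(4))
  show "cp u (act N (scal c) v) = vact p (\<beta> + \<gamma>) (M \<bullet> N) (scal c) (cp u v)"
    using cp_emb(2)[OF u v free_alg_closed(3), of c] by (simp add: emb_r_hom conv_sel(4))
qed

end

section \<open>Trilinear maps and morphisms out of (L o M) o N\<close>

locale triple = vv_setup p lam for p lam :: "'k::field" +
  fixes L :: "('k, 'l) vv_mod" and M :: "('k, 'm) vv_mod" and N :: "('k, 'n) vv_mod"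
  assumes L: "vv_module p lam L" and M: "vv_module p lam M" and N: "vv_module p lam N"
begin

abbreviation "\<alpha> \<equiv> deg L"
abbreviation "\<beta> \<equiv> deg M"
abbreviation "\<gamma> \<equiv> deg N"
abbreviation "\<rho> \<equiv> deg L + deg M + deg N"
abbreviation "AB \<equiv> cat (ps \<alpha>) (ps \<beta>)"
abbreviation "BC \<equiv> cat (ps \<beta>) (ps \<gamma>)"

interpretation LM: conv_data p lam L M by unfold_locales (rule L M)+
interpretation MN: conv_data p lam M N by unfold_locales (rule M N)+
interpretation L_MN: conv_data p lam L "M \<bullet> N" by unfold_locales (rule L MN.conv_vvm)+
interpretation LM_N: conv_data p lam "L \<bullet> M" N by unfold_locales (rule N LM.conv_vvm)+

lemma TH3: "\<alpha> \<in> TH" "\<beta> \<in> TH" "\<gamma> \<in> TH"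
  using L M N by (auto intro: vvm_TH)

lemma TH3': "\<alpha> + \<beta> \<in> TH" "\<beta> + \<gamma> \<in> TH" "\<rho> \<in> TH"
  using TH3 by (auto intro: TH_add)

lemma degs: "deg (L \<bullet> M) = \<alpha> + \<beta>" "deg (M \<bullet> N) = \<beta> + \<gamma>"
  "deg ((L \<bullet> M) \<bullet> N) = \<rho>" "deg (L \<bullet> (M \<bullet> N)) = \<rho>"
  by (simp_all add: LM.conv_sel MN.conv_sel LM_N.conv_sel L_MN.conv_sel add.assoc)

lemma ranks: "rank (\<alpha> + \<beta>) = rank \<alpha> + rank \<beta>" "rank (\<beta> + \<gamma>) = rank \<beta> + rank \<gamma>"
  "rank \<rho> = rank \<alpha> + rank \<beta> + rank \<gamma>"
  using TH3 TH3' by (simp_all add: rank_add)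

definition e3 :: "'k falg" where
  "e3 = (\<Sum>i\<in>ps \<alpha>. \<Sum>j\<in>ps \<beta>. \<Sum>k\<in>ps \<gamma>. ge (i @ j @ k))"

lemma triple_ps: "\<lbrakk>i \<in> ps \<alpha>; j \<in> ps \<beta>; k \<in> ps \<gamma>\<rbrakk> \<Longrightarrow> i @ j @ k \<in> ps \<rho>"
  using ps_append[OF _ ps_append[of j \<beta> k \<gamma>], of i \<alpha>] by (simp add: add.assoc)

lemma triple_theta: "\<lbrakk>i \<in> ps \<alpha>; j \<in> ps \<beta>; k \<in> ps \<gamma>\<rbrakk> \<Longrightarrow> i @ j @ k \<in> theta_seqs \<rho>"
  by (rule ps_theta[OF TH3'(3) triple_ps])

interpretation R: vv_signed p lam \<rho>
  by unfold_locales (rule TH3')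

lemma absorb:
  assumes "\<And>i j k. \<lbrakk>i \<in> ps \<alpha>; j \<in> ps \<beta>; k \<in> ps \<gamma>\<rbrakk> \<Longrightarrow> R.q f * R.E (i @ j @ k) = R.q g * R.E (i @ j @ k)"
  shows "R.q (f * e3) = R.q (g * e3)"
  unfolding e3_def qcl_mult qcl_sum sum_distrib_left by (intro sum.cong refl assms)

lemma absorb1:
  assumes "\<And>i j k. \<lbrakk>i \<in> ps \<alpha>; j \<in> ps \<beta>; k \<in> ps \<gamma>\<rbrakk> \<Longrightarrow> R.q f * R.E (i @ j @ k) = R.E (i @ j @ k)"
  shows "R.q (f * e3) = R.q e3"
  using absorb[of f 1] assms by (simp add: R.q_one)

lemma cat_BC: "b \<in> BC \<Longrightarrow> b \<in> ps (\<beta> + \<gamma>)" and cat_AB: "a \<in> AB \<Longrightarrow> a \<in> ps (\<alpha> + \<beta>)"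
  by (auto simp: cat_def intro: ps_append)

lemma block_l:
  assumes "B \<subseteq> ps (\<beta> + \<gamma>)" shows "vv_block \<rho> 0 (rank \<alpha>) {[]} B (ps \<alpha>)"
proof -
  have mem: "i @ b \<in> theta_seqs \<rho>" if "i \<in> ps \<alpha>" "b \<in> B" for i b
    using ps_theta[OF _ ps_append[OF that(1), of b "\<beta> + \<gamma>"]] that assms TH3' by (auto simp: add.assoc)
  show ?thesis
    by unfold_locales (use finite_subset[OF assms] mem in \<open>auto simp: length_ps[OF TH3(1)] ps_swap[OF TH3(1)] ranks\<close>)
qed

lemma block_r:
  assumes "A \<subseteq> ps (\<alpha> + \<beta>)" shows "vv_block \<rho> (rank \<alpha> + rank \<beta>) (rank \<gamma>) A {[]} (ps \<gamma>)"
proof -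
  have mem: "a @ k \<in> theta_seqs \<rho>" if "k \<in> ps \<gamma>" "a \<in> A" for a k
    using ps_theta[OF _ ps_append[OF _ that(1), of a "\<alpha> + \<beta>"]] that assms TH3' by auto
  have len: "length a = rank \<alpha> + rank \<beta>" if "a \<in> A" for a
    using length_ps[OF TH3'(1)] that assms by (auto simp: ranks)
  show ?thesis
    by unfold_locales (use finite_subset[OF assms] mem len in \<open>auto simp: length_ps[OF TH3(3)] ps_swap[OF TH3(3)] ranks\<close>)
qed

text \<open>The image of a generator depends on whether the complement is all arrangements in
  \<open>ps (\<beta> + \<gamma>)\<close> or only the concatenations in \<open>BC\<close>. On
  \<open>e3\<close> only the latter occur, so the two images agree there.\<close>

lemma loc_l_e3:
  assumes g: "g \<in> KLR_gens (pos \<alpha>)"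
  shows "R.q (loc_gen 0 {[]} (ps (\<beta> + \<gamma>)) g * e3) = R.q (loc_gen 0 {[]} BC g * e3)"
proof -
  interpret B1: vv_block p \<rho> 0 "rank \<alpha>" "{[]}" "ps (\<beta> + \<gamma>)" "ps \<alpha>" by (rule block_l) simp
  interpret B2: vv_block p \<rho> 0 "rank \<alpha>" "{[]}" BC "ps \<alpha>" by (rule block_l) (auto intro: cat_BC)
  from g consider l where "g = GX l" | k where "g = GS k" | i where "g = GE i" "i \<in> ps \<alpha>"
    by (auto simp: KLR_gens_eq[OF TH3(1)] klr_gens_def)
  then show ?thesis
  proof cases
    case i: 3
    show ?thesis
    proof (rule absorb)
      fix i' j k assume "i' \<in> ps \<alpha>" "j \<in> ps \<beta>" "k \<in> ps \<gamma>"
      then show "R.q (loc_gen 0 {[]} (ps (\<beta> + \<gamma>)) g) * R.E (i' @ j @ k) = R.q (loc_gen 0 {[]} BC g) * R.E (i' @ j @ k)"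
        using B1.EB_E[of "[]" i' "j @ k" i] B2.EB_E[of "[]" i' "j @ k" i] i
        by (simp add: cat_mem ps_append del: loc_gen.simps)
    qed
  qed simp_all
qed

lemma loc_r_e3:
  assumes g: "g \<in> KLR_gens (pos \<gamma>)"
  shows "R.q (loc_gen (rank \<alpha> + rank \<beta>) (ps (\<alpha> + \<beta>)) {[]} g * e3) = R.q (loc_gen (rank \<alpha> + rank \<beta>) AB {[]} g * e3)"
proof -
  interpret B1: vv_block p \<rho> "rank \<alpha> + rank \<beta>" "rank \<gamma>" "ps (\<alpha> + \<beta>)" "{[]}" "ps \<gamma>" by (rule block_r) simp
  interpret B2: vv_block p \<rho> "rank \<alpha> + rank \<beta>" "rank \<gamma>" AB "{[]}" "ps \<gamma>" by (rule block_r) (auto intro: cat_AB)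
  from g consider l where "g = GX l" | k where "g = GS k" | i where "g = GE i" "i \<in> ps \<gamma>"
    by (auto simp: KLR_gens_eq[OF TH3(3)] klr_gens_def)
  then show ?thesis
  proof cases
    case i: 3
    show ?thesis
    proof (rule absorb)
      fix i' j k assume "i' \<in> ps \<alpha>" "j \<in> ps \<beta>" "k \<in> ps \<gamma>"
      then show "R.q (loc_gen (rank \<alpha> + rank \<beta>) (ps (\<alpha> + \<beta>)) {[]} g) * R.E (i' @ j @ k) =
          R.q (loc_gen (rank \<alpha> + rank \<beta>) AB {[]} g) * R.E (i' @ j @ k)"
        using B1.EB_E[of "i' @ j" k "[]" i] B2.EB_E[of "i' @ j" k "[]" i] i
        by (simp add: cat_mem ps_append del: loc_gen.simps)
    qed
  qed simp_all
qed

lemma ep_e3: "R.q (R.ep * e3) = R.q e3"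
proof (rule absorb1)
  interpret B: vv_block p \<rho> 0 "rank \<rho>" "{[]}" "{[]}" "ps \<rho>" by (rule block0[OF TH3'(3)])
  fix i j k assume "i \<in> ps \<alpha>" "j \<in> ps \<beta>" "k \<in> ps \<gamma>"
  from B.eJ_E[OF _ triple_ps[OF this], of "[]" "[]"] show "R.q R.ep * R.E (i @ j @ k) = R.E (i @ j @ k)"
    by (simp add: e_pos_block)
qed

lemma par_e3:
  assumes "finite J" "J \<subseteq> theta_seqs \<nu>" "\<rho> = \<mu> + \<nu>" "i \<in> theta_seqs \<mu>" "j \<in> J"
  shows "R.q (par_e \<mu> J) * R.E (i @ j) = R.E (i @ j)"
proof -
  interpret B: vv_left_block p \<rho> "rank \<mu>" J "theta_seqs \<mu>"
    unfolding assms(3) by (rule left_block[OF assms(1,2)])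
  show ?thesis using B.eJ_E[of "[]" i j] assms by (simp add: par_e_def)
qed

lemma e_conv_e3: "R.q (e_conv p lam \<alpha> (\<beta> + \<gamma>) * e3) = R.q e3"
proof (rule absorb1)
  interpret B: vv_block p \<rho> 0 "rank \<alpha>" "{[]}" "ps (\<beta> + \<gamma>)" "ps \<alpha>" by (rule block_l) simp
  fix i j k assume h: "i \<in> ps \<alpha>" "j \<in> ps \<beta>" "k \<in> ps \<gamma>"
  from B.eJ_E[OF _ h(1), of "[]" "j @ k"] h show "R.q (e_conv p lam \<alpha> (\<beta> + \<gamma>)) * R.E (i @ j @ k) = R.E (i @ j @ k)"
    by (simp add: e_conv_block1 ps_append)
qed

text \<open>The analogue of \<open>balanced\<close> for three factors, independent of the
  bracketing. The clause on \<open>e3\<close> allows words to be exchanged that agree only after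
  multiplication by \<open>e3\<close>.\<close>

definition tri :: "('k palg, 'c, 'y) module_scheme \<Rightarrow> ('l \<Rightarrow> 'm \<Rightarrow> 'n \<Rightarrow> 'c) \<Rightarrow> bool" where
  "tri C f \<longleftrightarrow> (\<forall>u\<in>RC L. \<forall>v\<in>RC M. \<forall>w\<in>RC N. f u v w \<in> carrier C \<and> vact p \<rho> C e3 (f u v w) = f u v w \<and>
     (\<forall>u'\<in>RC L. f (u \<oplus>\<^bsub>L\<^esub> u') v w = f u v w \<oplus>\<^bsub>C\<^esub> f u' v w) \<and>
     (\<forall>v'\<in>RC M. f u (v \<oplus>\<^bsub>M\<^esub> v') w = f u v w \<oplus>\<^bsub>C\<^esub> f u v' w) \<and>
     (\<forall>w'\<in>RC N. f u v (w \<oplus>\<^bsub>N\<^esub> w') = f u v w \<oplus>\<^bsub>C\<^esub> f u v w') \<and>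
     (\<forall>c. f (act L (scal c) u) v w = vact p \<rho> C (scal c) (f u v w)) \<and>
     (\<forall>c. f u (act M (scal c) v) w = vact p \<rho> C (scal c) (f u v w)) \<and>
     (\<forall>c. f u v (act N (scal c) w) = vact p \<rho> C (scal c) (f u v w)) \<and>
     (\<forall>g\<in>KLR_gens (pos \<alpha>). f (act L (Poly_Mapping.single [g] 1) u) v w =
        vact p \<rho> C (loc_gen 0 {[]} BC g) (f u v w)) \<and>
     (\<forall>g\<in>KLR_gens (pos \<beta>). f u (act M (Poly_Mapping.single [g] 1) v) w =
        vact p \<rho> C (loc_gen (rank \<alpha>) (ps \<alpha>) (ps \<gamma>) g) (f u v w)) \<and>
     (\<forall>g\<in>KLR_gens (pos \<gamma>). f u v (act N (Poly_Mapping.single [g] 1) w) =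
        vact p \<rho> C (loc_gen (rank \<alpha> + rank \<beta>) AB {[]} g) (f u v w)))"

lemma triD:
  assumes "tri C f" "u \<in> RC L" "v \<in> RC M" "w \<in> RC N"
  shows "f u v w \<in> carrier C" "vact p \<rho> C e3 (f u v w) = f u v w"
    "u' \<in> RC L \<Longrightarrow> f (u \<oplus>\<^bsub>L\<^esub> u') v w = f u v w \<oplus>\<^bsub>C\<^esub> f u' v w"
    "v' \<in> RC M \<Longrightarrow> f u (v \<oplus>\<^bsub>M\<^esub> v') w = f u v w \<oplus>\<^bsub>C\<^esub> f u v' w"
    "w' \<in> RC N \<Longrightarrow> f u v (w \<oplus>\<^bsub>N\<^esub> w') = f u v w \<oplus>\<^bsub>C\<^esub> f u v w'"
    "f (act L (scal c) u) v w = vact p \<rho> C (scal c) (f u v w)"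
    "f u (act M (scal c) v) w = vact p \<rho> C (scal c) (f u v w)"
    "f u v (act N (scal c) w) = vact p \<rho> C (scal c) (f u v w)"
    "g \<in> KLR_gens (pos \<alpha>) \<Longrightarrow> f (act L (Poly_Mapping.single [g] 1) u) v w =
        vact p \<rho> C (loc_gen 0 {[]} BC g) (f u v w)"
    "g \<in> KLR_gens (pos \<beta>) \<Longrightarrow> f u (act M (Poly_Mapping.single [g] 1) v) w =
        vact p \<rho> C (loc_gen (rank \<alpha>) (ps \<alpha>) (ps \<gamma>) g) (f u v w)"
    "g \<in> KLR_gens (pos \<gamma>) \<Longrightarrow> f u v (act N (Poly_Mapping.single [g] 1) w) =
        vact p \<rho> C (loc_gen (rank \<alpha> + rank \<beta>) AB {[]} g) (f u v w)"
  using assms unfolding tri_def by blast+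

lemma act_e3:
  assumes C: "left_module (VV p \<rho>) C" and f: "tri C f" and w: "u \<in> RC L" "v \<in> RC M" "w \<in> RC N"
    and eq: "R.q (g * e3) = R.q (h * e3)"
  shows "vact p \<rho> C g (f u v w) = vact p \<rho> C h (f u v w)"
proof -
  note c = triD(1)[OF f w]
  have "vact p \<rho> C (x * e3) (f u v w) = vact p \<rho> C x (f u v w)" for x
    by (simp add: VV.act_hom(4)[OF C c c] triD(2)[OF f w])
  then show ?thesis using vact_cong[OF eq, of C "f u v w"] by simp
qed

text \<open>Two applications of the universal property. For fixed \<open>w\<close>, the map in
  \<open>u\<close> and \<open>v\<close> takes values in a part of \<open>C\<close> over the algebra
  of the first two factors and extends to a morphism \<open>G w\<close> on \<open>L o M\<close>. The
  family \<open>G\<close> is then balanced in \<open>z\<close> and \<open>w\<close>.\<close>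

lemma tri_hom_left:
  assumes C: "left_module (VV p \<rho>) C" and f: "tri C f"
  shows "\<exists>H \<in> mod_hom (VV p \<rho>) ((L \<bullet> M) \<bullet> N) C.
    \<forall>u\<in>RC L. \<forall>v\<in>RC M. \<forall>w\<in>RC N. H (conv_pure p lam (L \<bullet> M) N (conv_pure p lam L M u v) w) = f u v w"
proof -
  \<comment> \<open>The entries of \<open>L\<close> and \<open>M\<close> stand first, so their VV
    algebra, with its pi, acts on the sequences with suffix in \<open>ps \<gamma>\<close>.\<close>
  let ?P = "par (\<alpha> + \<beta>) \<rho> (ps \<gamma>) C"
  have J: "finite (ps \<gamma>)" "ps \<gamma> \<subseteq> theta_seqs \<gamma>" using ps_theta[OF TH3(3)] by auto
  note P = par_module[OF J refl C]
  interpret C: left_module "VV p \<rho>" C by (rule C)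
  have PC: "y \<in> carrier ?P \<Longrightarrow> y \<in> carrier C" for y by (simp add: par_sel)
  have cl: "scal c \<in> carrier (free_alg (VV_gens (\<alpha> + \<beta>)))" for c :: 'k by (rule free_alg_closed)
  have cll: "loc_gen 0 {[]} (ps \<beta>) g \<in> carrier (free_alg (VV_gens (\<alpha> + \<beta>)))" if "g \<in> KLR_gens (pos \<alpha>)" for g
    by (rule block_gens_closed[OF TH3(1) block1[OF TH3(1,2)] that])
  have clr: "loc_gen (rank \<alpha>) (ps \<alpha>) {[]} g \<in> carrier (free_alg (VV_gens (\<alpha> + \<beta>)))" if "g \<in> KLR_gens (pos \<beta>)" for g
    by (rule block_gens_closed[OF TH3(2) block2[OF TH3(1,2)] that])
  have fP: "f u v w \<in> carrier ?P" if w: "u \<in> RC L" "v \<in> RC M" "w \<in> RC N" for u v w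
  proof -
    have "R.q (par_e (\<alpha> + \<beta>) (ps \<gamma>) * e3) = R.q (1 * e3)"
    proof (rule absorb)
      fix i j k assume h: "i \<in> ps \<alpha>" "j \<in> ps \<beta>" "k \<in> ps \<gamma>"
      have "i @ j \<in> theta_seqs (\<alpha> + \<beta>)" by (rule ps_theta[OF TH3'(1) ps_append[OF h(1,2)]])
      from par_e3[OF J refl this h(3)] show "R.q (par_e (\<alpha> + \<beta>) (ps \<gamma>)) * R.E (i @ j @ k) = R.q 1 * R.E (i @ j @ k)"
        by (simp add: R.q_one)
    qed
    from act_e3[OF C f w this] show ?thesis
      using triD(1)[OF f w] VV.act_hom(5)[OF C triD(1)[OF f w] triD(1)[OF f w]] by (simp add: par_sel)
  qed
  have bal: "LM.balanced ?P (\<lambda>u v. f u v w)" if w: "w \<in> RC N" for w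
    unfolding LM.balanced_def
  proof (intro ballI conjI allI)
    fix u v assume u: "u \<in> RC L" and v: "v \<in> RC M"
    note D = triD[OF f u v w] and F = fP[OF u v w]
    show "f u v w \<in> carrier ?P" by (rule F)
    show "f (u \<oplus>\<^bsub>L\<^esub> u') v w = f u v w \<oplus>\<^bsub>?P\<^esub> f u' v w" if "u' \<in> RC L" for u'
      using D(3)[OF that] by (simp add: par_sel)
    show "f u (v \<oplus>\<^bsub>M\<^esub> v') w = f u v w \<oplus>\<^bsub>?P\<^esub> f u v' w" if "v' \<in> RC M" for v'
      using D(4)[OF that] by (simp add: par_sel)
    show "f (act L (scal c) u) v w = vact p (\<alpha> + \<beta>) ?P (scal c) (f u v w)" for c
      using D(6) P(2)[OF cl F] by (simp add: subst_hom)
    show "f u (act M (scal c) v) w = vact p (\<alpha> + \<beta>) ?P (scal c) (f u v w)" for c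
      using D(7) P(2)[OF cl F] by (simp add: subst_hom)
    show "f (act L (Poly_Mapping.single [g] 1) u) v w = vact p (\<alpha> + \<beta>) ?P (loc_gen 0 {[]} (ps \<beta>) g) (f u v w)"
      if "g \<in> KLR_gens (pos \<alpha>)" for g
      using D(9)[OF that] P(2)[OF cll[OF that] F]
        loc_loc_left[of "ps \<beta>" "rank \<beta>" g "ps \<gamma>", OF length_ps[OF TH3(2)] gens_not_GP[OF that]] by simp
    show "f u (act M (Poly_Mapping.single [g] 1) v) w = vact p (\<alpha> + \<beta>) ?P (loc_gen (rank \<alpha>) (ps \<alpha>) {[]} g) (f u v w)"
      if "g \<in> KLR_gens (pos \<beta>)" for g
    proof -
      have "subst (loc_gen 0 {[]} (ps \<gamma>)) (loc_gen (rank \<alpha>) (ps \<alpha>) {[]} g) = loc_gen (rank \<alpha>) (ps \<alpha>) (ps \<gamma>) g"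
        using loc_loc_left[OF _ gens_not_GP[OF that], of "{[]}" 0 "ps \<gamma>" "rank \<alpha>" "ps \<alpha>"] by simp
      then show ?thesis unfolding D(10)[OF that] P(2)[OF clr[OF that] F] by simp
    qed
  qed
  have "\<forall>w\<in>RC N. \<exists>h. h \<in> mod_hom (VV p (\<alpha> + \<beta>)) (L \<bullet> M) ?P \<and> (\<forall>u\<in>RC L. \<forall>v\<in>RC M. h (LM.cp u v) = f u v w)"
    using LM.conv_universal[OF P(1) bal] by blast
  then obtain G where G: "\<And>w. w \<in> RC N \<Longrightarrow> G w \<in> mod_hom (VV p (\<alpha> + \<beta>)) (L \<bullet> M) ?P"
    and Gcp: "\<And>u v w. \<lbrakk>u \<in> RC L; v \<in> RC M; w \<in> RC N\<rbrakk> \<Longrightarrow> G w (LM.cp u v) = f u v w"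
    by (metis (no_types, lifting))
  have zM: "z \<in> carrier (L \<bullet> M)" if "z \<in> RC (L \<bullet> M)" for z by (rule RC_closed(1)[OF LM.conv_vvm that])
  have Gc: "G w z \<in> carrier ?P" if "w \<in> RC N" "z \<in> RC (L \<bullet> M)" for w z
    by (rule mod_homD(1)[OF G[OF that(1)] zM[OF that(2)]])
  have Gact: "G w (act (L \<bullet> M) h z) = vact p \<rho> C (emb_l \<gamma> h) (G w z)"
    if "w \<in> RC N" "z \<in> RC (L \<bullet> M)" "h \<in> KF (pos (\<alpha> + \<beta>))" for w z h
    unfolding LM.mod_hom_act[OF G[OF that(1)] zM[OF that(2)]] emb_l_def
    by (rule P(2)[OF KF_VV[OF TH3'(1) that(3)] Gc[OF that(1,2)]])
  have Gadd: "G w (z \<oplus>\<^bsub>L \<bullet> M\<^esub> z') = G w z \<oplus>\<^bsub>C\<^esub> G w z'" if "w \<in> RC N" "z \<in> RC (L \<bullet> M)" "z' \<in> RC (L \<bullet> M)" for w z z'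
    using mod_homD(2)[OF G[OF that(1)] zM[OF that(2)] zM[OF that(3)]] by (simp add: par_sel)
  have hC: "vact p \<rho> C g (y \<oplus>\<^bsub>C\<^esub> y') = vact p \<rho> C g y \<oplus>\<^bsub>C\<^esub> vact p \<rho> C g y'"
    "vact p \<rho> C (g * h) y = vact p \<rho> C g (vact p \<rho> C h y)" "vact p \<rho> C g y \<in> carrier C"
    if "y \<in> carrier ?P" "y' \<in> carrier ?P" for g h y y'
    using VV.act_hom[OF C PC[OF that(1)] PC[OF that(2)]] by auto
  \<comment> \<open>Linearity in the last factor is known for pure tensors. It spreads to all of the
    restriction of \<open>L o M\<close>, because \<open>x\<close> commutes with the KLR action that
    generates it.\<close>
  have G_r: "G w' z = vact p \<rho> C x (G w z)"
    if z: "z \<in> RC (L \<bullet> M)" and w: "w \<in> RC N" "w' \<in> RC N"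
      and base: "\<And>u v. \<lbrakk>u \<in> RC L; v \<in> RC M\<rbrakk> \<Longrightarrow> f u v w' = vact p \<rho> C x (f u v w)"
      and comm: "\<And>h. h \<in> KF (pos (\<alpha> + \<beta>)) \<Longrightarrow> R.q (emb_l \<gamma> h * x) = R.q (x * emb_l \<gamma> h)" for w w' z x
    using z
  proof (induction z rule: LM.Res_induct)
    case (pure u v)
    then show ?case using w base by (simp add: Gcp)
  next
    case (act h z)
    note y = Gc[OF w(1) act(2)]
    show ?case
      unfolding Gact[OF w(1) act(2,1)] Gact[OF w(2) act(2,1)] act(3)
      using vact_cong[OF comm[OF act(1)], of C "G w z"] by (simp add: hC(2)[OF y y])
  next
    case (add z z')
    then show ?case using w by (simp add: Gadd hC(1)[OF Gc Gc])
  qed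
  have comm_scal: "R.q (emb_l \<gamma> h * scal c) = R.q (scal c * emb_l \<gamma> h)" for h c
    by (simp only: scal_central)
  have comm_gen: "R.q (emb_l \<gamma> h * loc_gen (rank \<alpha> + rank \<beta>) (ps (\<alpha> + \<beta>)) {[]} g) =
      R.q (loc_gen (rank \<alpha> + rank \<beta>) (ps (\<alpha> + \<beta>)) {[]} g * emb_l \<gamma> h)"
    if "h \<in> KF (pos (\<alpha> + \<beta>))" "g \<in> KLR_gens (pos \<gamma>)" for h g
    using emb_comm[OF TH3'(1) TH3(3) that(1) gen_KF[OF that(2)]] by (simp add: emb_r_hom ranks)
  have bal2: "LM_N.balanced C (\<lambda>z w. G w z)"
    unfolding LM_N.balanced_def degs
  proof (intro ballI conjI allI)
    fix z w assume z: "z \<in> RC (L \<bullet> M)" and w: "w \<in> RC N"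
    have zL: "z \<in> carrier (L \<bullet> M)" by (rule zM[OF z])
    show "G w z \<in> carrier C" by (rule PC[OF Gc[OF w z]])
    show "G w (z \<oplus>\<^bsub>L \<bullet> M\<^esub> z') = G w z \<oplus>\<^bsub>C\<^esub> G w z'" if "z' \<in> RC (L \<bullet> M)" for z'
      by (rule Gadd[OF w z that])
    show "G (w \<oplus>\<^bsub>N\<^esub> w') z = G w z \<oplus>\<^bsub>C\<^esub> G w' z" if w': "w' \<in> RC N" for w'
      using z
    proof (induction z rule: LM.Res_induct)
      case (pure u v)
      then show ?case using w w' RC_closed(3)[OF N w w'] triD(5)[OF f] by (simp add: Gcp)
    next
      case (act h z)
      show ?case
        unfolding Gact[OF w act(2,1)] Gact[OF w' act(2,1)] Gact[OF RC_closed(3)[OF N w w'] act(2,1)] act(3)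
        by (rule hC(1)[OF Gc[OF w act(2)] Gc[OF w' act(2)]])
    next
      case (add x y)
      note S = PC[OF Gc[OF w add(1)]] PC[OF Gc[OF w add(2)]] PC[OF Gc[OF w' add(1)]] PC[OF Gc[OF w' add(2)]]
      show ?case
        unfolding Gadd[OF w add(1,2)] Gadd[OF w' add(1,2)] Gadd[OF RC_closed(3)[OF N w w'] add(1,2)] add(3,4)
        using S by (simp add: C.a_ac)
    qed
    show "G w (vact p (\<alpha> + \<beta>) (L \<bullet> M) (scal c) z) = vact p \<rho> C (scal c) (G w z)" for c
      using Gact[OF w z free_alg_closed(3), of c] by (simp add: emb_l_hom degs)
    show "G (act N (scal c) w) z = vact p \<rho> C (scal c) (G w z)" for c
      by (rule G_r[OF z w RC_closed(2)[OF N w]]) (use triD(8)[OF f _ _ w] comm_scal in \<open>auto simp: free_alg_closed\<close>)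
    show "G w (vact p (\<alpha> + \<beta>) (L \<bullet> M) (Poly_Mapping.single [g] 1) z) = vact p \<rho> C (loc_gen 0 {[]} (ps \<gamma>) g) (G w z)"
      if "g \<in> KLR_gens (pos (\<alpha> + \<beta>))" for g
      using Gact[OF w z gen_KF[OF that]] by (simp add: emb_l_hom degs)
    show "G (act N (Poly_Mapping.single [g] 1) w) z = vact p \<rho> C (loc_gen (rank (\<alpha> + \<beta>)) (ps (\<alpha> + \<beta>)) {[]} g) (G w z)"
      if g: "g \<in> KLR_gens (pos \<gamma>)" for g
      unfolding ranks
    proof (rule G_r[OF z w RC_closed(2)[OF N w gen_KF[OF g]]])
      fix u v assume "u \<in> RC L" "v \<in> RC M"
      then show "f u v (act N (Poly_Mapping.single [g] 1) w) =
          vact p \<rho> C (loc_gen (rank \<alpha> + rank \<beta>) (ps (\<alpha> + \<beta>)) {[]} g) (f u v w)"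
        using triD(11)[OF f _ _ w g] act_e3[OF C f _ _ w loc_r_e3[OF g]] by simp
    qed (rule comm_gen[OF _ g])
  qed
  have C': "left_module (VV p (deg (L \<bullet> M) + \<gamma>)) C" using C by (simp add: degs)
  obtain H where H: "H \<in> mod_hom (VV p (deg (L \<bullet> M) + \<gamma>)) ((L \<bullet> M) \<bullet> N) C"
    "\<forall>z\<in>RC (L \<bullet> M). \<forall>w\<in>RC N. H (LM_N.cp z w) = G w z"
    using LM_N.conv_universal[OF C' bal2] by blast
  then show ?thesis
    by (intro bexI[of _ H]) (auto simp: LM.cp_RC Gcp degs)
qed

end

section \<open>Morphisms out of L o (M o N)\<close>

lemma theta_seqs_flips: "i \<in> theta_seqs \<alpha> \<Longrightarrow> flips i \<in> theta_seqs (\<alpha> :: 'k::field multiset)"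
  by (auto simp: theta_seqs_def flips_def multiset.map_comp comp_def)

context triple
begin

interpretation LM: conv_data p lam L M by unfold_locales (rule L M)+
interpretation MN: conv_data p lam M N by unfold_locales (rule M N)+
interpretation L_MN: conv_data p lam L "M \<bullet> N" by unfold_locales (rule L MN.conv_vvm)+
interpretation LM_N: conv_data p lam "L \<bullet> M" N by unfold_locales (rule N LM.conv_vvm)+
interpretation R: vv_signed p lam \<rho> by unfold_locales (rule TH3')

text \<open>\<open>bn\<close> counts the entries of \<open>M\<close> and \<open>N\<close>. So
  \<open>ks\<close> lists the last positions, where \<open>TT\<close> deposits the inverted entries
  of \<open>L\<close>, and \<open>J\<close> is the set of suffixes that arise in this way.\<close>

abbreviation "J \<equiv> flips ` ps \<alpha>"
abbreviation "bn \<equiv> rank \<beta> + rank \<gamma>"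
abbreviation "ks \<equiv> [bn..<bn + rank \<alpha>]"
abbreviation "TT \<equiv> (vv_signed.Tf ks :: 'k falg)"
abbreviation "ec \<equiv> e_conv p lam \<alpha> (\<beta> + \<gamma>)"
abbreviation "ep \<equiv> e_pos p lam \<rho>"

lemma valid_ks: "R.valid ks"
  by (auto simp: R.valid_def ranks strict_sorted_iff)

lemma T_gx: "t < bn \<Longrightarrow> R.q (TT * gx (rank \<alpha> + t) * ep) = R.q (gx t * TT * ep)"
  using R.X_T_gt[OF valid_ks, of t] ranks
  by (intro R.ep_sum) (simp add: qcl_mult mult.assoc add.commute)

lemma T_gs: "Suc t < bn \<Longrightarrow> R.q (TT * gs (rank \<alpha> + t) * ep) = R.q (gs t * TT * ep)"
  using R.S_T_gt[OF valid_ks, of t] ranks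
  by (intro R.ep_sum) (simp add: qcl_mult mult.assoc add.commute)

lemma T_ge:
  assumes "i \<in> ps \<alpha>" "length y = bn" "i @ y \<in> theta_seqs \<rho>"
  shows "R.T ks * R.E (i @ y) = R.E (y @ flips i) * R.T ks"
  using R.T_E[OF valid_ks assms(3)] dls_flips[of y bn i "[]"] assms length_ps[OF TH3(1)] by simp

text \<open>\<open>TT\<close> intertwines a generator placed behind the entries of \<open>L\<close>
  with the same generator placed without them, the suffix being extended by \<open>J\<close>. The
  general form covers the blocks of \<open>M o N\<close>, of \<open>M\<close> and of
  \<open>N\<close>.\<close>

lemma T_loc:
  assumes g: "g \<in> klr_gens r J0" and len: "\<And>a. a \<in> A' \<Longrightarrow> length a = s" "\<And>x. x \<in> J0 \<Longrightarrow> length x = r"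
      "\<And>b. b \<in> B' \<Longrightarrow> length b = t" and n: "s + r + t = bn"
    and mem: "\<And>i a x b. \<lbrakk>i \<in> ps \<alpha>; a \<in> A'; x \<in> J0; b \<in> B'\<rbrakk> \<Longrightarrow> i @ a @ x @ b \<in> theta_seqs \<rho>"
  shows "R.q (TT * loc_gen (rank \<alpha> + s) (cat (ps \<alpha>) A') B' g * ep) = R.q (loc_gen s A' (cat B' J) g * TT * ep)"
proof -
  from g consider l where "g = GX l" "l < r" | k where "g = GS k" "Suc k < r" | x where "g = GE x" "x \<in> J0"
    by (auto simp: klr_gens_def)
  then show ?thesis
  proof cases
    case 1
    then show ?thesis using T_gx[of "s + l"] n by (simp add: add.assoc)
  next
    case 2
    then show ?thesis using T_gs[of "s + k"] n by (simp add: add.assoc)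
  next
    case 3
    have "R.q (TT * loc_gen (rank \<alpha> + s) (cat (ps \<alpha>) A') B' g) =
        (\<Sum>i\<in>ps \<alpha>. \<Sum>a\<in>A'. \<Sum>b\<in>B'. R.T ks * R.E (i @ a @ x @ b))"
      by (simp add: 3 sum_cat[OF length_ps[OF TH3(1)]] qcl_mult qcl_sum sum_distrib_left)
    also have "\<dots> = (\<Sum>i\<in>ps \<alpha>. \<Sum>a\<in>A'. \<Sum>b\<in>B'. R.E (a @ x @ b @ flips i) * R.T ks)"
    proof (intro sum.cong refl)
      fix i a b assume h: "i \<in> ps \<alpha>" "a \<in> A'" "b \<in> B'"
      show "R.T ks * R.E (i @ a @ x @ b) = R.E (a @ x @ b @ flips i) * R.T ks"
        using T_ge[OF h(1) _ mem[OF h(1,2) 3(2) h(3)]] len h 3 n by simp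
    qed
    also have "\<dots> = (\<Sum>a\<in>A'. \<Sum>i\<in>ps \<alpha>. \<Sum>b\<in>B'. R.E (a @ x @ b @ flips i) * R.T ks)"
      by (rule sum.swap)
    also have "\<dots> = (\<Sum>a\<in>A'. \<Sum>b\<in>B'. \<Sum>i\<in>ps \<alpha>. R.E (a @ x @ b @ flips i) * R.T ks)"
      by (intro sum.cong refl sum.swap)
    also have "\<dots> = R.q (loc_gen s A' (cat B' J) g * TT)"
      by (simp add: 3 sum_cat[OF len(3)] qcl_mult qcl_sum sum_distrib_right sum.reindex[OF inj_flips])
    finally show ?thesis by (simp only: qcl_mult)
  qed
qed

lemma ep_ec: "R.q (ep * ec) = R.q ec"
  using e_pos_e_conv[OF TH3(1) TH3'(2)] by (simp add: add.assoc)

lemma ep_trans: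
  assumes "R.q (ep * e) = R.q e" "R.q (a * ep) = R.q (b * ep)" shows "R.q (a * e) = R.q (b * e)"
proof -
  have "R.q (x * e) = R.q (x * ep) * R.q e" for x
    by (simp only: qcl_mult mult.assoc assms(1)[unfolded qcl_mult])
  then show ?thesis by (simp only: assms(2))
qed

lemma mem_MN: "\<lbrakk>i \<in> ps \<alpha>; y \<in> ps (\<beta> + \<gamma>)\<rbrakk> \<Longrightarrow> i @ y \<in> theta_seqs \<rho>"
  using ps_theta[OF TH3'(3)] ps_append[of i \<alpha> y "\<beta> + \<gamma>"] by (simp add: add.assoc)

lemma T_loc_MN: "g \<in> KLR_gens (pos (\<beta> + \<gamma>)) \<Longrightarrow> R.q (TT * loc_gen (rank \<alpha>) (ps \<alpha>) {[]} g * ep) = R.q (loc_gen 0 {[]} J g * TT * ep)"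
  using T_loc[of g bn "ps (\<beta> + \<gamma>)" "{[]}" 0 "{[]}" 0] length_ps[OF TH3'(2)] mem_MN
  by (simp add: KLR_gens_eq[OF TH3'(2)] ranks)

lemma T_loc_M: "g \<in> KLR_gens (pos \<beta>) \<Longrightarrow> R.q (TT * loc_gen (rank \<alpha>) (ps \<alpha>) (ps \<gamma>) g * ep) = R.q (loc_gen 0 {[]} (cat (ps \<gamma>) J) g * TT * ep)"
  using T_loc[of g "rank \<beta>" "ps \<beta>" "{[]}" 0 "ps \<gamma>" "rank \<gamma>"] length_ps[OF TH3(2)] length_ps[OF TH3(3)] triple_theta
  by (simp add: KLR_gens_eq[OF TH3(2)])

lemma T_loc_N: "g \<in> KLR_gens (pos \<gamma>) \<Longrightarrow> R.q (TT * loc_gen (rank \<alpha> + rank \<beta>) AB {[]} g * ep) = R.q (loc_gen (rank \<beta>) (ps \<beta>) J g * TT * ep)"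
  using T_loc[of g "rank \<gamma>" "ps \<gamma>" "ps \<beta>" "rank \<beta>" "{[]}" 0] length_ps[OF TH3(2)] length_ps[OF TH3(3)] triple_theta
  by (simp add: KLR_gens_eq[OF TH3(3)])

abbreviation "locJ \<equiv> subst (loc_gen 0 {[]} J)"

lemma emb_r_ec: "h \<in> KF (pos (\<beta> + \<gamma>)) \<Longrightarrow> R.q (emb_r \<alpha> h * ec) = R.q (ec * emb_r \<alpha> h)"
  using emb_commutes(2)[OF TH3(1) TH3'(2), of h] by (simp add: add.assoc)

text \<open>From generators to the whole KLR algebra. The identity for one generator holds in front
  of \<open>ec\<close>; as \<open>ec\<close> commutes with the image of \<open>emb_r\<close>, it can
  be brought next to each letter in turn.\<close>

lemma T_emb:
  assumes "h \<in> KF (pos (\<beta> + \<gamma>))" shows "R.q (TT * emb_r \<alpha> h * ec) = R.q (locJ h * TT * ec)"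
  using assms
proof (induction h rule: free_alg_induct)
  case (scal c)
  then show ?case by (simp add: emb_r_hom subst_hom scal_central)
next
  case (gen g h)
  let ?l = "loc_gen (rank \<alpha>) (ps \<alpha>) {[]} g" and ?j = "loc_gen 0 {[]} J g"
  have 1: "R.q (TT * ?l * ec) = R.q (?j * TT * ec)"
    by (rule ep_trans[OF ep_ec T_loc_MN[OF gen(1)]])
  have "R.q (TT * emb_r \<alpha> (Poly_Mapping.single [g] 1 * h) * ec) = R.q (TT * ?l) * R.q (emb_r \<alpha> h * ec)"
    by (simp only: emb_r_hom qcl_mult mult.assoc)
  also have "\<dots> = R.q (TT * ?l * ec) * R.q (emb_r \<alpha> h)"
    by (simp only: emb_r_ec[OF gen(2)]) (simp only: qcl_mult mult.assoc)
  also have "\<dots> = R.q (?j * TT) * R.q (ec * emb_r \<alpha> h)"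
    by (simp only: 1) (simp only: qcl_mult mult.assoc)
  also have "\<dots> = R.q ?j * R.q (TT * emb_r \<alpha> h * ec)"
    by (simp only: emb_r_ec[OF gen(2), symmetric]) (simp only: qcl_mult mult.assoc)
  also have "\<dots> = R.q (locJ (Poly_Mapping.single [g] 1 * h) * TT * ec)"
    unfolding gen(3) by (simp only: subst_hom qcl_mult mult.assoc)
  finally show ?case .
next
  case (add g h)
  then show ?case by (simp only: emb_r_hom subst_hom distrib_left distrib_right qcl_add)
qed

text \<open>The algebra of \<open>M\<close> and \<open>N\<close> acts where their entries stand
  first, and in the values of \<open>f\<close> the entries of \<open>L\<close> do. So the universal
  property is applied to \<open>TT\<close> times \<open>f\<close>, and the resulting morphism is
  pulled back by \<open>Ti ks\<close>.\<close>

lemma tri_hom_right: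
  assumes C: "left_module (VV p \<rho>) C" and f: "tri C f"
  shows "\<exists>H \<in> mod_hom (VV p \<rho>) (L \<bullet> (M \<bullet> N)) C.
    \<forall>u\<in>RC L. \<forall>v\<in>RC M. \<forall>w\<in>RC N. H (conv_pure p lam L (M \<bullet> N) u (conv_pure p lam M N v w)) = f u v w"
proof -
  let ?P = "par (\<beta> + \<gamma>) \<rho> J C"
  have Jth: "finite J" "J \<subseteq> theta_seqs \<alpha>" using ps_theta[OF TH3(1)] theta_seqs_flips by auto
  have \<rho>: "\<rho> = (\<beta> + \<gamma>) + \<alpha>" by (simp add: ac_simps)
  note P = par_module[OF Jth \<rho> C]
  interpret C: left_module "VV p \<rho>" C by (rule C)
  note hom = VV.act_hom[OF C]
  let ?a = "vact p \<rho> C"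
  have PC: "y \<in> carrier ?P \<Longrightarrow> y \<in> carrier C" for y by (simp add: par_sel)
  \<comment> \<open>On this part \<open>Ti ks\<close> is a left inverse of \<open>TT\<close>, and
    identities that hold in front of \<open>ec\<close> can be used.\<close>
  define Xc where "Xc = {c \<in> carrier C. ?a ec c = c}"
  have XcC: "c \<in> Xc \<Longrightarrow> c \<in> carrier C" for c by (simp add: Xc_def)
  have via: "?a g c = ?a h c" if "c \<in> Xc" "R.q (g * ec) = R.q (h * ec)" for g h c
  proof -
    have "?a (x * ec) c = ?a x c" for x
      using that(1) by (simp add: Xc_def hom(4)[of c c])
    then show ?thesis using vact_cong[OF that(2), of C c] by simp
  qed
  have Ti: "?a (Ti ks) (?a TT c) = c" if c: "c \<in> Xc" for c
  proof -
    have "R.q (Ti ks * TT * ec) = R.q (1 * ec)"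
      by (rule ep_trans[OF ep_ec]) (simp add: R.Ti_T_ep[OF valid_ks])
    from via[OF c this] show ?thesis
      using hom(4)[OF XcC[OF c] XcC[OF c]] hom(5)[OF XcC[OF c] XcC[OF c]] by simp
  qed
  have Xc_emb: "?a (emb_r \<alpha> h) c \<in> Xc" if c: "c \<in> Xc" and h: "h \<in> KF (pos (\<beta> + \<gamma>))" for h c
    using vact_cong[OF emb_r_ec[OF h], of C c] c hom[of c c] by (simp add: Xc_def)
  have Xc_add: "c \<oplus>\<^bsub>C\<^esub> c' \<in> Xc" if "c \<in> Xc" "c' \<in> Xc" for c c'
    using that hom[of c c'] by (simp add: Xc_def)
  have fXc: "f u v w \<in> Xc" if w: "u \<in> RC L" "v \<in> RC M" "w \<in> RC N" for u v w
    using act_e3[OF C f w, of ec 1] e_conv_e3 hom(5)[of "f u v w" "f u v w"] triD(1)[OF f w] by (simp add: Xc_def)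
  have cl: "scal c \<in> carrier (free_alg (VV_gens (\<beta> + \<gamma>)))" for c :: 'k by (rule free_alg_closed)
  have cll: "loc_gen 0 {[]} (ps \<gamma>) g \<in> carrier (free_alg (VV_gens (\<beta> + \<gamma>)))" if "g \<in> KLR_gens (pos \<beta>)" for g
    by (rule block_gens_closed[OF TH3(2) block1[OF TH3(2,3)] that])
  have clr: "loc_gen (rank \<beta>) (ps \<beta>) {[]} g \<in> carrier (free_alg (VV_gens (\<beta> + \<gamma>)))" if "g \<in> KLR_gens (pos \<gamma>)" for g
    by (rule block_gens_closed[OF TH3(3) block2[OF TH3(2,3)] that])
  \<comment> \<open>\<open>TT\<close> turns a sequence \<open>i @ j @ k\<close> into
    \<open>j @ k @ flips i\<close>, whose suffix lies in \<open>J\<close>.\<close>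
  have TP: "?a TT (f u v w) \<in> carrier ?P" if w: "u \<in> RC L" "v \<in> RC M" "w \<in> RC N" for u v w
  proof -
    have "R.q (par_e (\<beta> + \<gamma>) J * TT * e3) = R.q (TT * e3)"
    proof (rule absorb)
      fix i j k assume h: "i \<in> ps \<alpha>" "j \<in> ps \<beta>" "k \<in> ps \<gamma>"
      have th: "j @ k \<in> theta_seqs (\<beta> + \<gamma>)" by (rule ps_theta[OF TH3'(2) ps_append[OF h(2,3)]])
      have Tg: "R.T ks * R.E (i @ j @ k) = R.E (j @ k @ flips i) * R.T ks"
        using T_ge[OF h(1) _ triple_theta[OF h]] h length_ps[OF TH3(2)] length_ps[OF TH3(3)] by simp
      have "R.q (par_e (\<beta> + \<gamma>) J * TT) * R.E (i @ j @ k) = R.q (par_e (\<beta> + \<gamma>) J) * R.E ((j @ k) @ flips i) * R.T ks"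
        by (simp add: qcl_mult mult.assoc Tg)
      also have "R.q (par_e (\<beta> + \<gamma>) J) * R.E ((j @ k) @ flips i) = R.E ((j @ k) @ flips i)"
        by (rule par_e3[OF Jth \<rho> th]) (use h in simp)
      finally show "R.q (par_e (\<beta> + \<gamma>) J * TT) * R.E (i @ j @ k) = R.T ks * R.E (i @ j @ k)"
        by (simp add: Tg)
    qed
    from act_e3[OF C f w this] show ?thesis
      using triD(1)[OF f w] hom[of "f u v w" "f u v w"] by (simp add: par_sel)
  qed
  have bal: "MN.balanced ?P (\<lambda>v w. ?a TT (f u v w))" if u: "u \<in> RC L" for u
    unfolding MN.balanced_def
  proof (intro ballI conjI allI)
    fix v w assume v: "v \<in> RC M" and w: "w \<in> RC N"
    note D = triD[OF f u v w] and F = TP[OF u v w]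
    note fh = hom(4)[OF D(1) D(1)]
    show "?a TT (f u v w) \<in> carrier ?P" by (rule F)
    show "?a TT (f u (v \<oplus>\<^bsub>M\<^esub> v') w) = ?a TT (f u v w) \<oplus>\<^bsub>?P\<^esub> ?a TT (f u v' w)" if "v' \<in> RC M" for v'
      using D(4)[OF that] hom(3)[OF D(1) triD(1)[OF f u that w]] by (simp add: par_sel)
    show "?a TT (f u v (w \<oplus>\<^bsub>N\<^esub> w')) = ?a TT (f u v w) \<oplus>\<^bsub>?P\<^esub> ?a TT (f u v w')" if "w' \<in> RC N" for w'
      using D(5)[OF that] hom(3)[OF D(1) triD(1)[OF f u v that]] by (simp add: par_sel)
    have sc: "?a TT (?a (scal c) (f u v w)) = vact p (\<beta> + \<gamma>) ?P (scal c) (?a TT (f u v w))" for c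
      unfolding P(2)[OF cl F] subst_hom fh[symmetric] scal_central ..
    show "?a TT (f u (act M (scal c) v) w) = vact p (\<beta> + \<gamma>) ?P (scal c) (?a TT (f u v w))" for c
      using D(7) sc by simp
    show "?a TT (f u v (act N (scal c) w)) = vact p (\<beta> + \<gamma>) ?P (scal c) (?a TT (f u v w))" for c
      using D(8) sc by simp
    show "?a TT (f u (act M (Poly_Mapping.single [g] 1) v) w) = vact p (\<beta> + \<gamma>) ?P (loc_gen 0 {[]} (ps \<gamma>) g) (?a TT (f u v w))"
      if g: "g \<in> KLR_gens (pos \<beta>)" for g
      using act_e3[OF C f u v w ep_trans[OF ep_e3 T_loc_M[OF g]]]
        loc_loc_left[of "ps \<gamma>" "rank \<gamma>" g J, OF length_ps[OF TH3(3)] gens_not_GP[OF g]]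
      by (simp add: D(10)[OF g] P(2)[OF cll[OF g] F] fh)
    have "subst (loc_gen 0 {[]} J) (loc_gen (rank \<beta>) (ps \<beta>) {[]} g) = loc_gen (rank \<beta>) (ps \<beta>) J g"
      if "g \<in> KLR_gens (pos \<gamma>)" for g
      using loc_loc_left[of "{[]}" 0 g J "rank \<beta>" "ps \<beta>", OF _ gens_not_GP[OF that]] by simp
    then show "?a TT (f u v (act N (Poly_Mapping.single [g] 1) w)) = vact p (\<beta> + \<gamma>) ?P (loc_gen (rank \<beta>) (ps \<beta>) {[]} g) (?a TT (f u v w))"
      if g: "g \<in> KLR_gens (pos \<gamma>)" for g
      using act_e3[OF C f u v w ep_trans[OF ep_e3 T_loc_N[OF g]]] g
      by (simp add: D(11)[OF g] P(2)[OF clr[OF g] F] fh)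
  qed
  have "\<forall>u\<in>RC L. \<exists>h. h \<in> mod_hom (VV p (\<beta> + \<gamma>)) (M \<bullet> N) ?P \<and> (\<forall>v\<in>RC M. \<forall>w\<in>RC N. h (MN.cp v w) = ?a TT (f u v w))"
    using MN.conv_universal[OF P(1) bal] by blast
  then obtain G where G: "\<And>u. u \<in> RC L \<Longrightarrow> G u \<in> mod_hom (VV p (\<beta> + \<gamma>)) (M \<bullet> N) ?P"
    and Gcp: "\<And>u v w. \<lbrakk>u \<in> RC L; v \<in> RC M; w \<in> RC N\<rbrakk> \<Longrightarrow> G u (MN.cp v w) = ?a TT (f u v w)"
    by (metis (no_types, lifting))
  have zM: "z \<in> carrier (M \<bullet> N)" if "z \<in> RC (M \<bullet> N)" for z by (rule RC_closed(1)[OF MN.conv_vvm that])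
  have Gc: "G u z \<in> carrier ?P" if "u \<in> RC L" "z \<in> RC (M \<bullet> N)" for u z
    by (rule mod_homD(1)[OF G[OF that(1)] zM[OF that(2)]])
  have Gact: "G u (act (M \<bullet> N) h z) = ?a (locJ h) (G u z)"
    if "u \<in> RC L" "z \<in> RC (M \<bullet> N)" "h \<in> KF (pos (\<beta> + \<gamma>))" for u z h
    unfolding MN.mod_hom_act[OF G[OF that(1)] zM[OF that(2)]]
    by (rule P(2)[OF KF_VV[OF TH3'(2) that(3)] Gc[OF that(1,2)]])
  have Gadd: "G u (z \<oplus>\<^bsub>M \<bullet> N\<^esub> z') = G u z \<oplus>\<^bsub>C\<^esub> G u z'" if "u \<in> RC L" "z \<in> RC (M \<bullet> N)" "z' \<in> RC (M \<bullet> N)" for u z z'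
    using mod_homD(2)[OF G[OF that(1)] zM[OF that(2)] zM[OF that(3)]] by (simp add: par_sel)
  have T_act: "?a (locJ h) (?a TT c) = ?a TT (?a (emb_r \<alpha> h) c)" if c: "c \<in> Xc" and h: "h \<in> KF (pos (\<beta> + \<gamma>))" for c h
    using via[OF c T_emb[OF h]] hom(4)[OF XcC[OF c] XcC[OF c]] by simp
  \<comment> \<open>Pulling back requires the values of \<open>G u\<close> to lie in the image of
    \<open>Xc\<close> under \<open>TT\<close>. This holds for pure tensors and is preserved by the
    KLR action, which \<open>TT\<close> carries over by \<open>T_act\<close>.\<close>
  have ex: "\<exists>c\<in>Xc. G u z = ?a TT c" if u: "u \<in> RC L" and z: "z \<in> RC (M \<bullet> N)" for u z
    using z
  proof (induction z rule: MN.Res_induct)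
    case (pure v w)
    then show ?case using Gcp[OF u] fXc[OF u] by blast
  next
    case (act h z)
    then obtain c where c: "c \<in> Xc" "G u z = ?a TT c" by blast
    show ?case
      by (rule bexI[OF _ Xc_emb[OF c(1) act(1)]])
        (simp only: Gact[OF u act(2,1)] c(2) T_act[OF c(1) act(1)])
  next
    case (add x y)
    then obtain c c' where c: "c \<in> Xc" "c' \<in> Xc" "G u x = ?a TT c" "G u y = ?a TT c'" by blast
    show ?case
      by (rule bexI[OF _ Xc_add[OF c(1,2)]])
        (simp only: Gadd[OF u add(1,2)] c(3,4) hom(3)[OF XcC[OF c(1)] XcC[OF c(2)]])
  qed
  \<comment> \<open>Multiplication by \<open>Ti ks\<close> recovers the preimage in
    \<open>Xc\<close>, so \<open>F\<close> inherits additivity and linearity from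
    \<open>G\<close>.\<close>
  define F where "F u z = ?a (Ti ks) (G u z)" for u z
  have F: "F u z \<in> Xc" "G u z = ?a TT (F u z)" if "u \<in> RC L" "z \<in> RC (M \<bullet> N)" for u z
    using ex[OF that] Ti by (auto simp: F_def)
  have FI: "F u z = c" if "G u z = ?a TT c" "c \<in> Xc" for u z c
    using that Ti by (simp add: F_def)
  have Fcp: "F u (MN.cp v w) = f u v w" if "u \<in> RC L" "v \<in> RC M" "w \<in> RC N" for u v w
    by (rule FI[OF Gcp[OF that] fXc[OF that]])
  have Fact: "F u (act (M \<bullet> N) h z) = ?a (emb_r \<alpha> h) (F u z)"
    if u: "u \<in> RC L" and z: "z \<in> RC (M \<bullet> N)" and h: "h \<in> KF (pos (\<beta> + \<gamma>))" for u z h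
    by (rule FI[OF _ Xc_emb[OF F(1)[OF u z] h]]) (simp only: Gact[OF u z h] F(2)[OF u z] T_act[OF F(1)[OF u z] h])
  have Fadd: "F u (z \<oplus>\<^bsub>M \<bullet> N\<^esub> z') = F u z \<oplus>\<^bsub>C\<^esub> F u z'"
    if u: "u \<in> RC L" and z: "z \<in> RC (M \<bullet> N)" "z' \<in> RC (M \<bullet> N)" for u z z'
    by (rule FI[OF _ Xc_add[OF F(1)[OF u z(1)] F(1)[OF u z(2)]]])
      (simp only: Gadd[OF u z] F(2)[OF u z(1)] F(2)[OF u z(2)] hom(3)[OF XcC[OF F(1)[OF u z(1)]] XcC[OF F(1)[OF u z(2)]]])
  have Fc: "F u z \<in> carrier C" if "u \<in> RC L" "z \<in> RC (M \<bullet> N)" for u z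
    by (rule XcC[OF F(1)[OF that]])
  have F_l: "F u' z = ?a x (F u z)"
    if z: "z \<in> RC (M \<bullet> N)" and u: "u \<in> RC L" "u' \<in> RC L"
      and base: "\<And>v w. \<lbrakk>v \<in> RC M; w \<in> RC N\<rbrakk> \<Longrightarrow> f u' v w = ?a x (f u v w)"
      and comm: "\<And>h. h \<in> KF (pos (\<beta> + \<gamma>)) \<Longrightarrow> R.q (emb_r \<alpha> h * x) = R.q (x * emb_r \<alpha> h)" for u u' z x
    using z
  proof (induction z rule: MN.Res_induct)
    case (pure v w)
    then show ?case using u base by (simp add: Fcp)
  next
    case (act h z)
    note y = Fc[OF u(1) act(2)]
    show ?case
      unfolding Fact[OF u(1) act(2,1)] Fact[OF u(2) act(2,1)] act(3)
      using vact_cong[OF comm[OF act(1)], of C "F u z"] by (simp add: hom(4)[OF y y])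
  next
    case (add z z')
    show ?case
      unfolding Fadd[OF u(1) add(1,2)] Fadd[OF u(2) add(1,2)] add(3,4)
      by (rule hom(3)[OF Fc[OF u(1) add(1)] Fc[OF u(1) add(2)], symmetric])
  qed
  have bal2: "L_MN.balanced C F"
    unfolding L_MN.balanced_def degs add.assoc[symmetric]
  proof (intro ballI conjI allI)
    fix u z assume u: "u \<in> RC L" and z: "z \<in> RC (M \<bullet> N)"
    show "F u z \<in> carrier C" by (rule Fc[OF u z])
    show "F u (z \<oplus>\<^bsub>M \<bullet> N\<^esub> z') = F u z \<oplus>\<^bsub>C\<^esub> F u z'" if "z' \<in> RC (M \<bullet> N)" for z'
      by (rule Fadd[OF u z that])
    show "F (u \<oplus>\<^bsub>L\<^esub> u') z = F u z \<oplus>\<^bsub>C\<^esub> F u' z" if u': "u' \<in> RC L" for u'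
      using z
    proof (induction z rule: MN.Res_induct)
      case (pure v w)
      then show ?case using u u' RC_closed(3)[OF L u u'] triD(3)[OF f] by (simp add: Fcp)
    next
      case (act h z)
      show ?case
        unfolding Fact[OF u act(2,1)] Fact[OF u' act(2,1)] Fact[OF RC_closed(3)[OF L u u'] act(2,1)] act(3)
        by (rule hom(3)[OF Fc[OF u act(2)] Fc[OF u' act(2)]])
    next
      case (add x y)
      note S = Fc[OF u add(1)] Fc[OF u add(2)] Fc[OF u' add(1)] Fc[OF u' add(2)]
      show ?case
        unfolding Fadd[OF u add(1,2)] Fadd[OF u' add(1,2)] Fadd[OF RC_closed(3)[OF L u u'] add(1,2)] add(3,4)
        using S by (simp add: C.a_ac)
    qed
    show "F u (vact p (\<beta> + \<gamma>) (M \<bullet> N) (scal c) z) = ?a (scal c) (F u z)" for c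
      using Fact[OF u z free_alg_closed(3), of c] by (simp add: emb_r_hom degs)
    show "F (act L (scal c) u) z = ?a (scal c) (F u z)" for c
      by (rule F_l[OF z u RC_closed(2)[OF L u]]) (use triD(6)[OF f u] in \<open>auto simp: free_alg_closed scal_central\<close>)
    show "F u (vact p (\<beta> + \<gamma>) (M \<bullet> N) (Poly_Mapping.single [g] 1) z) = ?a (loc_gen (rank \<alpha>) (ps \<alpha>) {[]} g) (F u z)"
      if "g \<in> KLR_gens (pos (\<beta> + \<gamma>))" for g
      using Fact[OF u z gen_KF[OF that]] by (simp add: emb_r_hom degs)
    show "F (act L (Poly_Mapping.single [g] 1) u) z = ?a (loc_gen 0 {[]} (ps (\<beta> + \<gamma>)) g) (F u z)"
      if g: "g \<in> KLR_gens (pos \<alpha>)" for g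
    proof (rule F_l[OF z u RC_closed(2)[OF L u gen_KF[OF g]]])
      fix v w assume "v \<in> RC M" "w \<in> RC N"
      then show "f (act L (Poly_Mapping.single [g] 1) u) v w = ?a (loc_gen 0 {[]} (ps (\<beta> + \<gamma>)) g) (f u v w)"
        using triD(9)[OF f u _ _ g] act_e3[OF C f u _ _ loc_l_e3[OF g]] by simp
    next
      fix h assume h: "h \<in> KF (pos (\<beta> + \<gamma>))"
      show "R.q (emb_r \<alpha> h * loc_gen 0 {[]} (ps (\<beta> + \<gamma>)) g) = R.q (loc_gen 0 {[]} (ps (\<beta> + \<gamma>)) g * emb_r \<alpha> h)"
        using emb_comm[OF TH3(1) TH3'(2) gen_KF[OF g] h] by (simp add: emb_l_hom add.assoc)
    qed
  qed
  have C': "left_module (VV p (\<alpha> + deg (M \<bullet> N))) C" using C by (simp add: degs add.assoc)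
  obtain H where H: "H \<in> mod_hom (VV p (\<alpha> + deg (M \<bullet> N))) (L \<bullet> (M \<bullet> N)) C"
    "\<forall>u\<in>RC L. \<forall>z\<in>RC (M \<bullet> N). H (L_MN.cp u z) = F u z"
    using L_MN.conv_universal[OF C' bal2] by blast
  then show ?thesis
    by (intro bexI[of _ H]) (auto simp: MN.cp_RC Fcp degs add.assoc)
qed

end

section \<open>The associativity isomorphism\<close>

lemma mod_hom_comp:
  assumes "g \<in> mod_hom R A B" "h \<in> mod_hom R B C" shows "h \<circ> g \<in> mod_hom R A C"
  using assms unfolding mod_hom_def by (auto simp: Pi_def)

lemma mod_hom_id: "id \<in> mod_hom R A A"
  by (auto simp: mod_hom_def)

context triple
begin

interpretation LM: conv_data p lam L M by unfold_locales (rule L M)+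
interpretation MN: conv_data p lam M N by unfold_locales (rule M N)+
interpretation L_MN: conv_data p lam L "M \<bullet> N" by unfold_locales (rule L MN.conv_vvm)+
interpretation LM_N: conv_data p lam "L \<bullet> M" N by unfold_locales (rule N LM.conv_vvm)+
interpretation R: vv_signed p lam \<rho> by unfold_locales (rule TH3')

abbreviation "pure_l u v w \<equiv> conv_pure p lam (L \<bullet> M) N (conv_pure p lam L M u v) w"
abbreviation "pure_r u v w \<equiv> conv_pure p lam L (M \<bullet> N) u (conv_pure p lam M N v w)"

lemma modules: "left_module (VV p \<rho>) ((L \<bullet> M) \<bullet> N)" "left_module (VV p \<rho>) (L \<bullet> (M \<bullet> N))"
  using vvm_module[OF LM_N.conv_vvm] vvm_module[OF L_MN.conv_vvm] by (simp_all add: degs)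

lemma pure_closed: assumes "u \<in> RC L" "v \<in> RC M" "w \<in> RC N"
  shows "pure_l u v w \<in> carrier ((L \<bullet> M) \<bullet> N)" "pure_r u v w \<in> carrier (L \<bullet> (M \<bullet> N))"
  using assms by (simp_all add: LM_N.cp_closed L_MN.cp_closed LM.cp_RC MN.cp_RC)

lemma hom_eq_left:
  assumes C: "left_module (VV p \<rho>) C" and g: "g \<in> mod_hom (VV p \<rho>) ((L \<bullet> M) \<bullet> N) C"
    and h: "h \<in> mod_hom (VV p \<rho>) ((L \<bullet> M) \<bullet> N) C"
    and eq: "\<And>u v w. \<lbrakk>u \<in> RC L; v \<in> RC M; w \<in> RC N\<rbrakk> \<Longrightarrow> g (pure_l u v w) = h (pure_l u v w)"
    and x: "x \<in> carrier ((L \<bullet> M) \<bullet> N)"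
  shows "g x = h x"
proof -
  have C': "left_module (VV p (deg (L \<bullet> M) + \<gamma>)) C" using C by (simp add: degs)
  have g': "g \<in> mod_hom (VV p (deg (L \<bullet> M) + \<gamma>)) ((L \<bullet> M) \<bullet> N) C" using g by (simp add: degs)
  have h': "h \<in> mod_hom (VV p (deg (L \<bullet> M) + \<gamma>)) ((L \<bullet> M) \<bullet> N) C" using h by (simp add: degs)
  have "g (LM_N.cp z w) = h (LM_N.cp z w)" if z: "z \<in> RC (L \<bullet> M)" and w: "w \<in> RC N" for z w
    using z
  proof (induction z rule: LM.Res_induct)
    case (pure u v)
    then show ?case using eq w by simp
  next
    case (act f z)
    have f: "f \<in> KF (pos (deg (L \<bullet> M)))" using act(1) by (simp add: degs)
    have c: "LM_N.cp z w \<in> carrier ((L \<bullet> M) \<bullet> N)" by (rule LM_N.cp_closed[OF act(2) w])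
    show ?case
      by (simp only: LM_N.cp_emb(1)[OF act(2) w f] LM_N.mod_hom_act[OF g' c] LM_N.mod_hom_act[OF h' c] act(3))
  next
    case (add y z)
    note c = LM_N.cp_closed[OF add(1) w] LM_N.cp_closed[OF add(2) w]
    show ?case
      by (simp only: LM_N.cp_add(1)[OF add(1,2) w] mod_homD(2)[OF g c] mod_homD(2)[OF h c] add(3,4))
  qed
  then show ?thesis by (rule LM_N.hom_eqI[OF C' g' h' _ x])
qed

lemma hom_eq_right:
  assumes C: "left_module (VV p \<rho>) C" and g: "g \<in> mod_hom (VV p \<rho>) (L \<bullet> (M \<bullet> N)) C"
    and h: "h \<in> mod_hom (VV p \<rho>) (L \<bullet> (M \<bullet> N)) C"
    and eq: "\<And>u v w. \<lbrakk>u \<in> RC L; v \<in> RC M; w \<in> RC N\<rbrakk> \<Longrightarrow> g (pure_r u v w) = h (pure_r u v w)"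
    and x: "x \<in> carrier (L \<bullet> (M \<bullet> N))"
  shows "g x = h x"
proof -
  have C': "left_module (VV p (\<alpha> + deg (M \<bullet> N))) C" using C by (simp add: degs add.assoc)
  have g': "g \<in> mod_hom (VV p (\<alpha> + deg (M \<bullet> N))) (L \<bullet> (M \<bullet> N)) C" using g by (simp add: degs add.assoc)
  have h': "h \<in> mod_hom (VV p (\<alpha> + deg (M \<bullet> N))) (L \<bullet> (M \<bullet> N)) C" using h by (simp add: degs add.assoc)
  have "g (L_MN.cp u z) = h (L_MN.cp u z)" if u: "u \<in> RC L" and z: "z \<in> RC (M \<bullet> N)" for z u
    using z
  proof (induction z rule: MN.Res_induct)
    case (pure v w)
    then show ?case using eq u by simp
  next
    case (act f z)
    have f: "f \<in> KF (pos (deg (M \<bullet> N)))" using act(1) by (simp add: degs)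
    have c: "L_MN.cp u z \<in> carrier (L \<bullet> (M \<bullet> N))" by (rule L_MN.cp_closed[OF u act(2)])
    show ?case
      by (simp only: L_MN.cp_emb(2)[OF u act(2) f] L_MN.mod_hom_act[OF g' c] L_MN.mod_hom_act[OF h' c] act(3))
  next
    case (add y z)
    note c = L_MN.cp_closed[OF u add(1)] L_MN.cp_closed[OF u add(2)]
    show ?case
      by (simp only: L_MN.cp_add(2)[OF u add(1,2)] mod_homD(2)[OF g c] mod_homD(2)[OF h c] add(3,4))
  qed
  then show ?thesis by (rule L_MN.hom_eqI[OF C' g' h' _ x])
qed

lemma e3_l: "emb_l \<gamma> (e_conv p lam \<alpha> \<beta>) = e3"
  by (simp add: e_conv_def e3_def emb_l_hom)

lemma e3_r: "emb_r \<alpha> (e_conv p lam \<beta> \<gamma>) = e3"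
proof -
  have "emb_r \<alpha> (e_conv p lam \<beta> \<gamma>) = (\<Sum>j\<in>ps \<beta>. \<Sum>k\<in>ps \<gamma>. \<Sum>i\<in>ps \<alpha>. ge (i @ j @ k))"
    by (simp add: e_conv_def emb_r_hom)
  also have "\<dots> = (\<Sum>j\<in>ps \<beta>. \<Sum>i\<in>ps \<alpha>. \<Sum>k\<in>ps \<gamma>. ge (i @ j @ k))"
    by (intro sum.cong refl sum.swap)
  also have "\<dots> = e3" unfolding e3_def by (rule sum.swap)
  finally show ?thesis .
qed

lemma tri_l: "tri ((L \<bullet> M) \<bullet> N) pure_l"
  unfolding tri_def
proof (intro ballI conjI allI)
  fix u v w assume h: "u \<in> RC L" "v \<in> RC M" "w \<in> RC N"
  let ?C = "(L \<bullet> M) \<bullet> N"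
  note c = LM.cp_RC[OF h(1,2)] and K = pure_closed(1)[OF h]
  note G = LM.cp_gen[OF h(1,2)]
  have E: "LM_N.cp (vact p (\<alpha> + \<beta>) (L \<bullet> M) f (LM.cp u v)) w = vact p \<rho> ?C (emb_l \<gamma> f) (pure_l u v w)"
    if "f \<in> KF (pos (\<alpha> + \<beta>))" for f
    using LM_N.cp_emb(1)[OF c h(3), of f] that by (simp add: degs)
  have R: "LM_N.cp (LM.cp u v) (act N f w) = vact p \<rho> ?C (emb_r (\<alpha> + \<beta>) f) (pure_l u v w)"
    if "f \<in> KF (pos \<gamma>)" for f
    using LM_N.cp_emb(2)[OF c h(3) that] by (simp add: degs)
  show "pure_l u v w \<in> carrier ?C" by (rule K)
  show e3: "vact p \<rho> ?C e3 (pure_l u v w) = pure_l u v w"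
    using E[OF e_conv_KF[OF TH3(1,2)]] LM.cp_e[OF h(1,2)] by (simp add: e3_l degs)
  show "pure_l (u \<oplus>\<^bsub>L\<^esub> u') v w = pure_l u v w \<oplus>\<^bsub>?C\<^esub> pure_l u' v w" if "u' \<in> RC L" for u'
    using LM.cp_add(1)[OF h(1) that h(2)] LM_N.cp_add(1)[OF c LM.cp_RC[OF that h(2)] h(3)] by simp
  show "pure_l u (v \<oplus>\<^bsub>M\<^esub> v') w = pure_l u v w \<oplus>\<^bsub>?C\<^esub> pure_l u v' w" if "v' \<in> RC M" for v'
    using LM.cp_add(2)[OF h(1,2) that] LM_N.cp_add(1)[OF c LM.cp_RC[OF h(1) that] h(3)] by simp
  show "pure_l u v (w \<oplus>\<^bsub>N\<^esub> w') = pure_l u v w \<oplus>\<^bsub>?C\<^esub> pure_l u v w'" if "w' \<in> RC N" for w'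
    by (rule LM_N.cp_add(2)[OF c h(3) that])
  show "pure_l (act L (scal a) u) v w = vact p \<rho> ?C (scal a) (pure_l u v w)" for a
    unfolding G(3) E[OF free_alg_closed(3)] emb_l_hom ..
  show "pure_l u (act M (scal a) v) w = vact p \<rho> ?C (scal a) (pure_l u v w)" for a
    unfolding G(4) E[OF free_alg_closed(3)] emb_l_hom ..
  show "pure_l u v (act N (scal a) w) = vact p \<rho> ?C (scal a) (pure_l u v w)" for a
    unfolding R[OF free_alg_closed(3)] emb_r_hom ..
  show "pure_l (act L (Poly_Mapping.single [g] 1) u) v w = vact p \<rho> ?C (loc_gen 0 {[]} BC g) (pure_l u v w)"
    if g: "g \<in> KLR_gens (pos \<alpha>)" for g
    using loc_loc_left[of "ps \<beta>" "rank \<beta>" g "ps \<gamma>", OF length_ps[OF TH3(2)] gens_not_GP[OF g]]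
    by (simp only: G(1)[OF g] E[OF KF_cl_l[OF TH3(1,2) g]] emb_l_def)
  show "pure_l u (act M (Poly_Mapping.single [g] 1) v) w = vact p \<rho> ?C (loc_gen (rank \<alpha>) (ps \<alpha>) (ps \<gamma>) g) (pure_l u v w)"
    if g: "g \<in> KLR_gens (pos \<beta>)" for g
    using loc_loc_left[of "{[]}" 0 g "ps \<gamma>", OF _ gens_not_GP[OF g]]
    by (simp add: G(2)[OF g] E[OF KF_cl_r[OF TH3(1,2) g]] emb_l_def)
  have e: "vact p \<rho> ?C (x * e3) (pure_l u v w) = vact p \<rho> ?C x (pure_l u v w)" for x
    by (simp add: VV.act_hom(4)[OF modules(1) K K] e3)
  show "pure_l u v (act N (Poly_Mapping.single [g] 1) w) = vact p \<rho> ?C (loc_gen (rank \<alpha> + rank \<beta>) AB {[]} g) (pure_l u v w)"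
    if g: "g \<in> KLR_gens (pos \<gamma>)" for g
    using R[OF gen_KF[OF g]] vact_cong[OF loc_r_e3[OF g], of ?C "pure_l u v w"] by (simp add: emb_r_hom ranks e)
qed

lemma tri_r: "tri (L \<bullet> (M \<bullet> N)) pure_r"
  unfolding tri_def
proof (intro ballI conjI allI)
  fix u v w assume h: "u \<in> RC L" "v \<in> RC M" "w \<in> RC N"
  let ?C = "L \<bullet> (M \<bullet> N)"
  note c = MN.cp_RC[OF h(2,3)] and K = pure_closed(2)[OF h]
  note G = MN.cp_gen[OF h(2,3)]
  have E: "L_MN.cp u (vact p (\<beta> + \<gamma>) (M \<bullet> N) f (MN.cp v w)) = vact p \<rho> ?C (emb_r \<alpha> f) (pure_r u v w)"
    if "f \<in> KF (pos (\<beta> + \<gamma>))" for f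
    using L_MN.cp_emb(2)[OF h(1) c, of f] that by (simp add: degs add.assoc)
  have R: "L_MN.cp (act L f u) (MN.cp v w) = vact p \<rho> ?C (emb_l (\<beta> + \<gamma>) f) (pure_r u v w)"
    if "f \<in> KF (pos \<alpha>)" for f
    using L_MN.cp_emb(1)[OF h(1) c that] by (simp add: degs add.assoc)
  show "pure_r u v w \<in> carrier ?C" by (rule K)
  show e3: "vact p \<rho> ?C e3 (pure_r u v w) = pure_r u v w"
    using E[OF e_conv_KF[OF TH3(2,3)]] MN.cp_e[OF h(2,3)] by (simp add: e3_r degs)
  show "pure_r (u \<oplus>\<^bsub>L\<^esub> u') v w = pure_r u v w \<oplus>\<^bsub>?C\<^esub> pure_r u' v w" if "u' \<in> RC L" for u'
    by (rule L_MN.cp_add(1)[OF h(1) that c])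
  show "pure_r u (v \<oplus>\<^bsub>M\<^esub> v') w = pure_r u v w \<oplus>\<^bsub>?C\<^esub> pure_r u v' w" if "v' \<in> RC M" for v'
    using MN.cp_add(1)[OF h(2) that h(3)] L_MN.cp_add(2)[OF h(1) c MN.cp_RC[OF that h(3)]] by simp
  show "pure_r u v (w \<oplus>\<^bsub>N\<^esub> w') = pure_r u v w \<oplus>\<^bsub>?C\<^esub> pure_r u v w'" if "w' \<in> RC N" for w'
    using MN.cp_add(2)[OF h(2,3) that] L_MN.cp_add(2)[OF h(1) c MN.cp_RC[OF h(2) that]] by simp
  show "pure_r (act L (scal a) u) v w = vact p \<rho> ?C (scal a) (pure_r u v w)" for a
    unfolding R[OF free_alg_closed(3)] emb_l_hom ..
  show "pure_r u (act M (scal a) v) w = vact p \<rho> ?C (scal a) (pure_r u v w)" for a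
    unfolding G(3) E[OF free_alg_closed(3)] emb_r_hom ..
  show "pure_r u v (act N (scal a) w) = vact p \<rho> ?C (scal a) (pure_r u v w)" for a
    unfolding G(4) E[OF free_alg_closed(3)] emb_r_hom ..
  have e: "vact p \<rho> ?C (x * e3) (pure_r u v w) = vact p \<rho> ?C x (pure_r u v w)" for x
    by (simp add: VV.act_hom(4)[OF modules(2) K K] e3)
  show "pure_r (act L (Poly_Mapping.single [g] 1) u) v w = vact p \<rho> ?C (loc_gen 0 {[]} BC g) (pure_r u v w)"
    if g: "g \<in> KLR_gens (pos \<alpha>)" for g
    using R[OF gen_KF[OF g]] vact_cong[OF loc_l_e3[OF g], of ?C "pure_r u v w"] by (simp add: emb_l_hom e)
  show "pure_r u (act M (Poly_Mapping.single [g] 1) v) w = vact p \<rho> ?C (loc_gen (rank \<alpha>) (ps \<alpha>) (ps \<gamma>) g) (pure_r u v w)"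
    if g: "g \<in> KLR_gens (pos \<beta>)" for g
    using loc_loc_right[of "ps \<alpha>" "rank \<alpha>" g "rank \<alpha>" 0 "{[]}" "ps \<gamma>", OF length_ps[OF TH3(1)] gens_not_GP[OF g]]
    by (simp add: G(1)[OF g] E[OF KF_cl_l[OF TH3(2,3) g]] emb_r_def)
  show "pure_r u v (act N (Poly_Mapping.single [g] 1) w) = vact p \<rho> ?C (loc_gen (rank \<alpha> + rank \<beta>) AB {[]} g) (pure_r u v w)"
    if g: "g \<in> KLR_gens (pos \<gamma>)" for g
    using loc_loc_right[of "ps \<alpha>" "rank \<alpha>" g "rank \<alpha>" "rank \<beta>" "ps \<beta>" "{[]}", OF length_ps[OF TH3(1)] gens_not_GP[OF g]]
    by (simp add: G(2)[OF g] E[OF KF_cl_r[OF TH3(2,3) g]] emb_r_def)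
qed

abbreviation "ass \<equiv> assoc p lam L M N"
abbreviation "ass' \<equiv> assoc_inv p lam L M N"

text \<open>The pure tensors of either bracketing form a map satisfying \<open>tri\<close>, so there
  are morphisms \<open>H\<close> and \<open>K\<close> in both directions that match them. Their
  composites fix the pure tensors and hence are identities, and the same argument gives uniqueness
  for \<open>THE\<close>.\<close>

theorem assoc_props:
  shows "ass \<in> mod_hom (VV p \<rho>) ((L \<bullet> M) \<bullet> N) (L \<bullet> (M \<bullet> N))"
    and "\<lbrakk>u \<in> RC L; v \<in> RC M; w \<in> RC N\<rbrakk> \<Longrightarrow> ass (pure_l u v w) = pure_r u v w"
    and "ass' \<in> mod_hom (VV p \<rho>) (L \<bullet> (M \<bullet> N)) ((L \<bullet> M) \<bullet> N)"
    and "x \<in> carrier ((L \<bullet> M) \<bullet> N) \<Longrightarrow> ass' (ass x) = x"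
    and "y \<in> carrier (L \<bullet> (M \<bullet> N)) \<Longrightarrow> ass (ass' y) = y"
proof -
  let ?A = "(L \<bullet> M) \<bullet> N" and ?B = "L \<bullet> (M \<bullet> N)"
  obtain H where H: "H \<in> mod_hom (VV p \<rho>) ?A ?B"
    "\<And>u v w. \<lbrakk>u \<in> RC L; v \<in> RC M; w \<in> RC N\<rbrakk> \<Longrightarrow> H (pure_l u v w) = pure_r u v w"
    using tri_hom_left[OF modules(2) tri_r] by blast
  obtain K where K: "K \<in> mod_hom (VV p \<rho>) ?B ?A"
    "\<And>u v w. \<lbrakk>u \<in> RC L; v \<in> RC M; w \<in> RC N\<rbrakk> \<Longrightarrow> K (pure_r u v w) = pure_l u v w"
    using tri_hom_right[OF modules(1) tri_l] by blast
  have KH: "K (H x) = x" if "x \<in> carrier ?A" for x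
    using hom_eq_left[OF modules(1) mod_hom_comp[OF H(1) K(1)] mod_hom_id _ that] H(2) K(2) by simp
  have HK: "H (K y) = y" if "y \<in> carrier ?B" for y
    using hom_eq_right[OF modules(2) mod_hom_comp[OF K(1) H(1)] mod_hom_id _ that] H(2) K(2) by simp
  let ?H = "restrict H (carrier ?A)"
  let ?P = "\<lambda>h. h \<in> mod_hom (VV p \<rho>) ?A ?B \<and> h \<in> extensional (carrier ?A) \<and> bij_betw h (carrier ?A) (carrier ?B) \<and>
    (\<forall>u\<in>RC L. \<forall>v\<in>RC M. \<forall>w\<in>RC N. h (pure_l u v w) = pure_r u v w)"
  interpret A: left_module "VV p \<rho>" ?A by (rule modules)
  have bij: "bij_betw ?H (carrier ?A) (carrier ?B)"
    by (rule bij_betwI[where g=K]) (use mod_homD(1)[OF H(1)] mod_homD(1)[OF K(1)] KH HK in auto)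
  have "?H \<in> mod_hom (VV p \<rho>) ?A ?B"
    using H(1) A.smult_closed by (auto simp: mod_hom_def)
  then have P: "?P ?H" using bij H(2) pure_closed(1) by simp
  have "?P (THE h. ?P h)"
  proof (rule theI[of ?P, OF P])
    fix g assume g: "?P g"
    show "g = ?H"
    proof (rule extensionalityI)
      fix x assume "x \<in> carrier ?A"
      then show "g x = ?H x"
        using hom_eq_left[OF modules(2), of g ?H x] g P by auto
    qed (use g in auto)
  qed
  then have ass: "?P ass" by (simp add: assoc_def)
  then show 1: "ass \<in> mod_hom (VV p \<rho>) ?A ?B"
    and 2: "\<And>u v w. \<lbrakk>u \<in> RC L; v \<in> RC M; w \<in> RC N\<rbrakk> \<Longrightarrow> ass (pure_l u v w) = pure_r u v w" by auto
  from ass have bij: "bij_betw ass (carrier ?A) (carrier ?B)" by simp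
  show 3: "ass' (ass x) = x" if "x \<in> carrier ?A" for x
    unfolding assoc_inv_def using bij that by (rule bij_betw_inv_into_left)
  show 4: "ass (ass' y) = y" if "y \<in> carrier ?B" for y
    unfolding assoc_inv_def using bij that by (rule bij_betw_inv_into_right)
  \<comment> \<open>\<open>ass'\<close> is only an inverse of functions; it is a morphism because it
    agrees with \<open>K\<close>.\<close>
  have KA: "ass' y = K y" if "y \<in> carrier ?B" for y
  proof -
    have "ass (K y) = y"
      using hom_eq_right[OF modules(2) mod_hom_comp[OF K(1) 1] mod_hom_id _ that] 2 K(2) by simp
    then show ?thesis using 3[OF mod_homD(1)[OF K(1) that]] by simp
  qed
  interpret B: left_module "VV p \<rho>" ?B by (rule modules)
  show "ass' \<in> mod_hom (VV p \<rho>) ?B ?A"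
    using K(1) KA B.smult_closed by (auto simp: mod_hom_def)
qed

lemma assoc_inv_pure: "\<lbrakk>u \<in> RC L; v \<in> RC M; w \<in> RC N\<rbrakk> \<Longrightarrow> ass' (pure_r u v w) = pure_l u v w"
  using assoc_props(2,4) pure_closed(1) by metis

end

section \<open>Intertwiners\<close>

text \<open>
  \<open>V a b c\<close> stands for the elements \<open>y\<close> with \<open>e(i) y = y\<close> for a sequence \<open>i\<close> with the consecutive entries
  \<open>a, b, c\<close>; \<open>f1\<close> and \<open>f2\<close> below are the intertwiners \<open>\<phi>\<close> of the two pairs of neighbours.
\<close>

locale klr_triple =
  fixes V :: "'c \<Rightarrow> 'c \<Rightarrow> 'c \<Rightarrow> 'r::ring set" and s1 s2 x1 x2 x3 :: 'r
  assumes V_s: "y \<in> V b a c \<Longrightarrow> s1 * y \<in> V a b c" "y \<in> V a c b \<Longrightarrow> s2 * y \<in> V a b c"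
    and V_x: "y \<in> V a b c \<Longrightarrow> x1 * y \<in> V a b c" "y \<in> V a b c \<Longrightarrow> x2 * y \<in> V a b c" "y \<in> V a b c \<Longrightarrow> x3 * y \<in> V a b c"
    and V_minus: "y \<in> V a b c \<Longrightarrow> - y \<in> V a b c"
    and x_x: "x2 * x1 = x1 * x2" "x3 * x1 = x1 * x3" "x3 * x2 = x2 * x3"
    and s1_x1: "y \<in> V a b c \<Longrightarrow> s1 * (x1 * y) = (if a = b then x2 * (s1 * y) - y else x2 * (s1 * y))"
    and s1_x2: "y \<in> V a b c \<Longrightarrow> s1 * (x2 * y) = (if a = b then x1 * (s1 * y) + y else x1 * (s1 * y))"
    and s1_x3: "y \<in> V a b c \<Longrightarrow> s1 * (x3 * y) = x3 * (s1 * y)"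
    and s2_x1: "y \<in> V a b c \<Longrightarrow> s2 * (x1 * y) = x1 * (s2 * y)"
    and s2_x2: "y \<in> V a b c \<Longrightarrow> s2 * (x2 * y) = (if b = c then x3 * (s2 * y) - y else x3 * (s2 * y))"
    and s2_x3: "y \<in> V a b c \<Longrightarrow> s2 * (x3 * y) = (if b = c then x2 * (s2 * y) + y else x2 * (s2 * y))"
    and s1_s1: "y \<in> V a a c \<Longrightarrow> s1 * (s1 * y) = 0"
    and s2_s2: "y \<in> V a b b \<Longrightarrow> s2 * (s2 * y) = 0"
    and braid: "\<lbrakk>y \<in> V a b c; a \<noteq> c \<or> a = b\<rbrakk> \<Longrightarrow> s2 * (s1 * (s2 * y)) = s1 * (s2 * (s1 * y))"
    and braid': "\<lbrakk>y \<in> V a b a; a \<noteq> b\<rbrakk> \<Longrightarrow>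
      s2 * (s1 * (s2 * (x1 * y - x3 * y))) - s1 * (s2 * (s1 * (x1 * y - x3 * y))) = s1 * (s1 * y) - s2 * (s2 * y)"
begin

definition "f1 a b y = (if a = b then s1 * (x1 * y) - x1 * (s1 * y) else s1 * y)"
definition "f2 b c y = (if b = c then s2 * (x2 * y) - x2 * (s2 * y) else s2 * y)"

lemma x_xl: "x2 * (x1 * z) = x1 * (x2 * z)" "x3 * (x1 * z) = x1 * (x3 * z)" "x3 * (x2 * z) = x2 * (x3 * z)"
  by (simp_all only: x_x flip: mult.assoc)

text \<open>With no equal strands this is the braid relation. If equal strands occur, the factors x
  in the intertwiners produce correction terms, and these match on the two sides.\<close>

theorem slide:
  assumes y: "y \<in> V a b c"
  shows "s1 * f2 a c (f1 a b y) = f2 a b (f1 a c (s2 * y))"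
proof -
  note D = right_diff_distrib distrib_left f1_def f2_def
  note cl = V_s V_x y
  consider "a \<noteq> b" "a \<noteq> c" | "a = b" "a \<noteq> c" | "a = c" "a \<noteq> b" | "a = b" "a = c" by blast
  then show ?thesis
  proof cases
    case 1
    then show ?thesis using braid[OF y] by (simp add: D)
  next
    case 2
    then have y': "y \<in> V b b c" using y by simp
    show ?thesis
      using 2 by (simp add: D V_s V_x y' x_xl s1_x1[of _ b b c] s1_x2[of _ b b c] s1_x3[of _ b b c]
          s2_x1[of _ b b c] s2_x2[of _ b b c] s2_x3[of _ b b c] s1_x1[of _ b c b] s1_x2[of _ b c b] s1_x3[of _ b c b]
          s2_x1[of _ c b b] s2_x2[of _ c b b] s2_x3[of _ c b b] braid[of _ b b c])
  next
    case 3
    then have y': "y \<in> V a b a" and neq: "a \<noteq> b" using y by simp_all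
    have r: "s1 * f2 a a (f1 a b y) = s1 * (s2 * (s1 * (x1 * y - x3 * y))) + s1 * (s1 * y)"
      using neq by (simp add: D V_s V_x y' x_xl s1_x1[of _ a b a] s1_x3[of _ a b a] s2_x2[of _ b a a] s2_x3[of _ b a a]
          s2_x1[of _ b a a] algebra_simps)
    have l: "f2 a b (f1 a a (s2 * y)) = s2 * (s1 * (s2 * (x1 * y - x3 * y))) + s2 * (s2 * y)"
      using neq by (simp add: D V_s V_x y' x_xl s2_x1[of _ a b a] s2_x3[of _ a b a] s1_x1[of _ a a b] s1_x2[of _ a a b] algebra_simps)
    \<comment> \<open>The defect of the braid relation on \<open>x1 * y - x3 * y\<close> is exactly
      the difference of the quadratic terms left over in \<open>r\<close> and
      \<open>l\<close>.\<close>
    show ?thesis using braid'[OF y' neq] unfolding \<open>a = c\<close>[symmetric] r l by (simp add: algebra_simps)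
  next
    case 4
    then have y': "y \<in> V a a a" and eq: "b = a" "c = a" using y by simp_all
    show ?thesis
      unfolding eq by (simp add: D V_s V_x y' x_xl s1_x1[of _ a a a] s1_x2[of _ a a a] s1_x3[of _ a a a]
          s2_x1[of _ a a a] s2_x2[of _ a a a] s2_x3[of _ a a a] s1_s1[of _ a a] s2_s2[of _ a a] braid[of _ a a a] algebra_simps)
  qed
qed

text \<open>Reversal of the strands. The x change sign because the corrections in the exchange
  relation have opposite signs at the two positions. It yields the second sliding relation from the
  first.\<close>

lemma mirror: "klr_triple (\<lambda>a b c. V c b a) s2 s1 (- x3) (- x2) (- x1)"
proof
  fix y a b assume "y \<in> V a b a" "a \<noteq> b"
  from braid'[OF this]
  show "s1 * (s2 * (s1 * (- x3 * y - - x1 * y))) - s2 * (s1 * (s2 * (- x3 * y - - x1 * y))) = s2 * (s2 * y) - s1 * (s1 * y)"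
    by (simp add: algebra_simps)
qed (auto simp: V_s V_x V_minus x_x s1_x1 s1_x2 s1_x3 s2_x1 s2_x2 s2_x3 s1_s1 s2_s2 braid)

end

text \<open>A middle strand crosses equal strands on its left and on its right; the two quadratic
  relations list the vertices in opposite order and are compared by this symmetry.\<close>

lemma Qpol_swap: "Qpol p i j x y = Qpol p j i y (x::'r::ring_1)"
proof -
  have "(x - y) ^ n = (-1) ^ n * (y - x) ^ n" for n
    by (metis minus_diff_eq power_minus)
  moreover have "(-1) ^ m * ((-1) ^ (m + n) * z) = ((-1) ^ n * z :: 'r)" for m n z
    using left_right_inverse_power[of "-1 :: 'r" "-1" m] by (simp add: power_add mult.assoc[symmetric])
  ultimately show ?thesis
    by (auto simp: Qpol_def add.commute[of "arrows p j i"])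
qed

section \<open>Intertwiners in a VV algebra\<close>

context vv_ring
begin

abbreviation "Phi k \<equiv> q (phi \<nu> k)"

text \<open>The idempotents sum to the class of 1, so an equation between classes may be tested on
  each of them.\<close>

lemma eq_on_E:
  assumes "\<And>i. i \<in> \<theta> \<Longrightarrow> q f * E i = q g * E i" shows "q f = q g"
proof -
  have "q f * q 1 = q g * q 1"
    unfolding sum_E[symmetric] sum_distrib_left by (intro sum.cong refl assms)
  then show ?thesis by (simp only: q_one)
qed

lemma at_one: "i \<in> \<theta> \<Longrightarrow> E i * y = y \<Longrightarrow> q 1 * y = y"
  using arg_cong[OF q_one(2), of "\<lambda>z. z * y" "ge i"] by (simp add: mult.assoc)

lemma E_at: "i \<in> \<theta> \<Longrightarrow> E i * E i = E i"
  by (simp add: E_mult)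

lemma S_at: "\<lbrakk>Suc k < rank \<nu>; i \<in> \<theta>; E i * y = y\<rbrakk> \<Longrightarrow> E (permute_list (swap k) i) * (S k * y) = S k * y"
  using arg_cong[OF S_E, of k i "\<lambda>z. z * y"] by (simp add: mult.assoc)

lemma X_at: "\<lbrakk>l < rank \<nu>; i \<in> \<theta>; E i * y = y\<rbrakk> \<Longrightarrow> E i * (X l * y) = X l * y"
  using arg_cong[OF X_E, of l i "\<lambda>z. z * y"] by (simp add: mult.assoc)

lemma S_X_at:
  assumes k: "Suc k < rank \<nu>" and i: "i \<in> \<theta>" "E i * y = y"
  shows "S k * (X k * y) = (if i ! k = i ! Suc k then X (Suc k) * (S k * y) - y else X (Suc k) * (S k * y))"
    and "S k * (X (Suc k) * y) = (if i ! k = i ! Suc k then X k * (S k * y) + y else X k * (S k * y))"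
proof -
  have *: "(S k * X l - X (swap k l) * S k) * E i * y = S k * (X l * y) - X (swap k l) * (S k * y)" for l
    by (simp add: mult.assoc i left_diff_distrib)
  show "S k * (X k * y) = (if i ! k = i ! Suc k then X (Suc k) * (S k * y) - y else X (Suc k) * (S k * y))"
    using *[of k] k unfolding S_X[OF k _ i(1), of k, OF Suc_lessD[OF k]] by (auto simp: i algebra_simps split: if_splits)
  show "S k * (X (Suc k) * y) = (if i ! k = i ! Suc k then X k * (S k * y) + y else X k * (S k * y))"
    using *[of "Suc k"] unfolding S_X[OF k k i(1)] by (auto simp: i algebra_simps split: if_splits)
qed

lemma S_X_far': "\<lbrakk>Suc k < rank \<nu>; l < rank \<nu>; l \<noteq> k; l \<noteq> Suc k\<rbrakk> \<Longrightarrow> S k * (X l * y) = X l * (S k * y)"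
  using arg_cong[OF S_X_far, of k l "\<lambda>z. z * y"] by (simp add: mult.assoc)

lemma S_S_at:
  assumes "Suc k < rank \<nu>" "i \<in> \<theta>" "E i * y = y"
  shows "S k * (S k * y) = q (Qpol p (i ! k) (i ! Suc k) (gx (Suc k)) (gx k)) * y"
  using arg_cong[OF S_S[OF assms(1,2)], of "\<lambda>z. z * y"] by (simp add: mult.assoc assms)

lemma braid_at:
  assumes "k + 2 < rank \<nu>" "i \<in> \<theta>" "E i * y = y"
  shows "S (Suc k) * (S k * (S (Suc k) * y)) - S k * (S (Suc k) * (S k * y)) =
    (if i ! k = i ! (k + 2)
     then q (Qdiff p (i ! k) (i ! Suc k) (gx k) (gx (Suc k)) (gx (k + 2))) * y else 0)"
  using arg_cong[OF braid[OF assms(1,2)], of "\<lambda>z. z * y"] by (simp add: mult.assoc assms left_diff_distrib split: if_splits)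

lemma Phi_at:
  assumes i: "i \<in> \<theta>" "E i * y = y"
  shows "Phi k * y = (if i ! k = i ! Suc k then S k * (X k * y) - X k * (S k * y) else S k * y)"
proof -
  let ?g = "\<lambda>i. if i ! k = i ! Suc k then gs k * gx k - gx k * gs k else gs k"
  have "Phi k * E i = (\<Sum>j\<in>\<theta>. if j = i then q (?g i) * E i else 0)"
    unfolding phi_def qcl_sum sum_distrib_right qcl_mult
    by (intro sum.cong refl) (auto simp: mult.assoc E_mult i)
  also have "\<dots> = q (?g i) * E i"
    using i finite_theta_seqs[of \<nu>] by simp
  finally have "Phi k * E i * y = q (?g i) * E i * y" by simp
  then show ?thesis by (auto simp: mult.assoc i q_hom left_diff_distrib split: if_splits)
qed

lemma Phi_cl:
  assumes k: "Suc k < rank \<nu>" and i: "i \<in> \<theta>" "E i * y = y"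
  shows "E (permute_list (swap k) i) * (Phi k * y) = Phi k * y"
  using k S_at[OF k i] S_at[OF k i(1) X_at[OF Suc_lessD[OF k] i]]
    X_at[OF Suc_lessD[OF k] theta_seqs_swap[OF i(1) k] S_at[OF k i]]
  by (auto simp: Phi_at[OF i] right_diff_distrib)

lemma Phi_E:
  assumes "Suc k < rank \<nu>" "i \<in> \<theta>" shows "Phi k * E i = E (permute_list (swap k) i) * Phi k"
proof -
  have "q (phi \<nu> k * ge i) = q (ge (permute_list (swap k) i) * phi \<nu> k)"
  proof (rule eq_on_E)
    fix j assume j: "j \<in> \<theta>"
    have sj: "permute_list (swap k) j \<in> \<theta>" using assms j theta_seqs_swap by blast
    have si: "permute_list (swap k) i \<in> \<theta>" using assms theta_seqs_swap by blast
    have inv: "permute_list (swap k) (permute_list (swap k) t) = t" if "t \<in> \<theta>" for t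
    proof -
      have "permute_list (swap k) (permute_list (swap k) t) = permute_list (swap k \<circ> swap k) t"
        by (rule permute_list_compose[symmetric]) (use assms length_theta_seqs[OF that] in \<open>simp add: permutes_swap_id\<close>)
      then show ?thesis by simp
    qed
    then have neq: "permute_list (swap k) i \<noteq> permute_list (swap k) j" if "i \<noteq> j"
      using assms(2) j that by metis
    show "q (phi \<nu> k * ge i) * E j = q (ge (permute_list (swap k) i) * phi \<nu> k) * E j"
    proof (cases "i = j")
      case True
      then show ?thesis
        using Phi_cl[OF assms(1) j E_at[OF j]] by (simp add: qcl_mult mult.assoc E_at j)
    next
      case False
      have "E (permute_list (swap k) i) * (Phi k * E j) =
        E (permute_list (swap k) i) * (E (permute_list (swap k) j) * (Phi k * E j))"
        by (simp only: Phi_cl[OF assms(1) j E_at[OF j]])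
      also have "\<dots> = 0"
        using E_mult[OF si sj] neq[OF False] by (simp add: mult.assoc[symmetric])
      finally show ?thesis
        using False by (simp add: qcl_mult mult.assoc E_mult assms j)
    qed
  qed
  then show ?thesis by (simp only: qcl_mult)
qed

text \<open>For equal neighbours the intertwiner is \<open>(X (Suc k) - X k) * S k\<close> minus the
  unit, and the unit term cancels the correction of the exchange relation.\<close>

lemma Phi_X:
  assumes k: "Suc k < rank \<nu>" and l: "l < rank \<nu>"
  shows "Phi k * X l = X (swap k l) * Phi k"
proof -
  have "q (phi \<nu> k * gx l) = q (gx (swap k l) * phi \<nu> k)"
  proof (rule eq_on_E)
    fix i assume i: "i \<in> \<theta>"
    note R = S_X_at[OF k i] S_X_far'[OF k] E_at[OF i] X_at[OF _ i] X_X[of k "Suc k"]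
    have X: "X a * (X b * z) = X b * (X a * z)" if "a < rank \<nu>" "b < rank \<nu>" for a b z
      using X_X[OF that] by (simp add: mult.assoc[symmetric])
    have "Phi k * (X l * E i) = X (swap k l) * (Phi k * E i)"
      using k l unfolding Phi_at[OF i X_at[OF l i E_at[OF i]]] Phi_at[OF i E_at[OF i]]
      by (cases "l = k"; cases "l = Suc k") (auto simp: R right_diff_distrib distrib_left X[of "Suc k" k] X[of l k] X[of l "Suc k"])
    then show "q (phi \<nu> k * gx l) * E i = q (gx (swap k l) * phi \<nu> k) * E i"
      by (simp only: qcl_mult mult.assoc)
  qed
  then show ?thesis by (simp only: qcl_mult)
qed

lemma nth_swap_far: "\<lbrakk>t < length i; t \<noteq> k; t \<noteq> Suc k\<rbrakk> \<Longrightarrow> permute_list (swap k) i ! t = i ! t"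
  by (simp add: permute_list_def transpose_def)

lemma Phi_S_far:
  assumes k: "Suc k < rank \<nu>" and l: "Suc l < rank \<nu>" and far: "Suc k < l \<or> Suc l < k"
  shows "Phi k * S l = S l * Phi k"
proof -
  have "q (phi \<nu> k * gs l) = q (gs l * phi \<nu> k)"
  proof (rule eq_on_E)
    fix i assume i: "i \<in> \<theta>"
    have S: "S k * (S l * z) = S l * (S k * z)" for z
      using S_S_distant[OF k l] far by (auto simp: mult.assoc[symmetric])
    have "Phi k * (S l * E i) = S l * (Phi k * E i)"
      using k l far length_theta_seqs[OF i]
      unfolding Phi_at[OF theta_seqs_swap[OF i l] S_at[OF l i E_at[OF i]]] Phi_at[OF i E_at[OF i]]
      by (auto simp: nth_swap_far S S_X_far'[OF l, symmetric] right_diff_distrib)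
    then show "q (phi \<nu> k * gs l) * E i = q (gs l * phi \<nu> k) * E i"
      by (simp only: qcl_mult mult.assoc)
  qed
  then show ?thesis by (simp only: qcl_mult)
qed

lemma Phi_Phi_far:
  assumes k: "Suc k < rank \<nu>" and l: "Suc l < rank \<nu>" and far: "Suc k < l \<or> Suc l < k"
  shows "Phi k * Phi l = Phi l * Phi k"
proof -
  have "q (phi \<nu> k * phi \<nu> l) = q (phi \<nu> l * phi \<nu> k)"
  proof (rule eq_on_E)
    fix i assume i: "i \<in> \<theta>"
    have S: "Phi k * (S l * z) = S l * (Phi k * z)" for z
      using Phi_S_far[OF k l far] by (simp add: mult.assoc[symmetric])
    have X: "Phi k * (X l * z) = X l * (Phi k * z)" for z
      using Phi_X[OF k Suc_lessD[OF l]] far by (auto simp: transpose_def mult.assoc[symmetric])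
    have "Phi k * (Phi l * E i) = Phi l * (Phi k * E i)"
      using k l far length_theta_seqs[OF i]
      unfolding Phi_at[OF theta_seqs_swap[OF i k] Phi_cl[OF k i E_at[OF i]], of l]
      by (auto simp: nth_swap_far Phi_at[OF i E_at[OF i], of l] S X right_diff_distrib)
    then show "q (phi \<nu> k * phi \<nu> l) * E i = q (phi \<nu> l * phi \<nu> k) * E i"
      by (simp only: qcl_mult mult.assoc)
  qed
  then show ?thesis by (simp only: qcl_mult)
qed

text \<open>The generators commute as classes but the ring is not commutative, so the divided
  difference identity is checked directly: at most one arrow in each direction leaves four explicit
  cases of degree at most 2.\<close>

lemma Qdiff_mult:
  assumes "k + 2 < rank \<nu>" "i \<in> \<theta>" "E i * y = y" "a \<noteq> b"
  shows "q (Qdiff p a b (gx k) (gx (Suc k)) (gx (k + 2))) * (X k * y - X (k + 2) * y) =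
    q (Qpol p a b (gx (Suc k)) (gx k)) * y - q (Qpol p a b (gx (Suc k)) (gx (k + 2))) * y"
proof -
  have X: "X r * (X s * z) = X s * (X r * z)" if "r < rank \<nu>" "s < rank \<nu>" for r s z
    using X_X[OF that] by (simp add: mult.assoc[symmetric])
  have "arrows p a b \<le> 1" "arrows p b a \<le> 1" by (simp_all add: arrows_def)
  then consider "arrows p a b = 0" "arrows p b a = 0" | "arrows p a b = 0" "arrows p b a = 1"
    | "arrows p a b = 1" "arrows p b a = 0" | "arrows p a b = 1" "arrows p b a = 1"
    by linarith
  then show ?thesis
    using assms X[of "Suc k" k] X[of "Suc k" "k + 2"] X[of "k + 2" k] at_one[OF assms(2,3)] at_one[OF assms(2) X_at[OF _ assms(2,3)]]
    by cases (simp_all add: Qdiff_def Qpol_def q_hom power2_eq_square numeral_2_eq_2 algebra_simps)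
qed

definition "strand k a b c = {y. \<exists>i\<in>\<theta>. i ! k = a \<and> i ! Suc k = b \<and> i ! (k + 2) = c \<and> E i * y = y}"

lemma nth_swap3:
  assumes "k + 2 < rank \<nu>" "i \<in> \<theta>"
  shows "permute_list (swap k) i ! k = i ! Suc k" "permute_list (swap k) i ! Suc k = i ! k"
    "permute_list (swap k) i ! (k + 2) = i ! (k + 2)" "permute_list (swap (Suc k)) i ! k = i ! k"
    "permute_list (swap (Suc k)) i ! Suc k = i ! (k + 2)" "permute_list (swap (Suc k)) i ! (k + 2) = i ! Suc k"
  using assms(1) length_theta_seqs[OF assms(2)] by (auto simp: permute_list_def transpose_def)

lemma klr_triple:
  assumes k: "k + 2 < rank \<nu>"
  shows "klr_triple (strand k) (S k) (S (Suc k)) (X k) (X (Suc k)) (X (k + 2))"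
proof -
  have k': "Suc k < rank \<nu>" "Suc (Suc k) < rank \<nu>" "k < rank \<nu>" using k by auto
  note nth = nth_swap3[OF k]
  show ?thesis
  proof
    show "S k * y \<in> strand k a b c" if "y \<in> strand k b a c" for y a b c
      using that k' unfolding strand_def by (blast intro: S_at theta_seqs_swap nth[THEN trans])
    show "S (Suc k) * y \<in> strand k a b c" if "y \<in> strand k a c b" for y a b c
      using that k' unfolding strand_def by (blast intro: S_at theta_seqs_swap nth[THEN trans])
    show "X k * y \<in> strand k a b c" "X (Suc k) * y \<in> strand k a b c" "X (k + 2) * y \<in> strand k a b c"
      if "y \<in> strand k a b c" for y a b c
      using that k k' unfolding strand_def by (blast intro: X_at)+
    show "- y \<in> strand k a b c" if "y \<in> strand k a b c" for y a b c
      using that unfolding strand_def by (auto intro!: bexI)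
    show "X (Suc k) * X k = X k * X (Suc k)" "X (k + 2) * X k = X k * X (k + 2)" "X (k + 2) * X (Suc k) = X (Suc k) * X (k + 2)"
      using k by (auto intro: X_X)
    fix y a b c assume "y \<in> strand k a b c"
    then obtain i where i: "i \<in> \<theta>" "E i * y = y" and abc: "i ! k = a" "i ! Suc k = b" "i ! (k + 2) = c"
      by (auto simp: strand_def)
    note s1 = S_X_at[OF k'(1) i] and s2 = S_X_at[OF k'(2) i]
    show "S k * (X k * y) = (if a = b then X (Suc k) * (S k * y) - y else X (Suc k) * (S k * y))"
      "S k * (X (Suc k) * y) = (if a = b then X k * (S k * y) + y else X k * (S k * y))"
      "S (Suc k) * (X (Suc k) * y) = (if b = c then X (k + 2) * (S (Suc k) * y) - y else X (k + 2) * (S (Suc k) * y))"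
      "S (Suc k) * (X (k + 2) * y) = (if b = c then X (Suc k) * (S (Suc k) * y) + y else X (Suc k) * (S (Suc k) * y))"
      using s1 s2 abc by simp_all
    show "S k * (X (k + 2) * y) = X (k + 2) * (S k * y)" "S (Suc k) * (X k * y) = X k * (S (Suc k) * y)"
      using k by (simp_all add: S_X_far')
  next
    fix y a c assume "y \<in> strand k a a c"
    then show "S k * (S k * y) = 0"
      using k' by (auto simp: strand_def S_S_at Qpol_def q_hom)
  next
    fix y a b assume "y \<in> strand k a b b"
    then show "S (Suc k) * (S (Suc k) * y) = 0"
      using k' by (auto simp: strand_def S_S_at Qpol_def q_hom)
  next
    fix y a b c assume "y \<in> strand k a b c" and "a \<noteq> c \<or> a = b"
    then obtain i where i: "i \<in> \<theta>" "E i * y = y" and "i ! k \<noteq> i ! (k + 2) \<or> i ! k = i ! Suc k"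
      by (auto simp: strand_def)
    then have "S (Suc k) * (S k * (S (Suc k) * y)) - S k * (S (Suc k) * (S k * y)) = 0"
      unfolding braid_at[OF k i] by (auto simp: Qdiff_def q_hom)
    then show "S (Suc k) * (S k * (S (Suc k) * y)) = S k * (S (Suc k) * (S k * y))" by simp
  next
    fix y a b assume "y \<in> strand k a b a" and ab: "a \<noteq> b"
    then obtain i where i: "i \<in> \<theta>" "E i * y = y" and ent: "i ! k = a" "i ! Suc k = b" "i ! (k + 2) = a"
      by (auto simp: strand_def)
    have "E i * (X k * y - X (k + 2) * y) = X k * y - X (k + 2) * y"
      using k i by (simp add: X_at right_diff_distrib)
    from braid_at[OF k i(1) this]
    show "S (Suc k) * (S k * (S (Suc k) * (X k * y - X (k + 2) * y))) - S k * (S (Suc k) * (S k * (X k * y - X (k + 2) * y))) =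
      S k * (S k * y) - S (Suc k) * (S (Suc k) * y)"
      using Qdiff_mult[OF k i ab] ent by (simp add: S_S_at[OF k'(1) i] S_S_at[OF k'(2) i] Qpol_swap[of p b a])
  qed
qed

text \<open>For equal neighbours the commutator of \<open>S k\<close> with \<open>X k\<close> is the
  negative of that with \<open>X (Suc k)\<close>. Hence one intertwiner fits both the system of
  three strands and its mirror image.\<close>

lemma Phi_strand:
  assumes k: "k + 2 < rank \<nu>" and y: "y \<in> strand k a b c"
  shows "Phi k * y = klr_triple.f1 (S k) (X k) a b y"
    and "Phi (Suc k) * y = klr_triple.f2 (S (Suc k)) (X (Suc k)) b c y"
    and "Phi (Suc k) * y = klr_triple.f1 (S (Suc k)) (- X (k + 2)) c b y"
    and "Phi k * y = klr_triple.f2 (S k) (- X (Suc k)) b a y"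
    and "Phi k * y \<in> strand k b a c" "Phi (Suc k) * y \<in> strand k a c b"
proof -
  interpret T: klr_triple "strand k" "S k" "S (Suc k)" "X k" "X (Suc k)" "X (k + 2)" by (rule klr_triple[OF k])
  interpret T': klr_triple "\<lambda>a b c. strand k c b a" "S (Suc k)" "S k" "- X (k + 2)" "- X (Suc k)" "- X k" by (rule T.mirror)
  obtain i where i: "i \<in> \<theta>" "E i * y = y" and abc: "i ! k = a" "i ! Suc k = b" "i ! (k + 2) = c"
    using y by (auto simp: strand_def)
  have k': "Suc k < rank \<nu>" "Suc (Suc k) < rank \<nu>" using k by auto
  show "Phi k * y = T.f1 a b y" "Phi (Suc k) * y = T.f2 b c y"
    "Phi (Suc k) * y = T'.f1 c b y" "Phi k * y = T'.f2 b a y"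
    using S_X_at[OF k'(1) i] S_X_at[OF k'(2) i] abc
    unfolding T.f1_def T.f2_def T'.f1_def T'.f2_def Phi_at[OF i] by auto
  show "Phi k * y \<in> strand k b a c" "Phi (Suc k) * y \<in> strand k a c b"
    using i abc k' unfolding strand_def
    by (blast intro: Phi_cl theta_seqs_swap nth_swap3[OF k, THEN trans])+
qed

lemma slide:
  assumes k: "k + 2 < rank \<nu>"
  shows "S k * (Phi (Suc k) * Phi k) = Phi (Suc k) * Phi k * S (Suc k)"
    and "S (Suc k) * (Phi k * Phi (Suc k)) = Phi k * Phi (Suc k) * S k"
proof -
  interpret T: klr_triple "strand k" "S k" "S (Suc k)" "X k" "X (Suc k)" "X (k + 2)" by (rule klr_triple[OF k])
  interpret T': klr_triple "\<lambda>a b c. strand k c b a" "S (Suc k)" "S k" "- X (k + 2)" "- X (Suc k)" "- X k" by (rule T.mirror)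
  note P = Phi_strand[OF k]
  have "S k * (Phi (Suc k) * (Phi k * E i)) = Phi (Suc k) * (Phi k * (S (Suc k) * E i))"
    "S (Suc k) * (Phi k * (Phi (Suc k) * E i)) = Phi k * (Phi (Suc k) * (S k * E i))" if i: "i \<in> \<theta>" for i
  proof -
    define a b c where abc: "a = i ! k" "b = i ! Suc k" "c = i ! (k + 2)"
    have y: "E i \<in> strand k a b c" using i E_at[OF i] by (auto simp: strand_def abc)
    show "S k * (Phi (Suc k) * (Phi k * E i)) = Phi (Suc k) * (Phi k * (S (Suc k) * E i))"
      using T.slide[OF y] P(5)[OF y] P(5)[OF T.V_s(2)[OF y]]
      by (simp only: P(1)[OF y] P(2)[of _ b a c] P(1)[OF T.V_s(2)[OF y]] P(2)[of _ c a b])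
    show "S (Suc k) * (Phi k * (Phi (Suc k) * E i)) = Phi k * (Phi (Suc k) * (S k * E i))"
      using T'.slide[OF y] P(6)[OF y] P(6)[OF T.V_s(1)[OF y]]
      by (simp only: P(3)[OF y] P(4)[of _ a c b] P(3)[OF T.V_s(1)[OF y]] P(4)[of _ b c a])
  qed
  then have "q (gs k * (phi \<nu> (Suc k) * phi \<nu> k)) = q (phi \<nu> (Suc k) * phi \<nu> k * gs (Suc k))"
    "q (gs (Suc k) * (phi \<nu> k * phi \<nu> (Suc k))) = q (phi \<nu> k * phi \<nu> (Suc k) * gs k)"
    by - (rule eq_on_E, simp only: qcl_mult mult.assoc)+
  then show "S k * (Phi (Suc k) * Phi k) = Phi (Suc k) * Phi k * S (Suc k)"
    "S (Suc k) * (Phi k * Phi (Suc k)) = Phi k * Phi (Suc k) * S k"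
    by (simp_all only: qcl_mult)
qed

end

section \<open>The reduced word of the block permutation\<close>

lemma set_block_word: "k \<in> set (block_word n m) \<Longrightarrow> Suc k < n + m"
  by (auto simp: block_word_def)

lemma block_word_Suc: "block_word (Suc n) m = block_word n m @ rev [n..<n + m]"
  by (simp add: block_word_def)

lemma map_row: "map ((+) d) (rev [c..<c + b]) = rev [d + c..<d + c + b]"
  by (rule nth_equalityI) (auto simp: rev_nth)

text \<open>For this choice of reduced word the first factorization of the R-matrix is an equality
  of words.\<close>

lemma block_word_add: "block_word (n + r) m = block_word n m @ map ((+) n) (block_word r m)"
proof (induction r)
  case (Suc r)
  then show ?case
    by (simp only: add_Suc_right block_word_Suc map_append map_row append_assoc)
qed (simp add: block_word_def)

abbreviation permute_word :: "nat list \<Rightarrow> 'a list \<Rightarrow> 'a list" where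
  "permute_word a i \<equiv> foldr (\<lambda>k. permute_list (swap k)) a i"

lemma length_permute_word: "length (permute_word a i) = length i"
  by (induction a) auto

lemma word_perm_bound: "\<lbrakk>\<forall>k\<in>set a. Suc k < n; t < n\<rbrakk> \<Longrightarrow> word_perm a t < n"
  by (induction a) (auto simp: word_perm_def transpose_def)

lemma nth_permute_word:
  "\<lbrakk>\<forall>k\<in>set a. Suc k < length i; t < length i\<rbrakk> \<Longrightarrow> permute_word a i ! word_perm a t = i ! t"
proof (induction a)
  case (Cons k a)
  have "word_perm a t < length i"
    using Cons.prems by (intro word_perm_bound) auto
  moreover have "word_perm (k # a) t = swap k (word_perm a t)"
    by (simp add: word_perm_def)
  ultimately show ?case
    using Cons word_perm_bound[of "k # a" "length i" t]
    by (simp add: permute_list_nth[OF permutes_swap_id] length_permute_word)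
qed (simp add: word_perm_def)

lemma permute_word_block:
  assumes "length j = n" "length i = m"
  shows "permute_word (block_word n m) (j @ i) = i @ j"
proof (rule nth_equalityI)
  fix t assume "t < length (permute_word (block_word n m) (j @ i))"
  then have t: "t < n + m" using assms by (simp add: length_permute_word)
  define s where "s = (if t < m then t + n else t - m)"
  have s: "s < length (j @ i)" "block_perm n m s = t"
    using t assms by (auto simp: s_def block_perm_def)
  have "permute_word (block_word n m) (j @ i) ! t = (j @ i) ! s"
    using nth_permute_word[OF _ s(1), of "block_word n m"] s(2) set_block_word assms
    by (simp add: word_perm_block_word)
  then show "permute_word (block_word n m) (j @ i) ! t = (i @ j) ! t"
    using t assms by (auto simp: s_def nth_append)
qed (simp add: assms length_permute_word)

section \<open>Products of intertwiners along words\<close>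

context vv_ring
begin

abbreviation "PW a \<equiv> q (phi_word \<nu> a)"
abbreviation "valid_word a \<equiv> \<forall>k\<in>set a. Suc k < rank \<nu>"
abbreviation "far a b \<equiv> \<forall>k\<in>set a. \<forall>l\<in>set b. Suc k < l \<or> Suc l < k"

lemma PW_Cons: "PW (k # a) = Phi k * PW a"
  by (simp add: phi_word_def qcl_mult)

lemma PW_append: "PW (a @ b) = PW a * PW b"
  by (simp add: phi_word_def qcl_mult)

lemma PW_Nil: "PW [] = q 1"
  by (simp add: phi_word_def)

lemma PW_X: "\<lbrakk>valid_word a; l < rank \<nu>\<rbrakk> \<Longrightarrow> PW a * X l = X (word_perm a l) * PW a"
proof (induction a)
  case Nil
  then show ?case by (simp add: PW_Nil q_one word_perm_def)
next
  case (Cons k a)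
  have "word_perm a l < rank \<nu>" using Cons.prems by (intro word_perm_bound) auto
  moreover have "word_perm (k # a) l = swap k (word_perm a l)" by (simp add: word_perm_def)
  moreover have "PW (k # a) * X l = Phi k * X (word_perm a l) * PW a"
    using Cons by (simp add: PW_Cons mult.assoc)
  ultimately show ?case
    using Cons.prems by (simp add: Phi_X PW_Cons mult.assoc)
qed

lemma PW_E: "\<lbrakk>valid_word a; i \<in> \<theta>\<rbrakk> \<Longrightarrow> permute_word a i \<in> \<theta> \<and> PW a * E i = E (permute_word a i) * PW a"
proof (induction a)
  case Nil
  then show ?case by (simp add: PW_Nil q_one)
next
  case (Cons k a)
  then have i: "permute_word a i \<in> \<theta>" "PW a * E i = E (permute_word a i) * PW a" by auto
  have "PW (k # a) * E i = Phi k * E (permute_word a i) * PW a"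
    using i by (simp add: PW_Cons mult.assoc)
  then show ?case
    using Cons.prems i by (simp add: Phi_E PW_Cons mult.assoc theta_seqs_swap)
qed

lemma PW_S_far: "\<lbrakk>valid_word a; Suc l < rank \<nu>; far a [l]\<rbrakk> \<Longrightarrow> PW a * S l = S l * PW a"
proof (induction a)
  case Nil
  then show ?case by (simp add: PW_Nil q_one)
next
  case (Cons k a)
  then have "PW (k # a) * S l = Phi k * S l * PW a"
    by (simp add: PW_Cons mult.assoc)
  then show ?case
    using Cons.prems by (simp add: Phi_S_far PW_Cons mult.assoc)
qed

lemma PW_Phi_far: "\<lbrakk>valid_word a; Suc l < rank \<nu>; far a [l]\<rbrakk> \<Longrightarrow> PW a * Phi l = Phi l * PW a"
proof (induction a)
  case Nil
  then show ?case by (simp add: PW_Nil q_one)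
next
  case (Cons k a)
  then have "PW (k # a) * Phi l = Phi k * Phi l * PW a"
    by (simp add: PW_Cons mult.assoc)
  also have "Phi k * Phi l = Phi l * Phi k"
    using Cons.prems by (intro Phi_Phi_far) auto
  finally show ?case by (simp add: PW_Cons mult.assoc)
qed

lemma PW_PW_far: "\<lbrakk>valid_word a; valid_word b; far a b\<rbrakk> \<Longrightarrow> PW a * PW b = PW b * PW a"
proof (induction b)
  case Nil
  then show ?case by (simp add: PW_Nil q_one)
next
  case (Cons l b)
  have "PW a * PW (l # b) = PW a * Phi l * PW b"
    by (simp add: PW_Cons mult.assoc)
  also have "PW a * Phi l = Phi l * PW a"
    using Cons.prems by (intro PW_Phi_far) auto
  also have "Phi l * PW a * PW b = Phi l * (PW b * PW a)"
    using Cons by (auto simp: mult.assoc)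
  finally show ?case by (simp add: PW_Cons mult.assoc)
qed

text \<open>In a row only the adjacent letters \<open>Suc l\<close>, \<open>l\<close> interact with
  the crossing, and the first sliding relation takes it past them; the letters on either side of
  this pair commute with it.\<close>

lemma row_S:
  assumes "j \<le> l" "Suc l < j + m" "j + m < rank \<nu>"
  shows "PW (rev [j..<j + m]) * S (Suc l) = S l * PW (rev [j..<j + m])"
proof -
  have "[j..<j + m] = [j..<l] @ [l, Suc l] @ [l + 2..<j + m]"
    using assms upt_add_eq_append[of j l "j + m - l"] by (simp add: upt_conv_Cons)
  then have R: "PW (rev [j..<j + m]) = PW (rev [l + 2..<j + m]) * (Phi (Suc l) * Phi l) * PW (rev [j..<l])"
    by (simp add: PW_append PW_Cons mult.assoc)
  have 1: "PW (rev [j..<l]) * S (Suc l) = S (Suc l) * PW (rev [j..<l])"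
    using assms by (intro PW_S_far) auto
  have 2: "PW (rev [l + 2..<j + m]) * S l = S l * PW (rev [l + 2..<j + m])"
    using assms by (intro PW_S_far) auto
  have "PW (rev [j..<j + m]) * S (Suc l) = PW (rev [l + 2..<j + m]) * (Phi (Suc l) * Phi l * S (Suc l)) * PW (rev [j..<l])"
    by (simp only: R mult.assoc 1)
  also have "\<dots> = PW (rev [l + 2..<j + m]) * (S l * (Phi (Suc l) * Phi l)) * PW (rev [j..<l])"
    using assms by (simp add: slide(1))
  also have "\<dots> = S l * PW (rev [j..<j + m])"
    by (simp only: R mult.assoc[symmetric] 2)
  finally show ?thesis .
qed

text \<open>Two consecutive rows are read column by column: the new letter of the second row
  commutes past the first row, and each pair of letters raises the index of the crossing by one
  through the second sliding relation.\<close>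

lemma two_rows_S:
  "k + m + 1 < rank \<nu> \<Longrightarrow>
    PW (rev [k..<k + m] @ rev [Suc k..<Suc k + m]) * S k = S (k + m) * PW (rev [k..<k + m] @ rev [Suc k..<Suc k + m])"
proof (induction m)
  case 0
  then show ?case by (simp add: PW_Nil q_one)
next
  case (Suc m)
  let ?a = "rev [k..<k + m]" and ?b = "rev [Suc k..<Suc k + m]"
  have far: "PW ?a * Phi (Suc (k + m)) = Phi (Suc (k + m)) * PW ?a"
    using Suc.prems by (intro PW_Phi_far) auto
  have "PW (rev [k..<k + Suc m] @ rev [Suc k..<Suc k + Suc m]) = Phi (k + m) * (PW ?a * Phi (Suc (k + m))) * PW ?b"
    by (simp add: PW_append PW_Cons mult.assoc)
  also have "\<dots> = Phi (k + m) * Phi (Suc (k + m)) * PW (?a @ ?b)"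
    by (simp only: far PW_append mult.assoc)
  finally have R: "PW (rev [k..<k + Suc m] @ rev [Suc k..<Suc k + Suc m]) = Phi (k + m) * Phi (Suc (k + m)) * PW (?a @ ?b)" .
  have "Phi (k + m) * Phi (Suc (k + m)) * PW (?a @ ?b) * S k = (Phi (k + m) * Phi (Suc (k + m)) * S (k + m)) * PW (?a @ ?b)"
    using Suc by (simp add: mult.assoc)
  also have "\<dots> = S (Suc (k + m)) * (Phi (k + m) * Phi (Suc (k + m))) * PW (?a @ ?b)"
    using Suc.prems by (simp add: slide(2))
  finally show ?case unfolding R by (simp add: mult.assoc)
qed

lemma block_S_right:
  "\<lbrakk>Suc k < m; n + m \<le> rank \<nu>\<rbrakk> \<Longrightarrow> PW (block_word n m) * S (n + k) = S k * PW (block_word n m)"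
proof (induction n)
  case 0
  then show ?case by (simp add: block_word_def PW_Nil q_one)
next
  case (Suc n)
  have "PW (block_word (Suc n) m) * S (Suc n + k) = PW (block_word n m) * (PW (rev [n..<n + m]) * S (Suc (n + k)))"
    by (simp add: block_word_Suc PW_append mult.assoc)
  also have "\<dots> = PW (block_word n m) * S (n + k) * PW (rev [n..<n + m])"
    using Suc.prems by (simp add: row_S mult.assoc)
  also have "\<dots> = S k * PW (block_word (Suc n) m)"
    using Suc by (simp add: block_word_Suc PW_append mult.assoc)
  finally show ?case .
qed

lemma block_S_left:
  "\<lbrakk>Suc k < n; n + m \<le> rank \<nu>\<rbrakk> \<Longrightarrow> PW (block_word n m) * S k = S (m + k) * PW (block_word n m)"
proof (induction n)
  case (Suc n)
  show ?case
  proof (cases "Suc k < n")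
    case True
    have "PW (rev [n..<n + m]) * S k = S k * PW (rev [n..<n + m])"
      using Suc.prems True by (intro PW_S_far) auto
    then have "PW (block_word (Suc n) m) * S k = PW (block_word n m) * S k * PW (rev [n..<n + m])"
      by (simp add: block_word_Suc PW_append mult.assoc)
    then show ?thesis
      using Suc True by (simp add: block_word_Suc PW_append mult.assoc)
  next
    case False
    then have n: "n = Suc k" using Suc.prems by simp
    \<comment> \<open>Only the last two rows meet the crossing at \<open>k\<close>, which leaves
      them as a crossing at \<open>k + m\<close>. The letters of the other rows are at most
      \<open>k + m - 2\<close>, hence distant from it.\<close>
    let ?r = "rev [k..<k + m] @ rev [Suc k..<Suc k + m]"
    have w: "PW (block_word (Suc n) m) = PW (block_word k m) * PW ?r"
      by (simp add: n block_word_Suc PW_append mult.assoc)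
    have far: "PW (block_word k m) * S (k + m) = S (k + m) * PW (block_word k m)"
      using Suc.prems n by (intro PW_S_far) (auto dest!: set_block_word)
    have "PW (block_word (Suc n) m) * S k = PW (block_word k m) * S (k + m) * PW ?r"
      unfolding w mult.assoc using Suc.prems n by (subst two_rows_S) (auto simp: mult.assoc)
    then show ?thesis
      unfolding far w by (simp add: mult.assoc add.commute)
  qed
qed simp

text \<open>Each row splits into a part with letters from \<open>c + a\<close> on and a part below.
  The upper part has to pass the earlier lower parts, whose letters are at most
  \<open>c + a - 2\<close>, so only distant letters commute.\<close>

lemma block_word_split:
  "c + (a + b) \<le> rank \<nu> \<Longrightarrow> PW (block_word c (a + b)) = PW (map ((+) a) (block_word c b) @ block_word c a)"
proof (induction c)
  case 0
  then show ?case by (simp add: block_word_def)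
next
  case (Suc c)
  have row: "rev [c..<c + (a + b)] = rev [c + a..<c + a + b] @ rev [c..<c + a]"
    using arg_cong[OF upt_add_eq_append[of c "c + a" b], of rev] by (simp add: add.assoc)
  have map: "map ((+) a) (rev [c..<c + b]) = rev [c + a..<c + a + b]"
    unfolding map_row by (simp add: add.commute)
  have far: "PW (block_word c a) * PW (rev [c + a..<c + a + b]) = PW (rev [c + a..<c + a + b]) * PW (block_word c a)"
    using Suc.prems by (intro PW_PW_far) (auto dest!: set_block_word)
  have "PW (block_word (Suc c) (a + b)) =
      PW (map ((+) a) (block_word c b)) * (PW (block_word c a) * PW (rev [c + a..<c + a + b])) * PW (rev [c..<c + a])"
    using Suc by (simp add: block_word_Suc row PW_append mult.assoc)
  also have "\<dots> = PW (map ((+) a) (block_word (Suc c) b) @ block_word (Suc c) a)"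
    unfolding far by (simp only: block_word_Suc map_append map PW_append mult.assoc)
  finally show ?case .
qed

end

section \<open>R-matrices\<close>

context vv_setup
begin

text \<open>The product of intertwiners exchanges the generators of the two blocks without
  corrections: the x and the idempotents follow the permutation, and the crossings inside a block
  slide through the word.\<close>

lemma phi_block_gen:
  assumes TH: "\<beta> \<in> TH" "\<gamma> \<in> TH"
  defines "F \<equiv> phi_word (\<beta> + \<gamma>) (block_word (rank \<gamma>) (rank \<beta>))"
  shows "g \<in> KLR_gens (pos \<beta>) \<Longrightarrow>
      vq p (\<beta> + \<gamma>) (F * loc_gen (rank \<gamma>) (ps \<gamma>) {[]} g) = vq p (\<beta> + \<gamma>) (loc_gen 0 {[]} (ps \<gamma>) g * F)"
    and "g \<in> KLR_gens (pos \<gamma>) \<Longrightarrow>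
      vq p (\<beta> + \<gamma>) (F * loc_gen 0 {[]} (ps \<beta>) g) = vq p (\<beta> + \<gamma>) (loc_gen (rank \<beta>) (ps \<beta>) {[]} g * F)"
proof -
  interpret vv_ring p "\<beta> + \<gamma>" .
  let ?w = "block_word (rank \<gamma>) (rank \<beta>)"
  have rk: "rank (\<beta> + \<gamma>) = rank \<gamma> + rank \<beta>" by (simp add: rank_add TH)
  have w: "valid_word ?w" by (auto simp: rk dest: set_block_word)
  have E: "q F * E (j @ i) = E (i @ j) * q F" if "i \<in> ps \<beta>" "j \<in> ps \<gamma>" for i j
  proof -
    have "j @ i \<in> theta_seqs (\<beta> + \<gamma>)"
      using theta_seqs_append[OF ps_theta ps_theta, OF TH(2) that(2) TH(1) that(1)] by (simp add: add.commute)
    then show ?thesis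
      using PW_E[OF w] that TH by (simp add: F_def permute_word_block length_ps)
  qed
  have X: "q F * X l = X (block_perm (rank \<gamma>) (rank \<beta>) l) * q F" if "l < rank (\<beta> + \<gamma>)" for l
    using PW_X[OF w that] by (simp add: F_def word_perm_block_word)
  show "q (F * loc_gen (rank \<gamma>) (ps \<gamma>) {[]} g) = q (loc_gen 0 {[]} (ps \<gamma>) g * F)" if "g \<in> KLR_gens (pos \<beta>)"
  proof -
    consider l where "g = GX l" "l < rank \<beta>" | k where "g = GS k" "Suc k < rank \<beta>" | i where "g = GE i" "i \<in> ps \<beta>"
      using \<open>g \<in> KLR_gens (pos \<beta>)\<close> TH(1) by (auto simp: KLR_gens_eq klr_gens_def)
    then show ?thesis
    proof cases
      case 1
      then show ?thesis using X[of "rank \<gamma> + l"] by (simp add: qcl_mult rk block_perm_def)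
    next
      case 2
      then show ?thesis using block_S_right[of k "rank \<beta>" "rank \<gamma>"] by (simp add: qcl_mult rk F_def)
    next
      case 3
      then show ?thesis
        by (simp add: q_hom sum_distrib_left sum_distrib_right E)
    qed
  qed
  show "q (F * loc_gen 0 {[]} (ps \<beta>) g) = q (loc_gen (rank \<beta>) (ps \<beta>) {[]} g * F)" if "g \<in> KLR_gens (pos \<gamma>)"
  proof -
    consider l where "g = GX l" "l < rank \<gamma>" | k where "g = GS k" "Suc k < rank \<gamma>" | i where "g = GE i" "i \<in> ps \<gamma>"
      using \<open>g \<in> KLR_gens (pos \<gamma>)\<close> TH(2) by (auto simp: KLR_gens_eq klr_gens_def)
    then show ?thesis
    proof cases
      case 1
      then show ?thesis using X[of l] by (simp add: qcl_mult rk block_perm_def add.commute)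
    next
      case 2
      then show ?thesis using block_S_left[of k "rank \<gamma>" "rank \<beta>"] by (simp add: qcl_mult rk F_def)
    next
      case 3
      then show ?thesis
        by (simp add: q_hom sum_distrib_left sum_distrib_right E)
    qed
  qed
qed

text \<open>\<open>phi\<close> is a sum over all sequences of the VV algebra, also those with
  inverted entries, so it is not a KLR word. This truncation is one, and it acts in the same way on
  restrictions.\<close>

definition phi_pos :: "'k multiset \<Rightarrow> nat \<Rightarrow> 'k falg" where
  "phi_pos \<alpha> k = (\<Sum>i\<in>ps \<alpha>. (if i ! k = i ! Suc k then gs k * gx k - gx k * gs k else gs k) * ge i)"

lemma phi_pos_KF:
  assumes "\<alpha> \<in> TH" "Suc k < rank \<alpha>" shows "phi_pos \<alpha> k \<in> KF (pos \<alpha>)"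
  unfolding phi_pos_def using assms
  by (auto intro!: free_alg_intros gen_KF simp: KLR_gens_eq klr_gens_def)

lemma phi_pos_e_pos:
  assumes \<alpha>: "\<alpha> \<in> TH" shows "vq p \<alpha> (phi \<alpha> k * e_pos p lam \<alpha>) = vq p \<alpha> (phi_pos \<alpha> k)"
proof -
  interpret vv_ring p \<alpha> .
  have "Phi k * E i = q (if i ! k = i ! Suc k then gs k * gx k - gx k * gs k else gs k) * E i" if "i \<in> ps \<alpha>" for i
    using ps_theta[OF \<alpha> that] by (auto simp: Phi_at E_at q_hom left_diff_distrib mult.assoc)
  then show ?thesis
    by (simp add: e_pos_def phi_pos_def sum_distrib_left q_hom cong: sum.cong)
qed

text \<open>Both neighbours lie in the same factor, so the case distinction on equal entries comes
  out the same in the factor and in the concatenated sequence.\<close>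

lemma phi_pos_emb:
  assumes TH: "\<beta> \<in> TH" "\<gamma> \<in> TH"
  shows "Suc k < rank \<beta> \<Longrightarrow> vq p (\<beta> + \<gamma>) (emb_l \<gamma> (phi_pos \<beta> k) * e_conv p lam \<beta> \<gamma>) = vq p (\<beta> + \<gamma>) (phi (\<beta> + \<gamma>) k * e_conv p lam \<beta> \<gamma>)"
    and "Suc k < rank \<gamma> \<Longrightarrow> vq p (\<beta> + \<gamma>) (emb_r \<beta> (phi_pos \<gamma> k) * e_conv p lam \<beta> \<gamma>) =
      vq p (\<beta> + \<gamma>) (phi (\<beta> + \<gamma>) (rank \<beta> + k) * e_conv p lam \<beta> \<gamma>)"
proof -
  interpret vv_ring p "\<beta> + \<gamma>" .
  have th: "i @ j \<in> \<theta>" if "i \<in> ps \<beta>" "j \<in> ps \<gamma>" for i j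
    using that TH by (intro theta_seqs_append ps_theta)
  have e: "q (f * e_conv p lam \<beta> \<gamma>) = q (g * e_conv p lam \<beta> \<gamma>)"
    if "\<And>i j. \<lbrakk>i \<in> ps \<beta>; j \<in> ps \<gamma>\<rbrakk> \<Longrightarrow> q f * E (i @ j) = q g * E (i @ j)" for f g
    unfolding e_conv_def sum_distrib_left q_hom by (intro sum.cong refl that)
  let ?h = "\<lambda>s k i. (if i ! k = i ! Suc k then S (s + k) * X (s + k) - X (s + k) * S (s + k) else S (s + k))"
  show "q (emb_l \<gamma> (phi_pos \<beta> k) * e_conv p lam \<beta> \<gamma>) = q (phi (\<beta> + \<gamma>) k * e_conv p lam \<beta> \<gamma>)" if k: "Suc k < rank \<beta>"
  proof (rule e)
    fix i j assume ij: "i \<in> ps \<beta>" "j \<in> ps \<gamma>"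
    interpret vv_block p "\<beta> + \<gamma>" 0 "rank \<beta>" "{[]}" "ps \<gamma>" "ps \<beta>" by (rule block1[OF TH])
    have "q (emb_l \<gamma> (phi_pos \<beta> k)) * E (i @ j) = (\<Sum>i'\<in>ps \<beta>. ?h 0 k i' * (EB i' * E (i @ j)))"
      by (simp add: phi_pos_def emb_l_hom q_hom sum_distrib_right mult.assoc if_distrib[of "emb_l \<gamma>"] if_distrib[of q]
        del: sum_distrib_left cong: if_cong)
    also have "\<dots> = (\<Sum>i'\<in>ps \<beta>. if i' = i then ?h 0 k i' * E (i @ j) else 0)"
      using E_EB(2)[of "[]" i j] ij by (intro sum.cong refl) (auto)
    also have "\<dots> = Phi k * E (i @ j)"
      using ij k finite_ps[of \<beta>] by (simp add: Phi_at[OF th E_at[OF th]] nth_append length_ps[OF TH(1) ij(1)] left_diff_distrib mult.assoc)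
    finally show "q (emb_l \<gamma> (phi_pos \<beta> k)) * E (i @ j) = Phi k * E (i @ j)" .
  qed
  show "q (emb_r \<beta> (phi_pos \<gamma> k) * e_conv p lam \<beta> \<gamma>) = q (phi (\<beta> + \<gamma>) (rank \<beta> + k) * e_conv p lam \<beta> \<gamma>)"
    if k: "Suc k < rank \<gamma>"
  proof (rule e)
    fix i j assume ij: "i \<in> ps \<beta>" "j \<in> ps \<gamma>"
    interpret vv_block p "\<beta> + \<gamma>" "rank \<beta>" "rank \<gamma>" "ps \<beta>" "{[]}" "ps \<gamma>" by (rule block2[OF TH])
    have "q (emb_r \<beta> (phi_pos \<gamma> k)) * E (i @ j) = (\<Sum>i'\<in>ps \<gamma>. ?h (rank \<beta>) k i' * (EB i' * E (i @ j)))"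
      by (simp add: phi_pos_def emb_r_hom q_hom sum_distrib_right mult.assoc if_distrib[of "emb_r \<beta>"] if_distrib[of q]
        del: sum_distrib_left cong: if_cong)
    also have "\<dots> = (\<Sum>i'\<in>ps \<gamma>. if i' = j then ?h (rank \<beta>) k i' * E (i @ j) else 0)"
      using E_EB(2)[of i j "[]"] ij by (intro sum.cong refl) (auto)
    also have "\<dots> = Phi (rank \<beta> + k) * E (i @ j)"
      using ij k finite_ps[of \<gamma>] by (simp add: Phi_at[OF th E_at[OF th]] nth_append length_ps[OF TH(1) ij(1)] left_diff_distrib mult.assoc)
    finally show "q (emb_r \<beta> (phi_pos \<gamma> k)) * E (i @ j) = Phi (rank \<beta> + k) * E (i @ j)" .
  qed
qed

lemma phi_Res:
  assumes M: "vvm M" and k: "Suc k < rank (deg M)" and u: "u \<in> RC M"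
  shows "act M (phi (deg M) k) u = act M (phi_pos (deg M) k) u" "act M (phi (deg M) k) u \<in> RC M"
proof -
  have "act M (phi (deg M) k) u = act M (phi (deg M) k * e_pos p lam (deg M)) u"
    using u act_hom(4)[OF M RC_closed(1)[OF M u] RC_closed(1)[OF M u]] by (simp add: RC_iff[OF M])
  also have "\<dots> = act M (phi_pos (deg M) k) u"
    by (rule vact_cong[OF phi_pos_e_pos[OF vvm_TH[OF M]]])
  finally show "act M (phi (deg M) k) u = act M (phi_pos (deg M) k) u" .
  then show "act M (phi (deg M) k) u \<in> RC M"
    using RC_closed(2)[OF M u phi_pos_KF[OF vvm_TH[OF M] k]] by simp
qed

lemma phi_word_Cons: "phi_word \<nu> (k # a) = phi \<nu> k * phi_word \<nu> a"
  by (simp add: phi_word_def)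

lemma phi_word_cls:
  assumes "\<forall>k\<in>set a. Suc k < rank \<nu>" shows "vv_class p \<nu> (phi_word \<nu> a) = vcl p \<nu> (phi_word \<nu> a)"
proof (rule VV.pres_class_eq_cls)
  have "phi \<nu> k \<in> carrier (free_alg (VV_gens \<nu>))" if "Suc k < rank \<nu>" for k
    unfolding phi_def using that by (auto intro!: free_alg_intros simp: VV_gens_def klr_gens_def)
  then show "phi_word \<nu> a \<in> carrier (free_alg (VV_gens \<nu>))"
    using assms unfolding phi_word_def by (auto intro!: free_alg_intros)
qed

lemma phi_word_Res:
  assumes M: "vvm M" and u: "u \<in> RC M"
  shows "\<forall>k\<in>set a. Suc k < rank (deg M) \<Longrightarrow> act M (phi_word (deg M) a) u \<in> RC M"
proof (induction a)
  case Nil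
  show ?case using u act_hom(5)[OF M RC_closed(1)[OF M u] RC_closed(1)[OF M u]] by (simp add: phi_word_def)
next
  case (Cons k a)
  then show ?case
    using phi_Res(2)[OF M, of k] act_hom(4)[OF M RC_closed(1)[OF M u] RC_closed(1)[OF M u]]
    by (simp add: phi_word_Cons)
qed

lemma mod_hom_vact:
  assumes "h \<in> mod_hom (VV p \<nu>) Y Z" "y \<in> carrier Y" shows "h (vact p \<nu> Y f y) = vact p \<nu> Z f (h y)"
  using mod_homD(3)[OF assms(1) VV.cls_closed assms(2)] by (simp add: VV.act_def)

lemma mod_hom_RC:
  assumes "vvm M" "vvm N" "deg N = deg M" and h: "h \<in> mod_hom (VV p (deg M)) M N" and u: "u \<in> RC M"
  shows "h u \<in> RC N"
  using u mod_homD(1)[OF h] mod_hom_vact[OF h, of u "e_pos p lam (deg M)"] assms(3)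
  by (simp add: RC_iff assms(1,2))

end

section \<open>R-matrices and products of morphisms as morphisms\<close>

context conv_data
begin

lemma cp_phi:
  assumes u: "u \<in> RC M" and v: "v \<in> RC N"
  shows "Suc k < rank \<beta> \<Longrightarrow> cp (act M (phi \<beta> k) u) v = act (M \<bullet> N) (phi (\<beta> + \<gamma>) k) (cp u v)"
    and "Suc k < rank \<gamma> \<Longrightarrow> cp u (act N (phi \<gamma> k) v) = act (M \<bullet> N) (phi (\<beta> + \<gamma>) (rank \<beta> + k)) (cp u v)"
proof -
  have e: "act (M \<bullet> N) (f * e) (cp u v) = act (M \<bullet> N) f (cp u v)" for f
    using cp_e[OF u v] cp_closed[OF u v] by (simp add: act_hom(4)[OF conv_vvm cp_closed[OF u v] cp_closed[OF u v]])
  show "cp (act M (phi \<beta> k) u) v = act (M \<bullet> N) (phi (\<beta> + \<gamma>) k) (cp u v)" if k: "Suc k < rank \<beta>"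
    unfolding phi_Res(1)[OF M k u] cp_emb(1)[OF u v phi_pos_KF[OF TH(1) k]]
    using vact_cong[OF phi_pos_emb(1)[OF TH k], of "M \<bullet> N" "cp u v"] e by (simp add: conv_sel(4))
  show "cp u (act N (phi \<gamma> k) v) = act (M \<bullet> N) (phi (\<beta> + \<gamma>) (rank \<beta> + k)) (cp u v)" if k: "Suc k < rank \<gamma>"
    unfolding phi_Res(1)[OF N k v] cp_emb(2)[OF u v phi_pos_KF[OF TH(2) k]]
    using vact_cong[OF phi_pos_emb(2)[OF TH k], of "M \<bullet> N" "cp u v"] e by (simp add: conv_sel(4))
qed

lemma cp_phi_word:
  assumes u: "u \<in> RC M" and v: "v \<in> RC N"
  shows "\<forall>k\<in>set a. Suc k < rank \<beta> \<Longrightarrow> cp (act M (phi_word \<beta> a) u) v = act (M \<bullet> N) (phi_word (\<beta> + \<gamma>) a) (cp u v)"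
    and "\<forall>k\<in>set a. Suc k < rank \<gamma> \<Longrightarrow> cp u (act N (phi_word \<gamma> a) v) =
      act (M \<bullet> N) (phi_word (\<beta> + \<gamma>) (map ((+) (rank \<beta>)) a)) (cp u v)"
proof -
  note uc = RC_closed(1)[OF M u] and vc = RC_closed(1)[OF N v] and cc = cp_closed[OF u v]
  note one = act_hom(5)[OF M uc uc] act_hom(5)[OF N vc vc] act_hom(5)[OF conv_vvm cc cc]
  note mult = act_hom(4)[OF M uc uc] act_hom(4)[OF N vc vc] act_hom(4)[OF conv_vvm cc cc]
  show "cp (act M (phi_word \<beta> a) u) v = act (M \<bullet> N) (phi_word (\<beta> + \<gamma>) a) (cp u v)" if "\<forall>k\<in>set a. Suc k < rank \<beta>"
    using that
  proof (induction a)
    case Nil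
    show ?case by (simp add: phi_word_def one)
  next
    case (Cons k a)
    then show ?case
      using cp_phi(1)[OF phi_word_Res[OF M u, of a] v, of k] by (simp add: phi_word_Cons mult)
  qed
  show "cp u (act N (phi_word \<gamma> a) v) = act (M \<bullet> N) (phi_word (\<beta> + \<gamma>) (map ((+) (rank \<beta>)) a)) (cp u v)"
    if "\<forall>k\<in>set a. Suc k < rank \<gamma>"
    using that
  proof (induction a)
    case Nil
    show ?case by (simp add: phi_word_def one)
  next
    case (Cons k a)
    then show ?case
      using cp_phi(2)[OF u phi_word_Res[OF N v, of a], of k] by (simp add: phi_word_Cons mult)
  qed
qed

abbreviation "R \<equiv> Rmat p lam M N"
abbreviation "F \<equiv> phi_word (\<beta> + \<gamma>) (block_word (rank \<gamma>) (rank \<beta>))"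

text \<open>In \<open>N \<bullet> M\<close> the generators of \<open>M\<close> act on the second
  block and those of \<open>N\<close> on the first. Moving them through \<open>F\<close> exchanges
  the blocks, which is the balance condition on the source.\<close>

lemma Rmat_props:
  shows "R \<in> mod_hom W (M \<bullet> N) (N \<bullet> M)"
    and "\<lbrakk>u \<in> RC M; v \<in> RC N\<rbrakk> \<Longrightarrow> R (cp u v) = vact p (\<beta> + \<gamma>) (N \<bullet> M) F (conv_pure p lam N M v u)"
proof -
  interpret T: conv_data p lam N M by unfold_locales (rule N M)+
  have C: "left_module W (N \<bullet> M)" using T.conv_module by (simp add: add.commute)
  note hom = VV.act_hom[OF C]
  let ?act = "vact p (\<beta> + \<gamma>) (N \<bullet> M)"
  let ?f = "\<lambda>u v. ?act F (T.cp v u)"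
  have "balanced (N \<bullet> M) ?f"
    unfolding balanced_def
  proof (intro ballI conjI allI)
    fix u v assume u: "u \<in> RC M" and v: "v \<in> RC N"
    note cl = T.cp_closed[OF v u]
    note gen = T.cp_gen[OF v u, unfolded add.commute[of \<gamma> \<beta>]]
    show "?f u v \<in> carrier (N \<bullet> M)" by (rule hom(1)[OF cl cl])
    show "?f (u \<oplus>\<^bsub>M\<^esub> u') v = ?f u v \<oplus>\<^bsub>N \<bullet> M\<^esub> ?f u' v" if "u' \<in> RC M" for u'
      using u v that by (simp add: T.cp_add hom T.cp_closed)
    show "?f u (v \<oplus>\<^bsub>N\<^esub> v') = ?f u v \<oplus>\<^bsub>N \<bullet> M\<^esub> ?f u v'" if "v' \<in> RC N" for v'
      using u v that by (simp add: T.cp_add hom T.cp_closed)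
    show "?f (act M (scal c) u) v = ?act (scal c) (?f u v)" for c
      unfolding gen(4) hom(4)[OF cl cl, symmetric] scal_central ..
    show "?f u (act N (scal c) v) = ?act (scal c) (?f u v)" for c
      unfolding gen(3) hom(4)[OF cl cl, symmetric] scal_central ..
    show "?f (act M (Poly_Mapping.single [g] 1) u) v = ?act (loc_gen 0 {[]} (ps \<gamma>) g) (?f u v)" if "g \<in> KLR_gens (pos \<beta>)" for g
      unfolding gen(2)[OF that] hom(4)[OF cl cl, symmetric] by (rule vact_cong[OF phi_block_gen(1)[OF TH that]])
    show "?f u (act N (Poly_Mapping.single [g] 1) v) = ?act (loc_gen (rank \<beta>) (ps \<beta>) {[]} g) (?f u v)" if "g \<in> KLR_gens (pos \<gamma>)" for g
      unfolding gen(1)[OF that] hom(4)[OF cl cl, symmetric] by (rule vact_cong[OF phi_block_gen(2)[OF TH that]])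
  qed
  note P = conv_extend_props[OF C this]
  have w: "\<forall>k\<in>set (block_word (rank \<gamma>) (rank \<beta>)). Suc k < rank (\<beta> + \<gamma>)"
    using set_block_word[of _ "rank \<gamma>" "rank \<beta>"] by (simp add: rank_add[OF TH] add.commute[of "rank \<beta>"])
  have R: "R = conv_extend p lam M N (N \<bullet> M) ?f"
    unfolding Rmat_def VV.act_def phi_word_cls[OF w] ..
  show "R \<in> mod_hom W (M \<bullet> N) (N \<bullet> M)" unfolding R by (rule P(1))
  show "R (cp u v) = ?act F (T.cp v u)" if "u \<in> RC M" "v \<in> RC N"
    unfolding R by (rule P(2)[OF that])
qed

lemma conv_map_props:
  fixes M' :: "('k, 'm1) vv_mod" and N' :: "('k, 'n1) vv_mod"
  assumes M': "vvm M'" "deg M' = \<beta>" and N': "vvm N'" "deg N' = \<gamma>"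
    and f: "f \<in> mod_hom (VV p \<beta>) M M'" and g: "g \<in> mod_hom (VV p \<gamma>) N N'"
  shows "conv_map p lam M N M' N' f g \<in> mod_hom W (M \<bullet> N) (M' \<bullet> N')"
    and "\<lbrakk>u \<in> RC M; v \<in> RC N\<rbrakk> \<Longrightarrow> conv_map p lam M N M' N' f g (cp u v) = conv_pure p lam M' N' (f u) (g v)"
proof -
  interpret T: conv_data p lam M' N' by unfold_locales (rule M' N')+
  have C: "left_module W (M' \<bullet> N')" using T.conv_module by (simp add: M' N')
  let ?f = "\<lambda>u v. T.cp (f u) (g v)"
  have "balanced (M' \<bullet> N') ?f"
    unfolding balanced_def
  proof (intro ballI conjI allI)
    fix u v assume u: "u \<in> RC M" and v: "v \<in> RC N"
    have fu: "f u' \<in> RC M'" if "u' \<in> RC M" for u' by (rule mod_hom_RC[OF M M' f that])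
    have gv: "g v' \<in> RC N'" if "v' \<in> RC N" for v' by (rule mod_hom_RC[OF N N' g that])
    note uc = RC_closed(1)[OF M] and vc = RC_closed(1)[OF N]
    note fact = mod_hom_vact[OF f uc[OF u]] and gact = mod_hom_vact[OF g vc[OF v]]
    note gen = T.cp_gen[OF fu[OF u] gv[OF v], unfolded M'(2) N'(2)]
    show "?f u v \<in> carrier (M' \<bullet> N')" by (rule T.cp_closed[OF fu[OF u] gv[OF v]])
    show "?f (u \<oplus>\<^bsub>M\<^esub> u') v = ?f u v \<oplus>\<^bsub>M' \<bullet> N'\<^esub> ?f u' v" if "u' \<in> RC M" for u'
      unfolding mod_homD(2)[OF f uc[OF u] uc[OF that]] by (rule T.cp_add(1)[OF fu[OF u] fu[OF that] gv[OF v]])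
    show "?f u (v \<oplus>\<^bsub>N\<^esub> v') = ?f u v \<oplus>\<^bsub>M' \<bullet> N'\<^esub> ?f u v'" if "v' \<in> RC N" for v'
      unfolding mod_homD(2)[OF g vc[OF v] vc[OF that]] by (rule T.cp_add(2)[OF fu[OF u] gv[OF v] gv[OF that]])
    show "?f (act M (scal c) u) v = vact p (\<beta> + \<gamma>) (M' \<bullet> N') (scal c) (?f u v)" for c
      unfolding fact by (rule gen(3))
    show "?f u (act N (scal c) v) = vact p (\<beta> + \<gamma>) (M' \<bullet> N') (scal c) (?f u v)" for c
      unfolding gact by (rule gen(4))
    show "?f (act M (Poly_Mapping.single [h] 1) u) v = vact p (\<beta> + \<gamma>) (M' \<bullet> N') (loc_gen 0 {[]} (ps \<gamma>) h) (?f u v)"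
      if "h \<in> KLR_gens (pos \<beta>)" for h
      unfolding fact by (rule gen(1)[OF that])
    show "?f u (act N (Poly_Mapping.single [h] 1) v) = vact p (\<beta> + \<gamma>) (M' \<bullet> N') (loc_gen (rank \<beta>) (ps \<beta>) {[]} h) (?f u v)"
      if "h \<in> KLR_gens (pos \<gamma>)" for h
      unfolding gact by (rule gen(2)[OF that])
  qed
  note P = conv_extend_props[OF C this, folded conv_map_def]
  show "conv_map p lam M N M' N' f g \<in> mod_hom W (M \<bullet> N) (M' \<bullet> N')" by (rule P(1))
  show "conv_map p lam M N M' N' f g (cp u v) = T.cp (f u) (g v)" if "u \<in> RC M" "v \<in> RC N"
    by (rule P(2)[OF that])
qed

end

section \<open>The two factorizations and the Yang-Baxter equation\<close>

context vv_setup
begin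

lemma tripleI: "\<lbrakk>vvm L; vvm M; vvm N\<rbrakk> \<Longrightarrow> triple p lam L M N"
  by unfold_locales

lemma conv_dataI: "\<lbrakk>vvm M; vvm N\<rbrakk> \<Longrightarrow> conv_data p lam M N"
  by unfold_locales

lemma deg_conv: "deg (M \<bullet> N) = deg M + deg N"
  by (simp add: conv_def Let_def)

lemma conv_vvm: "\<lbrakk>vvm M; vvm N\<rbrakk> \<Longrightarrow> vvm (M \<bullet> N)"
  using conv_data.conv_vvm[OF conv_dataI] .

abbreviation "cp M N \<equiv> conv_pure p lam M N"
abbreviation "pure_left L M N u v w \<equiv> cp (L \<bullet> M) N (cp L M u v) w"
abbreviation "pure_right L M N u v w \<equiv> cp L (M \<bullet> N) u (cp M N v w)"

lemma cp_RC: "\<lbrakk>vvm M; vvm N; u \<in> RC M; v \<in> RC N\<rbrakk> \<Longrightarrow> cp M N u v \<in> RC (M \<bullet> N)"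
  using conv_data.cp_RC[OF conv_dataI] .

lemma block_word_valid:
  "\<lbrakk>vvm M; vvm N; \<rho> = deg M + deg N\<rbrakk> \<Longrightarrow> \<forall>k\<in>set (block_word (rank (deg N)) (rank (deg M))). Suc k < rank \<rho>"
  using set_block_word[of _ "rank (deg N)" "rank (deg M)"]
  by (auto simp: rank_add vvm_TH add.commute[of "rank (deg M)"])

lemma Rmat_hom:
  "\<lbrakk>vvm M; vvm N; \<rho> = deg M + deg N\<rbrakk> \<Longrightarrow> Rmat p lam M N \<in> mod_hom (VV p \<rho>) (M \<bullet> N) (N \<bullet> M)"
  by (hypsubst, rule conv_data.Rmat_props(1)[OF conv_dataI])

lemma Rmat_pure:
  "\<lbrakk>vvm M; vvm N; \<rho> = deg M + deg N; u \<in> RC M; v \<in> RC N\<rbrakk> \<Longrightarrow> Rmat p lam M N (cp M N u v) =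
     vact p \<rho> (N \<bullet> M) (phi_word \<rho> (block_word (rank (deg N)) (rank (deg M)))) (cp N M v u)"
  by (hypsubst, rule conv_data.Rmat_props(2)[OF conv_dataI])

text \<open>Both composites send the tensor of \<open>u\<close> and \<open>z\<close> to the same
  word of intertwiners applied to the tensor of \<open>g z\<close> and \<open>u\<close>: the word
  depends only on the degrees, and morphisms commute with its action.\<close>

lemma Rmat_naturality:
  assumes L: "vvm L" and Z: "vvm Z" "vvm Z'" "deg Z' = deg Z" and g: "g \<in> mod_hom (VV p (deg Z)) Z Z'"
    and x: "x \<in> carrier (L \<bullet> Z)"
  shows "conv_map p lam Z L Z' L g id (Rmat p lam L Z x) = Rmat p lam L Z' (conv_map p lam L Z L Z' id g x)"
proof -
  let ?\<rho> = "deg L + deg Z"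
  have \<rho>: "?\<rho> = deg Z + deg L" by (rule add.commute)
  interpret D: conv_data p lam L Z by (rule conv_dataI[OF L Z(1)])
  interpret D': conv_data p lam Z L by (rule conv_dataI[OF Z(1) L])
  note id = mod_hom_id[of "VV p (deg L)" L]
  note cl = D.conv_map_props[OF L refl Z(2,3) id g]
    and cr = D'.conv_map_props[OF Z(2,3) L refl g id, folded \<rho>]
  have C: "left_module (VV p ?\<rho>) (Z' \<bullet> L)"
    using vvm_module[OF conv_vvm[OF Z(2) L]] by (simp add: deg_conv Z(3) \<rho>)
  note R = Rmat_hom[OF L Z(1) refl] Rmat_hom[OF L Z(2), of ?\<rho>, unfolded Z(3), OF refl]
  have "(conv_map p lam Z L Z' L g id \<circ> Rmat p lam L Z) x = (Rmat p lam L Z' \<circ> conv_map p lam L Z L Z' id g) x"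
  proof (rule D.hom_eqI[OF C mod_hom_comp[OF R(1) cr(1)] mod_hom_comp[OF cl(1) R(2)] _ x])
    fix u z assume u: "u \<in> RC L" and z: "z \<in> RC Z"
    show "(conv_map p lam Z L Z' L g id \<circ> Rmat p lam L Z) (cp L Z u z) =
      (Rmat p lam L Z' \<circ> conv_map p lam L Z L Z' id g) (cp L Z u z)"
      using mod_hom_vact[OF cr(1) D'.cp_closed[OF z u]] cr(2)[OF z u] cl(2)[OF u z]
        Rmat_pure[OF L Z(1) refl u z] Rmat_pure[OF L Z(2) _ u mod_hom_RC[OF Z g z], of ?\<rho>]
      by (simp add: Z(3))
  qed
  then show ?thesis by simp
qed

lemma swap_left:
  assumes L: "vvm L" and M: "vvm M" and N: "vvm N" and \<rho>: "\<rho> = deg L + deg M + deg N"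
  shows "conv_map p lam (L \<bullet> M) N (M \<bullet> L) N (Rmat p lam L M) id
      \<in> mod_hom (VV p \<rho>) ((L \<bullet> M) \<bullet> N) ((M \<bullet> L) \<bullet> N)"
    and "\<lbrakk>u \<in> RC L; v \<in> RC M; w \<in> RC N\<rbrakk> \<Longrightarrow>
      conv_map p lam (L \<bullet> M) N (M \<bullet> L) N (Rmat p lam L M) id (pure_left L M N u v w) =
      vact p \<rho> ((M \<bullet> L) \<bullet> N) (phi_word \<rho> (block_word (rank (deg M)) (rank (deg L)))) (pure_left M L N v u w)"
proof -
  interpret D: conv_data p lam "L \<bullet> M" N by (rule conv_dataI[OF conv_vvm[OF L M] N])
  interpret D': conv_data p lam "M \<bullet> L" N by (rule conv_dataI[OF conv_vvm[OF M L] N])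
  have d: "deg (M \<bullet> L) = deg (L \<bullet> M)" "deg (L \<bullet> M) + deg N = \<rho>" "deg ((M \<bullet> L) \<bullet> N) = \<rho>"
    by (simp_all add: deg_conv \<rho> add.commute[of "deg M"])
  note C = D.conv_map_props[OF D'.M d(1) N refl Rmat_hom[OF L M deg_conv] mod_hom_id, unfolded d(2)]
  show "conv_map p lam (L \<bullet> M) N (M \<bullet> L) N (Rmat p lam L M) id \<in> mod_hom (VV p \<rho>) ((L \<bullet> M) \<bullet> N) ((M \<bullet> L) \<bullet> N)"
    by (rule C(1))
  assume u: "u \<in> RC L" and v: "v \<in> RC M" and w: "w \<in> RC N"
  have "conv_map p lam (L \<bullet> M) N (M \<bullet> L) N (Rmat p lam L M) id (pure_left L M N u v w) =
    cp (M \<bullet> L) N (act (M \<bullet> L) (phi_word (deg (M \<bullet> L)) (block_word (rank (deg M)) (rank (deg L)))) (cp M L v u)) w"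
    using C(2)[OF cp_RC[OF L M u v] w] Rmat_pure[OF L M deg_conv u v] by (simp add: d(1))
  also have "\<dots> = vact p \<rho> ((M \<bullet> L) \<bullet> N) (phi_word \<rho> (block_word (rank (deg M)) (rank (deg L)))) (pure_left M L N v u w)"
    using D'.cp_phi_word(1)[OF cp_RC[OF M L v u] w block_word_valid[OF L M]] by (simp add: d deg_conv[of L] \<rho>)
  finally show "conv_map p lam (L \<bullet> M) N (M \<bullet> L) N (Rmat p lam L M) id (pure_left L M N u v w) =
      vact p \<rho> ((M \<bullet> L) \<bullet> N) (phi_word \<rho> (block_word (rank (deg M)) (rank (deg L)))) (pure_left M L N v u w)" .
qed

text \<open>The entries of \<open>L\<close> precede those being exchanged, so the letters of the
  word are shifted by the rank of \<open>L\<close>; in \<open>swap_left\<close> there is no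
  shift.\<close>

lemma swap_right:
  assumes L: "vvm L" and M: "vvm M" and N: "vvm N" and \<rho>: "\<rho> = deg L + deg M + deg N"
  shows "conv_map p lam L (M \<bullet> N) L (N \<bullet> M) id (Rmat p lam M N)
      \<in> mod_hom (VV p \<rho>) (L \<bullet> (M \<bullet> N)) (L \<bullet> (N \<bullet> M))"
    and "\<lbrakk>u \<in> RC L; v \<in> RC M; w \<in> RC N\<rbrakk> \<Longrightarrow>
      conv_map p lam L (M \<bullet> N) L (N \<bullet> M) id (Rmat p lam M N) (pure_right L M N u v w) =
      vact p \<rho> (L \<bullet> (N \<bullet> M)) (phi_word \<rho> (map ((+) (rank (deg L))) (block_word (rank (deg N)) (rank (deg M)))))
        (pure_right L N M u w v)"
proof -
  interpret D: conv_data p lam L "M \<bullet> N" by (rule conv_dataI[OF L conv_vvm[OF M N]])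
  interpret D': conv_data p lam L "N \<bullet> M" by (rule conv_dataI[OF L conv_vvm[OF N M]])
  have d: "deg (N \<bullet> M) = deg (M \<bullet> N)" "deg L + deg (M \<bullet> N) = \<rho>" "deg (L \<bullet> (N \<bullet> M)) = \<rho>"
    by (simp_all add: deg_conv \<rho> add.assoc add.commute[of "deg N"])
  note C = D.conv_map_props[OF L refl D'.N d(1) mod_hom_id Rmat_hom[OF M N deg_conv], unfolded d(2)]
  show "conv_map p lam L (M \<bullet> N) L (N \<bullet> M) id (Rmat p lam M N) \<in> mod_hom (VV p \<rho>) (L \<bullet> (M \<bullet> N)) (L \<bullet> (N \<bullet> M))"
    by (rule C(1))
  assume u: "u \<in> RC L" and v: "v \<in> RC M" and w: "w \<in> RC N"
  let ?w = "block_word (rank (deg N)) (rank (deg M))"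
  have "conv_map p lam L (M \<bullet> N) L (N \<bullet> M) id (Rmat p lam M N) (pure_right L M N u v w) =
    cp L (N \<bullet> M) u (act (N \<bullet> M) (phi_word (deg (N \<bullet> M)) ?w) (cp N M w v))"
    using C(2)[OF u cp_RC[OF M N v w]] Rmat_pure[OF M N deg_conv v w] by (simp add: d(1))
  also have "\<dots> = vact p \<rho> (L \<bullet> (N \<bullet> M)) (phi_word \<rho> (map ((+) (rank (deg L))) ?w)) (pure_right L N M u w v)"
    using D'.cp_phi_word(2)[OF u cp_RC[OF N M w v] block_word_valid[OF M N]] by (simp add: d deg_conv[of M] \<rho> add.assoc)
  finally show "conv_map p lam L (M \<bullet> N) L (N \<bullet> M) id (Rmat p lam M N) (pure_right L M N u v w) =
      vact p \<rho> (L \<bullet> (N \<bullet> M)) (phi_word \<rho> (map ((+) (rank (deg L))) ?w)) (pure_right L N M u w v)" .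
qed

lemma assoc_facts:
  assumes L: "vvm L" and M: "vvm M" and N: "vvm N" and \<rho>: "\<rho> = deg L + deg M + deg N"
  shows "assoc p lam L M N \<in> mod_hom (VV p \<rho>) ((L \<bullet> M) \<bullet> N) (L \<bullet> (M \<bullet> N))"
    and "\<lbrakk>u \<in> RC L; v \<in> RC M; w \<in> RC N\<rbrakk> \<Longrightarrow> assoc p lam L M N (pure_left L M N u v w) = pure_right L M N u v w"
    and "assoc_inv p lam L M N \<in> mod_hom (VV p \<rho>) (L \<bullet> (M \<bullet> N)) ((L \<bullet> M) \<bullet> N)"
    and "\<lbrakk>u \<in> RC L; v \<in> RC M; w \<in> RC N\<rbrakk> \<Longrightarrow> assoc_inv p lam L M N (pure_right L M N u v w) = pure_left L M N u v w"
    and "x \<in> carrier ((L \<bullet> M) \<bullet> N) \<Longrightarrow> assoc_inv p lam L M N (assoc p lam L M N x) = x"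
    and "y \<in> carrier (L \<bullet> (M \<bullet> N)) \<Longrightarrow> assoc p lam L M N (assoc_inv p lam L M N y) = y"
    and "left_module (VV p \<rho>) ((L \<bullet> M) \<bullet> N)" "left_module (VV p \<rho>) (L \<bullet> (M \<bullet> N))"
    and "\<lbrakk>u \<in> RC L; v \<in> RC M; w \<in> RC N\<rbrakk> \<Longrightarrow> pure_left L M N u v w \<in> carrier ((L \<bullet> M) \<bullet> N)"
    and "\<lbrakk>u \<in> RC L; v \<in> RC M; w \<in> RC N\<rbrakk> \<Longrightarrow> pure_right L M N u v w \<in> carrier (L \<bullet> (M \<bullet> N))"
proof -
  interpret triple p lam L M N by (rule tripleI[OF L M N])
  show "assoc p lam L M N \<in> mod_hom (VV p \<rho>) ((L \<bullet> M) \<bullet> N) (L \<bullet> (M \<bullet> N))"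
    "assoc_inv p lam L M N \<in> mod_hom (VV p \<rho>) (L \<bullet> (M \<bullet> N)) ((L \<bullet> M) \<bullet> N)"
    "left_module (VV p \<rho>) ((L \<bullet> M) \<bullet> N)" "left_module (VV p \<rho>) (L \<bullet> (M \<bullet> N))"
    unfolding \<rho> by (rule assoc_props modules)+
qed (fact triple.assoc_props(2)[OF tripleI[OF L M N]] triple.assoc_inv_pure[OF tripleI[OF L M N]]
    triple.assoc_props(4,5)[OF tripleI[OF L M N]] triple.pure_closed[OF tripleI[OF L M N]])+

text \<open>On pure tensors both sides act by words of intertwiners, and these words coincide by
  \<open>block_word_add\<close>.\<close>

theorem hexagon_right:
  assumes L: "vvm L" and M: "vvm M" and N: "vvm N" and \<rho>: "\<rho> = deg L + deg M + deg N"
  shows "eq_mor (VV p \<rho>) ((L \<bullet> M) \<bullet> N) (M \<bullet> (N \<bullet> L))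
       (assoc p lam M N L \<circ> Rmat p lam L (M \<bullet> N) \<circ> assoc p lam L M N)
       (conv_map p lam M (L \<bullet> N) M (N \<bullet> L) id (Rmat p lam L N)
        \<circ> assoc p lam M L N
        \<circ> conv_map p lam (L \<bullet> M) N (M \<bullet> L) N (Rmat p lam L M) id)"
    (is "eq_mor _ ?A ?B ?f ?g")
proof -
  have r: "\<rho> = deg M + deg N + deg L" "\<rho> = deg M + deg L + deg N" "\<rho> = deg L + deg (M \<bullet> N)"
    by (simp_all add: \<rho> deg_conv add_ac)
  have rk: "rank (deg (M \<bullet> N)) = rank (deg M) + rank (deg N)"
    by (simp add: deg_conv rank_add vvm_TH M N)
  note aLMN = assoc_facts[OF L M N \<rho>] and aMNL = assoc_facts[OF M N L r(1)] and aMLN = assoc_facts[OF M L N r(2)]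
  note R = Rmat_hom[OF L conv_vvm[OF M N] r(3)] and sl = swap_left[OF L M N \<rho>] and sr = swap_right[OF M L N r(2)]
  have f: "?f \<in> mod_hom (VV p \<rho>) ?A ?B"
    by (intro mod_hom_comp) (rule aLMN(1) R aMNL(1))+
  have g: "?g \<in> mod_hom (VV p \<rho>) ?A ?B"
    by (intro mod_hom_comp) (rule sl(1) aMLN(1) sr(1))+
  have "?f x = ?g x" if x: "x \<in> carrier ?A" for x
  proof (rule triple.hom_eq_left[OF tripleI[OF L M N] _ _ _ _ x, folded \<rho>])
    fix u v w assume u: "u \<in> RC L" and v: "v \<in> RC M" and w: "w \<in> RC N"
    let ?a = "block_word (rank (deg M)) (rank (deg L))" and ?b = "block_word (rank (deg N)) (rank (deg L))"
    have z: "pure_right M N L v w u \<in> carrier (M \<bullet> (N \<bullet> L))" by (rule aMNL(10)[OF v w u])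
    have "?f (pure_left L M N u v w) =
      vact p \<rho> ?B (phi_word \<rho> (block_word (rank (deg M) + rank (deg N)) (rank (deg L)))) (pure_right M N L v w u)"
      using Rmat_pure[OF L conv_vvm[OF M N] r(3) u cp_RC[OF M N v w]]
      by (simp add: aLMN(2) u v w rk mod_hom_vact[OF aMNL(1) aMNL(9)] aMNL(2))
    also have "\<dots> = vact p \<rho> ?B (phi_word \<rho> ?a) (vact p \<rho> ?B (phi_word \<rho> (map ((+) (rank (deg M))) ?b)) (pure_right M N L v w u))"
      by (simp add: VV.act_hom(4)[OF aMNL(8) z z, symmetric] block_word_add phi_word_def)
    also have "\<dots> = ?g (pure_left L M N u v w)"
      by (simp add: sl(2) u v w mod_hom_vact[OF aMLN(1) aMLN(9)] aMLN(2) mod_hom_vact[OF sr(1) aMLN(10)] sr(2))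
    finally show "?f (pure_left L M N u v w) = ?g (pure_left L M N u v w)" .
  qed (rule aMNL(8) f g)+
  then show ?thesis
    unfolding eq_mor_def using f g by blast
qed

text \<open>The words on the two sides differ by commutations of distant letters, supplied by
  \<open>block_word_split\<close>.\<close>

theorem hexagon_left:
  assumes L: "vvm L" and M: "vvm M" and N: "vvm N" and \<rho>: "\<rho> = deg L + deg M + deg N"
  shows "eq_mor (VV p \<rho>) ((L \<bullet> M) \<bullet> N) (N \<bullet> (L \<bullet> M))
       (Rmat p lam (L \<bullet> M) N)
       (assoc p lam N L M
        \<circ> conv_map p lam (L \<bullet> N) M (N \<bullet> L) M (Rmat p lam L N) id
        \<circ> assoc_inv p lam L N M
        \<circ> conv_map p lam L (M \<bullet> N) L (N \<bullet> M) id (Rmat p lam M N)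
        \<circ> assoc p lam L M N)"
    (is "eq_mor _ ?A ?B ?f ?g")
proof -
  have r: "\<rho> = deg L + deg N + deg M" "\<rho> = deg N + deg L + deg M" "\<rho> = deg (L \<bullet> M) + deg N"
    by (simp_all add: \<rho> deg_conv add_ac)
  have rk: "rank (deg (L \<bullet> M)) = rank (deg L) + rank (deg M)"
    by (simp add: deg_conv rank_add vvm_TH L M)
  have rk': "rank (deg N) + (rank (deg L) + rank (deg M)) \<le> rank \<rho>"
    using vvm_TH[OF L] vvm_TH[OF M] vvm_TH[OF N] by (simp add: \<rho> rank_add TH_add)
  note aLMN = assoc_facts[OF L M N \<rho>] and aLNM = assoc_facts[OF L N M r(1)] and aNLM = assoc_facts[OF N L M r(2)]
  note f = Rmat_hom[OF conv_vvm[OF L M] N r(3)] and sl = swap_left[OF L N M r(1)] and sr = swap_right[OF L M N \<rho>]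
  have g: "?g \<in> mod_hom (VV p \<rho>) ?A ?B"
    by (intro mod_hom_comp) (rule sl(1) aLMN(1) aLNM(3) aNLM(1) sr(1))+
  have "?f x = ?g x" if x: "x \<in> carrier ?A" for x
  proof (rule triple.hom_eq_left[OF tripleI[OF L M N] _ _ _ _ x, folded \<rho>])
    fix u v w assume u: "u \<in> RC L" and v: "v \<in> RC M" and w: "w \<in> RC N"
    let ?a = "block_word (rank (deg N)) (rank (deg M))" and ?b = "block_word (rank (deg N)) (rank (deg L))"
    have z: "pure_right N L M w u v \<in> carrier ?B" by (rule aNLM(10)[OF w u v])
    have z': "pure_left N L M w u v \<in> carrier ((N \<bullet> L) \<bullet> M)" by (rule aNLM(9)[OF w u v])
    have "?f (pure_left L M N u v w) =
      vact p \<rho> ?B (phi_word \<rho> (block_word (rank (deg N)) (rank (deg L) + rank (deg M)))) (pure_right N L M w u v)"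
      using Rmat_pure[OF conv_vvm[OF L M] N r(3) cp_RC[OF L M u v] w] by (simp add: rk)
    also have "\<dots> = vact p \<rho> ?B (phi_word \<rho> (map ((+) (rank (deg L))) ?a @ ?b)) (pure_right N L M w u v)"
      by (rule vact_cong[OF vv_ring.block_word_split[OF rk']])
    also have "\<dots> = vact p \<rho> ?B (phi_word \<rho> (map ((+) (rank (deg L))) ?a)) (vact p \<rho> ?B (phi_word \<rho> ?b) (pure_right N L M w u v))"
      by (simp add: VV.act_hom(4)[OF aNLM(8) z z, symmetric] phi_word_def)
    also have "\<dots> = ?g (pure_left L M N u v w)"
      by (simp add: aLMN(2) sr(2) u v w mod_hom_vact[OF aLNM(3) aLNM(10)] aLNM(4)
        mod_hom_vact[OF sl(1) aLNM(9)] sl(2) mod_hom_vact[OF aNLM(1)] VV.act_hom(1)[OF aNLM(7) z' z'] aNLM(2) z')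
    finally show "?f (pure_left L M N u v w) = ?g (pure_left L M N u v w)" .
  qed (rule aNLM(8) f g)+
  then show ?thesis
    unfolding eq_mor_def using f g by blast
qed

theorem yang_baxter:
  assumes L: "vvm L" and M: "vvm M" and N: "vvm N" and \<rho>: "\<rho> = deg L + deg M + deg N"
  shows "eq_mor (VV p \<rho>) ((L \<bullet> M) \<bullet> N) (N \<bullet> (M \<bullet> L))
       (assoc p lam N M L
        \<circ> conv_map p lam (M \<bullet> N) L (N \<bullet> M) L (Rmat p lam M N) id
        \<circ> assoc_inv p lam M N L
        \<circ> conv_map p lam M (L \<bullet> N) M (N \<bullet> L) id (Rmat p lam L N)
        \<circ> assoc p lam M L N
        \<circ> conv_map p lam (L \<bullet> M) N (M \<bullet> L) N (Rmat p lam L M) id)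
       (conv_map p lam N (L \<bullet> M) N (M \<bullet> L) id (Rmat p lam L M)
        \<circ> assoc p lam N L M
        \<circ> conv_map p lam (L \<bullet> N) M (N \<bullet> L) M (Rmat p lam L N) id
        \<circ> assoc_inv p lam L N M
        \<circ> conv_map p lam L (M \<bullet> N) L (N \<bullet> M) id (Rmat p lam M N)
        \<circ> assoc p lam L M N)"
    (is "eq_mor _ ?A ?B ?f ?g")
proof -
  have r: "\<rho> = deg L + deg N + deg M" "\<rho> = deg N + deg L + deg M" "\<rho> = deg N + deg M + deg L"
    "\<rho> = deg M + deg N + deg L" "\<rho> = deg M + deg L + deg N" "\<rho> = deg L + deg (M \<bullet> N)"
    by (simp_all add: \<rho> deg_conv add_ac)
  note aLMN = assoc_facts[OF L M N \<rho>] and aLNM = assoc_facts[OF L N M r(1)] and aNLM = assoc_facts[OF N L M r(2)]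
    and aNML = assoc_facts[OF N M L r(3)] and aMNL = assoc_facts[OF M N L r(4)] and aMLN = assoc_facts[OF M L N r(5)]
  note sl = swap_left(1)[OF L M N \<rho>] swap_left(1)[OF M N L r(4)] swap_left(1)[OF L N M r(1)]
    and sr = swap_right(1)[OF L M N \<rho>] swap_right(1)[OF M L N r(5)] swap_right(1)[OF N L M r(2)]
  have f: "?f \<in> mod_hom (VV p \<rho>) ?A ?B"
    by (intro mod_hom_comp) (rule sl aNML(1) aMNL(3) aMLN(1) sr)+
  have g: "?g \<in> mod_hom (VV p \<rho>) ?A ?B"
    by (intro mod_hom_comp) (rule sl aLMN(1) aLNM(3) aNLM(1) sr)+
  have R: "Rmat p lam L (M \<bullet> N) \<in> mod_hom (VV p \<rho>) (L \<bullet> (M \<bullet> N)) ((M \<bullet> N) \<bullet> L)"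
    by (rule Rmat_hom[OF L conv_vvm[OF M N] r(6)])
  have "?f x = ?g x" if x: "x \<in> carrier ?A" for x
  proof -
    define z where "z = assoc p lam L M N x"
    define y where "y = conv_map p lam L (M \<bullet> N) L (N \<bullet> M) id (Rmat p lam M N) z"
    define y' where "y' = assoc_inv p lam L N M y"
    have z: "z \<in> carrier (L \<bullet> (M \<bullet> N))" unfolding z_def by (rule mod_homD(1)[OF aLMN(1) x])
    have y: "y \<in> carrier (L \<bullet> (N \<bullet> M))" unfolding y_def by (rule mod_homD(1)[OF sr(1) z])
    have y': "y' \<in> carrier ((L \<bullet> N) \<bullet> M)" unfolding y'_def by (rule mod_homD(1)[OF aLNM(3) y])
    have "?f x = assoc p lam N M L (conv_map p lam (M \<bullet> N) L (N \<bullet> M) L (Rmat p lam M N) id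
        (assoc_inv p lam M N L (assoc p lam M N L (Rmat p lam L (M \<bullet> N) z))))"
      using hexagon_right[OF L M N \<rho>] x by (simp add: eq_mor_def z_def)
    also have "\<dots> = assoc p lam N M L (conv_map p lam (M \<bullet> N) L (N \<bullet> M) L (Rmat p lam M N) id (Rmat p lam L (M \<bullet> N) z))"
      by (simp only: aMNL(5)[OF mod_homD(1)[OF R z]])
    \<comment> \<open>Naturality in the second argument, applied to the morphism
      \<open>Rmat p lam M N\<close>.\<close>
    also have "\<dots> = assoc p lam N M L (Rmat p lam L (N \<bullet> M) y)"
      unfolding y_def
      by (subst Rmat_naturality[OF L conv_vvm[OF M N] conv_vvm[OF N M] _ Rmat_hom[OF M N deg_conv] z])
        (simp_all add: deg_conv add.commute)
    \<comment> \<open>Rebracketing \<open>y\<close> exposes the left-hand side of the first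
      factorization for \<open>(L, N, M)\<close>, evaluated at \<open>y'\<close>.\<close>
    also have "\<dots> = assoc p lam N M L (Rmat p lam L (N \<bullet> M) (assoc p lam L N M y'))"
      unfolding y'_def aLNM(6)[OF y] ..
    also have "\<dots> = ?g x"
      using hexagon_right[OF L N M r(1)] y' by (simp add: eq_mor_def y'_def y_def z_def)
    finally show ?thesis .
  qed
  then show ?thesis
    unfolding eq_mor_def using f g by blast
qed

end

section \<open>From the conditions on I to signs of entries\<close>

lemma vv_setup_Iset:
  fixes p lam :: "'k::field"
  assumes p: "p \<noteq> 0" and lam: "lam \<noteq> 0" and I: "{1, -1, p, -p} \<inter> Iset p lam = {}"
  shows "vv_setup p lam"
proof
  fix i assume i: "i \<in> Ipos p lam"
  show "inverse i \<notin> Ipos p lam"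
  proof
    assume "inverse i \<in> Ipos p lam"
    then obtain m where m: "inverse i = p powi (2 * m) * lam" unfolding Ipos_def by blast
    obtain n where n: "i = p powi (2 * n) * lam" using i unfolding Ipos_def by blast
    have "i \<noteq> 0" using n p lam by (simp add: power_int_eq_0_iff)
    then have "i * inverse i = 1" by simp
    then have "p powi (2 * n) * lam * (p powi (2 * m) * lam) = 1"
      unfolding m unfolding n .
    moreover have "p powi (2 * n) * p powi (2 * m) = (p powi (n + m))\<^sup>2"
      using p by (simp add: power2_eq_square power_int_add[symmetric] algebra_simps)
    ultimately have "(p powi (n + m) * lam)\<^sup>2 = 1"
      by (simp add: power_mult_distrib power2_eq_square mult_ac)
    then have pm: "p powi (n + m) * lam = 1 \<or> p powi (n + m) * lam = -1"
      by (simp add: power2_eq_1_iff)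
    have mem: "p powi (2 * k) * lam \<in> Iset p lam" for k
      by (auto simp: Iset_def Ipos_def)
    show False
    \<comment> \<open>I^+ contains the products of \<open>lam\<close> with even powers of
      \<open>p\<close>. For an even exponent the element equal to 1 or -1 is itself in I; for an odd
      one its multiple by \<open>p\<close> is, and equals \<open>p\<close> or \<open>-p\<close>.
      Both are excluded.\<close>
    proof (cases "even (n + m)")
      case True
      then obtain k where "n + m = 2 * k" by blast
      then show False using pm mem[of k] I by auto
    next
      case False
      then obtain k where "n + m = 2 * k + 1" by (elim oddE)
      then have "p powi (2 * (k + 1)) * lam = p * (p powi (n + m) * lam)"
        using p by (simp add: power_int_add algebra_simps power2_eq_square)
      then have "p * (p powi (n + m) * lam) \<in> Iset p lam" using mem[of "k + 1"] by metis
      then show False using pm I by (elim disjE; simp only: mult_1_right mult_minus1_right) auto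
    qed
  qed
qed (rule p lam)+

theorem mainTheorem1:
  fixes p q lam :: "'k::field"
    and L :: "('k, 'l) vv_mod" and M :: "('k, 'm) vv_mod" and N :: "('k, 'n) vv_mod"
  assumes "CHAR('k) \<noteq> 2"
    and "p \<noteq> 0" and "q \<noteq> 0" and "lam \<noteq> 0"
    and "\<forall>n::int. p \<noteq> q powi n" and "\<forall>n::int. q \<noteq> p powi n"
    and "p \<noteq> 1" and "p \<noteq> -1"
    and "{1, -1, p, -p, q, -q} \<inter> Iset p lam = {}"
    and "vv_module p lam L" and "vv_module p lam M" and "vv_module p lam N"
  shows
    "eq_mor (VV p (deg L + deg M + deg N))
       ((L \<circ>\<^bsub>p,lam\<^esub> M) \<circ>\<^bsub>p,lam\<^esub> N) (M \<circ>\<^bsub>p,lam\<^esub> (N \<circ>\<^bsub>p,lam\<^esub> L))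
       (assoc p lam M N L \<circ> Rmat p lam L (M \<circ>\<^bsub>p,lam\<^esub> N) \<circ> assoc p lam L M N)
       (conv_map p lam M (L \<circ>\<^bsub>p,lam\<^esub> N) M (N \<circ>\<^bsub>p,lam\<^esub> L) id (Rmat p lam L N)
        \<circ> assoc p lam M L N
        \<circ> conv_map p lam (L \<circ>\<^bsub>p,lam\<^esub> M) N (M \<circ>\<^bsub>p,lam\<^esub> L) N (Rmat p lam L M) id)
   \<and> eq_mor (VV p (deg L + deg M + deg N))
       ((L \<circ>\<^bsub>p,lam\<^esub> M) \<circ>\<^bsub>p,lam\<^esub> N) (N \<circ>\<^bsub>p,lam\<^esub> (L \<circ>\<^bsub>p,lam\<^esub> M))
       (Rmat p lam (L \<circ>\<^bsub>p,lam\<^esub> M) N)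
       (assoc p lam N L M
        \<circ> conv_map p lam (L \<circ>\<^bsub>p,lam\<^esub> N) M (N \<circ>\<^bsub>p,lam\<^esub> L) M (Rmat p lam L N) id
        \<circ> assoc_inv p lam L N M
        \<circ> conv_map p lam L (M \<circ>\<^bsub>p,lam\<^esub> N) L (N \<circ>\<^bsub>p,lam\<^esub> M) id (Rmat p lam M N)
        \<circ> assoc p lam L M N)
   \<and> eq_mor (VV p (deg L + deg M + deg N))
       ((L \<circ>\<^bsub>p,lam\<^esub> M) \<circ>\<^bsub>p,lam\<^esub> N) (N \<circ>\<^bsub>p,lam\<^esub> (M \<circ>\<^bsub>p,lam\<^esub> L))
       (assoc p lam N M L
        \<circ> conv_map p lam (M \<circ>\<^bsub>p,lam\<^esub> N) L (N \<circ>\<^bsub>p,lam\<^esub> M) L (Rmat p lam M N) id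
        \<circ> assoc_inv p lam M N L
        \<circ> conv_map p lam M (L \<circ>\<^bsub>p,lam\<^esub> N) M (N \<circ>\<^bsub>p,lam\<^esub> L) id (Rmat p lam L N)
        \<circ> assoc p lam M L N
        \<circ> conv_map p lam (L \<circ>\<^bsub>p,lam\<^esub> M) N (M \<circ>\<^bsub>p,lam\<^esub> L) N (Rmat p lam L M) id)
       (conv_map p lam N (L \<circ>\<^bsub>p,lam\<^esub> M) N (M \<circ>\<^bsub>p,lam\<^esub> L) id (Rmat p lam L M)
        \<circ> assoc p lam N L M
        \<circ> conv_map p lam (L \<circ>\<^bsub>p,lam\<^esub> N) M (N \<circ>\<^bsub>p,lam\<^esub> L) M (Rmat p lam L N) id
        \<circ> assoc_inv p lam L N M
        \<circ> conv_map p lam L (M \<circ>\<^bsub>p,lam\<^esub> N) L (N \<circ>\<^bsub>p,lam\<^esub> M) id (Rmat p lam M N)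
        \<circ> assoc p lam L M N)"
proof -
  interpret vv_setup p lam
    by (rule vv_setup_Iset) (use assms in auto)
  show ?thesis
    by (intro conjI hexagon_right hexagon_left yang_baxter refl) (fact assms)+
qed

end
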